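(* Let $m\ge 1$ be an integer and $t>0$. For every integer $N\geq 1$ let $V_N$ be a complex Hilbert space, let $\mathfrak{h}_N:=L^2(\mathbb{R}_{\geq 0};V_N)$, let $\psi_N\in V_N$, and let $\mathsf{h}^{(1)}_N,\dots,\mathsf{h}^{(m)}_N\in B(V_N)$ be bounded operators with $\mathsf{h}^{(i)}_N\psi_N\neq 0$ for $i=1,\dots,m$. For $s\ge 0$ let $X^{(i)}_{N,s}:=\Lambda_s(1\otimes \mathsf{h}^{(i)}_N)$ be the associated conservation operator processes on the symmetric Fock space $\mathcal{F}(\mathfrak{h}_N)$, and for $s>0$ write $\langle\,\cdot\,\rangle_{N,s}:=\langle\,\cdot\,\rangle_{(\psi_N)_s}$, $\mathrm{Var}_{N,s}(\,\cdot\,):=\mathrm{Var}_{(\psi_N)_s}(\,\cdot\,)$ and $$\widehat X^{(i)}_{N,s}:=\frac{X^{(i)}_{N,s}-\langle X^{(i)}_{N,s}\rangle_{N,s}}{\mathrm{Var}_{N,s}(X^{(i)}_{N,s})^{1/2}}\qquad(i=1,\dots,m).$$ Assume that there exists $C>0$ such that $$\left|\langle \widehat X^{(i_1)}_{N,t}\cdots \widehat X^{(i_k)}_{N,t}\rangle_{N,t}\right|<C$$ for every $i_1,\dots,i_k\in\{1,\dots,m\}$, every $k=1,\dots,m$ and every $N\geq 1$. Then the family of processes $(\widehat X^{(1)}_{N,Nt})_{t\ge0},\dots,(\widehat X^{(m)}_{N,Nt})_{t\ge0}$ with scaled time $Nt$ converges in the moment sense to a Gaussian family as $N\to\infty$,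 i.e., $$\lim_{N\to\infty}\langle \widehat X^{(1)}_{N,Nt}\cdots\widehat X^{(m)}_{N,Nt}\rangle_{N,Nt}=\begin{cases}\displaystyle\sum_{\pi\in\mathcal{P}_2(m)}\ \prod_{\{a<b\}\in\pi}C_{a,b}(t) & m\text{ is even},\\ 0 & m\text{ is odd},\end{cases}$$ where $C_{a,b}(t):=\lim_{N\to\infty}\langle \widehat X^{(a)}_{N,t}\widehat X^{(b)}_{N,t}\rangle_{N,t}$ and $\mathcal{P}_2(m)$ is the set of pair partitions of $\{1,\dots,m\}$.
   Context: Inner products are linear in the first variable. For a complex Hilbert space $\mathfrak{h}$, $\mathcal{F}(\mathfrak{h})=\bigoplus_{n\ge 0}\mathfrak{h}^{\odot n}$ is the symmetric Fock space, where $\mathfrak h^{\odot n}$ is the $n$-th symmetric tensor power and $\mathfrak{h}^{\odot 0}=\mathbb{C}\Omega$ with $\Omega$ a unit vector. For $\psi\in\mathfrak{h}$ the exponential vector is $e(\psi)=\sum_{n\ge 0}\frac{1}{\sqrt{n!}}\psi^{\odot n}$, so $\langle e(\psi),e(\varphi)\rangle=e^{\langle\psi,\varphi\rangle}$; the span of exponential vectors is denoted $\mathcal{E}(\mathfrak{h})$ and is dense. For bounded self-adjoint $H$ on $\mathfrak{h}$, $\Lambda(H)$ is the self-adjoint generator of the one-parameter unitary group determined by $e^{\mathrm{i}r\Lambda(H)}e(\psi)=e(e^{\mathrm{i}rH}\psi)$, $r\in\mathbb{R}$. For $H\in B(\mathfrak{h})$ (bounded operators), the conservation operator is $\Lambda(H):=\Lambda\left(\frac{H+H^*}{2}\right)+\mathrm{i}\Lambda\left(\frac{H-H^*}{2\mathrm{i}}\right)$.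 For $H_1,\dots,H_n\in B(\mathfrak{h})$ the vector $\Lambda(H_2)\cdots\Lambda(H_n)e(\psi)$ lies in the domain of $\Lambda(H_1)$, so products of conservation operators are defined on $\mathcal{E}(\mathfrak{h})$. For $\mathfrak{h}=L^2(\mathbb{R}_{\ge 0};V)\cong L^2(\mathbb{R}_{\ge0})\otimes V$ and $\mathsf{h}\in B(V)$, the conservation operator process is $\Lambda_s(1\otimes\mathsf{h}):=\Lambda((1\otimes\mathsf{h})_s)$, $s\ge 0$, where $(1\otimes\mathsf{h})_s:=p([0,s])(1\otimes\mathsf{h})$ and $p(E)$ is the projection onto $L^2(E;V)$ (multiplication by the indicator function $\mathbf{1}_E$). For $\psi\in V$ set $\psi_s:=\mathbf{1}_{[0,s)}\otimes\psi\in\mathfrak{h}$. For $\varphi\in\mathfrak{h}$ and an operator $X$ whose domain contains $\mathcal{E}(\mathfrak{h})$, define $\langle X\rangle_\varphi:=\frac{\langle Xe(\varphi),e(\varphi)\rangle}{\langle e(\varphi),e(\varphi)\rangle}$ and $\mathrm{Var}_\varphi(X):=\langle (X-\langle X\rangle_\varphi)^*(X-\langle X\rangle_\varphi)\rangle_\varphi$.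
   Formalization: For even m, the existence of the limits defining C_{a,b}(t), for all a<b, is assumed; the boundedness hypothesis does not imply it (e.g. m=2, V_N=ℂ, ψ_N=1, h^(1)=1, h^(2)=(-1)^N). *)

theory Defs
  imports "HOL-Analysis.Analysis" "HOL-Library.Multiset" "HOL-Library.Disjoint_Sets"
begin

section \<open>Complex Hilbert spaces with explicit carrier\<close>

text \<open>
  Carriers and operations are explicit so that a sequence of unrelated Hilbert spaces can be
  handled inside one statement. Only their underlying sets share a type.
  Inner products are linear in the first variable.
\<close>

record 'a inner_space =
  hcarrier :: "'a set"
  hadd :: "'a \<Rightarrow> 'a \<Rightarrow> 'a"
  hzero :: 'a
  hscale :: "complex \<Rightarrow> 'a \<Rightarrow> 'a"
  hinner :: "'a \<Rightarrow> 'a \<Rightarrow> complex"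

definition hdiff :: "'a inner_space \<Rightarrow> 'a \<Rightarrow> 'a \<Rightarrow> 'a" where
  "hdiff H x y = hadd H x (hscale H (-1) y)"

definition hnorm :: "'a inner_space \<Rightarrow> 'a \<Rightarrow> real" where
  "hnorm H x = sqrt (Re (hinner H x x))"

definition hdist :: "'a inner_space \<Rightarrow> 'a \<Rightarrow> 'a \<Rightarrow> real" where
  "hdist H x y = hnorm H (hdiff H x y)"

definition hconverges :: "'a inner_space \<Rightarrow> ('b \<Rightarrow> 'a) \<Rightarrow> 'a \<Rightarrow> 'b filter \<Rightarrow> bool" where
  "hconverges H f l F \<longleftrightarrow> l \<in> hcarrier H \<and> ((\<lambda>r. hdist H (f r) l) \<longlongrightarrow> 0) F"

definition hlim :: "'a inner_space \<Rightarrow> ('b \<Rightarrow> 'a) \<Rightarrow> 'b filter \<Rightarrow> 'a" where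
  "hlim H f F = (THE l. hconverges H f l F)"

primrec hsum :: "'a inner_space \<Rightarrow> (nat \<Rightarrow> 'a) \<Rightarrow> nat \<Rightarrow> 'a" where
  "hsum H f 0 = hzero H"
| "hsum H f (Suc n) = hadd H (hsum H f n) (f n)"

locale complex_hilbert_space =
  fixes H :: "'a inner_space"
  assumes zero_closed: "hzero H \<in> hcarrier H"
    and add_closed: "\<lbrakk>x \<in> hcarrier H; y \<in> hcarrier H\<rbrakk> \<Longrightarrow> hadd H x y \<in> hcarrier H"
    and scale_closed: "x \<in> hcarrier H \<Longrightarrow> hscale H c x \<in> hcarrier H"
    and add_assoc: "\<lbrakk>x \<in> hcarrier H; y \<in> hcarrier H; z \<in> hcarrier H\<rbrakk>
      \<Longrightarrow> hadd H (hadd H x y) z = hadd H x (hadd H y z)"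
    and add_commute: "\<lbrakk>x \<in> hcarrier H; y \<in> hcarrier H\<rbrakk> \<Longrightarrow> hadd H x y = hadd H y x"
    and add_zero: "x \<in> hcarrier H \<Longrightarrow> hadd H x (hzero H) = x"
    and diff_self: "x \<in> hcarrier H \<Longrightarrow> hdiff H x x = hzero H"
    and scale_one: "x \<in> hcarrier H \<Longrightarrow> hscale H 1 x = x"
    and scale_scale: "x \<in> hcarrier H \<Longrightarrow> hscale H c (hscale H d x) = hscale H (c * d) x"
    and scale_add_left: "x \<in> hcarrier H
      \<Longrightarrow> hscale H (c + d) x = hadd H (hscale H c x) (hscale H d x)"
    and scale_add_right: "\<lbrakk>x \<in> hcarrier H; y \<in> hcarrier H\<rbrakk>
      \<Longrightarrow> hscale H c (hadd H x y) = hadd H (hscale H c x) (hscale H c y)"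
    and inner_add_left: "\<lbrakk>x \<in> hcarrier H; y \<in> hcarrier H; z \<in> hcarrier H\<rbrakk>
      \<Longrightarrow> hinner H (hadd H x y) z = hinner H x z + hinner H y z"
    and inner_scale_left: "\<lbrakk>x \<in> hcarrier H; y \<in> hcarrier H\<rbrakk>
      \<Longrightarrow> hinner H (hscale H c x) y = c * hinner H x y"
    and inner_commute: "\<lbrakk>x \<in> hcarrier H; y \<in> hcarrier H\<rbrakk>
      \<Longrightarrow> hinner H y x = cnj (hinner H x y)"
    and inner_ge_zero: "x \<in> hcarrier H \<Longrightarrow> 0 \<le> Re (hinner H x x)"
    and inner_eq_zero: "\<lbrakk>x \<in> hcarrier H; hinner H x x = 0\<rbrakk> \<Longrightarrow> x = hzero H"
    and complete: "\<lbrakk>\<And>n. f n \<in> hcarrier H;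
        \<And>e. e > 0 \<Longrightarrow> \<exists>n0. \<forall>m\<ge>n0. \<forall>n\<ge>n0. hdist H (f m) (f n) < e\<rbrakk>
      \<Longrightarrow> \<exists>l. hconverges H f l sequentially"

definition orthonormal_basis :: "'a inner_space \<Rightarrow> 'a set \<Rightarrow> bool" where
  "orthonormal_basis H B \<longleftrightarrow> B \<subseteq> hcarrier H
     \<and> (\<forall>x\<in>B. \<forall>y\<in>B. hinner H x y = (if x = y then 1 else 0))
     \<and> (\<forall>x\<in>hcarrier H. (\<forall>b\<in>B. hinner H x b = 0) \<longrightarrow> x = hzero H)"

definition linear_operator :: "'a inner_space \<Rightarrow> ('a \<Rightarrow> 'a) \<Rightarrow> bool" where
  "linear_operator H T \<longleftrightarrow> (\<forall>x\<in>hcarrier H. T x \<in> hcarrier H)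
     \<and> (\<forall>x\<in>hcarrier H. \<forall>y\<in>hcarrier H. T (hadd H x y) = hadd H (T x) (T y))
     \<and> (\<forall>c. \<forall>x\<in>hcarrier H. T (hscale H c x) = hscale H c (T x))"

definition bounded_operator :: "'a inner_space \<Rightarrow> ('a \<Rightarrow> 'a) \<Rightarrow> bool" where
  "bounded_operator H T \<longleftrightarrow> linear_operator H T
     \<and> (\<exists>K. \<forall>x\<in>hcarrier H. hnorm H (T x) \<le> K * hnorm H x)"

definition bounded_adjoint :: "'a inner_space \<Rightarrow> ('a \<Rightarrow> 'a) \<Rightarrow> 'a \<Rightarrow> 'a" where
  "bounded_adjoint H T y =
     (THE z. z \<in> hcarrier H \<and> (\<forall>x\<in>hcarrier H. hinner H (T x) y = hinner H x z))"

definition operator_exp :: "'a inner_space \<Rightarrow> ('a \<Rightarrow> 'a) \<Rightarrow> 'a \<Rightarrow> 'a" where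
  "operator_exp H T x =
     hlim H (\<lambda>n. hsum H (\<lambda>k. hscale H (1 / fact k) ((T ^^ k) x)) n) sequentially"

definition unitary_operator :: "'a inner_space \<Rightarrow> ('a \<Rightarrow> 'a) \<Rightarrow> bool" where
  "unitary_operator H U \<longleftrightarrow> linear_operator H U
     \<and> bij_betw U (hcarrier H) (hcarrier H)
     \<and> (\<forall>x\<in>hcarrier H. \<forall>y\<in>hcarrier H. hinner H (U x) (U y) = hinner H x y)"

definition unitary_group :: "'a inner_space \<Rightarrow> (real \<Rightarrow> 'a \<Rightarrow> 'a) \<Rightarrow> bool" where
  "unitary_group H U \<longleftrightarrow> (\<forall>r. unitary_operator H (U r))
     \<and> (\<forall>x\<in>hcarrier H. U 0 x = x)
     \<and> (\<forall>r s. \<forall>x\<in>hcarrier H. U (r + s) x = U r (U s x))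
     \<and> (\<forall>x\<in>hcarrier H. \<forall>r. hconverges H (\<lambda>s. U s x) (U r x) (at r))"

section \<open>Unbounded operators\<close>

text \<open>
  An operator defined on a subset of the space is a partial function whose domain is \<^const>\<open>dom\<close>.
  The product is \<^const>\<open>map_comp\<close>. Sums are defined on the intersection of the domains.
\<close>

definition op_id :: "'a inner_space \<Rightarrow> 'a \<Rightarrow> 'a option" where
  "op_id H x = (if x \<in> hcarrier H then Some x else None)"

definition op_add :: "'a inner_space \<Rightarrow> ('a \<Rightarrow> 'a option) \<Rightarrow> ('a \<Rightarrow> 'a option) \<Rightarrow> 'a \<Rightarrow> 'a option" where
  "op_add H X Y = (\<lambda>x. if x \<in> dom X \<inter> dom Y then Some (hadd H (the (X x)) (the (Y x))) else None)"

definition op_scale :: "'a inner_space \<Rightarrow> complex \<Rightarrow> ('a \<Rightarrow> 'a option) \<Rightarrow> 'a \<Rightarrow> 'a option" where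
  "op_scale H c X = (\<lambda>x. map_option (hscale H c) (X x))"

text \<open>\<open>op_shift H X c\<close> is \<open>X - c\<close>.\<close>

definition op_shift :: "'a inner_space \<Rightarrow> ('a \<Rightarrow> 'a option) \<Rightarrow> complex \<Rightarrow> 'a \<Rightarrow> 'a option" where
  "op_shift H X c = op_add H X (op_scale H (- c) (op_id H))"

text \<open>\<open>op_prod H [X\<^sub>1, \<dots>, X\<^sub>k] = X\<^sub>1 \<cdots> X\<^sub>k\<close>, so \<open>X\<^sub>k\<close> is applied first.\<close>

definition op_prod :: "'a inner_space \<Rightarrow> ('a \<Rightarrow> 'a option) list \<Rightarrow> 'a \<Rightarrow> 'a option" where
  "op_prod H Xs = foldr (\<circ>\<^sub>m) Xs (op_id H)"

text \<open>The adjoint is meaningful for densely defined \<open>X\<close>, where the witness is unique.\<close>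

definition op_adjoint :: "'a inner_space \<Rightarrow> ('a \<Rightarrow> 'a option) \<Rightarrow> 'a \<Rightarrow> 'a option" where
  "op_adjoint H X = (\<lambda>y.
     let P = (\<lambda>z. z \<in> hcarrier H \<and> (\<forall>x\<in>dom X. hinner H (the (X x)) y = hinner H x z))
     in if y \<in> hcarrier H \<and> (\<exists>z. P z) then Some (THE z. P z) else None)"

text \<open>
  Stone generator \<open>A\<close> of a unitary group \<open>U\<^sub>r = exp (\<i> r A)\<close>:
  \<open>A x = lim\<^bsub>r\<rightarrow>0\<^esub> (U\<^sub>r x - x) / (\<i> r)\<close>, on the vectors where the limit exists.
\<close>

definition generator :: "'a inner_space \<Rightarrow> (real \<Rightarrow> 'a \<Rightarrow> 'a) \<Rightarrow> 'a \<Rightarrow> 'a option" where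
  "generator H U = (\<lambda>x.
     let q = (\<lambda>r. hscale H (1 / (\<i> * of_real r)) (hdiff H (U r x) x))
     in if x \<in> hcarrier H \<and> (\<exists>y. hconverges H q y (at 0)) then Some (hlim H q (at 0)) else None)"

section \<open>Symmetric Fock space\<close>

text \<open>
  The Hilbert space tensor power \<open>H\<^sup>\<otimes>\<^sup>n\<close> is realised, as in Kadison and Ringrose, by the bounded
  Hilbert--Schmidt \<open>n\<close>-functionals. With inner products linear in the first variable,
  \<open>\<psi>\<^sub>1 \<otimes> \<dots> \<otimes> \<psi>\<^sub>n\<close> is the conjugate-multilinear functional
  \<open>(x\<^sub>1, \<dots>, x\<^sub>n) \<mapsto> \<langle>\<psi>\<^sub>1, x\<^sub>1\<rangle> \<cdots> \<langle>\<psi>\<^sub>n, x\<^sub>n\<rangle>\<close>. Arguments are lists of length \<open>n\<close>, and functionals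
  vanish outside their domain so that equality is extensional. The inner product does not
  depend on the chosen orthonormal basis.
\<close>

definition tuples :: "nat \<Rightarrow> 'a set \<Rightarrow> 'a list set" where
  "tuples n A = {xs. length xs = n \<and> set xs \<subseteq> A}"

definition basis_tuples :: "'a inner_space \<Rightarrow> nat \<Rightarrow> 'a list set" where
  "basis_tuples H n = tuples n (SOME B. orthonormal_basis H B)"

definition tensor_power :: "'a inner_space \<Rightarrow> nat \<Rightarrow> ('a list \<Rightarrow> complex) inner_space" where
  "tensor_power H n = \<lparr>
     hcarrier = {T.
       (\<forall>xs. xs \<notin> tuples n (hcarrier H) \<longrightarrow> T xs = 0)
       \<and> (\<forall>us vs. \<forall>x\<in>hcarrier H. \<forall>y\<in>hcarrier H. us @ x # vs \<in> tuples n (hcarrier H) \<longrightarrow>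
            T (us @ hadd H x y # vs) = T (us @ x # vs) + T (us @ y # vs))
       \<and> (\<forall>us vs. \<forall>c. \<forall>x\<in>hcarrier H. us @ x # vs \<in> tuples n (hcarrier H) \<longrightarrow>
            T (us @ hscale H c x # vs) = cnj c * T (us @ x # vs))
       \<and> (\<exists>K. \<forall>xs\<in>tuples n (hcarrier H). cmod (T xs) \<le> K * (\<Prod>x\<leftarrow>xs. hnorm H x))
       \<and> (\<lambda>bs. (cmod (T bs))\<^sup>2) summable_on basis_tuples H n},
     hadd = (\<lambda>S T xs. S xs + T xs),
     hzero = (\<lambda>xs. 0),
     hscale = (\<lambda>c T xs. c * T xs),
     hinner = (\<lambda>S T. \<Sum>\<^sub>\<infinity>bs\<in>basis_tuples H n. S bs * cnj (T bs)) \<rparr>"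

definition sym_tensor_power :: "'a inner_space \<Rightarrow> nat \<Rightarrow> ('a list \<Rightarrow> complex) inner_space" where
  "sym_tensor_power H n = (tensor_power H n)\<lparr>
     hcarrier := {T \<in> hcarrier (tensor_power H n). \<forall>xs ys. mset xs = mset ys \<longrightarrow> T xs = T ys} \<rparr>"

definition direct_sum :: "(nat \<Rightarrow> 'b inner_space) \<Rightarrow> (nat \<Rightarrow> 'b) inner_space" where
  "direct_sum G = \<lparr>
     hcarrier = {\<xi>. (\<forall>n. \<xi> n \<in> hcarrier (G n)) \<and> summable (\<lambda>n. (hnorm (G n) (\<xi> n))\<^sup>2)},
     hadd = (\<lambda>\<xi> \<eta> n. hadd (G n) (\<xi> n) (\<eta> n)),
     hzero = (\<lambda>n. hzero (G n)),
     hscale = (\<lambda>c \<xi> n. hscale (G n) c (\<xi> n)),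
     hinner = (\<lambda>\<xi> \<eta>. \<Sum>n. hinner (G n) (\<xi> n) (\<eta> n)) \<rparr>"

definition fock :: "'a inner_space \<Rightarrow> (nat \<Rightarrow> 'a list \<Rightarrow> complex) inner_space" where
  "fock H = direct_sum (sym_tensor_power H)"

definition sym_power :: "'a inner_space \<Rightarrow> nat \<Rightarrow> 'a \<Rightarrow> 'a list \<Rightarrow> complex" where
  "sym_power H n \<psi> xs = (if xs \<in> tuples n (hcarrier H) then \<Prod>x\<leftarrow>xs. hinner H \<psi> x else 0)"

definition exp_vec :: "'a inner_space \<Rightarrow> 'a \<Rightarrow> nat \<Rightarrow> 'a list \<Rightarrow> complex" where
  "exp_vec H \<psi> n = hscale (sym_tensor_power H n) (of_real (1 / sqrt (fact n))) (sym_power H n \<psi>)"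

section \<open>Conservation operators\<close>

definition conservation_sa ::
  "'a inner_space \<Rightarrow> ('a \<Rightarrow> 'a) \<Rightarrow> (nat \<Rightarrow> 'a list \<Rightarrow> complex) \<Rightarrow> (nat \<Rightarrow> 'a list \<Rightarrow> complex) option" where
  "conservation_sa H T = (THE L. \<exists>U. unitary_group (fock H) U
     \<and> (\<forall>r. \<forall>\<psi>\<in>hcarrier H.
          U r (exp_vec H \<psi>) = exp_vec H (operator_exp H (\<lambda>x. hscale H (\<i> * of_real r) (T x)) \<psi>))
     \<and> L = generator (fock H) U)"

definition conservation ::
  "'a inner_space \<Rightarrow> ('a \<Rightarrow> 'a) \<Rightarrow> (nat \<Rightarrow> 'a list \<Rightarrow> complex) \<Rightarrow> (nat \<Rightarrow> 'a list \<Rightarrow> complex) option" where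
  "conservation H T = op_add (fock H)
     (conservation_sa H (\<lambda>x. hscale H (1 / 2) (hadd H (T x) (bounded_adjoint H T x))))
     (op_scale (fock H) \<i>
       (conservation_sa H (\<lambda>x. hscale H (1 / (2 * \<i>)) (hdiff H (T x) (bounded_adjoint H T x)))))"

definition expect ::
  "'a inner_space \<Rightarrow> 'a \<Rightarrow> ((nat \<Rightarrow> 'a list \<Rightarrow> complex) \<Rightarrow> (nat \<Rightarrow> 'a list \<Rightarrow> complex) option) \<Rightarrow> complex" where
  "expect H \<phi> X = hinner (fock H) (the (X (exp_vec H \<phi>))) (exp_vec H \<phi>)
     / hinner (fock H) (exp_vec H \<phi>) (exp_vec H \<phi>)"

definition variance ::
  "'a inner_space \<Rightarrow> 'a \<Rightarrow> ((nat \<Rightarrow> 'a list \<Rightarrow> complex) \<Rightarrow> (nat \<Rightarrow> 'a list \<Rightarrow> complex) option) \<Rightarrow> complex" where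
  "variance H \<phi> X =
     (let Y = op_shift (fock H) X (expect H \<phi> X)
      in expect H \<phi> (op_prod (fock H) [op_adjoint (fock H) Y, Y]))"

definition standardize ::
  "'a inner_space \<Rightarrow> 'a \<Rightarrow> ((nat \<Rightarrow> 'a list \<Rightarrow> complex) \<Rightarrow> (nat \<Rightarrow> 'a list \<Rightarrow> complex) option)
     \<Rightarrow> (nat \<Rightarrow> 'a list \<Rightarrow> complex) \<Rightarrow> (nat \<Rightarrow> 'a list \<Rightarrow> complex) option" where
  "standardize H \<phi> X =
     op_scale (fock H) (1 / csqrt (variance H \<phi> X)) (op_shift (fock H) X (expect H \<phi> X))"

section \<open>Square-integrable functions on the half-line\<close>

text \<open>
  \<open>V\<close> need not be separable, so measurability is strong measurability: pointwise norm limits of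
  simple functions. Vectors are classes of almost everywhere equal functions, and operations
  are computed on arbitrary representatives. Values on the negative half-line are irrelevant.
\<close>

definition strongly_measurable :: "'v inner_space \<Rightarrow> 'x measure \<Rightarrow> ('x \<Rightarrow> 'v) \<Rightarrow> bool" where
  "strongly_measurable V M f \<longleftrightarrow> (\<forall>x\<in>space M. f x \<in> hcarrier V)
     \<and> (\<exists>s. (\<forall>n. simple_function M (s n))
          \<and> (\<forall>n. \<forall>x\<in>space M. s n x \<in> hcarrier V)
          \<and> (\<forall>x\<in>space M. hconverges V (\<lambda>n. s n x) (f x) sequentially))"

abbreviation half_line :: "real measure" where
  "half_line \<equiv> lebesgue_on {0..}"

definition square_integrable :: "'v inner_space \<Rightarrow> (real \<Rightarrow> 'v) set" where
  "square_integrable V = {f. strongly_measurable V half_line f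
     \<and> integrable half_line (\<lambda>x. (hnorm V (f x))\<^sup>2)}"

definition L2_class :: "'v inner_space \<Rightarrow> (real \<Rightarrow> 'v) \<Rightarrow> (real \<Rightarrow> 'v) set" where
  "L2_class V f = {g \<in> square_integrable V. AE x in half_line. g x = f x}"

definition rep :: "(real \<Rightarrow> 'v) set \<Rightarrow> real \<Rightarrow> 'v" where
  "rep F = (SOME f. f \<in> F)"

definition L2_space :: "'v inner_space \<Rightarrow> (real \<Rightarrow> 'v) set inner_space" where
  "L2_space V = \<lparr>
     hcarrier = L2_class V ` square_integrable V,
     hadd = (\<lambda>F G. L2_class V (\<lambda>x. hadd V (rep F x) (rep G x))),
     hzero = L2_class V (\<lambda>x. hzero V),
     hscale = (\<lambda>c F. L2_class V (\<lambda>x. hscale V c (rep F x))),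
     hinner = (\<lambda>F G. LINT x|half_line. hinner V (rep F x) (rep G x)) \<rparr>"

text \<open>Under \<open>L\<^sup>2(\<real>\<^bsub>\<ge>0\<^esub>; V) \<cong> L\<^sup>2(\<real>\<^bsub>\<ge>0\<^esub>) \<otimes> V\<close>, the operator \<open>1 \<otimes> a\<close> acts pointwise.\<close>

definition ampliation :: "'v inner_space \<Rightarrow> ('v \<Rightarrow> 'v) \<Rightarrow> (real \<Rightarrow> 'v) set \<Rightarrow> (real \<Rightarrow> 'v) set" where
  "ampliation V a F = L2_class V (\<lambda>x. a (rep F x))"

definition L2_proj :: "'v inner_space \<Rightarrow> real set \<Rightarrow> (real \<Rightarrow> 'v) set \<Rightarrow> (real \<Rightarrow> 'v) set" where
  "L2_proj V E F = L2_class V (\<lambda>x. hscale V (indicator E x) (rep F x))"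

definition step_vec :: "'v inner_space \<Rightarrow> 'v \<Rightarrow> real \<Rightarrow> (real \<Rightarrow> 'v) set" where
  "step_vec V \<psi> s = L2_class V (\<lambda>x. hscale V (indicator {0..<s} x) \<psi>)"

definition conservation_process ::
  "'v inner_space \<Rightarrow> ('v \<Rightarrow> 'v) \<Rightarrow> real
     \<Rightarrow> (nat \<Rightarrow> (real \<Rightarrow> 'v) set list \<Rightarrow> complex) \<Rightarrow> (nat \<Rightarrow> (real \<Rightarrow> 'v) set list \<Rightarrow> complex) option" where
  "conservation_process V a s =
     conservation (L2_space V) (\<lambda>F. L2_proj V {0..s} (ampliation V a F))"

text \<open>
  For indices \<open>is = [i\<^sub>1, \<dots>, i\<^sub>k]\<close>, the expectation in the exponential vector of \<open>\<psi>\<^sub>s\<close> of the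
  product of the standardized processes of \<open>a i\<^sub>1, \<dots>, a i\<^sub>k\<close> at time \<open>s\<close>.
\<close>

definition standardized_moment ::
  "'v inner_space \<Rightarrow> 'v \<Rightarrow> (nat \<Rightarrow> 'v \<Rightarrow> 'v) \<Rightarrow> real \<Rightarrow> nat list \<Rightarrow> complex" where
  "standardized_moment V \<psi> a s is =
     expect (L2_space V) (step_vec V \<psi> s)
       (op_prod (fock (L2_space V))
         (map (\<lambda>i. standardize (L2_space V) (step_vec V \<psi> s) (conservation_process V (a i) s)) is))"

definition pair_partitions :: "nat \<Rightarrow> nat set set set" where
  "pair_partitions m = {\<pi>. partition_on {1..m} \<pi> \<and> (\<forall>B\<in>\<pi>. card B = 2)}"

end

(*
  The map sending a Fock vector xi to the function v |-> <xi, e(v)> is injective, and it turns a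
  conservation operator into a derivation, because its unitary group acts on exponential vectors by
  v |-> exp(irH) v. The vector X e(psi) becomes <H psi, v> times the function of e(psi), so moving this
  factor past the remaining operators with the Leibniz rule gives a recursion of moments in terms of the
  cumulants <h_{i_1} ... h_{i_k} psi, psi>, and centring removes the cumulants of order one. After
  standardization, passing from time t to time N t multiplies a cumulant of order k by N^(1 - k/2). The
  hypothesis bounds the cumulants at time t, hence only pair partitions survive in the limit.

  The generators are computed without domain theory: difference quotients of the unitary group converge
  coordinatewise by calculus, a mean value inequality bounds their norms by the norm of the limit, and
  in l^2 these two facts imply strong convergence.
*)

theory Submission
  imports Defs
begin

section \<open>Complex inner product spaces\<close>

text \<open>The operators are unbounded and need not commute, so products are opened at the
  rightmost factor: it meets the exponential vector directly and turns into a multiplication. This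
  is why the largest index is distinguished in every recursion. Creation operators are never formed;
  only the identity of functions that they would satisfy is used. The power of N comes from step
  vectors: pairing two of them at time s gives a factor s, each of the k normalisations divides by
  sqrt s, and what remains is a fixed inner product in \<open>V N\<close>. Two obstacles shape the
  Fock space part. The inner product is a sum over one basis picked by choice, so unitarity of a
  second quantised operator has to come from a contraction estimate, applied to the operator and to
  its inverse. The variance contains the adjoint of an unbounded operator with respect to its full
  domain, so generators must be shown symmetric between that whole domain and a convenient invariant
  one. Cumulants are bounded by solving the moment recursion at time t for its top term, without any
  estimate on the operators.\<close>

lemma tendsto_norm_le_zero:
  assumes "(g \<longlongrightarrow> 0) F" "\<And>x. norm (f x) \<le> g x"
  shows "(f \<longlongrightarrow> 0) F"
  using assms by (intro Lim_null_comparison[OF _ assms(1)] always_eventually) auto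

text \<open>Completeness is left out so that the same geometry serves \<open>L2_space\<close> before
  its completeness is proved, and also the Fock space. The remaining module laws of
  \<open>hscale\<close> are recovered from \<open>weak_eqI\<close>.\<close>

locale pre_hilbert =
  fixes H :: "'a inner_space"
  assumes zero_mem [simp]: "hzero H \<in> hcarrier H"
    and add_mem [simp]: "\<lbrakk>x \<in> hcarrier H; y \<in> hcarrier H\<rbrakk> \<Longrightarrow> hadd H x y \<in> hcarrier H"
    and scale_mem [simp]: "x \<in> hcarrier H \<Longrightarrow> hscale H c x \<in> hcarrier H"
    and hadd_assoc: "\<lbrakk>x \<in> hcarrier H; y \<in> hcarrier H; z \<in> hcarrier H\<rbrakk>
      \<Longrightarrow> hadd H (hadd H x y) z = hadd H x (hadd H y z)"
    and hadd_commute: "\<lbrakk>x \<in> hcarrier H; y \<in> hcarrier H\<rbrakk> \<Longrightarrow> hadd H x y = hadd H y x"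
    and hadd_zero: "x \<in> hcarrier H \<Longrightarrow> hadd H x (hzero H) = x"
    and hdiff_self: "x \<in> hcarrier H \<Longrightarrow> hdiff H x x = hzero H"
    and hinner_add_left [simp]: "\<lbrakk>x \<in> hcarrier H; y \<in> hcarrier H; z \<in> hcarrier H\<rbrakk>
      \<Longrightarrow> hinner H (hadd H x y) z = hinner H x z + hinner H y z"
    and hinner_scale_left [simp]: "\<lbrakk>x \<in> hcarrier H; y \<in> hcarrier H\<rbrakk>
      \<Longrightarrow> hinner H (hscale H c x) y = c * hinner H x y"
    and hinner_commute: "\<lbrakk>x \<in> hcarrier H; y \<in> hcarrier H\<rbrakk>
      \<Longrightarrow> hinner H y x = cnj (hinner H x y)"
    and hinner_ge_zero: "x \<in> hcarrier H \<Longrightarrow> 0 \<le> Re (hinner H x x)"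
    and hinner_eq_zero: "\<lbrakk>x \<in> hcarrier H; hinner H x x = 0\<rbrakk> \<Longrightarrow> x = hzero H"
begin

lemma diff_mem [simp]: "\<lbrakk>x \<in> hcarrier H; y \<in> hcarrier H\<rbrakk> \<Longrightarrow> hdiff H x y \<in> hcarrier H"
  by (simp add: hdiff_def)

lemma hinner_add_right [simp]:
  assumes "x \<in> hcarrier H" "y \<in> hcarrier H" "z \<in> hcarrier H"
  shows "hinner H z (hadd H x y) = hinner H z x + hinner H z y"
  using assms hinner_commute[of "hadd H x y" z] hinner_commute[of x z] hinner_commute[of y z] by simp

lemma hinner_scale_right [simp]:
  assumes "x \<in> hcarrier H" "y \<in> hcarrier H"
  shows "hinner H y (hscale H c x) = cnj c * hinner H y x"
  using assms hinner_commute[of "hscale H c x" y] hinner_commute[of x y] by simp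

lemma hinner_diff_left [simp]:
  "\<lbrakk>x \<in> hcarrier H; y \<in> hcarrier H; z \<in> hcarrier H\<rbrakk> \<Longrightarrow> hinner H (hdiff H x y) z = hinner H x z - hinner H y z"
  by (simp add: hdiff_def)

lemma hinner_diff_right [simp]:
  "\<lbrakk>x \<in> hcarrier H; y \<in> hcarrier H; z \<in> hcarrier H\<rbrakk> \<Longrightarrow> hinner H z (hdiff H x y) = hinner H z x - hinner H z y"
  by (simp add: hdiff_def)

lemma hinner_zero_left [simp]:
  assumes "x \<in> hcarrier H" shows "hinner H (hzero H) x = 0"
proof -
  have "hinner H (hadd H (hzero H) (hzero H)) x = hinner H (hzero H) x"
    using hadd_zero[of "hzero H"] by simp
  then show ?thesis using assms by simp
qed

lemma hinner_zero_right [simp]: "x \<in> hcarrier H \<Longrightarrow> hinner H x (hzero H) = 0"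
  using hinner_commute[of "hzero H" x] by simp

lemma hdiff_eq_zeroD:
  assumes "x \<in> hcarrier H" "y \<in> hcarrier H" "hdiff H x y = hzero H"
  shows "x = y"
proof -
  have "hadd H (hscale H (-1) y) y = hzero H"
    using assms hadd_commute[of y "hscale H (-1) y"] hdiff_self[of y] by (simp add: hdiff_def)
  then have "hadd H (hdiff H x y) y = x"
    using assms(1,2) hadd_assoc[of x "hscale H (-1) y" y] hadd_zero[of x] by (simp add: hdiff_def)
  then show ?thesis using assms hadd_commute[of "hzero H" y] hadd_zero[of y] by simp
qed

text \<open>Testing against \<open>hdiff H x y\<close> reduces the claim to definiteness. Vector
  identities are mostly proved this way: both sides are expanded by linearity of the inner product,
  and complex arithmetic does the rest.\<close>

lemma weak_eqI:
  assumes "x \<in> hcarrier H" "y \<in> hcarrier H"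
    and "\<And>z. z \<in> hcarrier H \<Longrightarrow> hinner H x z = hinner H y z"
  shows "x = y"
proof (rule hdiff_eq_zeroD)
  show "hdiff H x y = hzero H"
    using assms(1,2) assms(3)[of "hdiff H x y"]
    by (intro hinner_eq_zero) (simp_all del: hinner_diff_right)
qed (use assms in auto)

lemma weak_eqI_right:
  assumes "x \<in> hcarrier H" "y \<in> hcarrier H"
    and "\<And>z. z \<in> hcarrier H \<Longrightarrow> hinner H z x = hinner H z y"
  shows "x = y"
proof (rule weak_eqI)
  fix z assume z: "z \<in> hcarrier H"
  show "hinner H x z = hinner H y z"
    using assms(3)[OF z] hinner_commute[OF z assms(1)] hinner_commute[OF z assms(2)] by simp
qed (use assms in auto)

lemma hinner_self: "x \<in> hcarrier H \<Longrightarrow> hinner H x x = of_real ((hnorm H x)\<^sup>2)"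
  using arg_cong[OF hinner_commute[of x x], of Im] hinner_ge_zero[of x]
  by (simp add: hnorm_def complex_eq_iff)

lemma hnorm_nonneg [simp]: "x \<in> hcarrier H \<Longrightarrow> hnorm H x \<ge> 0"
  using hinner_ge_zero[of x] by (simp add: hnorm_def)

lemma hnorm_eq_zero: "x \<in> hcarrier H \<Longrightarrow> hnorm H x = 0 \<longleftrightarrow> x = hzero H"
  using hinner_self[of x] hinner_eq_zero[of x] by (auto simp: hnorm_def)

lemma hnorm_zero [simp]: "hnorm H (hzero H) = 0"
  by (simp add: hnorm_def)

lemma Re_hinner_self: "x \<in> hcarrier H \<Longrightarrow> Re (hinner H x x) = (hnorm H x)\<^sup>2"
  by (simp add: hinner_self)

lemma hnorm_scale [simp]: "x \<in> hcarrier H \<Longrightarrow> hnorm H (hscale H c x) = cmod c * hnorm H x"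
proof -
  assume x: "x \<in> hcarrier H"
  have "hinner H (hscale H c x) (hscale H c x) = of_real ((cmod c * hnorm H x)\<^sup>2)"
    using x complex_norm_square[of c] by (simp add: hinner_self[OF x] power_mult_distrib mult.assoc[symmetric] mult.commute)
  then have "(hnorm H (hscale H c x))\<^sup>2 = (cmod c * hnorm H x)\<^sup>2"
    using x Re_hinner_self[of "hscale H c x"] by (metis Re_complex_of_real scale_mem)
  then show ?thesis using x by (simp add: power2_eq_iff_nonneg)
qed

lemma Cauchy_Schwarz:
  assumes x: "x \<in> hcarrier H" and y: "y \<in> hcarrier H"
  shows "cmod (hinner H x y) \<le> hnorm H x * hnorm H y"
proof (cases "hnorm H y = 0")
  case True
  then show ?thesis using assms by (simp add: hnorm_eq_zero)
next
  case False
  let ?a = "hinner H x y" and ?n = "hnorm H y"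
  \<comment> \<open>The component of \<open>x\<close> orthogonal to \<open>y\<close>, multiplied by
    the squared norm of \<open>y\<close> so that no division occurs.\<close>
  let ?z = "hdiff H (hscale H (of_real (?n\<^sup>2)) x) (hscale H ?a y)"
  have a: "hinner H y x = cnj ?a" using hinner_commute[OF x y] .
  have "hinner H ?z ?z = of_real (?n\<^sup>2 * (?n\<^sup>2 * (hnorm H x)\<^sup>2 - (cmod ?a)\<^sup>2))"
    using x y by (simp add: a hinner_self[OF x] hinner_self[OF y] del: of_real_power)
      (simp add: complex_norm_square[of ?a, symmetric] power2_eq_square algebra_simps)
  then have "0 \<le> ?n\<^sup>2 * (?n\<^sup>2 * (hnorm H x)\<^sup>2 - (cmod ?a)\<^sup>2)"
    using hinner_ge_zero[of ?z] x y by (simp del: hinner_diff_left hinner_diff_right)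
  then have "(cmod ?a)\<^sup>2 \<le> (hnorm H x * ?n)\<^sup>2"
    using False zero_less_power2[of ?n] by (auto simp: zero_le_mult_iff power_mult_distrib mult.commute)
  then show ?thesis using x y by (simp add: power2_le_iff_abs_le)
qed

lemma hnorm_add_sq:
  assumes "x \<in> hcarrier H" "y \<in> hcarrier H"
  shows "(hnorm H (hadd H x y))\<^sup>2 = (hnorm H x)\<^sup>2 + (hnorm H y)\<^sup>2 + 2 * Re (hinner H x y)"
  using assms hinner_commute[of x y] by (simp flip: Re_hinner_self)

lemma hnorm_diff_sq:
  assumes "x \<in> hcarrier H" "y \<in> hcarrier H"
  shows "(hnorm H (hdiff H x y))\<^sup>2 = (hnorm H x)\<^sup>2 + (hnorm H y)\<^sup>2 - 2 * Re (hinner H x y)"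
  using assms hinner_commute[of x y] by (simp flip: Re_hinner_self)

lemma hnorm_triangle:
  assumes "x \<in> hcarrier H" "y \<in> hcarrier H"
  shows "hnorm H (hadd H x y) \<le> hnorm H x + hnorm H y"
proof -
  have "Re (hinner H x y) \<le> hnorm H x * hnorm H y"
    using Cauchy_Schwarz[OF assms] complex_Re_le_cmod order_trans by blast
  then have "(hnorm H (hadd H x y))\<^sup>2 \<le> (hnorm H x + hnorm H y)\<^sup>2"
    by (simp add: hnorm_add_sq[OF assms] power2_sum)
  then show ?thesis using assms by (simp add: power2_le_iff_abs_le)
qed

lemma hnorm_diff_commute:
  assumes "x \<in> hcarrier H" "y \<in> hcarrier H"
  shows "hnorm H (hdiff H x y) = hnorm H (hdiff H y x)"
proof -
  have "hdiff H x y = hscale H (-1) (hdiff H y x)"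
    using assms by (intro weak_eqI) simp_all
  then show ?thesis using assms by simp
qed

lemma hdist_triangle:
  assumes "x \<in> hcarrier H" "y \<in> hcarrier H" "z \<in> hcarrier H"
  shows "hdist H x z \<le> hdist H x y + hdist H y z"
proof -
  have "hdiff H x z = hadd H (hdiff H x y) (hdiff H y z)"
    using assms by (intro weak_eqI) simp_all
  then show ?thesis unfolding hdist_def using assms hnorm_triangle by simp
qed

lemma hdist_commute: "\<lbrakk>x \<in> hcarrier H; y \<in> hcarrier H\<rbrakk> \<Longrightarrow> hdist H x y = hdist H y x"
  by (simp add: hdist_def hnorm_diff_commute)

lemma hdist_nonneg [simp]: "\<lbrakk>x \<in> hcarrier H; y \<in> hcarrier H\<rbrakk> \<Longrightarrow> 0 \<le> hdist H x y"
  by (simp add: hdist_def)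

lemma hdist_eq_zeroD: "\<lbrakk>x \<in> hcarrier H; y \<in> hcarrier H; hdist H x y = 0\<rbrakk> \<Longrightarrow> x = y"
  by (simp add: hdist_def hnorm_eq_zero hdiff_eq_zeroD)

lemma hnorm_diff_ineq:
  assumes "x \<in> hcarrier H" "y \<in> hcarrier H"
  shows "\<bar>hnorm H x - hnorm H y\<bar> \<le> hdist H x y"
proof -
  have *: "hnorm H x \<le> hdist H x y + hnorm H y" if "x \<in> hcarrier H" "y \<in> hcarrier H" for x y
  proof -
    have "x = hadd H (hdiff H x y) y" using that by (intro weak_eqI) simp_all
    then show ?thesis using that hnorm_triangle[of "hdiff H x y" y] by (simp add: hdist_def)
  qed
  show ?thesis using *[OF assms] *[OF assms(2,1)] hdist_commute[OF assms] by linarith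
qed

text \<open>Uniqueness is what lets the definite description in \<open>hlim\<close> denote.\<close>

lemma hconverges_unique:
  assumes "hconverges H f l F" "hconverges H f l' F" "F \<noteq> bot" "\<And>r. f r \<in> hcarrier H"
  shows "l = l'"
proof -
  have l: "l \<in> hcarrier H" "l' \<in> hcarrier H" using assms by (auto simp: hconverges_def)
  have "((\<lambda>r. hdist H (f r) l + hdist H (f r) l') \<longlongrightarrow> 0 + 0) F"
    using assms by (intro tendsto_add) (auto simp: hconverges_def)
  moreover have "hdist H l l' \<le> hdist H (f r) l + hdist H (f r) l'" for r
    using hdist_triangle[of l "f r" l'] hdist_commute[of l "f r"] l assms(4) by simp
  ultimately have "hdist H l l' \<le> 0 + 0"
    using assms(3) by (intro tendsto_le[OF _ _ tendsto_const, where F=F]) auto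
  then show ?thesis using l hdist_eq_zeroD hdist_nonneg by (metis add_0 antisym)
qed

lemma hlim_eq:
  assumes "hconverges H f l F" "F \<noteq> bot" "\<And>r. f r \<in> hcarrier H"
  shows "hlim H f F = l"
  unfolding hlim_def using assms by (intro the_equality) (auto intro: hconverges_unique)

lemma hconverges_inner:
  assumes "hconverges H f l F" "\<And>r. f r \<in> hcarrier H" "y \<in> hcarrier H"
  shows "((\<lambda>r. hinner H (f r) y) \<longlongrightarrow> hinner H l y) F"
proof -
  have l: "l \<in> hcarrier H" and lim: "((\<lambda>r. hdist H (f r) l) \<longlongrightarrow> 0) F"
    using assms by (auto simp: hconverges_def)
  have "((\<lambda>r. hdist H (f r) l * hnorm H y) \<longlongrightarrow> 0) F"
    using tendsto_mult_right[OF lim, of "hnorm H y"] by simp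
  moreover have "norm (hinner H (f r) y - hinner H l y) \<le> hdist H (f r) l * hnorm H y" for r
    using Cauchy_Schwarz[of "hdiff H (f r) l" y] assms l by (simp add: hdist_def)
  ultimately have "((\<lambda>r. hinner H (f r) y - hinner H l y) \<longlongrightarrow> 0) F"
    by (rule tendsto_norm_le_zero)
  then show ?thesis using Lim_null by blast
qed

lemma hconverges_norm:
  assumes "hconverges H f l F" "\<And>r. f r \<in> hcarrier H"
  shows "((\<lambda>r. hnorm H (f r)) \<longlongrightarrow> hnorm H l) F"
proof -
  have l: "l \<in> hcarrier H" and lim: "((\<lambda>r. hdist H (f r) l) \<longlongrightarrow> 0) F"
    using assms by (auto simp: hconverges_def)
  have "((\<lambda>r. hnorm H (f r) - hnorm H l) \<longlongrightarrow> 0) F"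
    using assms l hnorm_diff_ineq by (intro Lim_null_comparison[OF _ lim] always_eventually) auto
  then show ?thesis using Lim_null by blast
qed

lemma hnorm_le_iff_weak:
  assumes "x \<in> hcarrier H" "0 \<le> c"
    and "\<And>y. y \<in> hcarrier H \<Longrightarrow> cmod (hinner H x y) \<le> c * hnorm H y"
  shows "hnorm H x \<le> c"
proof -
  have "(hnorm H x)\<^sup>2 \<le> c * hnorm H x"
    using assms(3)[OF assms(1)] hinner_self[OF assms(1)] by (simp add: norm_mult power2_eq_square)
  then show ?thesis using assms
    by (cases "hnorm H x = 0") (auto simp: power2_eq_square less_le)
qed

lemma hsum_mem [simp]: "(\<And>k. f k \<in> hcarrier H) \<Longrightarrow> hsum H f n \<in> hcarrier H"
  by (induction n) auto

lemma hinner_hsum: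
  "(\<And>k. f k \<in> hcarrier H) \<Longrightarrow> y \<in> hcarrier H \<Longrightarrow> hinner H (hsum H f n) y = (\<Sum>k<n. hinner H (f k) y)"
  by (induction n) auto

text \<open>The Cauchy estimate by which a summable majorant of the norms yields norm
  convergence.\<close>

lemma hsum_diff_le:
  assumes "\<And>k. f k \<in> hcarrier H" "m \<le> n"
  shows "hdist H (hsum H f n) (hsum H f m) \<le> (\<Sum>k=m..<n. hnorm H (f k))"
  using assms(2)
proof (induction n rule: dec_induct)
  case base
  then show ?case using assms by (simp add: hdist_def hdiff_self)
next
  case (step n)
  have "hdiff H (hsum H f (Suc n)) (hsum H f m) = hadd H (hdiff H (hsum H f n) (hsum H f m)) (f n)"
    using assms by (intro weak_eqI) (simp_all del: hsum.simps add: hinner_hsum)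
  then show ?case using step assms hnorm_triangle[of "hdiff H (hsum H f n) (hsum H f m)" "f n"]
    by (simp add: hdist_def del: hsum.simps)
qed

lemma linear_operatorD:
  assumes "linear_operator H T" "x \<in> hcarrier H"
  shows "T x \<in> hcarrier H" "y \<in> hcarrier H \<Longrightarrow> T (hadd H x y) = hadd H (T x) (T y)"
    "T (hscale H c x) = hscale H c (T x)"
  using assms by (auto simp: linear_operator_def)

lemma linear_operator_diff:
  assumes "linear_operator H T" "x \<in> hcarrier H" "y \<in> hcarrier H"
  shows "T (hdiff H x y) = hdiff H (T x) (T y)"
  using assms by (simp add: hdiff_def linear_operatorD)

lemma bounded_operatorD:
  assumes "bounded_operator H T"
  shows "\<exists>K>0. \<forall>x\<in>hcarrier H. hnorm H (T x) \<le> K * hnorm H x"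
proof -
  obtain K where K: "\<And>x. x \<in> hcarrier H \<Longrightarrow> hnorm H (T x) \<le> K * hnorm H x"
    using assms by (auto simp: bounded_operator_def)
  have "hnorm H (T x) \<le> (\<bar>K\<bar> + 1) * hnorm H x" if x: "x \<in> hcarrier H" for x
  proof -
    have "K * hnorm H x \<le> (\<bar>K\<bar> + 1) * hnorm H x" using x by (intro mult_right_mono) auto
    then show ?thesis using K[OF x] by linarith
  qed
  then show ?thesis by (intro exI[of _ "\<bar>K\<bar> + 1"]) auto
qed

end

sublocale complex_hilbert_space \<subseteq> pre_hilbert H
proof
qed (fact zero_closed add_closed scale_closed add_assoc add_commute add_zero diff_self
    inner_add_left inner_scale_left inner_commute inner_ge_zero inner_eq_zero)+

section \<open>Riesz representation, adjoints and orthonormal bases\<close>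

context complex_hilbert_space
begin

text \<open>If \<open>f\<close> is represented by \<open>u\<close>, then \<open>Q x\<close> is the
  squared distance from \<open>x\<close> to \<open>u\<close> minus the squared norm of
  \<open>u\<close>. So \<open>u\<close> is sought as the minimiser of \<open>Q\<close>: the
  parallelogram law makes a minimising sequence Cauchy, and vanishing of the first variation at its
  limit is the representation.\<close>

lemma Riesz:
  assumes add: "\<And>x y. x \<in> hcarrier H \<Longrightarrow> y \<in> hcarrier H \<Longrightarrow> f (hadd H x y) = f x + f y"
    and scale: "\<And>c x. x \<in> hcarrier H \<Longrightarrow> f (hscale H c x) = c * f x"
    and bound: "\<And>x. x \<in> hcarrier H \<Longrightarrow> cmod (f x) \<le> K * hnorm H x"
  shows "\<exists>u\<in>hcarrier H. \<forall>x\<in>hcarrier H. f x = hinner H x u"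
proof -
  define Q where "Q x = (hnorm H x)\<^sup>2 - 2 * Re (f x)" for x
  define m where "m = (INF x\<in>hcarrier H. Q x)"
  have Qge: "Q x \<ge> - K\<^sup>2" if x: "x \<in> hcarrier H" for x
  proof -
    have "Re (f x) \<le> K * hnorm H x" using bound[OF x] complex_Re_le_cmod order_trans by blast
    moreover have "0 \<le> (hnorm H x - K)\<^sup>2" by simp
    ultimately show ?thesis by (simp add: Q_def power2_eq_square algebra_simps)
  qed
  then have bdd: "bdd_below (Q ` hcarrier H)" by (intro bdd_belowI2)
  have mle: "m \<le> Q x" if "x \<in> hcarrier H" for x
    unfolding m_def using bdd that by (rule cINF_lower)
  have "\<exists>x\<in>hcarrier H. Q x < m + 1 / real (Suc n)" for n
  proof (rule ccontr)
    assume "\<not> ?thesis"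
    then have "m + 1 / real (Suc n) \<le> m"
      unfolding m_def using zero_mem by (intro cINF_greatest) (auto simp: m_def[symmetric] not_less simp del: zero_mem)
    then show False by simp
  qed
  then obtain X where X: "\<And>n. X n \<in> hcarrier H" "\<And>n. Q (X n) < m + 1 / real (Suc n)"
    by metis
  \<comment> \<open>Parallelogram law, with \<open>Q \<ge> m\<close> used at the midpoint: two
    near-minimisers are close to each other.\<close>
  have par: "(hdist H x y)\<^sup>2 \<le> 2 * (Q x - m) + 2 * (Q y - m)" if x: "x \<in> hcarrier H" and y: "y \<in> hcarrier H" for x y
  proof -
    have "Q (hscale H (1/2) (hadd H x y)) \<ge> m" using x y mle by simp
    then have "4 * m \<le> (hnorm H (hadd H x y))\<^sup>2 - 4 * Re (f x) - 4 * Re (f y)"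
      using x y by (simp add: Q_def add scale power_mult_distrib power_divide field_simps)
    then show ?thesis using x y by (simp add: hdist_def hnorm_diff_sq hnorm_add_sq Q_def)
  qed
  have "\<exists>l. hconverges H X l sequentially"
  proof (rule complete)
    fix e :: real assume e: "e > 0"
    \<comment> \<open>This puts both excesses over \<open>m\<close> below \<open>e^2 / 4\<close>,
      and \<open>par\<close> then gives a squared distance below \<open>e^2\<close>.\<close>
    obtain n0 where n0: "4 / e\<^sup>2 < real n0" using reals_Archimedean2 by blast
    have "hdist H (X i) (X j) < e" if "i \<ge> n0" "j \<ge> n0" for i j
    proof -
      have p: "0 < 4 / e\<^sup>2" using e by simp
      have "Q (X k) < m + e\<^sup>2 / 4" if "k \<ge> n0" for k
      proof -
        have "4 / e\<^sup>2 < real (Suc k)" using that n0 by linarith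
        then have "1 / real (Suc k) < e\<^sup>2 / 4" using e by (simp add: field_simps del: of_nat_Suc)
        then show ?thesis using X(2)[of k] by (meson add_strict_left_mono less_trans)
      qed
      from this[OF \<open>i \<ge> n0\<close>] this[OF \<open>j \<ge> n0\<close>]
      have "(hdist H (X i) (X j))\<^sup>2 < e\<^sup>2"
        using par[OF X(1) X(1), of i j] by (auto simp: field_simps)
      then show ?thesis using e power2_less_imp_less less_imp_le by blast
    qed
    then show "\<exists>n0. \<forall>m\<ge>n0. \<forall>n\<ge>n0. hdist H (X m) (X n) < e" by blast
  qed (fact X)
  then obtain u where u: "hconverges H X u sequentially" ..
  then have uH: "u \<in> hcarrier H" by (simp add: hconverges_def)
  have flim: "(\<lambda>n. f (X n)) \<longlonglongrightarrow> f u"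
  proof -
    have "(\<lambda>n. K * hdist H (X n) u) \<longlonglongrightarrow> 0"
      using u tendsto_mult_right_zero unfolding hconverges_def by blast
    moreover have "norm (f (X n) - f u) \<le> K * hdist H (X n) u" for n
      using bound[of "hdiff H (X n) u"] X uH by (simp add: hdist_def hdiff_def add scale)
    ultimately have "(\<lambda>n. f (X n) - f u) \<longlonglongrightarrow> 0"
      by (rule tendsto_norm_le_zero)
    then show ?thesis using Lim_null by blast
  qed
  have "(\<lambda>n. Q (X n)) \<longlonglongrightarrow> Q u"
    unfolding Q_def by (intro tendsto_intros hconverges_norm[OF u] X flim)
  moreover have "(\<lambda>n. m + 1 / real (Suc n)) \<longlonglongrightarrow> m + 0"
    by (intro tendsto_intros LIMSEQ_inverse_real_of_nat[unfolded inverse_eq_divide])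
  ultimately have Qu: "Q u \<le> m"
    using X(2) by (intro LIMSEQ_le[of "\<lambda>n. Q (X n)" _ "\<lambda>n. m + 1 / real (Suc n)"]) (auto intro: less_imp_le)
  have "f y = hinner H y u" if y: "y \<in> hcarrier H" for y
  proof -
    \<comment> \<open>\<open>d\<close> is the defect of the representation at \<open>y\<close>.
      Moving from \<open>u\<close> by \<open>c\<close> times \<open>y\<close> changes
      \<open>Q\<close> by \<open>e * |d|^2 * (e * |y|^2 - 2)\<close>. This is negative unless
      \<open>d = 0\<close>, because \<open>e\<close> is chosen with
      \<open>e * |y|^2 < 1\<close>.\<close>
    define d where "d = f y - hinner H y u"
    define e where "e = 1 / ((hnorm H y)\<^sup>2 + 1)"
    define c where "c = of_real e * cnj d"
    have pos: "(hnorm H y)\<^sup>2 + 1 > 0" by (simp add: add_nonneg_pos)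
    have e: "e > 0" "e * (hnorm H y)\<^sup>2 < 1" using pos by (auto simp: e_def field_simps)
    have "Q u \<le> Q (hadd H u (hscale H c y))" using Qu mle[of "hadd H u (hscale H c y)"] y uH by simp
    then have "0 \<le> (cmod c * hnorm H y)\<^sup>2 + 2 * Re (hinner H u (hscale H c y)) - 2 * Re (c * f y)"
      using y uH by (simp add: Q_def hnorm_add_sq add scale del: hinner_scale_right)
    also have "Re (hinner H u (hscale H c y)) = Re (c * hinner H y u)"
      using y uH hinner_commute[of y u] by simp
    finally have "0 \<le> (cmod c * hnorm H y)\<^sup>2 - 2 * Re (c * d)"
      by (simp add: d_def algebra_simps)
    also have "c * d = of_real (e * (cmod d)\<^sup>2)"
      using complex_norm_square[of d] by (simp add: c_def mult_ac)
    also have "cmod c = e * cmod d" using e by (simp add: c_def norm_mult)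
    finally have "0 \<le> (e * (cmod d)\<^sup>2) * (e * (hnorm H y)\<^sup>2 - 2)"
      by (simp add: power2_eq_square algebra_simps)
    then have "e * (cmod d)\<^sup>2 \<le> 0" using e by (simp add: zero_le_mult_iff)
    then have "d = 0" using e by (simp add: mult_le_0_iff)
    then show ?thesis by (simp add: d_def)
  qed
  then show ?thesis using uH by blast
qed

lemma adjoint_exists:
  assumes "bounded_operator H T" "y \<in> hcarrier H"
  shows "\<exists>z\<in>hcarrier H. \<forall>x\<in>hcarrier H. hinner H (T x) y = hinner H x z"
proof -
  have lin: "linear_operator H T" using assms by (simp add: bounded_operator_def)
  obtain K where K: "K > 0" "\<And>x. x \<in> hcarrier H \<Longrightarrow> hnorm H (T x) \<le> K * hnorm H x"
    using bounded_operatorD[OF assms(1)] by blast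
  show ?thesis
  proof (rule Riesz[of "\<lambda>x. hinner H (T x) y" "K * hnorm H y"])
    fix x assume x: "x \<in> hcarrier H"
    have "cmod (hinner H (T x) y) \<le> hnorm H (T x) * hnorm H y"
      using x assms lin by (intro Cauchy_Schwarz) (auto simp: linear_operatorD)
    also have "\<dots> \<le> (K * hnorm H x) * hnorm H y" using K(2)[OF x] assms(2) by (intro mult_right_mono) auto
    finally show "cmod (hinner H (T x) y) \<le> K * hnorm H y * hnorm H x" by (simp add: algebra_simps)
  qed (use assms lin in \<open>auto simp: linear_operatorD\<close>)
qed

lemma
  assumes "bounded_operator H T" "y \<in> hcarrier H"
  shows adjoint_mem [simp]: "bounded_adjoint H T y \<in> hcarrier H"
    and hinner_adjoint: "x \<in> hcarrier H \<Longrightarrow> hinner H (T x) y = hinner H x (bounded_adjoint H T y)"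
proof -
  have "\<exists>!z. z \<in> hcarrier H \<and> (\<forall>x\<in>hcarrier H. hinner H (T x) y = hinner H x z)"
    using adjoint_exists[OF assms] by (auto intro: weak_eqI_right)
  from theI'[OF this]
  show "bounded_adjoint H T y \<in> hcarrier H"
    and "x \<in> hcarrier H \<Longrightarrow> hinner H (T x) y = hinner H x (bounded_adjoint H T y)"
    by (auto simp: bounded_adjoint_def)
qed

lemma bounded_adjoint_bounded:
  assumes "bounded_operator H T"
  shows "bounded_operator H (bounded_adjoint H T)"
proof -
  have lin: "linear_operator H T" using assms by (simp add: bounded_operator_def)
  obtain K where K: "K > 0" "\<And>x. x \<in> hcarrier H \<Longrightarrow> hnorm H (T x) \<le> K * hnorm H x"
    using bounded_operatorD[OF assms(1)] by blast
  have "linear_operator H (bounded_adjoint H T)"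
    unfolding linear_operator_def using assms lin
    by (auto intro!: weak_eqI_right simp: linear_operatorD simp flip: hinner_adjoint)
  moreover have "hnorm H (bounded_adjoint H T x) \<le> K * hnorm H x" if x: "x \<in> hcarrier H" for x
  proof (rule hnorm_le_iff_weak)
    fix y assume y: "y \<in> hcarrier H"
    have "cmod (hinner H (bounded_adjoint H T x) y) = cmod (hinner H (T y) x)"
      using x y assms hinner_commute[of y "bounded_adjoint H T x"] by (simp add: hinner_adjoint)
    also have "\<dots> \<le> hnorm H (T y) * hnorm H x"
      using x y lin by (intro Cauchy_Schwarz) (auto simp: linear_operatorD)
    also have "\<dots> \<le> (K * hnorm H y) * hnorm H x" using K(2)[OF y] x by (intro mult_right_mono) auto
    finally show "cmod (hinner H (bounded_adjoint H T x) y) \<le> K * hnorm H x * hnorm H y"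
      by (simp add: algebra_simps)
  qed (use x K assms in auto)
  ultimately show ?thesis by (auto simp: bounded_operator_def)
qed

text \<open>Zorn's lemma on orthonormal sets; two vectors in the union of a chain lie in a common
  member. A maximal set is a basis, since a nonzero vector orthogonal to it could be normalised and
  adjoined. The tensor powers select their basis by choice, so they rest on this existence.\<close>

lemma orthonormal_basis_exists: "\<exists>B. orthonormal_basis H B"
proof -
  define P where "P = {B. B \<subseteq> hcarrier H \<and> (\<forall>x\<in>B. \<forall>y\<in>B. hinner H x y = (if x = y then 1 else 0))}"
  have "\<exists>M\<in>P. \<forall>X\<in>P. M \<subseteq> X \<longrightarrow> X = M"
  proof (rule subset_Zorn)
    fix C assume C: "subset.chain P C"
    show "\<exists>U\<in>P. \<forall>X\<in>C. X \<subseteq> U"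
    proof (intro bexI[of _ "\<Union>C"] ballI)
      have "hinner H x y = (if x = y then 1 else 0)" if "X \<in> C" "x \<in> X" "Y \<in> C" "y \<in> Y" for x y X Y
      proof -
        have "X \<subseteq> Y \<or> Y \<subseteq> X" using C that by (auto simp: subset.chain_def)
        moreover have "X \<in> P" "Y \<in> P" using C that by (auto simp: subset.chain_def)
        ultimately show ?thesis using that unfolding P_def by blast
      qed
      moreover have "\<Union>C \<subseteq> hcarrier H" using C by (auto simp: subset.chain_def P_def)
      ultimately show "\<Union>C \<in> P" unfolding P_def by blast
    qed auto
  qed
  then obtain M where M: "M \<in> P" "\<And>X. X \<in> P \<Longrightarrow> M \<subseteq> X \<Longrightarrow> X = M" by blast
  have "x = hzero H" if x: "x \<in> hcarrier H" "\<forall>b\<in>M. hinner H x b = 0" for x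
  proof (rule ccontr)
    assume nz: "x \<noteq> hzero H"
    let ?u = "hscale H (1 / of_real (hnorm H x)) x"
    have n: "hnorm H x \<noteq> 0" using nz x hnorm_eq_zero by blast
    have uu: "hinner H ?u ?u = 1" using x n by (simp add: hinner_self power2_eq_square norm_divide)
    have "hinner H ?u b = 0" "hinner H b ?u = 0" if "b \<in> M" for b
      using that x M(1) hinner_commute[of x b] by (auto simp: P_def)
    moreover from this have "?u \<notin> M" using uu by force
    ultimately have "insert ?u M \<in> P" using M(1) x uu by (auto simp: P_def)
    then show False using M(2)[of "insert ?u M"] \<open>?u \<notin> M\<close> by blast
  qed
  then have "orthonormal_basis H M" using M(1) by (auto simp: orthonormal_basis_def P_def)
  then show ?thesis ..
qed

end

section \<open>Parseval's identity and unitary exponentials\<close>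

lemma l2_abs_summable:
  fixes f g :: "'a \<Rightarrow> complex"
  assumes "(\<lambda>x. (cmod (f x))\<^sup>2) summable_on A" "(\<lambda>x. (cmod (g x))\<^sup>2) summable_on A"
  shows "(\<lambda>x. cmod (f x * g x)) summable_on A"
proof (rule summable_on_comparison_test)
  show "(\<lambda>x. (cmod (f x))\<^sup>2 + (cmod (g x))\<^sup>2) summable_on A"
    using assms by (rule summable_on_add)
  show "norm (f x * g x) \<le> (cmod (f x))\<^sup>2 + (cmod (g x))\<^sup>2" for x
  proof -
    have "0 \<le> (cmod (f x) - cmod (g x))\<^sup>2" "0 \<le> cmod (f x) * cmod (g x)" by simp_all
    then show ?thesis unfolding norm_mult power2_diff by linarith
  qed
qed auto

text \<open>Absolute convergence reduces the estimate to finite partial sums.\<close>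

lemma l2_Cauchy_Schwarz:
  fixes f g :: "'a \<Rightarrow> complex"
  assumes f: "(\<lambda>x. (cmod (f x))\<^sup>2) summable_on A" and g: "(\<lambda>x. (cmod (g x))\<^sup>2) summable_on A"
  shows "cmod (infsum (\<lambda>x. f x * g x) A)
    \<le> sqrt (infsum (\<lambda>x. (cmod (f x))\<^sup>2) A) * sqrt (infsum (\<lambda>x. (cmod (g x))\<^sup>2) A)"
proof -
  note s = l2_abs_summable[OF assms]
  have "cmod (infsum (\<lambda>x. f x * g x) A) \<le> infsum (\<lambda>x. cmod (f x * g x)) A"
    using s by (rule norm_infsum_bound)
  also have "\<dots> \<le> sqrt (infsum (\<lambda>x. (cmod (f x))\<^sup>2) A) * sqrt (infsum (\<lambda>x. (cmod (g x))\<^sup>2) A)"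
  proof (rule infsum_le_finite_sums[OF s])
    fix F assume F: "finite F" "F \<subseteq> A"
    have "(\<Sum>x\<in>F. cmod (f x * g x)) = (\<Sum>x\<in>F. \<bar>cmod (f x)\<bar> * \<bar>cmod (g x)\<bar>)"
      by (simp add: norm_mult)
    also have "\<dots> \<le> L2_set (\<lambda>x. cmod (f x)) F * L2_set (\<lambda>x. cmod (g x)) F"
      by (rule L2_set_mult_ineq)
    also have "\<dots> \<le> sqrt (infsum (\<lambda>x. (cmod (f x))\<^sup>2) A) * sqrt (infsum (\<lambda>x. (cmod (g x))\<^sup>2) A)"
      unfolding L2_set_def using F f g
      by (intro mult_mono real_sqrt_le_mono finite_sum_le_infsum) (auto intro!: sum_nonneg infsum_nonneg)
    finally show "(\<Sum>x\<in>F. cmod (f x * g x)) \<le> \<dots>" .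
  qed
  finally show ?thesis .
qed

text \<open>Derivatives of vectors in an explicit carrier are expressed by norm limits of difference
  quotients, so scalar derivatives are brought into the same form.\<close>

lemma has_vector_derivative_iff_quotient:
  fixes f :: "real \<Rightarrow> 'b::real_normed_vector"
  shows "(f has_vector_derivative D) (at x) \<longleftrightarrow> ((\<lambda>h. (f (x + h) - f x) /\<^sub>R h) \<longlongrightarrow> D) (at 0)"
proof -
  have "(f has_vector_derivative D) (at x) \<longleftrightarrow> ((\<lambda>h. norm (f (x + h) - f x - h *\<^sub>R D) / norm h) \<longlongrightarrow> 0) (at 0)"
    by (simp add: has_vector_derivative_def has_derivative_at bounded_linear_scaleR_left)
  also have "\<dots> \<longleftrightarrow> ((\<lambda>h. norm ((f (x + h) - f x) /\<^sub>R h - D)) \<longlongrightarrow> 0) (at 0)"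
  proof (intro filterlim_cong refl)
    have "norm (f (x + h) - f x - h *\<^sub>R D) / norm h = norm ((f (x + h) - f x) /\<^sub>R h - D)" if "h \<noteq> 0" for h
    proof -
      have "(f (x + h) - f x) /\<^sub>R h - D = (f (x + h) - f x - h *\<^sub>R D) /\<^sub>R h"
        using that by (simp add: scaleR_right_diff_distrib)
      then show ?thesis by (simp add: divide_inverse mult.commute)
    qed
    then show "\<forall>\<^sub>F h in at 0. norm (f (x + h) - f x - h *\<^sub>R D) / norm h = norm ((f (x + h) - f x) /\<^sub>R h - D)"
      by (simp add: eventually_at_filter)
  qed
  also have "\<dots> \<longleftrightarrow> ((\<lambda>h. (f (x + h) - f x) /\<^sub>R h) \<longlongrightarrow> D) (at 0)"
    by (simp add: tendsto_norm_zero_iff flip: Lim_null)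
  finally show ?thesis .
qed

context pre_hilbert
begin

text \<open>The projection onto the span of \<open>F\<close> is described by its inner products
  alone and built up one basis vector at a time.\<close>

lemma orthonormal_projection:
  assumes "finite F" "F \<subseteq> hcarrier H" "\<forall>b\<in>F. \<forall>c\<in>F. hinner H b c = (if b = c then 1 else 0)"
    "x \<in> hcarrier H"
  shows "\<exists>p\<in>hcarrier H. \<forall>y\<in>hcarrier H. hinner H p y = (\<Sum>b\<in>F. hinner H x b * hinner H b y)"
  using assms(1,2)
proof (induction F rule: finite_induct)
  case empty
  then show ?case by (intro bexI[of _ "hzero H"]) auto
next
  case (insert b F)
  then obtain p where "p \<in> hcarrier H" "\<forall>y\<in>hcarrier H. hinner H p y = (\<Sum>b\<in>F. hinner H x b * hinner H b y)"
    by auto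
  then show ?case using insert
    by (intro bexI[of _ "hadd H p (hscale H (hinner H x b) b)"]) auto
qed

text \<open>Both \<open>hinner H p x\<close> and \<open>hinner H p p\<close> equal the sum of
  squared coefficients, so the squared distance from \<open>x\<close> to its projection is the
  difference of the two sides.\<close>

lemma Bessel:
  assumes F: "finite F" "F \<subseteq> hcarrier H" and on: "\<forall>b\<in>F. \<forall>c\<in>F. hinner H b c = (if b = c then 1 else 0)"
    and x: "x \<in> hcarrier H"
  shows "(\<Sum>b\<in>F. (cmod (hinner H x b))\<^sup>2) \<le> (hnorm H x)\<^sup>2"
proof -
  obtain p where p: "p \<in> hcarrier H"
    "\<And>y. y \<in> hcarrier H \<Longrightarrow> hinner H p y = (\<Sum>b\<in>F. hinner H x b * hinner H b y)"
    using orthonormal_projection[OF assms] by blast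
  let ?s = "\<Sum>b\<in>F. (cmod (hinner H x b))\<^sup>2"
  have 1: "hinner H p x = of_real ?s"
  proof -
    have "hinner H b x = cnj (hinner H x b)" if "b \<in> F" for b
      using that F x hinner_commute by blast
    then show ?thesis using x by (simp add: p complex_norm_square[symmetric] del: of_real_power)
  qed
  have "hinner H b p = cnj (hinner H x b)" if b: "b \<in> F" for b
  proof -
    have "hinner H p b = (\<Sum>c\<in>F. if c = b then hinner H x c else 0)"
    proof (subst p(2))
      have "hinner H c b = (if c = b then 1 else 0)" if "c \<in> F" for c using on b that by blast
      then show "(\<Sum>c\<in>F. hinner H x c * hinner H c b) = (\<Sum>c\<in>F. if c = b then hinner H x c else 0)"
        by (intro sum.cong) auto
    qed (use b F in auto)
    then have "hinner H p b = hinner H x b" using b F by (simp add: sum.delta)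
    moreover have "b \<in> hcarrier H" using b F by blast
    ultimately show ?thesis using hinner_commute[of p b] p(1) by simp
  qed
  then have 2: "hinner H p p = of_real ?s"
    by (subst p(2)[OF p(1)]) (simp add: complex_norm_square[symmetric] del: of_real_power)
  have "0 \<le> (hnorm H (hdiff H x p))\<^sup>2" by simp
  also have "\<dots> = (hnorm H x)\<^sup>2 - ?s"
    using 1 2 p x hinner_commute[of p x] by (simp add: hnorm_diff_sq flip: Re_hinner_self)
  finally show ?thesis by simp
qed

end

context complex_hilbert_space
begin

lemma
  assumes B: "orthonormal_basis H B" and x: "x \<in> hcarrier H"
  shows Bessel_summable: "(\<lambda>b. (cmod (hinner H x b))\<^sup>2) summable_on B"
    and Bessel_infsum: "infsum (\<lambda>b. (cmod (hinner H x b))\<^sup>2) B \<le> (hnorm H x)\<^sup>2"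
proof -
  have *: "(\<Sum>b\<in>F. (cmod (hinner H x b))\<^sup>2) \<le> (hnorm H x)\<^sup>2" if "finite F" "F \<subseteq> B" for F
  proof (rule Bessel)
    show "\<forall>b\<in>F. \<forall>c\<in>F. hinner H b c = (if b = c then 1 else 0)"
      using B that unfolding orthonormal_basis_def by blast
  qed (use B that x in \<open>auto simp: orthonormal_basis_def\<close>)
  then show s: "(\<lambda>b. (cmod (hinner H x b))\<^sup>2) summable_on B"
    by (intro nonneg_bdd_above_summable_on bdd_aboveI[of _ "(hnorm H x)\<^sup>2"]) auto
  show "infsum (\<lambda>b. (cmod (hinner H x b))\<^sup>2) B \<le> (hnorm H x)\<^sup>2"
    using s * by (rule infsum_le_finite_sums)
qed

text \<open>The Fourier series is not summed in \<open>H\<close>. The functional taking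
  \<open>y\<close> to the sum of \<open>hinner H y b * hinner H b z\<close> is bounded by Bessel,
  hence given by some \<open>u\<close> by Riesz. Since \<open>u\<close> and \<open>z\<close> have
  the same coefficients, totality of \<open>B\<close> makes them equal. Completeness enters this
  argument through Riesz.\<close>

lemma Parseval_has_sum:
  assumes B: "orthonormal_basis H B" and x: "x \<in> hcarrier H" and z: "z \<in> hcarrier H"
  shows "((\<lambda>b. hinner H x b * hinner H b z) has_sum hinner H x z) B"
    and "(\<lambda>b. cmod (hinner H x b * hinner H b z)) summable_on B"
proof -
  have BH: "b \<in> hcarrier H" if "b \<in> B" for b using B that by (auto simp: orthonormal_basis_def)
  have flip: "hinner H b z = cnj (hinner H z b)" if "b \<in> B" for b
    using hinner_commute[OF z BH[OF that]] .
  have zs: "(\<lambda>b. (cmod (hinner H b z))\<^sup>2) summable_on B" "infsum (\<lambda>b. (cmod (hinner H b z))\<^sup>2) B \<le> (hnorm H z)\<^sup>2"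
    using Bessel_summable[OF B z] Bessel_infsum[OF B z]
    by (simp_all add: flip cong: summable_on_cong infsum_cong)
  have abs: "(\<lambda>b. cmod (hinner H y b * hinner H b z)) summable_on B" if "y \<in> hcarrier H" for y
    using Bessel_summable[OF B that] zs(1) by (rule l2_abs_summable)
  have summ: "(\<lambda>b. hinner H y b * hinner H b z) summable_on B" if "y \<in> hcarrier H" for y
    by (rule Infinite_Sum.abs_summable_summable[OF abs[OF that]])
  define f where "f y = infsum (\<lambda>b. hinner H y b * hinner H b z) B" for y
  have "\<exists>u\<in>hcarrier H. \<forall>y\<in>hcarrier H. f y = hinner H y u"
  proof (rule Riesz[of _ "hnorm H z"])
    fix y assume y: "y \<in> hcarrier H"
    have "cmod (f y) \<le> sqrt (infsum (\<lambda>b. (cmod (hinner H y b))\<^sup>2) B) * sqrt (infsum (\<lambda>b. (cmod (hinner H b z))\<^sup>2) B)"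
      unfolding f_def using Bessel_summable[OF B y] zs(1) by (rule l2_Cauchy_Schwarz)
    also have "\<dots> \<le> sqrt ((hnorm H y)\<^sup>2) * sqrt ((hnorm H z)\<^sup>2)"
      using Bessel_infsum[OF B y] zs(2) by (intro mult_mono real_sqrt_le_mono) (auto intro: infsum_nonneg)
    finally show "cmod (f y) \<le> hnorm H z * hnorm H y" using y z by (simp add: mult.commute)
  next
    fix y y' assume y: "y \<in> hcarrier H" "y' \<in> hcarrier H"
    have "f (hadd H y y') = infsum (\<lambda>b. hinner H y b * hinner H b z + hinner H y' b * hinner H b z) B"
      unfolding f_def using y BH by (intro infsum_cong) (simp add: distrib_right)
    then show "f (hadd H y y') = f y + f y'" unfolding f_def using summ y by (simp add: infsum_add)
  next
    fix c y assume y: "y \<in> hcarrier H"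
    have "f (hscale H c y) = infsum (\<lambda>b. c * (hinner H y b * hinner H b z)) B"
      unfolding f_def using y BH by (intro infsum_cong) simp
    then show "f (hscale H c y) = c * f y"
      unfolding f_def using summ[OF y] by (simp add: infsum_cmult_right)
  qed
  then obtain u where u: "u \<in> hcarrier H" "\<And>y. y \<in> hcarrier H \<Longrightarrow> f y = hinner H y u" by blast
  have "hinner H (hdiff H u z) b = 0" if b: "b \<in> B" for b
  proof -
    have "f b = infsum (\<lambda>c. if c = b then hinner H c z else 0) B"
      unfolding f_def using b B by (intro infsum_cong) (auto simp: orthonormal_basis_def)
    also have "\<dots> = infsum (\<lambda>c. hinner H c z) {b}"
      using b by (intro infsum_cong_neutral) auto
    finally have "hinner H b u = hinner H b z" using u b BH by simp
    then show ?thesis using u z b BH hinner_commute[of b u] hinner_commute[of b z] by simp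
  qed
  then have "hdiff H u z = hzero H" using B u z by (simp add: orthonormal_basis_def)
  then have "u = z" using u z hdiff_eq_zeroD by blast
  then show "((\<lambda>b. hinner H x b * hinner H b z) has_sum hinner H x z) B"
    using summ[OF x] u x unfolding f_def has_sum_iff by auto
  show "(\<lambda>b. cmod (hinner H x b * hinner H b z)) summable_on B" using abs[OF x] .
qed

lemma Parseval_norm:
  assumes B: "orthonormal_basis H B" and x: "x \<in> hcarrier H"
  shows "((\<lambda>b. (cmod (hinner H x b))\<^sup>2) has_sum (hnorm H x)\<^sup>2) B"
proof -
  have "((\<lambda>b. hinner H x b * hinner H b x) has_sum hinner H x x) B" using Parseval_has_sum B x by blast
  also have "hinner H x x = of_real ((hnorm H x)\<^sup>2)" using hinner_self[OF x] .
  also have "((\<lambda>b. hinner H x b * hinner H b x) has_sum of_real ((hnorm H x)\<^sup>2)) B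
      \<longleftrightarrow> ((\<lambda>b. of_real ((cmod (hinner H x b))\<^sup>2)) has_sum (of_real ((hnorm H x)\<^sup>2)::complex)) B"
  proof (rule has_sum_cong)
    fix b assume "b \<in> B"
    then have "b \<in> hcarrier H" using B by (auto simp: orthonormal_basis_def)
    then show "hinner H x b * hinner H b x = of_real ((cmod (hinner H x b))\<^sup>2)"
      using hinner_commute[OF x] by (simp add: complex_norm_square[symmetric] del: of_real_power)
  qed
  finally show ?thesis by (simp add: has_sum_of_real_iff del: of_real_power)
qed

end

section \<open>The unitary group generated by a bounded self-adjoint operator\<close>

definition self_adjoint :: "'a inner_space \<Rightarrow> ('a \<Rightarrow> 'a) \<Rightarrow> bool" where
  "self_adjoint H T \<longleftrightarrow> bounded_operator H T
     \<and> (\<forall>x\<in>hcarrier H. \<forall>y\<in>hcarrier H. hinner H (T x) y = hinner H x (T y))"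

text \<open>Spelled as in \<open>conservation_sa\<close>, so that the exponential occurring there
  folds to this constant.\<close>

definition unitary_exp :: "'a inner_space \<Rightarrow> ('a \<Rightarrow> 'a) \<Rightarrow> real \<Rightarrow> 'a \<Rightarrow> 'a" where
  "unitary_exp H T r = operator_exp H (\<lambda>x. hscale H (\<i> * of_real r) (T x))"

locale self_adjoint_op = complex_hilbert_space +
  fixes T assumes sa: "self_adjoint H T"
begin

lemma T_bounded: "bounded_operator H T" using sa by (simp add: self_adjoint_def)
lemma T_linear: "linear_operator H T" using T_bounded by (simp add: bounded_operator_def)
lemma T_mem [simp]: "x \<in> hcarrier H \<Longrightarrow> T x \<in> hcarrier H" using T_linear by (rule linear_operatorD)
lemma T_sym: "x \<in> hcarrier H \<Longrightarrow> y \<in> hcarrier H \<Longrightarrow> hinner H (T x) y = hinner H x (T y)"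
  using sa by (simp add: self_adjoint_def)

lemma T_pow_mem [simp]: "x \<in> hcarrier H \<Longrightarrow> (T ^^ k) x \<in> hcarrier H"
  by (induction k) auto

lemma T_pow_sym: "x \<in> hcarrier H \<Longrightarrow> y \<in> hcarrier H \<Longrightarrow> hinner H ((T ^^ k) x) y = hinner H x ((T ^^ k) y)"
proof (induction k arbitrary: y)
  case (Suc k)
  then show ?case using T_sym[of "(T ^^ k) x" y] Suc.IH[of "T y"] by (simp add: funpow_swap1)
qed simp

definition K where "K = (SOME K. K > 0 \<and> (\<forall>x\<in>hcarrier H. hnorm H (T x) \<le> K * hnorm H x))"

lemma K: "K > 0" "x \<in> hcarrier H \<Longrightarrow> hnorm H (T x) \<le> K * hnorm H x"
proof -
  have "\<exists>K. K > 0 \<and> (\<forall>x\<in>hcarrier H. hnorm H (T x) \<le> K * hnorm H x)"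
    using bounded_operatorD[OF T_bounded] by blast
  from someI_ex[OF this]
  show "K > 0" "x \<in> hcarrier H \<Longrightarrow> hnorm H (T x) \<le> K * hnorm H x" unfolding K_def by blast+
qed

lemma T_pow_norm: "x \<in> hcarrier H \<Longrightarrow> hnorm H ((T ^^ k) x) \<le> K ^ k * hnorm H x"
proof (induction k)
  case (Suc k)
  have "hnorm H ((T ^^ Suc k) x) \<le> K * hnorm H ((T ^^ k) x)" using Suc K by simp
  also have "\<dots> \<le> K * (K ^ k * hnorm H x)" using Suc K(1) by (intro mult_left_mono) auto
  finally show ?case by (simp add: mult.assoc)
qed simp

lemma funpow_scale:
  "x \<in> hcarrier H \<Longrightarrow> ((\<lambda>x. hscale H c (T x)) ^^ k) x = hscale H (c ^ k) ((T ^^ k) x)"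
proof (induction k)
  case 0
  then show ?case by (simp add: scale_one)
next
  case (Suc k)
  then show ?case using linear_operatorD(3)[OF T_linear, of "(T ^^ k) x"] by (simp add: scale_scale)
qed

text \<open>The partial sums are Cauchy by comparison with the real series for
  \<open>exp (cmod c * K)\<close>.\<close>

lemma exp_convergent:
  assumes x: "x \<in> hcarrier H"
  shows "\<exists>l. hconverges H (hsum H (\<lambda>k. hscale H (1 / fact k) (((\<lambda>x. hscale H c (T x)) ^^ k) x))) l sequentially"
proof -
  define f where "f k = hscale H (1 / fact k) (((\<lambda>x. hscale H c (T x)) ^^ k) x)" for k
  define g where "g k = (cmod c * K) ^ k /\<^sub>R fact k * hnorm H x" for k
  have f: "f k \<in> hcarrier H" for k using x by (simp add: f_def funpow_scale)
  have fg: "hnorm H (f k) \<le> g k" for k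
    using x mult_left_mono[OF T_pow_norm[OF x, of k], of "cmod c ^ k / fact k"]
    by (simp add: f_def g_def funpow_scale norm_divide norm_mult norm_power power_mult_distrib field_simps)
  have "summable g" unfolding g_def by (intro summable_mult2 summable_exp_generic)
  have main: "\<exists>n0. \<forall>m\<ge>n0. \<forall>n\<ge>n0. hdist H (hsum H f m) (hsum H f n) < e" if e: "e > 0" for e
  proof -
    obtain n0 where n0: "\<And>m n. m \<ge> n0 \<Longrightarrow> norm (sum g {m..<n}) < e"
      using \<open>summable g\<close> e unfolding summable_Cauchy by blast
    have *: "hdist H (hsum H f n) (hsum H f m) < e" if "m \<ge> n0" "m \<le> n" for m n
    proof -
      have "hdist H (hsum H f n) (hsum H f m) \<le> sum g {m..<n}"
        using hsum_diff_le[of f m n] f fg that sum_mono[of "{m..<n}" "\<lambda>k. hnorm H (f k)" g] by force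
      then show ?thesis using n0[OF that(1), of n] by simp
    qed
    have "hdist H (hsum H f m) (hsum H f n) < e" if "m \<ge> n0" "n \<ge> n0" for m n
      using *[of m n] *[of n m] that hdist_commute[of "hsum H f m" "hsum H f n"] f
      by (cases m n rule: linorder_le_cases) auto
    then show ?thesis by blast
  qed
  show ?thesis unfolding f_def[symmetric] using f main by (intro complete) auto
qed

abbreviation E where "E \<equiv> unitary_exp H T"

text \<open>From here on the exponential is handled weakly, through the scalar power series of its
  matrix elements. The limit hidden in \<open>operator_exp\<close> does not have to be evaluated
  again.\<close>

lemma
  assumes x: "x \<in> hcarrier H"
  shows E_mem [simp]: "E r x \<in> hcarrier H"
    and E_sums: "y \<in> hcarrier H \<Longrightarrow> (\<lambda>k. (\<i> * of_real r) ^ k / fact k * hinner H ((T ^^ k) x) y) sums hinner H (E r x) y"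
proof -
  define f where "f k = hscale H (1 / fact k) (((\<lambda>x. hscale H (\<i> * of_real r) (T x)) ^^ k) x)" for k
  have f: "f k \<in> hcarrier H" for k using x by (simp add: f_def funpow_scale)
  obtain l where l: "hconverges H (hsum H f) l sequentially"
    using exp_convergent[OF x] unfolding f_def by blast
  have "E r x = l"
    unfolding unitary_exp_def operator_exp_def f_def[symmetric] using f by (intro hlim_eq[OF l]) auto
  then show "E r x \<in> hcarrier H" using l by (simp add: hconverges_def)
  assume y: "y \<in> hcarrier H"
  have "(\<lambda>n. hinner H (hsum H f n) y) \<longlonglongrightarrow> hinner H l y"
    using f y by (intro hconverges_inner[OF l]) auto
  then show "(\<lambda>k. (\<i> * of_real r) ^ k / fact k * hinner H ((T ^^ k) x) y) sums hinner H (E r x) y"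
    using f y x \<open>E r x = l\<close> by (simp add: hinner_hsum sums_def) (simp add: f_def funpow_scale)
qed

lemma E_zero: "x \<in> hcarrier H \<Longrightarrow> E 0 x = x"
proof (rule weak_eqI)
  fix y assume "x \<in> hcarrier H" "y \<in> hcarrier H"
  then have "(\<lambda>k. (\<i> * of_real 0) ^ k / fact k * hinner H ((T ^^ k) x) y) sums hinner H (E 0 x) y"
    by (rule E_sums)
  moreover have "(\<lambda>k. (\<i> * of_real 0) ^ k / fact k * hinner H ((T ^^ k) x) y) sums (\<Sum>k\<in>{0}. (\<i> * of_real 0) ^ k / fact k * hinner H ((T ^^ k) x) y)"
    by (intro sums_finite) auto
  ultimately show "hinner H (E 0 x) y = hinner H x y" using sums_unique2 by fastforce
qed auto

lemma T_pow_add: "x \<in> hcarrier H \<Longrightarrow> y \<in> hcarrier H \<Longrightarrow> (T ^^ k) (hadd H x y) = hadd H ((T ^^ k) x) ((T ^^ k) y)"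
  by (induction k) (auto simp: linear_operatorD[OF T_linear])

lemma T_pow_scale: "x \<in> hcarrier H \<Longrightarrow> (T ^^ k) (hscale H c x) = hscale H c ((T ^^ k) x)"
  by (induction k) (auto simp: linear_operatorD[OF T_linear])

lemma E_linear: "linear_operator H (E r)"
  unfolding linear_operator_def
proof (intro conjI ballI allI)
  fix x y assume x: "x \<in> hcarrier H" and y: "y \<in> hcarrier H"
  show "E r (hadd H x y) = hadd H (E r x) (E r y)"
  proof (rule weak_eqI)
    fix z assume z: "z \<in> hcarrier H"
    show "hinner H (E r (hadd H x y)) z = hinner H (hadd H (E r x) (E r y)) z"
      using E_sums[of "hadd H x y" z r] sums_add[OF E_sums[OF x z, of r] E_sums[OF y z, of r]] x y z
      by (simp add: T_pow_add distrib_left sums_unique2)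
  qed (use x y in auto)
next
  fix c x assume x: "x \<in> hcarrier H"
  show "E r (hscale H c x) = hscale H c (E r x)"
  proof (rule weak_eqI)
    fix z assume z: "z \<in> hcarrier H"
    show "hinner H (E r (hscale H c x)) z = hinner H (hscale H c (E r x)) z"
      using E_sums[of "hscale H c x" z r] sums_mult[OF E_sums[OF x z, of r], of c] x z
      by (simp add: T_pow_scale sums_unique2 mult_ac)
  qed (use x in auto)
qed auto

text \<open>Term by term: conjugating the scalar factor for \<open>- r\<close> gives the one for
  \<open>r\<close>, and symmetry of \<open>T\<close> moves its powers to the other side.\<close>

lemma E_adjoint:
  assumes x: "x \<in> hcarrier H" and y: "y \<in> hcarrier H"
  shows "hinner H (E r x) y = hinner H x (E (- r) y)"
proof -
  have "(\<lambda>k. cnj ((\<i> * of_real (- r)) ^ k / fact k * hinner H ((T ^^ k) y) x)) sums cnj (hinner H (E (- r) y) x)"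
    using E_sums[OF y x, of "- r"] by (simp only: sums_cnj)
  also have "cnj (hinner H (E (- r) y) x) = hinner H x (E (- r) y)"
    using hinner_commute[of "E (- r) y" x] x y by simp
  also have "(\<lambda>k. cnj ((\<i> * of_real (- r)) ^ k / fact k * hinner H ((T ^^ k) y) x))
      = (\<lambda>k. (\<i> * of_real r) ^ k / fact k * hinner H ((T ^^ k) x) y)"
  proof
    fix k
    have "cnj (hinner H ((T ^^ k) y) x) = hinner H ((T ^^ k) x) y"
      using hinner_commute[of "(T ^^ k) y" x] T_pow_sym[OF x y] x y by simp
    then show "cnj ((\<i> * of_real (- r)) ^ k / fact k * hinner H ((T ^^ k) y) x)
      = (\<i> * of_real r) ^ k / fact k * hinner H ((T ^^ k) x) y" by simp
  qed
  finally show ?thesis using E_sums[OF x y, of r] sums_unique2 by blast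
qed

lemma inner_T_pow_bound:
  assumes "x \<in> hcarrier H" "y \<in> hcarrier H"
  shows "cmod (hinner H ((T ^^ k) x) y) \<le> K ^ k * (hnorm H x * hnorm H y)"
proof -
  have "cmod (hinner H ((T ^^ k) x) y) \<le> hnorm H ((T ^^ k) x) * hnorm H y"
    using assms by (intro Cauchy_Schwarz) auto
  also have "\<dots> \<le> (K ^ k * hnorm H x) * hnorm H y"
    using assms T_pow_norm by (intro mult_right_mono) auto
  finally show ?thesis by (simp add: mult.assoc)
qed

lemma E_norm_summable:
  assumes x: "x \<in> hcarrier H" and y: "y \<in> hcarrier H"
  shows "summable (\<lambda>k. norm ((\<i> * of_real r) ^ k / fact k * hinner H ((T ^^ k) x) y))"
proof (rule summable_comparison_test')
  show "summable (\<lambda>k. (\<bar>r\<bar> * K) ^ k /\<^sub>R fact k * (hnorm H x * hnorm H y))"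
    by (intro summable_mult2 summable_exp_generic)
  show "norm (norm ((\<i> * of_real r) ^ k / fact k * hinner H ((T ^^ k) x) y)) \<le> (\<bar>r\<bar> * K) ^ k /\<^sub>R fact k * (hnorm H x * hnorm H y)" for k
    using mult_left_mono[OF inner_T_pow_bound[OF x y, of k], of "\<bar>r\<bar> ^ k / fact k"]
    by (simp add: norm_mult norm_divide norm_power power_mult_distrib field_simps)
qed

lemma E_has_sum:
  assumes x: "x \<in> hcarrier H" and y: "y \<in> hcarrier H"
  shows "((\<lambda>k. (\<i> * of_real r) ^ k / fact k * hinner H ((T ^^ k) x) y) has_sum hinner H (E r x) y) UNIV"
  using E_norm_summable[OF assms] E_sums[OF assms] by (rule norm_summable_imp_has_sum)

lemma exp_term_add:
  fixes a b :: complex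
  shows "(\<Sum>k\<le>n. a ^ k / fact k * (b ^ (n - k) / fact (n - k))) = (a + b) ^ n / fact n"
proof -
  have "a ^ k / fact k * (b ^ (n - k) / fact (n - k)) = of_nat (n choose k) * a ^ k * b ^ (n - k) / fact n"
    if "k \<le> n" for k
    using binomial_fact[OF that, where 'a=complex] by simp
  then show ?thesis by (simp add: binomial_ring sum_divide_distrib)
qed

text \<open>The Cauchy product of two exponential series, at the level of matrix elements. One
  absolutely summable double family is summed by rows, which gives \<open>E r (E s x)\<close>, and
  along antidiagonals, where the binomial theorem gives the series at \<open>r + s\<close>.\<close>

lemma E_add:
  assumes x: "x \<in> hcarrier H"
  shows "E (r + s) x = E r (E s x)"
proof (rule weak_eqI)
  fix y assume y: "y \<in> hcarrier H"
  define m where "m n = hinner H ((T ^^ n) x) y" for n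
  define a where "a = (\<lambda>(k, j). (\<i> * of_real r) ^ k / fact k * ((\<i> * of_real s) ^ j / fact j * m (j + k)))"
  define A where "A r k = (\<bar>r\<bar> * K) ^ k / fact k" for r :: real and k :: nat
  define c where "c = hnorm H x * hnorm H y"
  have A: "A r summable_on UNIV" "A r k \<ge> 0" for r k
  proof -
    have "summable (A r)" unfolding A_def using summable_exp_generic[of "\<bar>r\<bar> * K"] by (simp add: field_simps)
    then show "A r summable_on UNIV" using K(1)
      by (intro summable_nonneg_imp_summable_on) (auto simp: A_def)
    show "A r k \<ge> 0" using K(1) by (simp add: A_def)
  qed
  have abs: "(\<lambda>p. norm (a p)) summable_on UNIV \<times> UNIV"
  proof (rule summable_on_comparison_test)
    show "(\<lambda>(k, j). A r k * (A s j * c)) summable_on UNIV \<times> UNIV"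
    proof (rule summable_on_SigmaI)
      show "((\<lambda>j. (\<lambda>(k, j). A r k * (A s j * c)) (k, j)) has_sum A r k * (infsum (A s) UNIV * c)) UNIV" for k
        using A by (auto intro!: has_sum_cmult_right has_sum_cmult_left)
      show "(\<lambda>k. A r k * (infsum (A s) UNIV * c)) summable_on UNIV"
        using A by (intro summable_on_cmult_left)
    qed (use A x y in \<open>auto simp: c_def\<close>)
    fix p :: "nat \<times> nat"
    obtain k j where p: "p = (k, j)" by fastforce
    have "norm (m (j + k)) \<le> K ^ (j + k) * c" unfolding m_def c_def using x y by (rule inner_T_pow_bound)
    from mult_left_mono[OF this, of "\<bar>r\<bar> ^ k / fact k * (\<bar>s\<bar> ^ j / fact j)"]
    show "norm (a p) \<le> (\<lambda>(k, j). A r k * (A s j * c)) p"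
      by (simp add: p a_def A_def norm_mult norm_divide norm_power power_mult_distrib power_add mult_ac)
  qed auto
  then have summ: "a summable_on UNIV \<times> UNIV" by (rule Infinite_Sum.abs_summable_summable)
  \<comment> \<open>Moving \<open>k\<close> powers of \<open>T\<close> to \<open>y\<close> makes row
    \<open>k\<close> an exponential series of \<open>x\<close> tested against one fixed
    vector.\<close>
  have *: "hinner H ((T ^^ j) x) ((T ^^ k) y) = m (j + k)" for j k
    using T_pow_sym[of "(T ^^ j) x" y k] x y by (simp add: m_def add.commute[of j k] funpow_add)
  have "(a has_sum hinner H (E r (E s x)) y) (UNIV \<times> UNIV)"
  proof (rule has_sum_SigmaI)
    show "((\<lambda>j. a (k, j)) has_sum (\<i> * of_real r) ^ k / fact k * hinner H ((T ^^ k) (E s x)) y) UNIV" for k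
    proof -
      have "hinner H ((T ^^ k) (E s x)) y = hinner H (E s x) ((T ^^ k) y)"
        using x y by (simp add: T_pow_sym)
      then show ?thesis
        using has_sum_cmult_right[OF E_has_sum[OF x, of "(T ^^ k) y" s], of "(\<i> * of_real r) ^ k / fact k"] y
        by (simp add: a_def *)
    qed
    show "((\<lambda>k. (\<i> * of_real r) ^ k / fact k * hinner H ((T ^^ k) (E s x)) y) has_sum hinner H (E r (E s x)) y) UNIV"
      using x y by (intro E_has_sum) auto
  qed (fact summ)
  moreover have "(a has_sum hinner H (E (r + s) x) y) (UNIV \<times> UNIV)"
  proof -
    \<comment> \<open>Pairs \<open>(k, j)\<close> correspond to pairs \<open>(n, k)\<close> with
      \<open>n = k + j\<close> and \<open>k \<le> n\<close>.\<close>
    have re: "((\<lambda>(n, k). a (k, n - k)) has_sum S) (Sigma UNIV (\<lambda>n. {..n})) \<longleftrightarrow> (a has_sum S) (UNIV \<times> UNIV)" for S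
      by (rule has_sum_reindex_bij_witness[of _ "\<lambda>(k, j). (k + j, k)" "\<lambda>(n, k). (k, n - k)"]) auto
    have "((\<lambda>(n, k). a (k, n - k)) has_sum hinner H (E (r + s) x) y) (Sigma UNIV (\<lambda>n. {..n}))"
    proof (rule has_sum_SigmaI)
      show "((\<lambda>k. (\<lambda>(n, k). a (k, n - k)) (n, k)) has_sum (\<i> * of_real (r + s)) ^ n / fact n * hinner H ((T ^^ n) x) y) {..n}" for n
      proof (rule has_sum_finiteI)
        have "(\<Sum>k\<le>n. a (k, n - k)) = (\<Sum>k\<le>n. (\<i> * of_real r) ^ k / fact k * ((\<i> * of_real s) ^ (n - k) / fact (n - k))) * m n"
          unfolding sum_distrib_right by (intro sum.cong) (auto simp: a_def)
        then show "(\<i> * of_real (r + s)) ^ n / fact n * hinner H ((T ^^ n) x) y = (\<Sum>k\<le>n. (\<lambda>(n, k). a (k, n - k)) (n, k))"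
          by (simp only: exp_term_add m_def prod.case of_real_add distrib_left)
      qed simp
      show "((\<lambda>n. (\<i> * of_real (r + s)) ^ n / fact n * hinner H ((T ^^ n) x) y) has_sum hinner H (E (r + s) x) y) UNIV"
        using x y by (rule E_has_sum)
      show "(\<lambda>(n, k). a (k, n - k)) summable_on Sigma UNIV (\<lambda>n. {..n})"
        using summ re unfolding summable_on_def by blast
    qed
    then show ?thesis by (simp add: re)
  qed
  ultimately show "hinner H (E (r + s) x) y = hinner H (E r (E s x)) y" by (metis has_sum_unique)
qed (use x in auto)

lemma E_inverse: "x \<in> hcarrier H \<Longrightarrow> E r (E (- r) x) = x" "x \<in> hcarrier H \<Longrightarrow> E (- r) (E r x) = x"
  using E_add[of x r "- r"] E_add[of x "- r" r] by (simp_all add: E_zero)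

lemma E_isometric: "x \<in> hcarrier H \<Longrightarrow> y \<in> hcarrier H \<Longrightarrow> hinner H (E r x) (E r y) = hinner H x y"
  by (simp add: E_adjoint E_inverse)

text \<open>Dropping the first two terms of the series leaves a quadratic factor, and replacing
  \<open>fact (k + 2)\<close> by the smaller \<open>fact k\<close> resums the tail to the
  exponential. The constant is crude, but only the quadratic order in \<open>r\<close> matters for
  the derivative.\<close>

lemma E_Taylor:
  assumes x: "x \<in> hcarrier H"
  shows "hnorm H (hdiff H (E r x) (hadd H x (hscale H (\<i> * of_real r) (T x)))) \<le> (\<bar>r\<bar> * K)\<^sup>2 * exp (\<bar>r\<bar> * K) * hnorm H x"
proof (rule hnorm_le_iff_weak)
  fix y assume y: "y \<in> hcarrier H"
  define f where "f k = (\<i> * of_real r) ^ k / fact k * hinner H ((T ^^ k) x) y" for k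
  have "f sums hinner H (E r x) y" unfolding f_def using x y by (rule E_sums)
  then have "(\<lambda>k. f (k + 2)) sums (hinner H (E r x) y - (\<Sum>k<2. f k))" by (rule sums_split_initial_segment)
  also have "hinner H (E r x) y - (\<Sum>k<2. f k) = hinner H (hdiff H (E r x) (hadd H x (hscale H (\<i> * of_real r) (T x)))) y"
    using x y by (simp add: f_def lessThan_Suc numeral_2_eq_2)
  finally have s: "(\<lambda>k. f (k + 2)) sums \<dots>" .
  let ?R = "\<bar>r\<bar> * K" and ?c = "hnorm H x * hnorm H y"
  have b: "norm (f (k + 2)) \<le> ?R ^ k /\<^sub>R fact k * (?R\<^sup>2 * ?c)" for k
  proof -
    have "norm (f (k + 2)) = \<bar>r\<bar> ^ (k + 2) / fact (k + 2) * cmod (hinner H ((T ^^ (k + 2)) x) y)"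
      by (simp add: f_def norm_mult norm_divide norm_power del: fact_Suc funpow.simps power_Suc)
    also have "\<dots> \<le> \<bar>r\<bar> ^ (k + 2) / fact k * (K ^ (k + 2) * ?c)"
      using x y K(1) by (intro mult_mono inner_T_pow_bound divide_left_mono fact_mono) auto
    also have "\<dots> = ?R ^ k /\<^sub>R fact k * (?R\<^sup>2 * ?c)"
      by (simp add: power_mult_distrib power_add power2_eq_square field_simps)
    finally show ?thesis .
  qed
  have "(\<lambda>k. ?R ^ k /\<^sub>R fact k * (?R\<^sup>2 * ?c)) sums (exp ?R * (?R\<^sup>2 * ?c))"
    by (intro sums_mult2 exp_converges)
  then have "norm (hinner H (hdiff H (E r x) (hadd H x (hscale H (\<i> * of_real r) (T x)))) y) \<le> exp ?R * (?R\<^sup>2 * ?c)"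
    by (rule norm_sums_le[OF s _ b])
  then show "norm (hinner H (hdiff H (E r x) (hadd H x (hscale H (\<i> * of_real r) (T x)))) y) \<le> ?R\<^sup>2 * exp ?R * hnorm H x * hnorm H y"
    by (simp add: mult_ac)
qed (use x in auto)

text \<open>The sign in \<open>E (- h)\<close> anticipates second quantisation, where a functional
  is moved by applying the inverse exponential to its arguments. The quotient has the shape required
  by \<open>multilinear_derivative\<close>.\<close>

lemma E_derivative:
  assumes x: "x \<in> hcarrier H"
  shows "hconverges H (\<lambda>h. hscale H (1 / of_real h) (hdiff H (E (- h) x) x)) (hscale H (- \<i>) (T x)) (at 0)"
  unfolding hconverges_def
proof
  let ?d = "\<lambda>h. hdist H (hscale H (1 / of_real h) (hdiff H (E (- h) x) x)) (hscale H (- \<i>) (T x))"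
  have le: "?d h \<le> \<bar>h\<bar> * (K\<^sup>2 * exp (\<bar>h\<bar> * K) * hnorm H x)" if "h \<noteq> 0" for h
  proof -
    let ?u = "hdiff H (E (- h) x) (hadd H x (hscale H (\<i> * of_real (- h)) (T x)))"
    have "hdiff H (hscale H (1 / of_real h) (hdiff H (E (- h) x) x)) (hscale H (- \<i>) (T x))
       = hscale H (1 / of_real h) ?u"
      using x that by (intro weak_eqI) (auto simp: field_simps)
    then have "?d h = hnorm H ?u / \<bar>h\<bar>" using x by (simp add: hdist_def norm_divide)
    also have "\<dots> \<le> (\<bar>h\<bar> * K)\<^sup>2 * exp (\<bar>h\<bar> * K) * hnorm H x / \<bar>h\<bar>"
      using E_Taylor[OF x, of "- h"] by (intro divide_right_mono) auto
    also have "\<dots> = \<bar>h\<bar> * (K\<^sup>2 * exp (\<bar>h\<bar> * K) * hnorm H x)"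
      using that by (simp add: power2_eq_square)
    finally show ?thesis .
  qed
  have "((\<lambda>h. \<bar>h\<bar> * (K\<^sup>2 * exp (\<bar>h\<bar> * K) * hnorm H x)) \<longlongrightarrow> \<bar>0\<bar> * (K\<^sup>2 * exp (\<bar>0\<bar> * K) * hnorm H x)) (at (0::real))"
    by (intro tendsto_intros)
  then show "(?d \<longlongrightarrow> 0) (at 0)"
    using x le by (intro Lim_null_comparison[of ?d]) (auto simp: eventually_at_filter)
qed (use x in auto)

text \<open>The moving vector stands in the conjugate-linear argument, which turns
  \<open>- \<i>\<close> into \<open>\<i>\<close>.\<close>

lemma E_derivative_inner:
  assumes x: "x \<in> hcarrier H" and y: "y \<in> hcarrier H"
  shows "((\<lambda>r. hinner H y (E (- r) x)) has_vector_derivative \<i> * hinner H (T y) x) (at 0)"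
proof -
  have "((\<lambda>h. cnj (hinner H (hscale H (1 / of_real h) (hdiff H (E (- h) x) x)) y)) \<longlongrightarrow> cnj (hinner H (hscale H (- \<i>) (T x)) y)) (at 0)"
    using x y by (intro tendsto_cnj hconverges_inner[OF E_derivative]) auto
  moreover have "cnj (hinner H (hscale H (- \<i>) (T x)) y) = \<i> * hinner H (T y) x"
    using x y T_sym[of y x] hinner_commute[of "T x" y] by simp
  moreover have "cnj (hinner H (hscale H (1 / of_real h) (hdiff H (E (- h) x) x)) y)
      = (hinner H y (E (- (0 + h)) x) - hinner H y (E (- 0) x)) /\<^sub>R h" for h
    using x y hinner_commute[of "E (- h) x" y] hinner_commute[of x y] by (simp add: E_zero scaleR_conv_of_real field_simps)
  ultimately show ?thesis unfolding has_vector_derivative_iff_quotient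
    by simp
qed

end

section \<open>Square-integrable functions\<close>

context pre_hilbert
begin

lemma hscale_one: "x \<in> hcarrier H \<Longrightarrow> hscale H 1 x = x"
  by (rule weak_eqI) auto

lemma hscale_hscale: "x \<in> hcarrier H \<Longrightarrow> hscale H c (hscale H d x) = hscale H (c * d) x"
  by (rule weak_eqI) auto

lemma hscale_add_left: "x \<in> hcarrier H \<Longrightarrow> hscale H (c + d) x = hadd H (hscale H c x) (hscale H d x)"
  by (rule weak_eqI) (auto simp: distrib_right)

lemma hscale_add_right:
  "x \<in> hcarrier H \<Longrightarrow> y \<in> hcarrier H \<Longrightarrow> hscale H c (hadd H x y) = hadd H (hscale H c x) (hscale H c y)"
  by (rule weak_eqI) (auto simp: distrib_left)

section \<open>Norm limits, strong measurability and square-integrability\<close>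

lemma hconverges_add:
  assumes "hconverges H f a F" "hconverges H g b F" "\<And>r. f r \<in> hcarrier H" "\<And>r. g r \<in> hcarrier H"
  shows "hconverges H (\<lambda>r. hadd H (f r) (g r)) (hadd H a b) F"
proof -
  have ab: "a \<in> hcarrier H" "b \<in> hcarrier H" using assms by (auto simp: hconverges_def)
  have "((\<lambda>r. hdist H (f r) a + hdist H (g r) b) \<longlongrightarrow> 0 + 0) F"
    using assms by (intro tendsto_add) (auto simp: hconverges_def)
  then have lim: "((\<lambda>r. hdist H (f r) a + hdist H (g r) b) \<longlongrightarrow> 0) F" by simp
  have "hdist H (hadd H (f r) (g r)) (hadd H a b) \<le> hdist H (f r) a + hdist H (g r) b" for r
  proof -
    have "hdiff H (hadd H (f r) (g r)) (hadd H a b) = hadd H (hdiff H (f r) a) (hdiff H (g r) b)"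
      using ab assms by (intro weak_eqI) auto
    then show ?thesis using hnorm_triangle ab assms by (simp add: hdist_def)
  qed
  then have "((\<lambda>r. hdist H (hadd H (f r) (g r)) (hadd H a b)) \<longlongrightarrow> 0) F"
    using ab assms by (intro tendsto_norm_le_zero[OF lim]) auto
  then show ?thesis using ab by (simp add: hconverges_def)
qed

lemma hconverges_operator:
  assumes "bounded_operator H T" "hconverges H f a F" "\<And>r. f r \<in> hcarrier H"
  shows "hconverges H (\<lambda>r. T (f r)) (T a) F"
proof -
  have a: "a \<in> hcarrier H" "((\<lambda>r. hdist H (f r) a) \<longlongrightarrow> 0) F" using assms by (auto simp: hconverges_def)
  have lin: "linear_operator H T" using assms by (simp add: bounded_operator_def)
  obtain K where K: "\<And>x. x \<in> hcarrier H \<Longrightarrow> hnorm H (T x) \<le> K * hnorm H x"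
    using bounded_operatorD[OF assms(1)] by blast
  have lim: "((\<lambda>r. K * hdist H (f r) a) \<longlongrightarrow> 0) F" using a(2) tendsto_mult_right_zero by blast
  have "hdist H (T (f r)) (T a) \<le> K * hdist H (f r) a" for r
    using K[of "hdiff H (f r) a"] a assms lin by (simp add: hdist_def linear_operator_diff)
  then have "((\<lambda>r. hdist H (T (f r)) (T a)) \<longlongrightarrow> 0) F"
    using a assms lin by (intro tendsto_norm_le_zero[OF lim]) (auto simp: linear_operatorD)
  then show ?thesis using a lin by (simp add: hconverges_def linear_operatorD)
qed

lemma bounded_operator_scale: "bounded_operator H (hscale H c)"
proof -
  have "linear_operator H (hscale H c)"
    unfolding linear_operator_def by (auto intro!: weak_eqI simp: algebra_simps)
  then show ?thesis unfolding bounded_operator_def by (auto intro!: exI[of _ "cmod c"])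
qed

lemma hconverges_inner2:
  assumes "hconverges H f a F" "hconverges H g b F" "\<And>r. f r \<in> hcarrier H" "\<And>r. g r \<in> hcarrier H"
  shows "((\<lambda>r. hinner H (f r) (g r)) \<longlongrightarrow> hinner H a b) F"
proof -
  have ab: "a \<in> hcarrier H" "b \<in> hcarrier H" "((\<lambda>r. hdist H (f r) a) \<longlongrightarrow> 0) F"
    using assms by (auto simp: hconverges_def)
  have "((\<lambda>r. hdist H (f r) a * hnorm H (g r)) \<longlongrightarrow> 0 * hnorm H b) F"
    using assms ab by (intro tendsto_mult hconverges_norm) auto
  then have lim: "((\<lambda>r. hdist H (f r) a * hnorm H (g r)) \<longlongrightarrow> 0) F" by simp
  have "norm (hinner H (hdiff H (f r) a) (g r)) \<le> hdist H (f r) a * hnorm H (g r)" for r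
    using Cauchy_Schwarz[of "hdiff H (f r) a" "g r"] assms ab by (simp add: hdist_def del: hinner_diff_left)
  then have 1: "((\<lambda>r. hinner H (hdiff H (f r) a) (g r)) \<longlongrightarrow> 0) F"
    by (intro tendsto_norm_le_zero[OF lim]) auto
  have "((\<lambda>r. cnj (hinner H (g r) a)) \<longlongrightarrow> cnj (hinner H b a)) F"
    using assms ab by (intro tendsto_cnj hconverges_inner) auto
  then have "((\<lambda>r. hinner H a (g r)) \<longlongrightarrow> hinner H a b) F"
    using hinner_commute[OF _ ab(1)] assms ab by simp
  from tendsto_add[OF 1 this] show ?thesis using assms ab by simp
qed

lemma strongly_measurable_mem: "strongly_measurable H M f \<Longrightarrow> x \<in> space M \<Longrightarrow> f x \<in> hcarrier H"
  by (simp add: strongly_measurable_def)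

lemma strongly_measurable_simple:
  assumes "simple_function M f" "\<And>x. x \<in> space M \<Longrightarrow> f x \<in> hcarrier H"
  shows "strongly_measurable H M f"
  unfolding strongly_measurable_def using assms
  by (auto intro!: exI[of _ "\<lambda>n. f"] simp: hconverges_def hdist_def hdiff_self)

text \<open>Here and for scalars and operators below, the operation is applied to the approximating
  simple functions, and its norm continuity carries the limit.\<close>

lemma strongly_measurable_add:
  assumes "strongly_measurable H M f" "strongly_measurable H M g"
  shows "strongly_measurable H M (\<lambda>x. hadd H (f x) (g x))"
proof -
  obtain s t where s: "\<And>n. simple_function M (s n)" "\<And>n x. x \<in> space M \<Longrightarrow> s n x \<in> hcarrier H"
      "\<And>x. x \<in> space M \<Longrightarrow> hconverges H (\<lambda>n. s n x) (f x) sequentially"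
    and t: "\<And>n. simple_function M (t n)" "\<And>n x. x \<in> space M \<Longrightarrow> t n x \<in> hcarrier H"
      "\<And>x. x \<in> space M \<Longrightarrow> hconverges H (\<lambda>n. t n x) (g x) sequentially"
    using assms unfolding strongly_measurable_def by metis
  show ?thesis unfolding strongly_measurable_def
    using s t strongly_measurable_mem[OF assms(1)] strongly_measurable_mem[OF assms(2)]
    by (auto intro!: exI[of _ "\<lambda>n x. hadd H (s n x) (t n x)"] hconverges_add intro: simple_function_compose2)
qed

text \<open>Simple scalar factors cover both constants and the indicator functions of the
  projections.\<close>

lemma strongly_measurable_scale:
  assumes "strongly_measurable H M f" "simple_function M c"
  shows "strongly_measurable H M (\<lambda>x. hscale H (c x) (f x))"
proof -
  obtain s where s: "\<And>n. simple_function M (s n)" "\<And>n x. x \<in> space M \<Longrightarrow> s n x \<in> hcarrier H"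
      "\<And>x. x \<in> space M \<Longrightarrow> hconverges H (\<lambda>n. s n x) (f x) sequentially"
    using assms unfolding strongly_measurable_def by metis
  show ?thesis unfolding strongly_measurable_def
    using s assms(2) strongly_measurable_mem[OF assms(1)]
    by (auto intro!: exI[of _ "\<lambda>n x. hscale H (c x) (s n x)"] hconverges_operator[OF bounded_operator_scale]
        intro: simple_function_compose2)
qed

lemma strongly_measurable_operator:
  assumes "strongly_measurable H M f" "bounded_operator H T"
  shows "strongly_measurable H M (\<lambda>x. T (f x))"
proof -
  obtain s where s: "\<And>n. simple_function M (s n)" "\<And>n x. x \<in> space M \<Longrightarrow> s n x \<in> hcarrier H"
      "\<And>x. x \<in> space M \<Longrightarrow> hconverges H (\<lambda>n. s n x) (f x) sequentially"
    using assms unfolding strongly_measurable_def by metis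
  have lin: "linear_operator H T" using assms by (simp add: bounded_operator_def)
  show ?thesis unfolding strongly_measurable_def
    using s strongly_measurable_mem[OF assms(1)] linear_operatorD(1)[OF lin]
    by (auto intro!: exI[of _ "\<lambda>n x. T (s n x)"] hconverges_operator[OF assms(2)]
        intro: simple_function_compose1)
qed

text \<open>The value space carries no sigma-algebra. Measurability is therefore read off the scalar
  inner products of simple functions and passed to the pointwise limit.\<close>

lemma strongly_measurable_inner:
  assumes "strongly_measurable H M f" "strongly_measurable H M g"
  shows "(\<lambda>x. hinner H (f x) (g x)) \<in> borel_measurable M"
proof -
  obtain s t where s: "\<And>n. simple_function M (s n)" "\<And>n x. x \<in> space M \<Longrightarrow> s n x \<in> hcarrier H"
      "\<And>x. x \<in> space M \<Longrightarrow> hconverges H (\<lambda>n. s n x) (f x) sequentially"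
    and t: "\<And>n. simple_function M (t n)" "\<And>n x. x \<in> space M \<Longrightarrow> t n x \<in> hcarrier H"
      "\<And>x. x \<in> space M \<Longrightarrow> hconverges H (\<lambda>n. t n x) (g x) sequentially"
    using assms unfolding strongly_measurable_def by metis
  show ?thesis
  proof (rule borel_measurable_LIMSEQ_metric)
    show "(\<lambda>x. hinner H (s n x) (t n x)) \<in> borel_measurable M" for n
      using s t by (intro borel_measurable_simple_function simple_function_compose2[of _ _ _ "hinner H"])
    show "(\<lambda>n. hinner H (s n x) (t n x)) \<longlonglongrightarrow> hinner H (f x) (g x)" if "x \<in> space M" for x
      using s t that by (intro hconverges_inner2) auto
  qed
qed

lemma strongly_measurable_norm:
  assumes "strongly_measurable H M f"
  shows "(\<lambda>x. hnorm H (f x)) \<in> borel_measurable M"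
proof -
  have "(\<lambda>x. sqrt (Re (hinner H (f x) (f x)))) \<in> borel_measurable M"
    using strongly_measurable_inner[OF assms assms] by measurable
  then show ?thesis by (simp add: hnorm_def)
qed

lemma square_integrableI:
  assumes "strongly_measurable H half_line f" "integrable half_line g"
    "\<And>x. x \<ge> 0 \<Longrightarrow> (hnorm H (f x))\<^sup>2 \<le> g x"
  shows "f \<in> square_integrable H"
proof -
  have "integrable half_line (\<lambda>x. (hnorm H (f x))\<^sup>2)"
    using assms(2)
  proof (rule Bochner_Integration.integrable_bound)
    show "(\<lambda>x. (hnorm H (f x))\<^sup>2) \<in> borel_measurable half_line"
      using strongly_measurable_norm[OF assms(1)] by measurable
    show "AE x in half_line. norm ((hnorm H (f x))\<^sup>2) \<le> norm (g x)"
      using assms(3) by (intro AE_I2) (fastforce simp: space_restrict_space)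
  qed
  then show ?thesis using assms(1) by (simp add: square_integrable_def)
qed

lemma square_integrableD:
  assumes "f \<in> square_integrable H"
  shows "strongly_measurable H half_line f" "integrable half_line (\<lambda>x. (hnorm H (f x))\<^sup>2)"
    "x \<ge> 0 \<Longrightarrow> f x \<in> hcarrier H"
  using assms strongly_measurable_mem[of half_line f] by (auto simp: square_integrable_def space_restrict_space)

lemma square_integrable_add [intro]:
  assumes "f \<in> square_integrable H" "g \<in> square_integrable H"
  shows "(\<lambda>x. hadd H (f x) (g x)) \<in> square_integrable H"
proof (rule square_integrableI)
  show "strongly_measurable H half_line (\<lambda>x. hadd H (f x) (g x))"
    using assms by (intro strongly_measurable_add) (auto simp: square_integrable_def)
  show "integrable half_line (\<lambda>x. 2 * (hnorm H (f x))\<^sup>2 + 2 * (hnorm H (g x))\<^sup>2)"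
    using assms by (auto simp: square_integrable_def)
  fix x :: real assume "x \<ge> 0"
  then have fg: "f x \<in> hcarrier H" "g x \<in> hcarrier H" using assms square_integrableD by auto
  \<comment> \<open>Adding the squared norm of the difference completes the parallelogram law, hence
    the factor 2.\<close>
  then have "0 \<le> (hnorm H (hdiff H (f x) (g x)))\<^sup>2" by simp
  then show "(hnorm H (hadd H (f x) (g x)))\<^sup>2 \<le> 2 * (hnorm H (f x))\<^sup>2 + 2 * (hnorm H (g x))\<^sup>2"
    using fg by (simp add: hnorm_diff_sq hnorm_add_sq)
qed

lemma square_integrable_scale [intro]:
  assumes "f \<in> square_integrable H" "simple_function half_line c" "\<And>x. cmod (c x) \<le> k"
  shows "(\<lambda>x. hscale H (c x) (f x)) \<in> square_integrable H"
proof (rule square_integrableI)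
  show "strongly_measurable H half_line (\<lambda>x. hscale H (c x) (f x))"
    using assms by (intro strongly_measurable_scale) (auto simp: square_integrable_def)
  show "integrable half_line (\<lambda>x. k\<^sup>2 * (hnorm H (f x))\<^sup>2)"
    using assms by (auto simp: square_integrable_def)
  fix x :: real assume "x \<ge> 0"
  then have fg: "f x \<in> hcarrier H" using assms square_integrableD by auto
  have "(cmod (c x))\<^sup>2 \<le> k\<^sup>2" using assms(3)[of x] by (intro power_mono) auto
  then show "(hnorm H (hscale H (c x) (f x)))\<^sup>2 \<le> k\<^sup>2 * (hnorm H (f x))\<^sup>2"
    using fg by (simp add: power_mult_distrib mult_right_mono)
qed

lemma square_integrable_operator [intro]:
  assumes "f \<in> square_integrable H" "bounded_operator H T"
  shows "(\<lambda>x. T (f x)) \<in> square_integrable H"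
proof -
  have lin: "linear_operator H T" using assms by (simp add: bounded_operator_def)
  obtain K where K: "K > 0" "\<And>x. x \<in> hcarrier H \<Longrightarrow> hnorm H (T x) \<le> K * hnorm H x"
    using bounded_operatorD[OF assms(2)] by blast
  show ?thesis
  proof (rule square_integrableI)
    show "strongly_measurable H half_line (\<lambda>x. T (f x))"
      using square_integrableD(1)[OF assms(1)] assms(2) by (rule strongly_measurable_operator)
    show "integrable half_line (\<lambda>x. K\<^sup>2 * (hnorm H (f x))\<^sup>2)"
      using assms by (auto simp: square_integrable_def)
    fix x :: real assume "x \<ge> 0"
    then have fg: "f x \<in> hcarrier H" using assms square_integrableD by auto
    then show "(hnorm H (T (f x)))\<^sup>2 \<le> K\<^sup>2 * (hnorm H (f x))\<^sup>2"
      using power_mono[OF K(2)[OF fg], of 2] lin by (simp add: power_mult_distrib linear_operatorD)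
  qed
qed

lemma square_integrable_cscale [intro]:
  "f \<in> square_integrable H \<Longrightarrow> (\<lambda>x. hscale H c (f x)) \<in> square_integrable H"
  by (rule square_integrable_scale[where k = "cmod c"]) auto

lemma square_integrable_diff [intro]:
  "f \<in> square_integrable H \<Longrightarrow> g \<in> square_integrable H \<Longrightarrow> (\<lambda>x. hdiff H (f x) (g x)) \<in> square_integrable H"
  unfolding hdiff_def by auto

lemma square_integrable_zero [intro]: "(\<lambda>x. hzero H) \<in> square_integrable H"
  by (rule square_integrableI[of _ "\<lambda>x. 0"]) (auto intro: strongly_measurable_simple)

lemma integrable_inner:
  assumes "f \<in> square_integrable H" "g \<in> square_integrable H"
  shows "integrable half_line (\<lambda>x. hinner H (f x) (g x))"
proof (rule Bochner_Integration.integrable_bound)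
  show "integrable half_line (\<lambda>x. (hnorm H (f x))\<^sup>2 + (hnorm H (g x))\<^sup>2)"
    using assms by (auto simp: square_integrable_def)
  show "(\<lambda>x. hinner H (f x) (g x)) \<in> borel_measurable half_line"
    using assms by (intro strongly_measurable_inner) (auto simp: square_integrable_def)
  show "AE x in half_line. norm (hinner H (f x) (g x)) \<le> norm ((hnorm H (f x))\<^sup>2 + (hnorm H (g x))\<^sup>2)"
  proof (intro AE_I2)
    fix x assume "x \<in> space half_line"
    then have fg: "f x \<in> hcarrier H" "g x \<in> hcarrier H"
      using assms square_integrableD by (auto simp: space_restrict_space)
    have "0 \<le> (hnorm H (f x) - hnorm H (g x))\<^sup>2" "0 \<le> hnorm H (f x) * hnorm H (g x)" using fg by auto
    then show "norm (hinner H (f x) (g x)) \<le> norm ((hnorm H (f x))\<^sup>2 + (hnorm H (g x))\<^sup>2)"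
      using Cauchy_Schwarz[OF fg] unfolding power2_diff by (simp add: order_trans)
  qed
qed

section \<open>Classes of square-integrable functions as an inner product space\<close>

lemma L2_class_cong: "AE x in half_line. f x = g x \<Longrightarrow> L2_class H f = L2_class H g"
  unfolding L2_class_def by (auto elim!: eventually_elim2)

lemma L2_class_cong': "(\<And>x. x \<ge> 0 \<Longrightarrow> f x = g x) \<Longrightarrow> L2_class H f = L2_class H g"
  by (intro L2_class_cong AE_I2) (auto simp: space_restrict_space)

text \<open>A class contains the function it is formed from, so the representative chosen by
  \<open>rep\<close> agrees with that function almost everywhere. All operations on classes can then
  be computed on the given function.\<close>

lemma
  assumes "f \<in> square_integrable H"
  shows rep_square_integrable [intro]: "rep (L2_class H f) \<in> square_integrable H"
    and rep_AE: "AE x in half_line. rep (L2_class H f) x = f x"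
proof -
  have "f \<in> L2_class H f" using assms by (simp add: L2_class_def)
  then have "rep (L2_class H f) \<in> L2_class H f" unfolding rep_def by (rule someI[where P = "\<lambda>g. g \<in> L2_class H f"])
  then show "rep (L2_class H f) \<in> square_integrable H" "AE x in half_line. rep (L2_class H f) x = f x"
    by (auto simp: L2_class_def)
qed

lemma L2_mem [intro]: "f \<in> square_integrable H \<Longrightarrow> L2_class H f \<in> hcarrier (L2_space H)"
  by (simp add: L2_space_def)

lemma L2_cases:
  assumes "F \<in> hcarrier (L2_space H)"
  obtains f where "f \<in> square_integrable H" "F = L2_class H f"
  using assms by (auto simp: L2_space_def)

lemma L2_zero: "hzero (L2_space H) = L2_class H (\<lambda>x. hzero H)"
  by (simp add: L2_space_def)

lemma L2_add:
  assumes "f \<in> square_integrable H" "g \<in> square_integrable H"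
  shows "hadd (L2_space H) (L2_class H f) (L2_class H g) = L2_class H (\<lambda>x. hadd H (f x) (g x))"
  unfolding L2_space_def using rep_AE[OF assms(1)] rep_AE[OF assms(2)]
  by (auto intro!: L2_class_cong elim!: eventually_elim2)

lemma L2_scale:
  assumes "f \<in> square_integrable H"
  shows "hscale (L2_space H) c (L2_class H f) = L2_class H (\<lambda>x. hscale H c (f x))"
  unfolding L2_space_def using rep_AE[OF assms(1)]
  by (auto intro!: L2_class_cong elim!: eventually_mono)

lemma L2_diff:
  assumes "f \<in> square_integrable H" "g \<in> square_integrable H"
  shows "hdiff (L2_space H) (L2_class H f) (L2_class H g) = L2_class H (\<lambda>x. hdiff H (f x) (g x))"
  using assms by (simp add: hdiff_def L2_scale L2_add square_integrable_cscale)

lemma L2_inner: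
  assumes "f \<in> square_integrable H" "g \<in> square_integrable H"
  shows "hinner (L2_space H) (L2_class H f) (L2_class H g) = (LINT x|half_line. hinner H (f x) (g x))"
proof -
  have "(LINT x|half_line. hinner H (rep (L2_class H f) x) (rep (L2_class H g) x)) = (LINT x|half_line. hinner H (f x) (g x))"
  proof (rule integral_cong_AE)
    show "AE x in half_line. hinner H (rep (L2_class H f) x) (rep (L2_class H g) x) = hinner H (f x) (g x)"
      using rep_AE[OF assms(1)] rep_AE[OF assms(2)] by (auto elim!: eventually_elim2)
  qed (use assms in \<open>auto intro!: strongly_measurable_inner square_integrableD\<close>)
  then show ?thesis by (simp add: L2_space_def)
qed

lemma L2_norm:
  assumes "f \<in> square_integrable H"
  shows "(hnorm (L2_space H) (L2_class H f))\<^sup>2 = (LINT x|half_line. (hnorm H (f x))\<^sup>2)"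
    and "0 \<le> hnorm (L2_space H) (L2_class H f)"
proof -
  have "hinner (L2_space H) (L2_class H f) (L2_class H f) = (LINT x|half_line. of_real ((hnorm H (f x))\<^sup>2))"
    unfolding L2_inner[OF assms assms]
    using assms square_integrableD by (intro Bochner_Integration.integral_cong) (auto simp: hinner_self space_restrict_space)
  also have "\<dots> = of_real (LINT x|half_line. (hnorm H (f x))\<^sup>2)"
    using square_integrableD(2)[OF assms] by (rule integral_of_real)
  finally show "(hnorm (L2_space H) (L2_class H f))\<^sup>2 = (LINT x|half_line. (hnorm H (f x))\<^sup>2)"
    "0 \<le> hnorm (L2_space H) (L2_class H f)"
    by (simp_all add: hnorm_def)
qed

text \<open>Apart from definiteness, the laws come from pointwise facts at nonnegative arguments,
  where values are known to lie in the carrier. Definiteness uses that a nonnegative function with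
  vanishing integral is zero almost everywhere.\<close>

lemma L2_pre_hilbert: "pre_hilbert (L2_space H)"
proof
  fix x y z :: "(real \<Rightarrow> 'a) set" and c
  let ?L = "L2_space H"
  show "hzero ?L \<in> hcarrier ?L" by (auto simp: L2_zero)
  assume "x \<in> hcarrier ?L"
  then obtain f where f: "f \<in> square_integrable H" "x = L2_class H f" by (rule L2_cases)
  note fx = square_integrableD(3)[OF f(1)]
  show "hscale ?L c x \<in> hcarrier ?L" using f by (auto simp: L2_scale)
  show "hadd ?L x (hzero ?L) = x"
    using f fx by (auto simp: L2_zero L2_add square_integrable_zero hadd_zero intro!: L2_class_cong')
  show "hdiff ?L x x = hzero ?L"
    using f fx by (auto simp: L2_zero L2_diff hdiff_self intro!: L2_class_cong')
  show "0 \<le> Re (hinner ?L x x)"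
    using f fx by (auto simp: L2_inner integrable_inner hinner_ge_zero space_restrict_space
      simp flip: integral_Re intro!: Bochner_Integration.integral_nonneg)
  show "x = hzero ?L" if "hinner ?L x x = 0"
  proof -
    have "(LINT x|half_line. (hnorm H (f x))\<^sup>2) = 0"
      using L2_norm[OF f(1)] that f by (simp add: hnorm_def)
    then have "AE x in half_line. (hnorm H (f x))\<^sup>2 = 0"
      using square_integrableD(2)[OF f(1)] by (subst (asm) integral_nonneg_eq_0_iff_AE) auto
    moreover have "AE x in half_line. x \<in> {0..}" by (intro AE_I2) (auto simp: space_restrict_space)
    ultimately have "AE x in half_line. f x = hzero H"
      by eventually_elim (use fx in \<open>auto simp: hnorm_eq_zero\<close>)
    then show ?thesis unfolding f L2_zero by (rule L2_class_cong)
  qed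
  assume "y \<in> hcarrier ?L"
  then obtain g where g: "g \<in> square_integrable H" "y = L2_class H g" by (rule L2_cases)
  note gx = square_integrableD(3)[OF g(1)]
  show "hadd ?L x y \<in> hcarrier ?L" using f g by (auto simp: L2_add)
  show "hadd ?L x y = hadd ?L y x"
    using f g fx gx by (auto simp: L2_add hadd_commute intro!: L2_class_cong')
  show "hinner ?L (hscale ?L c x) y = c * hinner ?L x y"
  proof -
    have "(LINT x|half_line. hinner H (hscale H c (f x)) (g x)) = (LINT x|half_line. c * hinner H (f x) (g x))"
      using fx gx by (intro Bochner_Integration.integral_cong) (auto simp: space_restrict_space)
    then show ?thesis using f g by (simp add: L2_scale L2_inner square_integrable_cscale)
  qed
  show "hinner ?L y x = cnj (hinner ?L x y)"
  proof -
    have "(LINT x|half_line. hinner H (g x) (f x)) = (LINT x|half_line. cnj (hinner H (f x) (g x)))"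
      using fx gx by (intro Bochner_Integration.integral_cong hinner_commute) (auto simp: space_restrict_space)
    also have "\<dots> = cnj (LINT x|half_line. hinner H (f x) (g x))" by (rule Bochner_Integration.integral_cnj)
    finally show ?thesis unfolding f(2) g(2) L2_inner[OF f(1) g(1)] L2_inner[OF g(1) f(1)] .
  qed
  assume "z \<in> hcarrier ?L"
  then obtain h where h: "h \<in> square_integrable H" "z = L2_class H h" by (rule L2_cases)
  note hx = square_integrableD(3)[OF h(1)]
  show "hadd ?L (hadd ?L x y) z = hadd ?L x (hadd ?L y z)"
    using f g h fx gx hx by (auto simp: L2_add square_integrable_add hadd_assoc intro!: L2_class_cong')
  show "hinner ?L (hadd ?L x y) z = hinner ?L x z + hinner ?L y z"
  proof -
    have "(LINT x|half_line. hinner H (hadd H (f x) (g x)) (h x)) = (LINT x|half_line. hinner H (f x) (h x) + hinner H (g x) (h x))"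
      using fx gx hx by (intro Bochner_Integration.integral_cong hinner_add_left) (auto simp: space_restrict_space)
    also have "\<dots> = (LINT x|half_line. hinner H (f x) (h x)) + (LINT x|half_line. hinner H (g x) (h x))"
      using f g h by (intro Bochner_Integration.integral_add integrable_inner)
    finally show ?thesis using f(1) g(1) h(1)
      unfolding f(2) g(2) h(2) by (simp only: L2_add L2_inner square_integrable_add)
  qed
qed

end

lemma space_half_line: "space half_line = {0..}"
  by (simp add: space_restrict_space)

section \<open>Completeness of the space of square-integrable classes\<close>

context complex_hilbert_space
begin

text \<open>The approximants from strong measurability need not be dominated. Setting
  \<open>s n\<close> to zero where its norm exceeds twice that of \<open>f\<close> creates a
  dominating function without losing pointwise convergence.\<close>

lemma simple_approximation:
  assumes f: "f \<in> square_integrable H" and e: "e > 0"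
  shows "\<exists>g\<in>square_integrable H. simple_function half_line g
    \<and> hdist (L2_space H) (L2_class H f) (L2_class H g) < e"
proof -
  note fx = square_integrableD(3)[OF f]
  obtain s where s: "\<And>n. simple_function half_line (s n)" "\<And>n x. x \<ge> 0 \<Longrightarrow> s n x \<in> hcarrier H"
      "\<And>x. x \<ge> 0 \<Longrightarrow> hconverges H (\<lambda>n. s n x) (f x) sequentially"
    using square_integrableD(1)[OF f] unfolding strongly_measurable_def
    by (metis atLeast_iff space_half_line)
  define A where "A n = {x \<in> space half_line. hnorm H (s n x) \<le> 2 * hnorm H (f x)}" for n
  define c :: "nat \<Rightarrow> real \<Rightarrow> complex" where "c n = indicator (A n)" for n
  define g where "g n x = hscale H (c n x) (s n x)" for n x
  have sm: "strongly_measurable H half_line (s n)" for n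
    using s by (intro strongly_measurable_simple) (auto simp: space_restrict_space)
  have "A n \<in> sets half_line" for n
    unfolding A_def using strongly_measurable_norm[OF sm] strongly_measurable_norm[OF square_integrableD(1)[OF f]]
    by measurable
  then have c: "simple_function half_line (c n)" for n
    unfolding c_def by (rule simple_function_indicator)
  have gmem: "g n x \<in> hcarrier H" if "x \<ge> 0" for n x using s that by (simp add: g_def)
  have gsimple: "simple_function half_line (g n)" for n
    unfolding g_def using c s(1) by (rule simple_function_compose2)
  have gle: "hnorm H (g n x) \<le> 2 * hnorm H (f x)" if "x \<ge> 0" for n x
    using that s fx by (auto simp: g_def c_def A_def indicator_def space_restrict_space)
  have gsq: "g n \<in> square_integrable H" for n
  proof (rule square_integrableI)
    show "strongly_measurable H half_line (g n)"
      using gsimple gmem by (intro strongly_measurable_simple) (auto simp: space_restrict_space)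
    show "integrable half_line (\<lambda>x. 4 * (hnorm H (f x))\<^sup>2)" using square_integrableD(2)[OF f] by simp
    show "(hnorm H (g n x))\<^sup>2 \<le> 4 * (hnorm H (f x))\<^sup>2" if "x \<ge> 0" for x
      using power_mono[OF gle[OF that], of n 2] gmem[OF that] by (simp add: power_mult_distrib)
  qed
  have lim: "(\<lambda>n. (hnorm H (hdiff H (f x) (g n x)))\<^sup>2) \<longlonglongrightarrow> 0" if x: "x \<ge> 0" for x
  proof -
    have conv: "(\<lambda>n. hdist H (s n x) (f x)) \<longlonglongrightarrow> 0" using s(3)[OF x] by (simp add: hconverges_def)
    have "\<forall>\<^sub>F n in sequentially. hnorm H (hdiff H (f x) (g n x)) \<le> hdist H (s n x) (f x)"
    \<comment> \<open>If \<open>f x\<close> is zero, the cut-off forces \<open>g n x\<close> to be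
      zero. Otherwise the cut-off is eventually inactive, because twice the norm of
      \<open>f x\<close> strictly exceeds the limit of the norms of \<open>s n x\<close>.\<close>
    proof (cases "hnorm H (f x) = 0")
      case True
      then have f0: "f x = hzero H" using fx[OF x] hnorm_eq_zero by blast
      have "g n x = hzero H" for n
        using gle[OF x, of n] True hnorm_nonneg[OF gmem[OF x, of n]] hnorm_eq_zero[OF gmem[OF x, of n]] by simp
      then show ?thesis using s(2)[OF x] f0 by (auto simp: hdiff_self)
    next
      case False
      then have "hnorm H (f x) < 2 * hnorm H (f x)" using hnorm_nonneg[OF fx[OF x]] by linarith
      then have "\<forall>\<^sub>F n in sequentially. hnorm H (s n x) < 2 * hnorm H (f x)"
        using hconverges_norm[OF s(3)[OF x] s(2)[OF x]] by (rule order_tendstoD(2)[rotated])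
      then show ?thesis
      proof eventually_elim
        case (elim n)
        then have "g n x = hscale H 1 (s n x)" using x by (simp add: g_def c_def A_def space_restrict_space)
        then show ?case using s(2)[OF x] fx[OF x] hnorm_diff_commute by (simp add: scale_one hdist_def)
      qed
    qed
    then have "(\<lambda>n. hnorm H (hdiff H (f x) (g n x))) \<longlonglongrightarrow> 0"
      using conv fx[OF x] gmem[OF x] by (intro Lim_null_comparison[OF _ conv]) simp
    from tendsto_power[OF this, of 2] show ?thesis by simp
  qed
  have "(\<lambda>n. LINT x|half_line. (hnorm H (hdiff H (f x) (g n x)))\<^sup>2) \<longlonglongrightarrow> (LINT x|half_line. 0)"
  proof (rule integral_dominated_convergence)
    show "(\<lambda>x. (hnorm H (hdiff H (f x) (g n x)))\<^sup>2) \<in> borel_measurable half_line" for n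
      using strongly_measurable_norm[OF square_integrableD(1)[OF square_integrable_diff[OF f gsq]]] by measurable
    \<comment> \<open>The norm of \<open>g n x\<close> is at most twice that of \<open>f x\<close>,
      so the difference has at most three times that norm; 9 is the square.\<close>
    show "integrable half_line (\<lambda>x. 9 * (hnorm H (f x))\<^sup>2)" using square_integrableD(2)[OF f] by simp
    show "AE x in half_line. (\<lambda>n. (hnorm H (hdiff H (f x) (g n x)))\<^sup>2) \<longlonglongrightarrow> 0"
      using lim by (intro AE_I2) (auto simp: space_restrict_space)
    show "AE x in half_line. norm ((hnorm H (hdiff H (f x) (g n x)))\<^sup>2) \<le> 9 * (hnorm H (f x))\<^sup>2" for n
    proof (intro AE_I2)
      fix x assume "x \<in> space half_line"
      then have x: "x \<ge> 0" by (simp add: space_restrict_space)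
      have "hnorm H (hdiff H (f x) (g n x)) \<le> hnorm H (f x) + hnorm H (g n x)"
        using hnorm_triangle[of "f x" "hscale H (-1) (g n x)"] fx[OF x] gmem[OF x] by (simp add: hdiff_def)
      then have "hnorm H (hdiff H (f x) (g n x)) \<le> 3 * hnorm H (f x)" using gle[OF x, of n] by linarith
      from power_mono[OF this, of 2] show "norm ((hnorm H (hdiff H (f x) (g n x)))\<^sup>2) \<le> 9 * (hnorm H (f x))\<^sup>2"
        using fx[OF x] gmem[OF x] by (simp add: power_mult_distrib)
    qed
  qed auto
  then have sq: "(\<lambda>n. (hdist (L2_space H) (L2_class H f) (L2_class H (g n)))\<^sup>2) \<longlonglongrightarrow> 0"
    using f gsq by (simp add: hdist_def L2_diff L2_norm(1)[OF square_integrable_diff])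
  have "\<forall>\<^sub>F n in sequentially. (hdist (L2_space H) (L2_class H f) (L2_class H (g n)))\<^sup>2 < e\<^sup>2"
    using e by (intro order_tendstoD(2)[OF sq]) simp
  then obtain n where "(hdist (L2_space H) (L2_class H f) (L2_class H (g n)))\<^sup>2 < e\<^sup>2"
    using eventually_happens'[OF sequentially_bot] by blast
  then have "hdist (L2_space H) (L2_class H f) (L2_class H (g n)) < e"
    using e by (auto dest: power2_less_imp_less)
  then show ?thesis using gsq gsimple by blast
qed

text \<open>
  A sequence of simple functions converging fast in \<open>L\<^sup>2\<close> converges almost everywhere, so its limit is
  strongly measurable without any closure property of strong measurability under pointwise limits.
\<close>

lemma fast_simple_sequence_converges:
  assumes g: "\<And>n. g n \<in> square_integrable H" "\<And>n. simple_function half_line (g n)"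
    and fast: "\<And>n. hdist (L2_space H) (L2_class H (g n)) (L2_class H (g (Suc n))) \<le> c * (1/2) ^ n"
  shows "\<exists>h\<in>square_integrable H. \<forall>n. hdist (L2_space H) (L2_class H (g n)) (L2_class H h) \<le> 2 * c * (1/2) ^ n"
proof -
  interpret L: pre_hilbert "L2_space H" by (rule L2_pre_hilbert)
  let ?d = "\<lambda>f g. hdist (L2_space H) (L2_class H f) (L2_class H g)"
  note gx = square_integrableD(3)[OF g(1)]
  have c: "c \<ge> 0" using fast[of 0] L.hdist_nonneg[OF L2_mem L2_mem, OF g(1) g(1), of 0 1] by simp
  have dsq: "(?d f h)\<^sup>2 = (LINT x|half_line. (hnorm H (hdiff H (f x) (h x)))\<^sup>2)"
    if "f \<in> square_integrable H" "h \<in> square_integrable H" for f h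
    using that by (simp add: hdist_def L2_diff L2_norm(1)[OF square_integrable_diff])
  have nnd: "(\<integral>\<^sup>+x. ennreal ((hnorm H (hdiff H (f x) (h x)))\<^sup>2) \<partial>half_line) = ennreal ((?d f h)\<^sup>2)"
    if "f \<in> square_integrable H" "h \<in> square_integrable H" for f h
    unfolding dsq[OF that] using square_integrableD(2)[OF square_integrable_diff[OF that]]
    by (intro nn_integral_eq_integral) auto
  have dd: "?d (g n) (g (n + k)) \<le> 2 * c * (1/2) ^ n" for n k
  proof -
    have "?d (g n) (g (n + k)) \<le> (\<Sum>i<k. c * (1/2) ^ (n + i))"
    proof (induction k)
      case 0
      then show ?case using g by (simp add: hdist_def L.hdiff_self L2_mem)
    next
      case (Suc k)
      have "?d (g n) (g (n + Suc k)) \<le> ?d (g n) (g (n + k)) + ?d (g (n + k)) (g (n + Suc k))"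
        using g by (intro L.hdist_triangle) auto
      then show ?case using Suc fast[of "n + k"] by simp
    qed
    also have "\<dots> = c * (1/2) ^ n * (\<Sum>i<k. (1/2) ^ i)" by (simp add: sum_distrib_left power_add mult.assoc)
    also have "\<dots> \<le> c * (1/2) ^ n * 2"
    proof (intro mult_left_mono)
      have "(\<Sum>i<k. (1/2::real) ^ i) \<le> (\<Sum>i. (1/2) ^ i)" by (intro sum_le_suminf) (auto intro: summable_geometric)
      then show "(\<Sum>i<k. (1/2::real) ^ i) \<le> 2" by (simp add: suminf_geometric)
    qed (use c in auto)
    finally show ?thesis by (simp add: mult_ac)
  qed
  \<comment> \<open>The increments. Their squares have integrals at most
    \<open>c^2 * (1/4)^n\<close>, which leaves room for the weight \<open>2 ^ n\<close> below: the
    weighted squares still have a finite total integral, hence a finite sum almost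
    everywhere.\<close>
  define a where "a n x = hnorm H (hdiff H (g n x) (g (Suc n) x))" for n x
  have a0: "a n x \<ge> 0" if "x \<ge> 0" for n x using gx that by (simp add: a_def)
  have meas: "(\<lambda>x. ennreal (2 ^ n * (a n x)\<^sup>2)) \<in> borel_measurable half_line" for n
    using strongly_measurable_norm[OF square_integrableD(1)[OF square_integrable_diff[OF g(1) g(1)]]]
    unfolding a_def by measurable
  have "(\<integral>\<^sup>+x. (\<Sum>n. ennreal (2 ^ n * (a n x)\<^sup>2)) \<partial>half_line) = (\<Sum>n. \<integral>\<^sup>+x. ennreal (2 ^ n * (a n x)\<^sup>2) \<partial>half_line)"
    using meas by (rule nn_integral_suminf)
  also have "\<dots> \<le> (\<Sum>n. ennreal (c\<^sup>2 * (1/2) ^ n))"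
  proof (intro suminf_le)
    fix n
    have "(\<integral>\<^sup>+x. ennreal (2 ^ n * (a n x)\<^sup>2) \<partial>half_line) = ennreal (2 ^ n) * (\<integral>\<^sup>+x. ennreal ((a n x)\<^sup>2) \<partial>half_line)"
      using strongly_measurable_norm[OF square_integrableD(1)[OF square_integrable_diff[OF g(1) g(1)]]]
      unfolding a_def by (subst nn_integral_cmult[symmetric]) (auto simp: ennreal_mult)
    also have "\<dots> = ennreal (2 ^ n * (?d (g n) (g (Suc n)))\<^sup>2)"
      unfolding a_def using g by (subst nnd) (auto simp: ennreal_mult)
    also have "\<dots> \<le> ennreal (2 ^ n * (c * (1/2) ^ n)\<^sup>2)"
      using fast[of n] g by (intro ennreal_leI mult_left_mono power_mono L.hdist_nonneg L2_mem) auto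
    also have "2 ^ n * (c * (1/2) ^ n)\<^sup>2 = c\<^sup>2 * (1/2) ^ n"
      by (simp add: power2_eq_square power_divide)
    finally show "(\<integral>\<^sup>+x. ennreal (2 ^ n * (a n x)\<^sup>2) \<partial>half_line) \<le> ennreal (c\<^sup>2 * (1/2) ^ n)" .
  qed auto
  also have "\<dots> = ennreal (\<Sum>n. c\<^sup>2 * (1/2) ^ n)"
    by (intro suminf_ennreal2 summable_mult summable_geometric) auto
  also have "\<dots> < \<infinity>" by simp
  finally have "AE x in half_line. (\<Sum>n. ennreal (2 ^ n * (a n x)\<^sup>2)) \<noteq> \<infinity>"
    using meas by (intro nn_integral_PInf_AE) auto
  then have "AE x in half_line. summable (\<lambda>n. a n x)"
  proof (rule AE_mp, intro AE_I2 impI)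
    fix x assume x: "x \<in> space half_line" and fin: "(\<Sum>n. ennreal (2 ^ n * (a n x)\<^sup>2)) \<noteq> \<infinity>"
    have s: "summable (\<lambda>n. 2 ^ n * (a n x)\<^sup>2)" using fin by (intro summable_suminf_not_top) auto
    show "summable (\<lambda>n. a n x)"
    proof (rule summable_comparison_test')
      show "summable (\<lambda>n. 2 ^ n * (a n x)\<^sup>2 + (1/2) ^ n)" using s by (intro summable_add summable_geometric) auto
      fix n
      \<comment> \<open>Expanding this square bounds \<open>2 * a n x\<close> by the weighted
        squares plus a geometric sequence, both summable.\<close>
      have "0 \<le> 2 ^ n * (a n x - (1/2) ^ n)\<^sup>2" by simp
      also have "\<dots> = 2 ^ n * (a n x)\<^sup>2 - 2 * a n x + (1/2) ^ n"
        by (simp add: power2_diff algebra_simps power2_eq_square power_one_over)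
      finally show "norm (a n x) \<le> 2 ^ n * (a n x)\<^sup>2 + (1/2) ^ n" using a0[of x n] x by (simp add: space_restrict_space)
    qed
  qed
  then obtain N where N: "N \<in> null_sets half_line" "{x \<in> space half_line. \<not> summable (\<lambda>n. a n x)} \<subseteq> N"
    by (auto simp: eventually_ae_filter)
  \<comment> \<open>Putting the sequence to zero on the null set \<open>N\<close> makes it converge
    everywhere, as \<open>strongly_measurable\<close> demands.\<close>
  define s where "s n x = hscale H (indicator (- N) x) (g n x)" for n x
  have smem: "s n x \<in> hcarrier H" if "x \<ge> 0" for n x using gx that by (simp add: s_def)
  have conv: "\<exists>l. hconverges H (\<lambda>n. s n x) l sequentially" if x: "x \<ge> 0" for x
  proof (rule complete)
    show "s n x \<in> hcarrier H" for n using smem[OF x] .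
    fix e :: real assume e: "e > 0"
    show "\<exists>n0. \<forall>m\<ge>n0. \<forall>n\<ge>n0. hdist H (s m x) (s n x) < e"
    proof (cases "x \<in> N")
      case True
      then have "s n x = hzero H" for n using gx[OF x] by (auto simp: s_def intro!: weak_eqI)
      then show ?thesis using e by (simp add: hdist_def hdiff_self)
    next
      case False
      then have sg: "s n x = g n x" for n using gx[OF x] by (simp add: s_def scale_one)
      have "summable (\<lambda>n. a n x)" using N(2) False x by (auto simp: space_restrict_space)
      then obtain n0 where n0: "\<And>m n. m \<ge> n0 \<Longrightarrow> norm (\<Sum>k=m..<n. a k x) < e"
        using e unfolding summable_Cauchy by blast
      have le: "hdist H (g m x) (g n x) \<le> (\<Sum>k=m..<n. a k x)" if "m \<le> n" for m n
        using that
      proof (induction n rule: dec_induct)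
        case base
        then show ?case using gx[OF x] by (simp add: hdist_def hdiff_self)
      next
        case (step n)
        then show ?case using hdist_triangle[of "g m x" "g n x" "g (Suc n) x"] gx[OF x]
          by (simp add: a_def hdist_def)
      qed
      have "hdist H (g m x) (g n x) < e" if "m \<ge> n0" "n \<ge> n0" for m n
        using le[of m n] le[of n m] n0[OF that(1), of n] n0[OF that(2), of m]
          hdist_commute[OF gx[OF x] gx[OF x], of m n] by (cases m n rule: linorder_le_cases) auto
      then show ?thesis unfolding sg by blast
    qed
  qed
  define h where "h x = (SOME l. hconverges H (\<lambda>n. s n x) l sequentially)" for x
  have hconv: "hconverges H (\<lambda>n. s n x) (h x) sequentially" if "x \<ge> 0" for x
    unfolding h_def using someI_ex[OF conv[OF that]] .
  have hmem: "h x \<in> hcarrier H" if "x \<ge> 0" for x using hconv[OF that] by (simp add: hconverges_def)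
  have "simple_function half_line (s n)" for n
  proof -
    have "(indicator (- N) :: real \<Rightarrow> complex) = (\<lambda>x. 1 - indicator N x)" by (auto simp: indicator_def)
    moreover have "simple_function half_line (indicator N :: real \<Rightarrow> complex)"
      using N(1) by (intro simple_function_indicator) auto
    ultimately have "simple_function half_line (indicator (- N) :: real \<Rightarrow> complex)"
      using simple_function_compose1[of half_line "indicator N" "\<lambda>z. 1 - z"] by simp
    then show ?thesis unfolding s_def using g(2) by (rule simple_function_compose2)
  qed
  then have hsm: "strongly_measurable H half_line h"
    unfolding strongly_measurable_def space_half_line using smem hmem hconv by (auto intro!: exI[of _ s])
  have AEN: "AE x in half_line. x \<notin> N" using N(1) by (rule AE_not_in)
  \<comment> \<open>Fatou's lemma carries the bound on distances within the sequence over to the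
    limit. It also shows that the difference is square-integrable, and with it
    \<open>h\<close>.\<close>
  have fatou: "(\<integral>\<^sup>+x. ennreal ((hnorm H (hdiff H (h x) (g n x)))\<^sup>2) \<partial>half_line) \<le> ennreal ((2 * c * (1/2) ^ n)\<^sup>2)" for n
  proof -
    have "(\<integral>\<^sup>+x. ennreal ((hnorm H (hdiff H (h x) (g n x)))\<^sup>2) \<partial>half_line)
        = (\<integral>\<^sup>+x. liminf (\<lambda>k. ennreal ((hnorm H (hdiff H (g k x) (g n x)))\<^sup>2)) \<partial>half_line)"
    proof (rule nn_integral_cong_AE, rule AE_mp[OF AEN], intro AE_I2 impI)
      fix x assume "x \<in> space half_line" "x \<notin> N"
      then have x: "x \<ge> 0" "x \<notin> N" by (auto simp: space_restrict_space)
      then have sg: "s n x = g n x" for n using gx[OF x(1)] by (simp add: s_def scale_one)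
      have "hconverges H (\<lambda>k. g k x) (h x) sequentially" using hconv[OF x(1)] unfolding sg .
      moreover have "hconverges H (\<lambda>k. hscale H (-1) (g n x)) (hscale H (-1) (g n x)) sequentially"
        using gx[OF x(1)] by (simp add: hconverges_def hdist_def hdiff_self)
      ultimately have "hconverges H (\<lambda>k. hdiff H (g k x) (g n x)) (hdiff H (h x) (g n x)) sequentially"
        unfolding hdiff_def using gx[OF x(1)] by (intro hconverges_add) auto
      then have "(\<lambda>k. hnorm H (hdiff H (g k x) (g n x))) \<longlonglongrightarrow> hnorm H (hdiff H (h x) (g n x))"
        using gx[OF x(1)] by (intro hconverges_norm) auto
      then have "(\<lambda>k. ennreal ((hnorm H (hdiff H (g k x) (g n x)))\<^sup>2)) \<longlonglongrightarrow> ennreal ((hnorm H (hdiff H (h x) (g n x)))\<^sup>2)"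
        by (intro tendsto_ennrealI tendsto_power)
      then show "ennreal ((hnorm H (hdiff H (h x) (g n x)))\<^sup>2) = liminf (\<lambda>k. ennreal ((hnorm H (hdiff H (g k x) (g n x)))\<^sup>2))"
        using lim_imp_Liminf[OF sequentially_bot] by metis
    qed
    also have "\<dots> \<le> liminf (\<lambda>k. \<integral>\<^sup>+x. ennreal ((hnorm H (hdiff H (g k x) (g n x)))\<^sup>2) \<partial>half_line)"
      using strongly_measurable_norm[OF square_integrableD(1)[OF square_integrable_diff[OF g(1) g(1)]]]
      by (intro nn_integral_liminf) measurable
    also have "\<dots> = liminf (\<lambda>k. ennreal ((?d (g k) (g n))\<^sup>2))" using g by (simp add: nnd)
    also have "\<dots> \<le> limsup (\<lambda>k. ennreal ((?d (g k) (g n))\<^sup>2))" by (rule Liminf_le_Limsup) simp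
    also have "\<dots> \<le> ennreal ((2 * c * (1/2) ^ n)\<^sup>2)"
    proof (rule Limsup_bounded)
      show "\<forall>\<^sub>F k in sequentially. ennreal ((?d (g k) (g n))\<^sup>2) \<le> ennreal ((2 * c * (1/2) ^ n)\<^sup>2)"
        using eventually_ge_at_top[of n]
      proof eventually_elim
        case (elim k)
        then show ?case using dd[of n "k - n"] L.hdist_commute[OF L2_mem L2_mem, OF g(1) g(1), of k n]
            L.hdist_nonneg[OF L2_mem L2_mem, OF g(1) g(1), of k n]
          by (intro ennreal_leI power_mono) auto
      qed
    qed
    finally show ?thesis .
  qed
  have hg: "(\<lambda>x. hdiff H (h x) (g n x)) \<in> square_integrable H" for n
  proof -
    have sm: "strongly_measurable H half_line (\<lambda>x. hdiff H (h x) (g n x))"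
      unfolding hdiff_def
      by (rule strongly_measurable_add[OF hsm square_integrableD(1)[OF square_integrable_cscale[OF g(1)]]])
    moreover have "integrable half_line (\<lambda>x. (hnorm H (hdiff H (h x) (g n x)))\<^sup>2)"
    proof (rule integrableI_bounded)
      show "(\<lambda>x. (hnorm H (hdiff H (h x) (g n x)))\<^sup>2) \<in> borel_measurable half_line"
        using strongly_measurable_norm[OF sm] by measurable
      show "(\<integral>\<^sup>+x. ennreal (norm ((hnorm H (hdiff H (h x) (g n x)))\<^sup>2)) \<partial>half_line) < \<infinity>"
        using fatou[of n] le_less_trans by fastforce
    qed
    ultimately show ?thesis by (simp add: square_integrable_def)
  qed
  have hsq: "h \<in> square_integrable H"
  proof -
    have sq: "(\<lambda>x. hadd H (hdiff H (h x) (g 0 x)) (g 0 x)) \<in> square_integrable H" using hg g by auto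
    have e: "hadd H (hdiff H (h x) (g 0 x)) (g 0 x) = h x" if "x \<ge> 0" for x
      using hmem gx that by (intro weak_eqI) auto
    have "integrable half_line (\<lambda>x. (hnorm H (h x))\<^sup>2) \<longleftrightarrow> integrable half_line (\<lambda>x. (hnorm H (hadd H (hdiff H (h x) (g 0 x)) (g 0 x)))\<^sup>2)"
      using e by (intro Bochner_Integration.integrable_cong) (auto simp: space_restrict_space)
    then show ?thesis using hsm square_integrableD(2)[OF sq] by (simp add: square_integrable_def)
  qed
  have "?d (g n) h \<le> 2 * c * (1/2) ^ n" for n
  proof -
    have "(?d h (g n))\<^sup>2 \<le> (2 * c * (1/2) ^ n)\<^sup>2" using fatou[of n] c by (simp add: nnd[OF hsq g(1)])
    then have "?d h (g n) \<le> 2 * c * (1/2) ^ n" using c by (auto intro: power2_le_imp_le)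
    then show ?thesis using L.hdist_commute[OF L2_mem L2_mem, OF g(1) hsq, of n] by simp
  qed
  then show ?thesis using hsq by blast
qed

text \<open>Riesz-Fischer. A Cauchy sequence is thinned until its increments fall below
  \<open>(1/2) ^ k\<close>, and each member is replaced by a simple function at that distance. The
  limit of these simple functions is the limit of the whole sequence.\<close>

theorem L2_hilbert: "complex_hilbert_space (L2_space H)"
proof -
  interpret L: pre_hilbert "L2_space H" by (rule L2_pre_hilbert)
  let ?d = "hdist (L2_space H)"
  have compl: "\<exists>l. hconverges (L2_space H) F l sequentially"
    if F: "\<And>n. F n \<in> hcarrier (L2_space H)"
      and C: "\<And>e. e > 0 \<Longrightarrow> \<exists>n0. \<forall>m\<ge>n0. \<forall>n\<ge>n0. ?d (F m) (F n) < e"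
    for F :: "nat \<Rightarrow> (real \<Rightarrow> 'a) set"
  proof -
    have "\<exists>r. \<forall>m\<ge>r. \<forall>n\<ge>r. ?d (F m) (F n) < (1/2) ^ k" for k :: nat by (intro C) auto
    then obtain q where q: "\<And>k m n. m \<ge> q k \<Longrightarrow> n \<ge> q k \<Longrightarrow> ?d (F m) (F n) < (1/2) ^ k" by metis
    \<comment> \<open>Partial sums give a monotone sequence of indices lying above
      \<open>q\<close>.\<close>
    define r where "r k = (\<Sum>i\<le>k. q i)" for k
    have r: "r k \<ge> q k" "r (Suc k) \<ge> r k" for k unfolding r_def by (auto intro: member_le_sum)
    have "\<exists>g\<in>square_integrable H. simple_function half_line g \<and> ?d (F (r k)) (L2_class H g) < (1/2) ^ k" for k
      using F[of "r k"] by (auto simp: L2_space_def simp flip: L2_space_def intro!: simple_approximation elim!: L2_cases)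
    then obtain g where g: "\<And>k. g k \<in> square_integrable H" "\<And>k. simple_function half_line (g k)"
      "\<And>k. ?d (F (r k)) (L2_class H (g k)) < (1/2) ^ k" by metis
    have gm: "L2_class H (g k) \<in> hcarrier (L2_space H)" for k using g by auto
    have "?d (L2_class H (g n)) (L2_class H (g (Suc n))) \<le> 3 * (1/2) ^ n" for n
    proof -
      have "?d (L2_class H (g n)) (L2_class H (g (Suc n)))
          \<le> ?d (L2_class H (g n)) (F (r n)) + (?d (F (r n)) (F (r (Suc n))) + ?d (F (r (Suc n))) (L2_class H (g (Suc n))))"
        using L.hdist_triangle[OF gm[of n] F[of "r n"] gm[of "Suc n"]]
          L.hdist_triangle[OF F[of "r n"] F[of "r (Suc n)"] gm[of "Suc n"]] by linarith
      moreover have "?d (F (r n)) (F (r (Suc n))) < (1/2) ^ n"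
        using r(1)[of n] r(2)[of n] by (intro q) auto
      moreover have "?d (L2_class H (g n)) (F (r n)) < (1/2) ^ n"
        using g(3)[of n] L.hdist_commute[OF gm[of n] F[of "r n"]] by simp
      moreover have "?d (F (r (Suc n))) (L2_class H (g (Suc n))) \<le> (1/2) ^ n"
        using g(3)[of "Suc n"] power_decreasing[of n "Suc n" "1/2::real"] by linarith
      ultimately show ?thesis by linarith
    qed
    from fast_simple_sequence_converges[OF g(1,2) this]
    obtain h where h: "h \<in> square_integrable H"
      "\<And>n. ?d (L2_class H (g n)) (L2_class H h) \<le> 2 * 3 * (1/2) ^ n" by blast
    let ?h = "L2_class H h"
    have hm: "?h \<in> hcarrier (L2_space H)" using h by auto
    \<comment> \<open>The 8 collects one unit from \<open>F m\<close> to \<open>F (r n)\<close>, one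
      from there to the simple function, and six from the fast sequence with constant 3.\<close>
    have le: "?d (F m) ?h \<le> 8 * (1/2) ^ n" if "m \<ge> q n" for m n
    proof -
      have "?d (F m) ?h \<le> ?d (F m) (F (r n)) + (?d (F (r n)) (L2_class H (g n)) + ?d (L2_class H (g n)) ?h)"
        using L.hdist_triangle[OF F[of m] F[of "r n"] hm] L.hdist_triangle[OF F[of "r n"] gm[of n] hm] by linarith
      moreover have "?d (F m) (F (r n)) < (1/2) ^ n" using that r by (intro q) auto
      ultimately show ?thesis using g(3)[of n] h(2)[of n] by linarith
    qed
    have "(\<lambda>m. ?d (F m) ?h) \<longlonglongrightarrow> 0"
    proof (rule LIMSEQ_I)
      fix e :: real assume e: "e > 0"
      obtain n where "(1/2) ^ n < e / 8" using real_arch_pow_inv[of "e / 8" "1/2"] e by auto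
      then have "norm (?d (F m) ?h - 0) < e" if "m \<ge> q n" for m
        using le[OF that] L.hdist_nonneg[OF F[of m] hm] by simp
      then show "\<exists>m0. \<forall>m\<ge>m0. norm (?d (F m) ?h - 0) < e" by blast
    qed
    then show ?thesis using hm by (auto simp: hconverges_def)
  qed
  show ?thesis
    by (intro complex_hilbert_space.intro)
      (fact L.zero_mem L.add_mem L.scale_mem L.hadd_assoc L.hadd_commute L.hadd_zero L.hdiff_self
        L.hscale_one L.hscale_hscale L.hscale_add_left L.hscale_add_right L.hinner_add_left
        L.hinner_scale_left L.hinner_commute L.hinner_ge_zero L.hinner_eq_zero compl)+
qed

section \<open>Step vectors and truncated ampliations\<close>

lemma emeasure_half_line_Ico: "emeasure half_line {0..<s} = ennreal s"
proof -
  have "emeasure half_line {0..<s} = emeasure lebesgue {0..<s}"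
    by (intro emeasure_restrict_space) auto
  then show ?thesis by (cases "0 \<le> s") (auto simp: ennreal_neg)
qed

lemma step_square_integrable:
  assumes "v \<in> hcarrier H"
  shows "(\<lambda>x. hscale H (indicator {0..<s} x) v) \<in> square_integrable H"
proof (rule square_integrableI)
  have A: "{0..<s} \<in> sets half_line" by (auto simp: sets_restrict_space_iff)
  show "strongly_measurable H half_line (\<lambda>x. hscale H (indicator {0..<s} x) v)"
    using A assms by (intro strongly_measurable_simple simple_function_compose1[of _ _ "\<lambda>c. hscale H c v"]
      simple_function_indicator) auto
  show "integrable half_line (\<lambda>x. indicator {0..<s} x * (hnorm H v)\<^sup>2)"
    using A emeasure_half_line_Ico[of s] by (intro integrable_mult_left integrable_real_indicator) auto
  show "(hnorm H (hscale H (indicator {0..<s} x) v))\<^sup>2 \<le> indicator {0..<s} x * (hnorm H v)\<^sup>2" for x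
    using assms by (auto simp: indicator_def power_mult_distrib)
qed

lemma step_vec_mem: "v \<in> hcarrier H \<Longrightarrow> step_vec H v s \<in> hcarrier (L2_space H)"
  unfolding step_vec_def by (intro L2_mem step_square_integrable)

text \<open>The factor is the length of the interval; it is how time enters the cumulants.\<close>

lemma step_vec_inner:
  assumes "u \<in> hcarrier H" "v \<in> hcarrier H" "0 \<le> s"
  shows "hinner (L2_space H) (step_vec H u s) (step_vec H v s) = of_real s * hinner H u v"
proof -
  have "hinner (L2_space H) (step_vec H u s) (step_vec H v s)
      = (LINT x|half_line. hinner H (hscale H (indicator {0..<s} x) u) (hscale H (indicator {0..<s} x) v))"
    unfolding step_vec_def using assms by (intro L2_inner step_square_integrable)
  also have "\<dots> = (LINT x|half_line. indicator {0..<s} x *\<^sub>R hinner H u v)"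
    using assms by (intro Bochner_Integration.integral_cong) (auto simp: indicator_def)
  also have "\<dots> = measure half_line {0..<s} *\<^sub>R hinner H u v"
  proof -
    have A: "{0..<s} \<in> sets half_line" by (auto simp: sets_restrict_space_iff)
    then have "integrable half_line (indicator {0..<s} :: real \<Rightarrow> real)"
      using emeasure_half_line_Ico[of s] by (intro integrable_real_indicator) auto
    then have "(LINT x|half_line. indicator {0..<s} x *\<^sub>R hinner H u v) = (LINT x|half_line. indicator {0..<s} x) *\<^sub>R hinner H u v"
      by (rule integral_scaleR_left)
    also have "(LINT x|half_line. indicator {0..<s} x) = measure half_line ({0..<s} \<inter> space half_line)"
      by (rule Bochner_Integration.integral_indicator)
    also have "{0..<s} \<inter> space half_line = {0..<s}" by (auto simp: space_half_line)
    finally show ?thesis .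
  qed
  also have "measure half_line {0..<s} = s"
    using assms emeasure_half_line_Ico[of s] by (simp add: measure_def)
  finally show ?thesis by (simp add: scaleR_conv_of_real)
qed

text \<open>This is the operator that \<open>conservation_process\<close> passes to
  \<open>conservation\<close>.\<close>

definition process_op :: "('a \<Rightarrow> 'a) \<Rightarrow> real \<Rightarrow> (real \<Rightarrow> 'a) set \<Rightarrow> (real \<Rightarrow> 'a) set" where
  "process_op a s F = L2_proj H {0..s} (ampliation H a F)"

lemma simple_function_indicator_cc: "simple_function half_line (indicator {0..s} :: real \<Rightarrow> complex)"
  by (intro simple_function_indicator) (auto simp: sets_restrict_space_iff)

lemma process_square_integrable:
  assumes "bounded_operator H a" "f \<in> square_integrable H"
  shows "(\<lambda>x. hscale H (indicator {0..s} x) (a (f x))) \<in> square_integrable H"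
  by (rule square_integrable_scale[OF square_integrable_operator[OF assms(2,1)] simple_function_indicator_cc, where k = 1])
    (auto simp: indicator_def)

lemma process_op_class:
  assumes "bounded_operator H a" "f \<in> square_integrable H"
  shows "process_op a s (L2_class H f) = L2_class H (\<lambda>x. hscale H (indicator {0..s} x) (a (f x)))"
proof -
  let ?r = "rep (L2_class H f)"
  have "ampliation H a (L2_class H f) = L2_class H (\<lambda>x. a (f x))"
    unfolding ampliation_def using rep_AE[OF assms(2)] by (auto intro!: L2_class_cong elim!: eventually_mono)
  then have "process_op a s (L2_class H f) = L2_class H (\<lambda>x. hscale H (indicator {0..s} x) (rep (L2_class H (\<lambda>x. a (f x))) x))"
    by (simp add: process_op_def L2_proj_def)
  also have "\<dots> = L2_class H (\<lambda>x. hscale H (indicator {0..s} x) (a (f x)))"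
    using rep_AE[OF square_integrable_operator[OF assms(2,1)]] by (auto intro!: L2_class_cong elim!: eventually_mono)
  finally show ?thesis .
qed

text \<open>Truncation by an indicator does not increase pointwise norms, so a bound for
  \<open>a\<close> serves for every \<open>s\<close>.\<close>

lemma process_op_bounded:
  assumes a: "bounded_operator H a"
  shows "bounded_operator (L2_space H) (process_op a s)"
proof -
  have lin: "linear_operator H a" using a by (simp add: bounded_operator_def)
  obtain K where K: "K > 0" "\<And>x. x \<in> hcarrier H \<Longrightarrow> hnorm H (a x) \<le> K * hnorm H x"
    using bounded_operatorD[OF a] by blast
  have "linear_operator (L2_space H) (process_op a s)"
    unfolding linear_operator_def
  proof (intro conjI ballI allI)
    fix F c assume F: "F \<in> hcarrier (L2_space H)"
    then obtain f where f: "f \<in> square_integrable H" "F = L2_class H f" by (rule L2_cases)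
    note fx = square_integrableD(3)[OF f(1)]
    note sq = process_square_integrable[OF a]
    show "process_op a s F \<in> hcarrier (L2_space H)"
      using f sq by (simp add: process_op_class[OF a] L2_mem)
    have "L2_class H (\<lambda>x. hscale H (indicator {0..s} x) (a (hscale H c (f x))))
        = L2_class H (\<lambda>x. hscale H c (hscale H (indicator {0..s} x) (a (f x))))"
      using fx lin by (intro L2_class_cong') (auto simp: linear_operatorD hscale_hscale mult.commute)
    then show "process_op a s (hscale (L2_space H) c F) = hscale (L2_space H) c (process_op a s F)"
      using f sq by (simp add: L2_scale process_op_class[OF a] square_integrable_cscale)
    fix G assume G: "G \<in> hcarrier (L2_space H)"
    then obtain g where g: "g \<in> square_integrable H" "G = L2_class H g" by (rule L2_cases)
    note gx = square_integrableD(3)[OF g(1)]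
    have "L2_class H (\<lambda>x. hscale H (indicator {0..s} x) (a (hadd H (f x) (g x))))
        = L2_class H (\<lambda>x. hadd H (hscale H (indicator {0..s} x) (a (f x))) (hscale H (indicator {0..s} x) (a (g x))))"
      using fx gx lin by (intro L2_class_cong') (auto simp: linear_operatorD hscale_add_right)
    then show "process_op a s (hadd (L2_space H) F G) = hadd (L2_space H) (process_op a s F) (process_op a s G)"
      using f g sq by (simp add: L2_add process_op_class[OF a] square_integrable_add)
  qed
  moreover have "hnorm (L2_space H) (process_op a s F) \<le> K * hnorm (L2_space H) F"
    if F: "F \<in> hcarrier (L2_space H)" for F
  proof -
    obtain f where f: "f \<in> square_integrable H" "F = L2_class H f" using F by (rule L2_cases)
    note sq = process_square_integrable[OF a f(1), of s]
    have "(hnorm (L2_space H) (process_op a s F))\<^sup>2 = (LINT x|half_line. (hnorm H (hscale H (indicator {0..s} x) (a (f x))))\<^sup>2)"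
      using f sq by (simp add: process_op_class[OF a] L2_norm)
    also have "\<dots> \<le> (LINT x|half_line. K\<^sup>2 * (hnorm H (f x))\<^sup>2)"
    proof (intro integral_mono integrable_mult_right square_integrableD(2) sq f(1))
      fix x assume "x \<in> space half_line"
      then have fx: "f x \<in> hcarrier H" using square_integrableD(3)[OF f(1)] by (simp add: space_half_line)
      have "hnorm H (hscale H (indicator {0..s} x) (a (f x))) \<le> hnorm H (a (f x))"
        using fx lin by (auto simp: indicator_def linear_operatorD)
      then have "hnorm H (hscale H (indicator {0..s} x) (a (f x))) \<le> K * hnorm H (f x)"
        using K(2)[OF fx] by linarith
      then have "(hnorm H (hscale H (indicator {0..s} x) (a (f x))))\<^sup>2 \<le> (K * hnorm H (f x))\<^sup>2"
        using fx lin by (intro power_mono) (auto simp: linear_operatorD)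
      then show "(hnorm H (hscale H (indicator {0..s} x) (a (f x))))\<^sup>2 \<le> K\<^sup>2 * (hnorm H (f x))\<^sup>2"
        by (simp only: power_mult_distrib)
    qed
    also have "\<dots> = (K * hnorm (L2_space H) F)\<^sup>2" using f by (simp add: L2_norm(1)[OF f(1)] power_mult_distrib)
    finally show ?thesis using K(1) L2_norm(2)[OF f(1)] f(2) by (auto intro: power2_le_imp_le)
  qed
  ultimately show ?thesis by (auto simp: bounded_operator_def)
qed

text \<open>Cutting at \<open>{0..s}\<close> leaves a function supported in \<open>{0..<s}\<close>
  unchanged, so on step vectors of the same time only the action on values remains. This reduces the
  cumulants to the value space.\<close>

lemma process_op_step:
  assumes "bounded_operator H a" "v \<in> hcarrier H"
  shows "process_op a s (step_vec H v s) = step_vec H (a v) s"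
proof -
  have lin: "linear_operator H a" using assms by (simp add: bounded_operator_def)
  have "process_op a s (step_vec H v s) = L2_class H (\<lambda>x. hscale H (indicator {0..s} x) (a (hscale H (indicator {0..<s} x) v)))"
    unfolding step_vec_def using assms by (intro process_op_class step_square_integrable)
  also have "\<dots> = L2_class H (\<lambda>x. hscale H (indicator {0..<s} x) (a v))"
    using assms lin by (intro L2_class_cong') (auto simp: linear_operatorD hscale_hscale indicator_def)
  finally show ?thesis by (simp add: step_vec_def)
qed

end

section \<open>Multilinear functionals\<close>

lemma l2_add:
  fixes f g :: "'a \<Rightarrow> complex"
  assumes "(\<lambda>x. (cmod (f x))\<^sup>2) summable_on A" "(\<lambda>x. (cmod (g x))\<^sup>2) summable_on A"
  shows "(\<lambda>x. (cmod (f x + g x))\<^sup>2) summable_on A"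
proof (rule summable_on_comparison_test)
  show "(\<lambda>x. 2 * (cmod (f x))\<^sup>2 + 2 * (cmod (g x))\<^sup>2) summable_on A"
    using assms by (intro summable_on_add summable_on_cmult_right)
  show "(cmod (f x + g x))\<^sup>2 \<le> 2 * (cmod (f x))\<^sup>2 + 2 * (cmod (g x))\<^sup>2" for x
  proof -
    have "(cmod (f x + g x))\<^sup>2 \<le> (cmod (f x) + cmod (g x))\<^sup>2" by (intro power_mono norm_triangle_ineq) auto
    moreover have "0 \<le> (cmod (f x) - cmod (g x))\<^sup>2" by simp
    ultimately show ?thesis unfolding power2_sum power2_diff by linarith
  qed
qed auto

lemma l2_scale:
  fixes f :: "'a \<Rightarrow> complex"
  assumes "(\<lambda>x. (cmod (f x))\<^sup>2) summable_on A"
  shows "(\<lambda>x. (cmod (c * f x))\<^sup>2) summable_on A"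
  unfolding norm_mult power_mult_distrib using assms by (rule summable_on_cmult_right)

lemma l2_inner_summable:
  fixes f g :: "'a \<Rightarrow> complex"
  assumes "(\<lambda>x. (cmod (f x))\<^sup>2) summable_on A" "(\<lambda>x. (cmod (g x))\<^sup>2) summable_on A"
  shows "(\<lambda>x. f x * cnj (g x)) summable_on A"
  using l2_abs_summable[of f A "\<lambda>x. cnj (g x)"] assms by (auto intro: Infinite_Sum.abs_summable_summable)

text \<open>Tonelli as an inequality: bounds on the inner sums control the double family.\<close>

lemma nonneg_summable_Times_le:
  fixes f :: "'a \<times> 'b \<Rightarrow> real"
  assumes f: "\<And>x. x \<in> A \<Longrightarrow> (\<lambda>y. f (x, y)) summable_on B" "\<And>x. x \<in> A \<Longrightarrow> infsum (\<lambda>y. f (x, y)) B \<le> g x"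
    and g: "g summable_on A" and nonneg: "\<And>p. f p \<ge> 0"
  shows "f summable_on A \<times> B" "infsum f (A \<times> B) \<le> infsum g A"
proof -
  let ?h = "\<lambda>x. infsum (\<lambda>y. f (x, y)) B"
  have h: "?h summable_on A"
    using f(2) nonneg by (intro summable_on_comparison_test[OF g]) (auto intro: infsum_nonneg)
  show s: "f summable_on A \<times> B"
    using f(1) h nonneg by (intro summable_on_SigmaI[where g = ?h]) auto
  have "infsum f (A \<times> B) = infsum ?h A" using s by (simp add: infsum_Sigma_banach[symmetric])
  then show "infsum f (A \<times> B) \<le> infsum g A" using h g f(2) by (simp add: infsum_mono)
qed

lemma tuples_0 [simp]: "tuples 0 A = {[]}"
  by (auto simp: tuples_def)

lemma Cons_tuples [simp]: "x # xs \<in> tuples (Suc n) A \<longleftrightarrow> x \<in> A \<and> xs \<in> tuples n A"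
  by (auto simp: tuples_def)

lemma replicate_tuples: "x \<in> A \<Longrightarrow> replicate n x \<in> tuples n A"
  by (auto simp: tuples_def)

lemma has_sum_tuples_Suc:
  "(f has_sum S) (tuples (Suc n) A) \<longleftrightarrow> ((\<lambda>(x, xs). f (x # xs)) has_sum S) (A \<times> tuples n A)"
  by (rule has_sum_reindex_bij_witness[of _ "\<lambda>(x, xs). x # xs" "\<lambda>xs. (hd xs, tl xs)"])
    (auto simp: tuples_def length_Suc_conv)

lemma summable_on_tuples_Suc:
  "f summable_on tuples (Suc n) A \<longleftrightarrow> (\<lambda>(x, xs). f (x # xs)) summable_on A \<times> tuples n A"
  by (simp add: summable_on_def has_sum_tuples_Suc)

lemma infsum_tuples_Suc:
  "infsum f (tuples (Suc n) A) = infsum (\<lambda>(x, xs). f (x # xs)) (A \<times> tuples n A)"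
  by (rule infsum_reindex_bij_witness[of _ "\<lambda>(x, xs). x # xs" "\<lambda>xs. (hd xs, tl xs)"])
    (auto simp: tuples_def length_Suc_conv)

text \<open>A list determines its length, so a sum over all degrees and all tuples of each degree is
  a single sum over lists.\<close>

lemma has_sum_lists:
  "(f has_sum S) (lists A) \<longleftrightarrow> ((\<lambda>(n, xs). f xs) has_sum S) (SIGMA n:UNIV. tuples n A)"
  by (rule has_sum_reindex_bij_witness[of _ "\<lambda>(n, xs). xs" "\<lambda>xs. (length xs, xs)"])
    (auto simp: tuples_def lists_eq_set)

section \<open>Bounded multilinear functionals and their Hilbert-Schmidt norms\<close>

context complex_hilbert_space
begin

text \<open>The same choice expression as in \<open>basis_tuples\<close>, so that the two agree by
  unfolding.\<close>

definition basis where "basis = (SOME B. orthonormal_basis H B)"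

lemma basis: "orthonormal_basis H basis"
  unfolding basis_def using orthonormal_basis_exists by (rule someI_ex)

lemma basis_mem: "b \<in> basis \<Longrightarrow> b \<in> hcarrier H"
  using basis by (auto simp: orthonormal_basis_def)

lemma basis_tuples_eq: "basis_tuples H n = tuples n basis"
  by (simp add: basis_tuples_def basis_def)

lemma tuples_basis_mem: "bs \<in> tuples n basis \<Longrightarrow> bs \<in> tuples n (hcarrier H)"
  using basis_mem by (auto simp: tuples_def)

text \<open>The carrier conditions of \<open>tensor_power\<close> without square-summability. Fixing
  any first argument preserves them (\<open>multilinear_Cons\<close>), which is what inductions over
  the slots rely on.\<close>

definition multilinear :: "nat \<Rightarrow> ('a list \<Rightarrow> complex) \<Rightarrow> bool" where
  "multilinear n T \<longleftrightarrow>
       (\<forall>xs. xs \<notin> tuples n (hcarrier H) \<longrightarrow> T xs = 0)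
       \<and> (\<forall>us vs. \<forall>x\<in>hcarrier H. \<forall>y\<in>hcarrier H. us @ x # vs \<in> tuples n (hcarrier H) \<longrightarrow>
            T (us @ hadd H x y # vs) = T (us @ x # vs) + T (us @ y # vs))
       \<and> (\<forall>us vs. \<forall>c. \<forall>x\<in>hcarrier H. us @ x # vs \<in> tuples n (hcarrier H) \<longrightarrow>
            T (us @ hscale H c x # vs) = cnj c * T (us @ x # vs))
       \<and> (\<exists>K. \<forall>xs\<in>tuples n (hcarrier H). cmod (T xs) \<le> K * (\<Prod>x\<leftarrow>xs. hnorm H x))"

lemma multilinearI:
  assumes "\<And>xs. xs \<notin> tuples n (hcarrier H) \<Longrightarrow> T xs = 0"
    and "\<And>us vs x y. x \<in> hcarrier H \<Longrightarrow> y \<in> hcarrier H \<Longrightarrow> us @ x # vs \<in> tuples n (hcarrier H) \<Longrightarrow>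
            T (us @ hadd H x y # vs) = T (us @ x # vs) + T (us @ y # vs)"
    and "\<And>us vs c x. x \<in> hcarrier H \<Longrightarrow> us @ x # vs \<in> tuples n (hcarrier H) \<Longrightarrow>
            T (us @ hscale H c x # vs) = cnj c * T (us @ x # vs)"
    and "\<And>xs. xs \<in> tuples n (hcarrier H) \<Longrightarrow> cmod (T xs) \<le> K * (\<Prod>x\<leftarrow>xs. hnorm H x)"
  shows "multilinear n T"
  using assms unfolding multilinear_def by blast

lemma
  assumes "multilinear n T"
  shows multilinear_outside: "xs \<notin> tuples n (hcarrier H) \<Longrightarrow> T xs = 0"
    and multilinear_add: "x \<in> hcarrier H \<Longrightarrow> y \<in> hcarrier H \<Longrightarrow> us @ x # vs \<in> tuples n (hcarrier H) \<Longrightarrow>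
            T (us @ hadd H x y # vs) = T (us @ x # vs) + T (us @ y # vs)"
    and multilinear_scale: "x \<in> hcarrier H \<Longrightarrow> us @ x # vs \<in> tuples n (hcarrier H) \<Longrightarrow>
            T (us @ hscale H c x # vs) = cnj c * T (us @ x # vs)"
    and multilinear_bound: "\<exists>K\<ge>0. \<forall>xs\<in>tuples n (hcarrier H). cmod (T xs) \<le> K * (\<Prod>x\<leftarrow>xs. hnorm H x)"
proof -
  show "xs \<notin> tuples n (hcarrier H) \<Longrightarrow> T xs = 0"
    and "x \<in> hcarrier H \<Longrightarrow> y \<in> hcarrier H \<Longrightarrow> us @ x # vs \<in> tuples n (hcarrier H) \<Longrightarrow>
            T (us @ hadd H x y # vs) = T (us @ x # vs) + T (us @ y # vs)"
    and "x \<in> hcarrier H \<Longrightarrow> us @ x # vs \<in> tuples n (hcarrier H) \<Longrightarrow>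
            T (us @ hscale H c x # vs) = cnj c * T (us @ x # vs)"
    using assms unfolding multilinear_def by blast+
  obtain K where K: "\<forall>xs\<in>tuples n (hcarrier H). cmod (T xs) \<le> K * (\<Prod>x\<leftarrow>xs. hnorm H x)"
    using assms unfolding multilinear_def by blast
  have "cmod (T xs) \<le> \<bar>K\<bar> * (\<Prod>x\<leftarrow>xs. hnorm H x)" if xs: "xs \<in> tuples n (hcarrier H)" for xs
  proof -
    have "0 \<le> (\<Prod>x\<leftarrow>xs. hnorm H x)" using xs by (intro prod_list_nonneg) (auto simp: tuples_def)
    then have "K * (\<Prod>x\<leftarrow>xs. hnorm H x) \<le> \<bar>K\<bar> * (\<Prod>x\<leftarrow>xs. hnorm H x)" by (intro mult_right_mono) auto
    then show ?thesis using K xs by force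
  qed
  then show "\<exists>K\<ge>0. \<forall>xs\<in>tuples n (hcarrier H). cmod (T xs) \<le> K * (\<Prod>x\<leftarrow>xs. hnorm H x)"
    by (intro exI[of _ "\<bar>K\<bar>"]) auto
qed

lemma multilinear_Cons:
  assumes T: "multilinear (Suc n) T" and x: "x \<in> hcarrier H"
  shows "multilinear n (\<lambda>xs. T (x # xs))"
proof -
  obtain K where K: "\<forall>xs\<in>tuples (Suc n) (hcarrier H). cmod (T xs) \<le> K * (\<Prod>x\<leftarrow>xs. hnorm H x)"
    using multilinear_bound[OF T] by blast
  have "cmod (T (x # xs)) \<le> (K * hnorm H x) * (\<Prod>x\<leftarrow>xs. hnorm H x)" if "xs \<in> tuples n (hcarrier H)" for xs
    using bspec[OF K, of "x # xs"] that x by (simp add: mult.assoc)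
  then show ?thesis
    using multilinear_outside[OF T] multilinear_add[OF T, of _ _ "x # _"] multilinear_scale[OF T, of _ "x # _"] x
    by (intro multilinearI) auto
qed

text \<open>With the other arguments frozen, the functional is bounded and conjugate-linear in one
  slot, so Riesz applies to its conjugate. The entry \<open>hzero H\<close> in the premise merely
  marks the position.\<close>

lemma multilinear_slot:
  assumes T: "multilinear n T" and t: "us @ hzero H # vs \<in> tuples n (hcarrier H)"
  shows "\<exists>z\<in>hcarrier H. \<forall>x\<in>hcarrier H. T (us @ x # vs) = hinner H z x"
proof -
  have t': "us @ x # vs \<in> tuples n (hcarrier H)" if "x \<in> hcarrier H" for x
    using t that by (auto simp: tuples_def)
  obtain K where K: "\<forall>xs\<in>tuples n (hcarrier H). cmod (T xs) \<le> K * (\<Prod>x\<leftarrow>xs. hnorm H x)"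
    using multilinear_bound[OF T] by blast
  have "\<exists>z\<in>hcarrier H. \<forall>x\<in>hcarrier H. cnj (T (us @ x # vs)) = hinner H x z"
  proof (rule Riesz)
    fix x assume x: "x \<in> hcarrier H"
    show "cmod (cnj (T (us @ x # vs))) \<le> (K * (\<Prod>x\<leftarrow>us. hnorm H x) * (\<Prod>x\<leftarrow>vs. hnorm H x)) * hnorm H x"
      using bspec[OF K t'[OF x]] by (simp add: mult_ac)
  qed (use multilinear_add[OF T] multilinear_scale[OF T] t' in auto)
  then obtain z where z: "z \<in> hcarrier H" "\<And>x. x \<in> hcarrier H \<Longrightarrow> cnj (T (us @ x # vs)) = hinner H x z" by blast
  have "T (us @ x # vs) = hinner H z x" if "x \<in> hcarrier H" for x
    using z(2)[OF that] hinner_commute[OF that z(1)] by (metis complex_cnj_cnj)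
  then show ?thesis using z(1) by blast
qed

text \<open>Induction over the slots: once the tail is fixed, the vector representing the head slot
  is orthogonal to the basis.\<close>

lemma multilinear_eq_zero:
  "multilinear n T \<Longrightarrow> (\<And>bs. bs \<in> tuples n basis \<Longrightarrow> T bs = 0) \<Longrightarrow> T xs = 0"
proof (induction n arbitrary: T xs)
  case 0
  then show ?case using multilinear_outside[OF 0(1), of xs] by (cases "xs = []") auto
next
  case (Suc n)
  show ?case
  proof (cases "xs \<in> tuples (Suc n) (hcarrier H)")
    case True
    then obtain y ys where "xs = y # ys" by (cases xs) (simp_all add: tuples_def)
    with True have xs: "xs = y # ys" "y \<in> hcarrier H" "ys \<in> tuples n (hcarrier H)" by auto
    have b: "T (b # ys) = 0" if "b \<in> basis" for b
      by (rule Suc.IH[OF multilinear_Cons[OF Suc.prems(1) basis_mem[OF that]]]) (simp add: Suc.prems(2) that)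
    obtain z where z: "z \<in> hcarrier H" "\<And>x. x \<in> hcarrier H \<Longrightarrow> T (x # ys) = hinner H z x"
      using multilinear_slot[OF Suc.prems(1), of "[]" ys] xs by auto
    have "\<forall>b\<in>basis. hinner H z b = 0" using z(2)[OF basis_mem] b by simp
    then have "z = hzero H" using basis z(1) by (simp add: orthonormal_basis_def)
    then show ?thesis using xs z by simp
  qed (use multilinear_outside[OF Suc.prems(1)] in auto)
qed

text \<open>Expanding one slot at a time, with Parseval for the functional of that slot and Tonelli for the
  others, avoids any basis change.\<close>

definition adjoint_bound :: "('a \<Rightarrow> 'a) \<Rightarrow> real \<Rightarrow> bool" where
  "adjoint_bound W c \<longleftrightarrow> (\<forall>x\<in>hcarrier H. W x \<in> hcarrier H) \<and> c \<ge> 0 \<and> (\<exists>W'. \<forall>y\<in>hcarrier H. W' y \<in> hcarrier H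
     \<and> hnorm H (W' y) \<le> c * hnorm H y \<and> (\<forall>x\<in>hcarrier H. hinner H y (W x) = hinner H (W' y) x))"

text \<open>The squared Hilbert-Schmidt norm in the fixed basis. A divergent sum has the default
  value 0, so bounds on \<open>hs\<close> carry information only next to a statement of
  summability.\<close>

definition hs :: "nat \<Rightarrow> ('a list \<Rightarrow> complex) \<Rightarrow> real" where
  "hs n T = infsum (\<lambda>bs. (cmod (T bs))\<^sup>2) (tuples n basis)"

lemma hs_contraction:
  assumes "multilinear n T" "(\<lambda>bs. (cmod (T bs))\<^sup>2) summable_on tuples n basis"
    and "length Ws = n" "\<And>W c. (W, c) \<in> set Ws \<Longrightarrow> adjoint_bound W c"
  shows "(\<lambda>bs. (cmod (T (map2 (\<lambda>(W, c) b. W b) Ws bs)))\<^sup>2) summable_on tuples n basis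
    \<and> infsum (\<lambda>bs. (cmod (T (map2 (\<lambda>(W, c) b. W b) Ws bs)))\<^sup>2) (tuples n basis) \<le> (\<Prod>(W, c)\<leftarrow>Ws. c\<^sup>2) * hs n T"
  using assms
proof (induction n arbitrary: T Ws)
  case 0
  then show ?case by (simp add: hs_def)
next
  case (Suc n)
  then obtain W c Vs where Ws: "Ws = (W, c) # Vs" "length Vs = n" by (cases Ws) auto
  obtain W' where W: "\<And>x. x \<in> hcarrier H \<Longrightarrow> W x \<in> hcarrier H" "c \<ge> 0"
    "\<And>y. y \<in> hcarrier H \<Longrightarrow> W' y \<in> hcarrier H" "\<And>y. y \<in> hcarrier H \<Longrightarrow> hnorm H (W' y) \<le> c * hnorm H y"
    "\<And>x y. x \<in> hcarrier H \<Longrightarrow> y \<in> hcarrier H \<Longrightarrow> hinner H y (W x) = hinner H (W' y) x"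
    using Suc.prems(4)[of W c] unfolding Ws(1) adjoint_bound_def by auto
  let ?d = "\<Prod>(W, c)\<leftarrow>Vs. c\<^sup>2"
  have d: "?d \<ge> 0" by (intro prod_list_nonneg) auto
  define F where "F = (\<lambda>(b, bs). (cmod (T (W b # bs)))\<^sup>2)"
  define G where "G = (\<lambda>(b, bs). (cmod (T (b # bs)))\<^sup>2)"
  have G: "G summable_on basis \<times> tuples n basis" "infsum G (basis \<times> tuples n basis) = hs (Suc n) T"
    using Suc.prems(2) by (simp_all add: G_def hs_def summable_on_tuples_Suc infsum_tuples_Suc case_prod_unfold)
  \<comment> \<open>For a fixed tail the head slot is an inner product with some \<open>z\<close>,
    and replacing \<open>b\<close> by \<open>W b\<close> replaces \<open>z\<close> by
    \<open>W' z\<close>. Parseval evaluates both sums over \<open>b\<close>, leaving the norm bound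
    on \<open>W'\<close>.\<close>
  have slot: "(\<lambda>b. F (b, bs)) summable_on basis \<and> infsum (\<lambda>b. F (b, bs)) basis \<le> c\<^sup>2 * infsum (\<lambda>b. G (b, bs)) basis"
    if bs: "bs \<in> tuples n basis" for bs
  proof -
    obtain z where z: "z \<in> hcarrier H" "\<And>x. x \<in> hcarrier H \<Longrightarrow> T (x # bs) = hinner H z x"
      using multilinear_slot[OF Suc.prems(1), of "[]" bs] tuples_basis_mem[OF bs] by auto
    have Feq: "F (b, bs) = (cmod (hinner H (W' z) b))\<^sup>2" and Geq: "G (b, bs) = (cmod (hinner H z b))\<^sup>2"
      if "b \<in> basis" for b using that z W basis_mem by (auto simp: F_def G_def)
    have F: "((\<lambda>b. F (b, bs)) has_sum (hnorm H (W' z))\<^sup>2) basis"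
      using Parseval_norm[OF basis W(3)[OF z(1)]] Feq by (simp cong: has_sum_cong)
    have G: "((\<lambda>b. G (b, bs)) has_sum (hnorm H z)\<^sup>2) basis"
      using Parseval_norm[OF basis z(1)] Geq by (simp cong: has_sum_cong)
    have "(hnorm H (W' z))\<^sup>2 \<le> c\<^sup>2 * (hnorm H z)\<^sup>2"
      using power_mono[OF W(4)[OF z(1)], of 2] W(3) z(1) by (simp add: power_mult_distrib)
    then show ?thesis using F G by (auto simp: has_sum_iff)
  qed
  \<comment> \<open>The slot estimate sums over the head first, whereas the induction hypothesis
    sums over the tail first. The order is therefore swapped here and swapped back for
    \<open>F\<close>.\<close>
  let ?G' = "\<lambda>(bs, b). G (b, bs)" and ?F' = "\<lambda>(bs, b). F (b, bs)"
  have G': "?G' summable_on tuples n basis \<times> basis" "infsum ?G' (tuples n basis \<times> basis) = hs (Suc n) T"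
  proof -
    have "(G has_sum hs (Suc n) T) (basis \<times> tuples n basis)" using G by (simp add: has_sum_iff)
    then have "(?G' has_sum hs (Suc n) T) (tuples n basis \<times> basis)" by (subst (asm) has_sum_swap) simp
    then show "?G' summable_on tuples n basis \<times> basis" "infsum ?G' (tuples n basis \<times> basis) = hs (Suc n) T"
      by (simp_all add: has_sum_iff)
  qed
  have g: "(\<lambda>bs. infsum (\<lambda>b. G (b, bs)) basis) summable_on tuples n basis"
    "infsum (\<lambda>bs. infsum (\<lambda>b. G (b, bs)) basis) (tuples n basis) = hs (Suc n) T"
    using summable_on_Sigma_banach[OF G'(1)] infsum_Sigma'_banach[OF G'(1)] G'(2) by simp_all
  have F': "?F' summable_on tuples n basis \<times> basis" "infsum ?F' (tuples n basis \<times> basis) \<le> c\<^sup>2 * hs (Suc n) T"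
    using nonneg_summable_Times_le[of "tuples n basis" ?F' basis "\<lambda>bs. c\<^sup>2 * infsum (\<lambda>b. G (b, bs)) basis"] slot g
    by (auto simp: F_def summable_on_cmult_right infsum_cmult_right)
  have F: "F summable_on basis \<times> tuples n basis" "infsum F (basis \<times> tuples n basis) \<le> c\<^sup>2 * hs (Suc n) T"
  proof -
    have "(?F' has_sum infsum ?F' (tuples n basis \<times> basis)) (tuples n basis \<times> basis)" using F'(1) by simp
    then have "(F has_sum infsum ?F' (tuples n basis \<times> basis)) (basis \<times> tuples n basis)"
      by (subst (asm) has_sum_swap) (simp add: case_prod_unfold)
    then show "F summable_on basis \<times> tuples n basis" "infsum F (basis \<times> tuples n basis) \<le> c\<^sup>2 * hs (Suc n) T"
      using F'(2) by (auto simp: has_sum_iff)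
  qed
  have Fb: "(\<lambda>bs. F (b, bs)) summable_on tuples n basis" if "b \<in> basis" for b
    using summable_on_SigmaD1[of "\<lambda>x y. F (x, y)" basis "\<lambda>_. tuples n basis" b] F(1) that by simp
  have f: "(\<lambda>b. infsum (\<lambda>bs. F (b, bs)) (tuples n basis)) summable_on basis"
    "infsum (\<lambda>b. infsum (\<lambda>bs. F (b, bs)) (tuples n basis)) basis = infsum F (basis \<times> tuples n basis)"
    using F(1) summable_on_Sigma_banach[of "\<lambda>x y. F (x, y)" basis "\<lambda>_. tuples n basis"]
      infsum_Sigma'_banach[of "\<lambda>x y. F (x, y)" basis "\<lambda>_. tuples n basis"] by simp_all
  \<comment> \<open>The head is transformed already; for each \<open>b\<close> separately, the
    induction hypothesis now transforms the tail of the functional with first argument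
    \<open>W b\<close>.\<close>
  define R where "R = (\<lambda>(b, bs). (cmod (T (map2 (\<lambda>(W, c) b. W b) Ws (b # bs))))\<^sup>2)"
  have Rb: "(\<lambda>bs. R (b, bs)) summable_on tuples n basis \<and>
      infsum (\<lambda>bs. R (b, bs)) (tuples n basis) \<le> ?d * infsum (\<lambda>bs. F (b, bs)) (tuples n basis)" if b: "b \<in> basis" for b
  proof -
    have "multilinear n (\<lambda>xs. T (W b # xs))" using Suc.prems(1) W(1) basis_mem[OF b] by (intro multilinear_Cons)
    moreover have "(\<lambda>bs. (cmod (T (W b # bs)))\<^sup>2) summable_on tuples n basis"
      using Fb[OF b] by (simp add: F_def)
    ultimately show ?thesis
      using Suc.IH[of "\<lambda>xs. T (W b # xs)" Vs] Suc.prems(4) Ws by (simp add: R_def F_def hs_def)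
  qed
  have R: "R summable_on basis \<times> tuples n basis"
    "infsum R (basis \<times> tuples n basis) \<le> infsum (\<lambda>b. ?d * infsum (\<lambda>bs. F (b, bs)) (tuples n basis)) basis"
    using nonneg_summable_Times_le[of basis R "tuples n basis" "\<lambda>b. ?d * infsum (\<lambda>bs. F (b, bs)) (tuples n basis)"] Rb f(1)
    by (auto simp: R_def summable_on_cmult_right)
  note R(2)
  also have "infsum (\<lambda>b. ?d * infsum (\<lambda>bs. F (b, bs)) (tuples n basis)) basis = ?d * infsum F (basis \<times> tuples n basis)"
    using f by (simp add: infsum_cmult_right)
  also have "\<dots> \<le> ?d * (c\<^sup>2 * hs (Suc n) T)" using F(2) d by (rule mult_left_mono)
  finally show ?case using R(1) Ws
    by (simp add: R_def summable_on_tuples_Suc infsum_tuples_Suc case_prod_unfold mult_ac)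
qed

text \<open>The sum factors over the slots, and each contributes the squared norm of
  \<open>v\<close> by Parseval.\<close>

lemma power_vector_l2:
  assumes v: "v \<in> hcarrier H"
  shows "((\<lambda>bs. (cmod (\<Prod>b\<leftarrow>bs. hinner H v b))\<^sup>2) has_sum (hnorm H v)\<^sup>2 ^ n) (tuples n basis)"
proof (induction n)
  case 0
  show ?case by (rule has_sum_finiteI) auto
next
  case (Suc n)
  show ?case unfolding has_sum_tuples_Suc
  proof (rule has_sum_SigmaI)
    show "((\<lambda>bs. (\<lambda>(b, bs). (cmod (\<Prod>b\<leftarrow>b # bs. hinner H v b))\<^sup>2) (b, bs)) has_sum
        (cmod (hinner H v b))\<^sup>2 * (hnorm H v)\<^sup>2 ^ n) (tuples n basis)" for b
      using has_sum_cmult_right[OF Suc.IH, of "(cmod (hinner H v b))\<^sup>2"] by (simp add: norm_mult power_mult_distrib)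
    then show "(\<lambda>(b, bs). (cmod (\<Prod>b\<leftarrow>b # bs. hinner H v b))\<^sup>2) summable_on basis \<times> tuples n basis"
      by (rule summable_on_SigmaI)
        (use Parseval_norm[OF basis v] has_sum_imp_summable in \<open>auto intro!: summable_on_cmult_left\<close>)
    show "((\<lambda>b. (cmod (hinner H v b))\<^sup>2 * (hnorm H v)\<^sup>2 ^ n) has_sum (hnorm H v)\<^sup>2 ^ Suc n) basis"
      using has_sum_cmult_left[OF Parseval_norm[OF basis v]] by simp
  qed
qed

text \<open>Pairing with the n-th tensor power of \<open>v\<close> reproduces the diagonal value: by
  induction all later slots are filled with \<open>v\<close>, and Parseval fills the first. This
  connects inner products in the Fock space with values of functionals.\<close>

lemma multilinear_eval:
  assumes "v \<in> hcarrier H"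
  shows "multilinear n T \<Longrightarrow> (\<lambda>bs. (cmod (T bs))\<^sup>2) summable_on tuples n basis \<Longrightarrow>
    ((\<lambda>bs. T bs * cnj (\<Prod>b\<leftarrow>bs. hinner H v b)) has_sum T (replicate n v)) (tuples n basis)"
proof (induction n arbitrary: T)
  case 0
  then show ?case by (intro has_sum_finiteI) auto
next
  case (Suc n)
  have summ: "(\<lambda>bs. T bs * cnj (\<Prod>b\<leftarrow>bs. hinner H v b)) summable_on tuples (Suc n) basis"
    using Suc.prems(2) has_sum_imp_summable[OF power_vector_l2[OF assms]] by (rule l2_inner_summable)
  have summb: "(\<lambda>bs. (cmod (T (b # bs)))\<^sup>2) summable_on tuples n basis" if "b \<in> basis" for b
    using Suc.prems(2) that summable_on_SigmaD1[of "\<lambda>b bs. (cmod (T (b # bs)))\<^sup>2" basis "\<lambda>_. tuples n basis" b]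
    by (simp add: summable_on_tuples_Suc)
  obtain z where z: "z \<in> hcarrier H" "\<And>x. x \<in> hcarrier H \<Longrightarrow> T (x # replicate n v) = hinner H z x"
    using multilinear_slot[OF Suc.prems(1), of "[]" "replicate n v"] assms by (auto simp del: set_replicate_conv_if simp: replicate_tuples)
  show ?case unfolding has_sum_tuples_Suc
  proof (rule has_sum_SigmaI)
    show "((\<lambda>bs. (\<lambda>(b, bs). T (b # bs) * cnj (\<Prod>b\<leftarrow>b # bs. hinner H v b)) (b, bs)) has_sum
        cnj (hinner H v b) * T (b # replicate n v)) (tuples n basis)" if b: "b \<in> basis" for b
      using has_sum_cmult_right[OF Suc.IH[OF multilinear_Cons[OF Suc.prems(1) basis_mem[OF b]] summb[OF b]], of "cnj (hinner H v b)"]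
      by (simp add: mult_ac)
    have "cnj (hinner H v b) * T (b # replicate n v) = hinner H z b * hinner H b v" if b: "b \<in> basis" for b
      using z(2)[OF basis_mem[OF b]] hinner_commute[OF assms basis_mem[OF b]] by simp
    then show "((\<lambda>b. cnj (hinner H v b) * T (b # replicate n v)) has_sum T (replicate (Suc n) v)) basis"
      using Parseval_has_sum(1)[OF basis z(1) assms] unfolding replicate.simps z(2)[OF assms]
      by (simp cong: has_sum_cong)
    show "(\<lambda>(b, bs). T (b # bs) * cnj (\<Prod>b\<leftarrow>b # bs. hinner H v b)) summable_on basis \<times> tuples n basis"
      using summ by (simp only: summable_on_tuples_Suc)
  qed
qed

end

section \<open>The symmetric Fock space\<close>

lemma infsum_complex_of_real: "infsum (\<lambda>x. complex_of_real (f x)) A = of_real (infsum f A)"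
proof (cases "f summable_on A")
  case True
  then show ?thesis by (metis has_sum_infsum has_sum_of_real infsumI)
next
  case False
  then have "\<not> (\<lambda>x. complex_of_real (f x)) summable_on A"
    using summable_on_Re[of "\<lambda>x. complex_of_real (f x)" A] by auto
  with False show ?thesis by (simp add: infsum_not_exists)
qed

section \<open>The Fock space in coordinates indexed by lists of basis vectors\<close>

context complex_hilbert_space
begin

abbreviation fock_space ("\<F>") where "\<F> \<equiv> fock H"

text \<open>One index set serves all degrees: the length of the list selects the component.\<close>

definition coord :: "(nat \<Rightarrow> 'a list \<Rightarrow> complex) \<Rightarrow> 'a list \<Rightarrow> complex" where
  "coord \<xi> bs = \<xi> (length bs) bs"

definition symmetric :: "('a list \<Rightarrow> complex) \<Rightarrow> bool" where
  "symmetric T \<longleftrightarrow> (\<forall>xs ys. mset xs = mset ys \<longrightarrow> T xs = T ys)"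

lemma sym_tensor_simps:
  "hcarrier (sym_tensor_power H n) =
     {T. multilinear n T \<and> (\<lambda>bs. (cmod (T bs))\<^sup>2) summable_on tuples n basis \<and> symmetric T}"
  "hadd (sym_tensor_power H n) = (\<lambda>S T xs. S xs + T xs)"
  "hzero (sym_tensor_power H n) = (\<lambda>xs. 0)"
  "hscale (sym_tensor_power H n) = (\<lambda>c T xs. c * T xs)"
  "hinner (sym_tensor_power H n) = (\<lambda>S T. infsum (\<lambda>bs. S bs * cnj (T bs)) (tuples n basis))"
  by (auto simp: sym_tensor_power_def tensor_power_def basis_tuples_eq multilinear_def symmetric_def)

lemma sym_tensor_norm: "(hnorm (sym_tensor_power H n) T)\<^sup>2 = hs n T"
proof -
  have "infsum (\<lambda>bs. T bs * cnj (T bs)) (tuples n basis) = of_real (hs n T)"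
    unfolding hs_def infsum_complex_of_real[symmetric] by (simp only: complex_norm_square)
  moreover have "hs n T \<ge> 0" unfolding hs_def by (intro infsum_nonneg) auto
  ultimately show ?thesis by (simp add: hnorm_def sym_tensor_simps)
qed

lemma fock_simps:
  "hadd \<F> = (\<lambda>\<xi> \<eta> n xs. \<xi> n xs + \<eta> n xs)"
  "hzero \<F> = (\<lambda>n xs. 0)"
  "hscale \<F> = (\<lambda>c \<xi> n xs. c * \<xi> n xs)"
  "hdiff \<F> = (\<lambda>\<xi> \<eta> n xs. \<xi> n xs - \<eta> n xs)"
  by (simp_all add: fock_def direct_sum_def sym_tensor_simps hdiff_def fun_eq_iff)

lemma coord_simps [simp]:
  "coord (\<lambda>n xs. \<xi> n xs + \<eta> n xs) bs = coord \<xi> bs + coord \<eta> bs"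
  "coord (\<lambda>n xs. \<xi> n xs - \<eta> n xs) bs = coord \<xi> bs - coord \<eta> bs"
  "coord (\<lambda>n xs. c * \<xi> n xs) bs = c * coord \<xi> bs"
  "coord (\<lambda>n xs. 0) bs = 0"
  by (simp_all add: coord_def)

lemma coord_tuples: "bs \<in> tuples n A \<Longrightarrow> coord \<xi> bs = \<xi> n bs"
  by (simp add: coord_def tuples_def)

text \<open>Tonelli over the decomposition of lists by length. It turns the two-level summability of
  \<open>direct_sum\<close> into membership in a single l2 space.\<close>

lemma coord_sq_summable_iff:
  "(\<lambda>bs. (cmod (coord \<xi> bs))\<^sup>2) summable_on lists basis \<longleftrightarrow>
    (\<forall>n. (\<lambda>bs. (cmod (\<xi> n bs))\<^sup>2) summable_on tuples n basis) \<and> summable (\<lambda>n. hs n (\<xi> n))"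
  (is "?L \<longleftrightarrow> ?R")
proof -
  let ?f = "\<lambda>(n, bs). (cmod (coord \<xi> bs))\<^sup>2"
  have L: "?L \<longleftrightarrow> ?f summable_on (SIGMA n:UNIV. tuples n basis)"
    by (simp add: summable_on_def has_sum_lists case_prod_unfold)
  have c: "(\<lambda>bs. (cmod (coord \<xi> bs))\<^sup>2) summable_on tuples n basis \<longleftrightarrow> (\<lambda>bs. (cmod (\<xi> n bs))\<^sup>2) summable_on tuples n basis"
    "infsum (\<lambda>bs. (cmod (coord \<xi> bs))\<^sup>2) (tuples n basis) = hs n (\<xi> n)" for n
    unfolding hs_def by (auto simp: coord_tuples intro!: summable_on_cong infsum_cong)
  have pos: "hs n T \<ge> 0" for n T unfolding hs_def by (intro infsum_nonneg) auto
  show ?thesis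
  proof
    assume ?L
    then have f: "?f summable_on (SIGMA n:UNIV. tuples n basis)" using L by simp
    have 1: "(\<lambda>bs. (cmod (coord \<xi> bs))\<^sup>2) summable_on tuples n basis" for n
      using summable_on_SigmaD1[OF f, of n] by simp
    have "(\<lambda>n. infsum (\<lambda>bs. (cmod (coord \<xi> bs))\<^sup>2) (tuples n basis)) summable_on UNIV"
      using summable_on_Sigma_banach[OF f] .
    then show ?R using 1 unfolding c by (auto intro: summable_on_imp_summable)
  next
    assume R: ?R
    then have "(\<lambda>n. hs n (\<xi> n)) summable_on UNIV" using pos by (intro summable_nonneg_imp_summable_on) auto
    moreover have "((\<lambda>bs. ?f (n, bs)) has_sum hs n (\<xi> n)) (tuples n basis)" for n
      using R c by (simp add: has_sum_iff)
    ultimately have "?f summable_on (SIGMA n:UNIV. tuples n basis)"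
      by (intro summable_on_SigmaI) auto
    then show ?L using L by simp
  qed
qed

lemma fock_mem_iff:
  "\<xi> \<in> hcarrier \<F> \<longleftrightarrow> (\<forall>n. multilinear n (\<xi> n) \<and> symmetric (\<xi> n))
    \<and> (\<lambda>bs. (cmod (coord \<xi> bs))\<^sup>2) summable_on lists basis"
  unfolding coord_sq_summable_iff
  by (auto simp: fock_def direct_sum_def sym_tensor_norm sym_tensor_simps)

lemma fock_memD:
  assumes "\<xi> \<in> hcarrier \<F>"
  shows "multilinear n (\<xi> n)" "symmetric (\<xi> n)" "(\<lambda>bs. (cmod (coord \<xi> bs))\<^sup>2) summable_on lists basis"
    "(\<lambda>bs. (cmod (\<xi> n bs))\<^sup>2) summable_on tuples n basis"
  using assms coord_sq_summable_iff[of \<xi>] by (auto simp: fock_mem_iff)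

lemma fock_inner_has_sum:
  assumes "\<xi> \<in> hcarrier \<F>" "\<eta> \<in> hcarrier \<F>"
  shows "((\<lambda>bs. coord \<xi> bs * cnj (coord \<eta> bs)) has_sum hinner \<F> \<xi> \<eta>) (lists basis)"
proof -
  let ?f = "\<lambda>bs. coord \<xi> bs * cnj (coord \<eta> bs)"
  have s: "?f summable_on lists basis" using assms by (intro l2_inner_summable fock_memD)
  then have "((\<lambda>(n, bs). ?f bs) has_sum infsum ?f (lists basis)) (SIGMA n:UNIV. tuples n basis)"
    by (simp flip: has_sum_lists)
  moreover have "((\<lambda>bs. (\<lambda>(n, bs). ?f bs) (n, bs)) has_sum hinner (sym_tensor_power H n) (\<xi> n) (\<eta> n)) (tuples n basis)" for n
  proof -
    have "(\<lambda>bs. \<xi> n bs * cnj (\<eta> n bs)) summable_on tuples n basis"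
      using assms by (intro l2_inner_summable fock_memD)
    then show ?thesis by (simp add: sym_tensor_simps has_sum_iff coord_tuples cong: summable_on_cong infsum_cong)
  qed
  ultimately have "((\<lambda>n. hinner (sym_tensor_power H n) (\<xi> n) (\<eta> n)) has_sum infsum ?f (lists basis)) UNIV"
    by (rule has_sum_SigmaD)
  from has_sum_imp_sums[OF this] have "hinner \<F> \<xi> \<eta> = infsum ?f (lists basis)"
    by (simp add: fock_def direct_sum_def sums_iff)
  then show ?thesis using s by simp
qed

lemma multilinear_lin_comb:
  assumes S: "multilinear n S" and T: "multilinear n T"
  shows "multilinear n (\<lambda>xs. c * S xs + d * T xs)"
proof -
  obtain K L where KL: "\<forall>xs\<in>tuples n (hcarrier H). cmod (S xs) \<le> K * (\<Prod>x\<leftarrow>xs. hnorm H x)"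
    "\<forall>xs\<in>tuples n (hcarrier H). cmod (T xs) \<le> L * (\<Prod>x\<leftarrow>xs. hnorm H x)"
    using multilinear_bound[OF S] multilinear_bound[OF T] by blast
  show ?thesis
  proof (rule multilinearI[where K = "cmod c * K + cmod d * L"])
    fix xs assume "xs \<in> tuples n (hcarrier H)"
    then have "cmod (c * S xs + d * T xs) \<le> cmod c * (K * (\<Prod>x\<leftarrow>xs. hnorm H x)) + cmod d * (L * (\<Prod>x\<leftarrow>xs. hnorm H x))"
      using KL by (intro order_trans[OF norm_triangle_ineq] add_mono) (auto simp: norm_mult intro!: mult_left_mono)
    then show "cmod (c * S xs + d * T xs) \<le> (cmod c * K + cmod d * L) * (\<Prod>x\<leftarrow>xs. hnorm H x)"
      by (simp add: algebra_simps)
  qed (simp_all add: multilinear_outside[OF S] multilinear_outside[OF T] multilinear_add[OF S] multilinear_add[OF T]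
      multilinear_scale[OF S] multilinear_scale[OF T] algebra_simps)
qed

lemma fock_lin_comb:
  assumes "\<xi> \<in> hcarrier \<F>" "\<eta> \<in> hcarrier \<F>"
  shows "(\<lambda>n xs. c * \<xi> n xs + d * \<eta> n xs) \<in> hcarrier \<F>"
proof -
  have "symmetric (\<lambda>xs. c * \<xi> n xs + d * \<eta> n xs)" for n
    using fock_memD(2)[OF assms(1), of n] fock_memD(2)[OF assms(2), of n] unfolding symmetric_def by metis
  then show ?thesis
    using assms by (auto simp: fock_mem_iff intro!: multilinear_lin_comb l2_add l2_scale)
qed

lemma fock_pre_hilbert: "pre_hilbert \<F>"
proof
  fix \<xi> \<eta> \<zeta> :: "nat \<Rightarrow> 'a list \<Rightarrow> complex" and c
  show "hzero \<F> \<in> hcarrier \<F>"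
    by (auto simp: fock_simps fock_mem_iff symmetric_def intro!: multilinearI[of _ _ 0])
  assume x: "\<xi> \<in> hcarrier \<F>"
  show scale: "hscale \<F> c \<xi> \<in> hcarrier \<F>" using fock_lin_comb[OF x x, of c 0] by (simp add: fock_simps)
  show "hadd \<F> \<xi> (hzero \<F>) = \<xi>" "hdiff \<F> \<xi> \<xi> = hzero \<F>" by (simp_all add: fock_simps)
  have "((\<lambda>bs. of_real ((cmod (coord \<xi> bs))\<^sup>2)) has_sum hinner \<F> \<xi> \<xi>) (lists basis)"
    using fock_inner_has_sum[OF x x] by (simp add: complex_norm_square del: of_real_power)
  moreover have "((\<lambda>bs. of_real ((cmod (coord \<xi> bs))\<^sup>2)) has_sum (of_real (infsum (\<lambda>bs. (cmod (coord \<xi> bs))\<^sup>2) (lists basis)) :: complex)) (lists basis)"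
    using fock_memD(3)[OF x] by (simp add: has_sum_of_real_iff del: of_real_power)
  ultimately have xx: "hinner \<F> \<xi> \<xi> = of_real (infsum (\<lambda>bs. (cmod (coord \<xi> bs))\<^sup>2) (lists basis))"
    by (rule has_sum_unique)
  then show "0 \<le> Re (hinner \<F> \<xi> \<xi>)" by (simp add: infsum_nonneg)
  \<comment> \<open>A vanishing norm kills the coordinates on basis tuples, and
    \<open>multilinear_eq_zero\<close> extends this to all arguments.\<close>
  show "\<xi> = hzero \<F>" if "hinner \<F> \<xi> \<xi> = 0"
  proof (intro ext)
    fix n xs
    have z: "coord \<xi> bs = 0" if "bs \<in> lists basis" for bs
      using nonneg_infsum_le_0D[OF _ fock_memD(3)[OF x] _ that] xx \<open>hinner \<F> \<xi> \<xi> = 0\<close> by simp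
    have "\<xi> n xs = 0"
    proof (rule multilinear_eq_zero)
      fix bs assume bs: "bs \<in> tuples n basis"
      then have "bs \<in> lists basis" by (auto simp: tuples_def)
      then show "\<xi> n bs = 0" using z bs by (metis coord_tuples)
    qed (use x fock_memD in auto)
    then show "\<xi> n xs = hzero \<F> n xs" by (simp add: fock_simps)
  qed
  assume y: "\<eta> \<in> hcarrier \<F>"
  show add: "hadd \<F> \<xi> \<eta> \<in> hcarrier \<F>" using fock_lin_comb[OF x y, of 1 1] by (simp add: fock_simps)
  show "hadd \<F> \<xi> \<eta> = hadd \<F> \<eta> \<xi>" by (simp add: fock_simps add.commute)
  have "((\<lambda>bs. c * (coord \<xi> bs * cnj (coord \<eta> bs))) has_sum c * hinner \<F> \<xi> \<eta>) (lists basis)"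
    using fock_inner_has_sum[OF x y] by (rule has_sum_cmult_right)
  then show "hinner \<F> (hscale \<F> c \<xi>) \<eta> = c * hinner \<F> \<xi> \<eta>"
    using fock_inner_has_sum[OF scale y] by (auto simp: fock_simps mult.assoc intro: has_sum_unique)
  have "((\<lambda>bs. cnj (coord \<xi> bs * cnj (coord \<eta> bs))) has_sum cnj (hinner \<F> \<xi> \<eta>)) (lists basis)"
    using fock_inner_has_sum[OF x y] by (simp only: has_sum_cnj_iff)
  then show "hinner \<F> \<eta> \<xi> = cnj (hinner \<F> \<xi> \<eta>)"
    using fock_inner_has_sum[OF y x] by (auto simp: mult.commute intro: has_sum_unique)
  assume z: "\<zeta> \<in> hcarrier \<F>"
  show "hadd \<F> (hadd \<F> \<xi> \<eta>) \<zeta> = hadd \<F> \<xi> (hadd \<F> \<eta> \<zeta>)" by (simp add: fock_simps add.assoc)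
  have "((\<lambda>bs. coord \<xi> bs * cnj (coord \<zeta> bs) + coord \<eta> bs * cnj (coord \<zeta> bs)) has_sum hinner \<F> \<xi> \<zeta> + hinner \<F> \<eta> \<zeta>) (lists basis)"
    using fock_inner_has_sum[OF x z] fock_inner_has_sum[OF y z] by (rule has_sum_add)
  then show "hinner \<F> (hadd \<F> \<xi> \<eta>) \<zeta> = hinner \<F> \<xi> \<zeta> + hinner \<F> \<eta> \<zeta>"
    using fock_inner_has_sum[OF add z] by (auto simp: fock_simps distrib_right intro: has_sum_unique)
qed

lemma fock_norm_has_sum:
  assumes "\<xi> \<in> hcarrier \<F>"
  shows "((\<lambda>bs. (cmod (coord \<xi> bs))\<^sup>2) has_sum (hnorm \<F> \<xi>)\<^sup>2) (lists basis)"
proof -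
  interpret F: pre_hilbert \<F> by (rule fock_pre_hilbert)
  have "((\<lambda>bs. of_real ((cmod (coord \<xi> bs))\<^sup>2)) has_sum (of_real ((hnorm \<F> \<xi>)\<^sup>2) :: complex)) (lists basis)"
    using fock_inner_has_sum[OF assms assms] F.hinner_self[OF assms] by (simp add: complex_norm_square del: of_real_power)
  then show ?thesis by (simp add: has_sum_of_real_iff del: of_real_power)
qed

section \<open>Exponential vectors, and functionals along differentiable curves\<close>

lemma exp_vec_eq:
  "exp_vec H v n xs = (if xs \<in> tuples n (hcarrier H) then of_real (1 / sqrt (fact n)) * (\<Prod>x\<leftarrow>xs. hinner H v x) else 0)"
  by (simp add: exp_vec_def sym_tensor_simps sym_power_def)

text \<open>The component of degree n has as squared norm the n-th term of the exponential series at
  the squared norm of \<open>v\<close>.\<close>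

lemma exp_vec_mem [simp]:
  assumes v: "v \<in> hcarrier H"
  shows "exp_vec H v \<in> hcarrier \<F>"
proof -
  have bound: "cmod (\<Prod>x\<leftarrow>xs. hinner H v x) \<le> hnorm H v ^ length xs * (\<Prod>x\<leftarrow>xs. hnorm H x)"
    if "set xs \<subseteq> hcarrier H" for xs
    using that
  proof (induction xs)
    case (Cons x xs)
    have "cmod (hinner H v x) * cmod (\<Prod>x\<leftarrow>xs. hinner H v x)
        \<le> (hnorm H v * hnorm H x) * (hnorm H v ^ length xs * (\<Prod>x\<leftarrow>xs. hnorm H x))"
      using Cons v by (intro mult_mono Cauchy_Schwarz) auto
    then show ?case by (simp add: norm_mult mult_ac)
  qed simp
  have "multilinear n (exp_vec H v n)" for n
  proof (rule multilinearI)
    fix us vs x y assume "x \<in> hcarrier H" "y \<in> hcarrier H" "us @ x # vs \<in> tuples n (hcarrier H)"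
    then show "exp_vec H v n (us @ hadd H x y # vs) = exp_vec H v n (us @ x # vs) + exp_vec H v n (us @ y # vs)"
      using v by (simp add: exp_vec_eq tuples_def algebra_simps add_divide_distrib)
  next
    fix us vs c x assume "x \<in> hcarrier H" "us @ x # vs \<in> tuples n (hcarrier H)"
    then show "exp_vec H v n (us @ hscale H c x # vs) = cnj c * exp_vec H v n (us @ x # vs)"
      using v by (simp add: exp_vec_eq tuples_def algebra_simps)
  next
    fix xs assume "xs \<in> tuples n (hcarrier H)"
    then show "cmod (exp_vec H v n xs) \<le> (1 / sqrt (fact n) * hnorm H v ^ n) * (\<Prod>x\<leftarrow>xs. hnorm H x)"
      using mult_left_mono[OF bound[of xs], of "1 / sqrt (fact n)"]
      by (simp add: exp_vec_eq tuples_def norm_divide)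
  qed (simp add: exp_vec_eq)
  moreover have "symmetric (exp_vec H v n)" for n
    unfolding symmetric_def
  proof (intro allI impI)
    fix xs ys :: "'a list" assume m: "mset xs = mset ys"
    then have "xs \<in> tuples n (hcarrier H) \<longleftrightarrow> ys \<in> tuples n (hcarrier H)"
      by (metis (mono_tags, lifting) mem_Collect_eq mset_eq_length mset_eq_setD tuples_def)
    moreover have "(\<Prod>x\<leftarrow>xs. hinner H v x) = (\<Prod>x\<leftarrow>ys. hinner H v x)"
      using m by (metis mset_map prod_mset_prod_list)
    ultimately show "exp_vec H v n xs = exp_vec H v n ys" by (simp add: exp_vec_eq)
  qed
  moreover have "((\<lambda>bs. (cmod (exp_vec H v n bs))\<^sup>2) has_sum (hnorm H v)\<^sup>2 ^ n / fact n) (tuples n basis)" for n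
  proof -
    have "((\<lambda>bs. (cmod (\<Prod>b\<leftarrow>bs. hinner H v b))\<^sup>2 / fact n) has_sum (hnorm H v)\<^sup>2 ^ n / fact n) (tuples n basis)"
      using power_vector_l2[OF v] by (rule has_sum_divide_const)
    then show ?thesis
      by (simp add: exp_vec_eq tuples_basis_mem norm_divide norm_mult power_divide cong: has_sum_cong)
  qed
  moreover have "summable (\<lambda>n. (hnorm H v)\<^sup>2 ^ n / fact n)"
    using summable_exp_generic[of "(hnorm H v)\<^sup>2"] by (simp add: field_simps)
  ultimately show ?thesis
    by (simp add: fock_mem_iff coord_sq_summable_iff has_sum_iff hs_def)
qed

text \<open>\<open>multilinear_eval\<close> collapses each degree to a diagonal value; the root of
  the factorial is the weight inside \<open>exp_vec\<close>.\<close>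

lemma inner_exp_vec_sums:
  assumes x: "\<xi> \<in> hcarrier \<F>" and v: "v \<in> hcarrier H"
  shows "(\<lambda>n. \<xi> n (replicate n v) / of_real (sqrt (fact n))) sums hinner \<F> \<xi> (exp_vec H v)"
proof (rule has_sum_imp_sums)
  have "((\<lambda>(n, bs). coord \<xi> bs * cnj (coord (exp_vec H v) bs)) has_sum hinner \<F> \<xi> (exp_vec H v)) (SIGMA n:UNIV. tuples n basis)"
    using fock_inner_has_sum[OF x exp_vec_mem[OF v]] by (simp flip: has_sum_lists)
  moreover have "((\<lambda>bs. (\<lambda>(n, bs). coord \<xi> bs * cnj (coord (exp_vec H v) bs)) (n, bs)) has_sum
      \<xi> n (replicate n v) / of_real (sqrt (fact n))) (tuples n basis)" for n
  proof -
    have "((\<lambda>bs. \<xi> n bs * cnj (\<Prod>b\<leftarrow>bs. hinner H v b)) has_sum \<xi> n (replicate n v)) (tuples n basis)"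
      using x by (intro multilinear_eval[OF v]) (auto intro: fock_memD)
    then have "((\<lambda>bs. 1 / of_real (sqrt (fact n)) * (\<xi> n bs * cnj (\<Prod>b\<leftarrow>bs. hinner H v b))) has_sum
        \<xi> n (replicate n v) / of_real (sqrt (fact n))) (tuples n basis)"
      using has_sum_cmult_right[of _ _ _ "1 / of_real (sqrt (fact n)) :: complex"] by fastforce
    then show ?thesis by (simp add: coord_tuples exp_vec_eq tuples_basis_mem cong: has_sum_cong)
  qed
  ultimately show "((\<lambda>n. \<xi> n (replicate n v) / of_real (sqrt (fact n))) has_sum hinner \<F> \<xi> (exp_vec H v)) UNIV"
    by (rule has_sum_SigmaD)
qed

lemma inner_exp_exp:
  assumes u: "u \<in> hcarrier H" and v: "v \<in> hcarrier H"
  shows "hinner \<F> (exp_vec H u) (exp_vec H v) = exp (hinner H u v)"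
proof -
  have "exp_vec H u n (replicate n v) / of_real (sqrt (fact n)) = hinner H u v ^ n /\<^sub>R fact n" for n
  proof -
    have "complex_of_real (sqrt (fact n)) * of_real (sqrt (fact n)) = fact n"
      by (simp flip: of_real_mult)
    then show ?thesis
      using replicate_tuples[OF v, of n]
      by (simp add: exp_vec_eq scaleR_conv_of_real field_simps del: set_replicate_conv_if)
  qed
  then show ?thesis
    using inner_exp_vec_sums[OF exp_vec_mem[OF u] v] exp_converges[of "hinner H u v"] sums_unique2 by fastforce
qed

text \<open>The product rule for a bounded multilinear functional along curves that are
  differentiable at 0 in norm. The prefix \<open>us\<close> stores arguments held fixed, so that the
  induction can run through \<open>vs\<close>.\<close>

lemma multilinear_derivative:
  assumes T: "multilinear n T"
    and c: "\<And>x. x \<in> set vs \<Longrightarrow> c 0 x = x" "\<And>x h. x \<in> set vs \<Longrightarrow> c h x \<in> hcarrier H"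
    and D: "\<And>x. x \<in> set vs \<Longrightarrow> hconverges H (\<lambda>h. hscale H (1 / of_real h) (hdiff H (c h x) x)) (D x) (at 0)"
    and t: "us @ vs \<in> tuples n (hcarrier H)"
  shows "((\<lambda>h. T (us @ map (c h) vs)) has_vector_derivative (\<Sum>p<length vs. T (us @ vs[p := D (vs ! p)]))) (at 0)"
  using c D t
proof (induction vs arbitrary: us)
  case Nil
  then show ?case by simp
next
  case (Cons v vs)
  let ?m = "\<lambda>h. map (c h) vs"
  have v: "v \<in> hcarrier H" using Cons.prems(4) by (auto simp: tuples_def)
  have Dv: "D v \<in> hcarrier H" using Cons.prems(3)[of v] by (simp add: hconverges_def)
  have tm: "(us @ [x]) @ vs \<in> tuples n (hcarrier H)" if "x \<in> hcarrier H" for x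
    using Cons.prems(4) that by (auto simp: tuples_def)
  have tm': "us @ x # ?m h \<in> tuples n (hcarrier H)" if "x \<in> hcarrier H" for x h
    using Cons.prems(2,4) that by (auto simp: tuples_def)
  have IH: "((\<lambda>h. T (us @ x # ?m h)) has_vector_derivative (\<Sum>p<length vs. T (us @ x # vs[p := D (vs ! p)]))) (at 0)"
    if "x \<in> hcarrier H" for x
    using Cons.IH[OF _ _ _ tm[OF that]] Cons.prems by simp
  have map0: "?m 0 = vs" using Cons.prems(1) by (simp add: map_idI)
  define q where "q h = hscale H (1 / of_real h) (hdiff H (c h v) v)" for h
  have cv: "c h v \<in> hcarrier H" for h using Cons.prems(2) by simp
  have qm: "q h \<in> hcarrier H" for h using v cv by (simp add: q_def)
  have q: "((\<lambda>h. hdist H (q h) (D v)) \<longlongrightarrow> 0) (at 0)" using Cons.prems(3)[of v] by (simp add: hconverges_def q_def)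
  \<comment> \<open>Two errors are controlled: replacing the quotient \<open>q h\<close> by its
    limit uses the multilinear bound, and letting the remaining arguments return to
    \<open>vs\<close> uses the continuity given by the induction hypothesis with head
    \<open>D v\<close>.\<close>
  have main: "((\<lambda>h. T (us @ q h # ?m h)) \<longlongrightarrow> T (us @ D v # vs)) (at 0)"
  proof -
    obtain K where K: "K \<ge> 0" "\<forall>xs\<in>tuples n (hcarrier H). cmod (T xs) \<le> K * (\<Prod>x\<leftarrow>xs. hnorm H x)"
      using multilinear_bound[OF T] by blast
    let ?P = "\<lambda>h. (\<Prod>x\<leftarrow>us. hnorm H x) * (\<Prod>x\<leftarrow>vs. hnorm H (c h x))"
    \<comment> \<open>Each curve is continuous at 0, its increment being \<open>h\<close> times a
      convergent quotient. Hence the products of norms in the multilinear bound converge.\<close>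
    have lim_c: "((\<lambda>h. hnorm H (c h x)) \<longlongrightarrow> hnorm H x) (at 0)" if x: "x \<in> set vs" for x
    proof -
      have xm: "x \<in> hcarrier H" using x Cons.prems(4) by (auto simp: tuples_def)
      have cx: "c h x \<in> hcarrier H" for h using Cons.prems(2) x by simp
      let ?q = "\<lambda>h. hscale H (1 / of_real h) (hdiff H (c h x) x)"
      have "((\<lambda>h. \<bar>h\<bar> * hnorm H (?q h)) \<longlongrightarrow> \<bar>0\<bar> * hnorm H (D x)) (at 0)"
        using Cons.prems(3)[of x] x xm cx by (intro tendsto_intros hconverges_norm) auto
      then have "((\<lambda>h. \<bar>h\<bar> * hnorm H (?q h)) \<longlongrightarrow> 0) (at 0)" by simp
      moreover have "\<forall>\<^sub>F h in at 0. norm (hnorm H (c h x) - hnorm H x) \<le> \<bar>h\<bar> * hnorm H (?q h)"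
        unfolding eventually_at_filter
      proof (intro always_eventually allI impI)
        fix h :: real assume "h \<noteq> 0"
        then show "norm (hnorm H (c h x) - hnorm H x) \<le> \<bar>h\<bar> * hnorm H (?q h)"
          using hnorm_diff_ineq[OF cx[of h] xm] xm cx by (simp add: hdist_def norm_divide)
      qed
      ultimately have "((\<lambda>h. hnorm H (c h x) - hnorm H x) \<longlongrightarrow> 0) (at 0)" by (rule Lim_null_comparison[rotated])
      then show ?thesis using Lim_null by blast
    qed
    have "((\<lambda>h. \<Prod>x\<leftarrow>vs'. hnorm H (c h x)) \<longlongrightarrow> (\<Prod>x\<leftarrow>vs'. hnorm H x)) (at 0)" if "set vs' \<subseteq> set vs" for vs'
      using that by (induction vs') (auto intro!: tendsto_mult lim_c)
    then have "((\<lambda>h. K * (?P h * hdist H (q h) (D v))) \<longlongrightarrow> K * (((\<Prod>x\<leftarrow>us. hnorm H x) * (\<Prod>x\<leftarrow>vs. hnorm H x)) * 0)) (at 0)"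
      using q by (intro tendsto_intros) auto
    then have lim: "((\<lambda>h. K * (?P h * hdist H (q h) (D v))) \<longlongrightarrow> 0) (at 0)" by simp
    have "norm (T (us @ hdiff H (q h) (D v) # ?m h)) \<le> K * (?P h * hdist H (q h) (D v))" for h
      using bspec[OF K(2) tm'[of "hdiff H (q h) (D v)" h]] qm Dv by (simp add: hdist_def comp_def mult_ac)
    then have "((\<lambda>h. T (us @ hdiff H (q h) (D v) # ?m h)) \<longlongrightarrow> 0) (at 0)"
      by (intro tendsto_norm_le_zero[OF lim]) auto
    moreover have "T (us @ hdiff H (q h) (D v) # ?m h) = T (us @ q h # ?m h) - T (us @ D v # ?m h)" for h
      using multilinear_add[OF T qm[of h] _ tm'[OF qm[of h], of h], of "hscale H (-1) (D v)"]
        multilinear_scale[OF T Dv tm'[OF Dv, of h], of "-1"] Dv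
      by (simp add: hdiff_def)
    ultimately have 1: "((\<lambda>h. T (us @ q h # ?m h) - T (us @ D v # ?m h)) \<longlongrightarrow> 0) (at 0)" by simp
    have "isCont (\<lambda>h. T (us @ D v # ?m h)) 0"
      using IH[OF Dv] has_vector_derivative_continuous by blast
    then have 2: "((\<lambda>h. T (us @ D v # ?m h)) \<longlongrightarrow> T (us @ D v # vs)) (at 0)"
      using map0 by (simp add: isCont_def)
    show ?thesis using tendsto_add[OF 1 2] by simp
  qed
  have "((\<lambda>h. (T (us @ v # ?m h) - T (us @ v # vs)) /\<^sub>R h) \<longlongrightarrow> (\<Sum>p<length vs. T (us @ v # vs[p := D (vs ! p)]))) (at 0)"
    using IH[OF v] map0 by (simp add: has_vector_derivative_iff_quotient)
  from tendsto_add[OF main this]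
  have lim: "((\<lambda>h. T (us @ q h # ?m h) + (T (us @ v # ?m h) - T (us @ v # vs)) /\<^sub>R h) \<longlongrightarrow>
      T (us @ D v # vs) + (\<Sum>p<length vs. T (us @ v # vs[p := D (vs ! p)]))) (at 0)" .
  have "((\<lambda>h. (T (us @ map (c (0 + h)) (v # vs)) - T (us @ map (c 0) (v # vs))) /\<^sub>R h) \<longlongrightarrow>
      T (us @ D v # vs) + (\<Sum>p<length vs. T (us @ v # vs[p := D (vs ! p)]))) (at 0)"
  proof (rule Lim_transform_eventually[OF lim])
    show "\<forall>\<^sub>F h in at 0. T (us @ q h # ?m h) + (T (us @ v # ?m h) - T (us @ v # vs)) /\<^sub>R h =
        (T (us @ map (c (0 + h)) (v # vs)) - T (us @ map (c 0) (v # vs))) /\<^sub>R h"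
      unfolding eventually_at_filter
    proof (intro always_eventually allI impI)
      fix h :: real assume h: "h \<noteq> 0"
      \<comment> \<open>Writing the moved head as \<open>v\<close> plus \<open>h\<close> times its
        quotient splits the difference quotient of \<open>T\<close> into the two terms of
        \<open>lim\<close>.\<close>
      have "c h v = hadd H v (hscale H (of_real h) (q h))"
        using h v cv by (intro weak_eqI) (auto simp: q_def)
      then have "T (us @ c h v # ?m h) = T (us @ v # ?m h) + of_real h * T (us @ q h # ?m h)"
        using multilinear_add[OF T v _ tm'[OF v, of h], of "hscale H (of_real h) (q h)"]
          multilinear_scale[OF T qm[of h] tm'[OF qm[of h], of h], of "of_real h"] qm by simp
      then show "T (us @ q h # ?m h) + (T (us @ v # ?m h) - T (us @ v # vs)) /\<^sub>R h =
        (T (us @ map (c (0 + h)) (v # vs)) - T (us @ map (c 0) (v # vs))) /\<^sub>R h"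
        using h map0 Cons.prems(1) by (simp add: scaleR_conv_of_real field_simps)
    qed
  qed
  then have "((\<lambda>h. T (us @ map (c h) (v # vs))) has_vector_derivative
      T (us @ D v # vs) + (\<Sum>p<length vs. T (us @ v # vs[p := D (vs ! p)]))) (at 0)"
    by (simp add: has_vector_derivative_iff_quotient)
  then show ?case by (simp add: sum.lessThan_Suc_shift del: sum.lessThan_Suc)
qed

end

section \<open>Uniqueness of power series, norm convergence in l2, and polarisation\<close>

lemma power_series_zero:
  fixes a :: "nat \<Rightarrow> complex"
  assumes "\<And>z. (\<lambda>n. a n * z ^ n) sums 0"
  shows "a n = 0"
proof (induction n rule: less_induct)
  case (less n)
  have "(\<lambda>k. a (k + n) * z ^ k) sums 0" if z: "z \<noteq> 0" for z
  proof -
    have "(\<lambda>k. a (k + n) * z ^ (k + n)) sums (0 - (\<Sum>k<n. a k * z ^ k))"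
      by (rule sums_split_initial_segment[OF assms])
    then have "(\<lambda>k. z ^ n * (a (k + n) * z ^ k)) sums 0" using less by (simp add: power_add mult_ac)
    from sums_mult[OF this, of "1 / z ^ n"] show ?thesis using z by simp
  qed
  then have "((\<lambda>z::complex. 0) \<longlongrightarrow> a (0 + n)) (at 0)"
    by (intro powser_limit_0_strong[of 1 "\<lambda>k. a (k + n)" "\<lambda>z. 0"]) auto
  then show ?case by (simp add: tendsto_const_iff)
qed

lemma has_sum_finite_sum:
  fixes f :: "'a \<Rightarrow> 'b \<Rightarrow> real"
  assumes "finite P" "\<And>p. p \<in> P \<Longrightarrow> (f p has_sum s p) A"
  shows "((\<lambda>x. \<Sum>p\<in>P. f p x) has_sum (\<Sum>p\<in>P. s p)) A"
  using assms by (induction P rule: finite_induct) (auto intro!: has_sum_add)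

text \<open>Since the norms eventually do not exceed that of the limit, no mass can escape from a
  finite set of coordinates that nearly exhausts \<open>g\<close>; on such a set convergence is
  coordinatewise.\<close>

lemma l2_strong_convergence:
  fixes f :: "'r \<Rightarrow> 'i \<Rightarrow> complex" and F :: "'r filter"
  assumes pt: "\<And>i. i \<in> I \<Longrightarrow> ((\<lambda>r. f r i) \<longlongrightarrow> g i) F"
    and f: "\<And>r. ((\<lambda>i. (cmod (f r i))\<^sup>2) has_sum s r) I"
    and g: "((\<lambda>i. (cmod (g i))\<^sup>2) has_sum t) I"
    and le: "\<forall>\<^sub>F r in F. s r \<le> t"
    and d: "\<And>r. ((\<lambda>i. (cmod (f r i - g i))\<^sup>2) has_sum d r) I"
  shows "(d \<longlongrightarrow> 0) F"
proof (rule tendstoI)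
  fix e :: real assume e: "e > 0"
  \<comment> \<open>Outside \<open>J\<close> the mass of \<open>f r\<close> is below 2 \<epsilon>
    and that of \<open>g\<close> at most \<epsilon>, which after doubling gives less than 6
    \<epsilon>. The part on \<open>J\<close> adds at most one more, so an eighth of \<open>e\<close>
    suffices.\<close>
  define \<epsilon> where "\<epsilon> = e / 8"
  have \<epsilon>: "\<epsilon> > 0" using e by (simp add: \<epsilon>_def)
  obtain J where J: "finite J" "J \<subseteq> I" "dist (\<Sum>i\<in>J. (cmod (g i))\<^sup>2) t \<le> \<epsilon>"
    using has_sum_finite_approximation[OF g \<epsilon>] by blast
  have split: "((\<lambda>i. h i) has_sum (S - sum h J)) (I - J)" if "(h has_sum S) I" for h :: "'i \<Rightarrow> real" and S
    using that J by (intro has_sum_Diff) (auto intro: has_sum_finite)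
  have lim1: "((\<lambda>r. \<Sum>i\<in>J. (cmod (f r i))\<^sup>2) \<longlongrightarrow> (\<Sum>i\<in>J. (cmod (g i))\<^sup>2)) F"
    using J pt by (intro tendsto_sum tendsto_power tendsto_norm) auto
  have "((\<lambda>r. \<Sum>i\<in>J. (cmod (f r i - g i))\<^sup>2) \<longlongrightarrow> (\<Sum>i\<in>J. (cmod (g i - g i))\<^sup>2)) F"
    using J pt by (intro tendsto_sum tendsto_power tendsto_norm tendsto_diff) auto
  then have lim2: "((\<lambda>r. \<Sum>i\<in>J. (cmod (f r i - g i))\<^sup>2) \<longlongrightarrow> 0) F" by simp
  have "\<forall>\<^sub>F r in F. dist (\<Sum>i\<in>J. (cmod (f r i))\<^sup>2) (\<Sum>i\<in>J. (cmod (g i))\<^sup>2) < \<epsilon>"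
    using lim1 \<epsilon> by (rule tendstoD)
  moreover have "\<forall>\<^sub>F r in F. dist (\<Sum>i\<in>J. (cmod (f r i - g i))\<^sup>2) 0 < \<epsilon>"
    using lim2 \<epsilon> by (rule tendstoD)
  ultimately show "\<forall>\<^sub>F r in F. dist (d r) 0 < e" using le
  proof eventually_elim
    case (elim r)
    have "d r - (\<Sum>i\<in>J. (cmod (f r i - g i))\<^sup>2)
        \<le> 2 * (s r - (\<Sum>i\<in>J. (cmod (f r i))\<^sup>2)) + 2 * (t - (\<Sum>i\<in>J. (cmod (g i))\<^sup>2))"
    proof (rule has_sum_mono)
      show "((\<lambda>i. (cmod (f r i - g i))\<^sup>2) has_sum d r - (\<Sum>i\<in>J. (cmod (f r i - g i))\<^sup>2)) (I - J)"
        using d by (rule split)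
      show "((\<lambda>i. 2 * (cmod (f r i))\<^sup>2 + 2 * (cmod (g i))\<^sup>2) has_sum
          2 * (s r - (\<Sum>i\<in>J. (cmod (f r i))\<^sup>2)) + 2 * (t - (\<Sum>i\<in>J. (cmod (g i))\<^sup>2))) (I - J)"
        by (intro has_sum_add has_sum_cmult_right split f g)
      show "(cmod (f r i - g i))\<^sup>2 \<le> 2 * (cmod (f r i))\<^sup>2 + 2 * (cmod (g i))\<^sup>2" for i
      proof -
        have "(cmod (f r i - g i))\<^sup>2 \<le> (cmod (f r i) + cmod (g i))\<^sup>2" by (intro power_mono norm_triangle_ineq4) auto
        moreover have "0 \<le> (cmod (f r i) - cmod (g i))\<^sup>2" by simp
        ultimately show ?thesis unfolding power2_sum power2_diff by linarith
      qed
    qed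
    moreover have "d r \<ge> 0" using d by (rule has_sum_nonneg) auto
    ultimately show ?case using elim J(3) \<epsilon> by (auto simp: dist_real_def \<epsilon>_def abs_less_iff abs_if split: if_splits)
  qed
qed

context pre_hilbert
begin

text \<open>Polarisation: the norm of \<open>x + y\<close> determines the real part of the inner
  product, and that of \<open>x + \<i> y\<close> the imaginary part.\<close>

lemma isometric_inner:
  assumes add: "\<And>x y. x \<in> hcarrier H \<Longrightarrow> y \<in> hcarrier H \<Longrightarrow> U (hadd H x y) = hadd H (U x) (U y)"
    and scale: "\<And>c x. x \<in> hcarrier H \<Longrightarrow> U (hscale H c x) = hscale H c (U x)"
    and mem: "\<And>x. x \<in> hcarrier H \<Longrightarrow> U x \<in> hcarrier H"
    and norm: "\<And>x. x \<in> hcarrier H \<Longrightarrow> hnorm H (U x) = hnorm H x"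
    and x: "x \<in> hcarrier H" and y: "y \<in> hcarrier H"
  shows "hinner H (U x) (U y) = hinner H x y"
proof -
  have Re: "Re (hinner H (U x) (U y)) = Re (hinner H x y)" if "y \<in> hcarrier H" for y
    using norm[of "hadd H x y"] hnorm_add_sq[OF x that] hnorm_add_sq[OF mem[OF x] mem[OF that]] norm[OF x] norm[OF that]
      add[OF x that] x that by simp
  show ?thesis
    using Re[OF y] Re[of "hscale H \<i> y"] x y by (simp add: scale mem complex_eq_iff)
qed

end

section \<open>Totality of the exponential vectors, and differential second quantisation\<close>

context complex_hilbert_space
begin

lemma set_replicate_subset [simp]: "x \<in> A \<Longrightarrow> set (replicate k x) \<subseteq> A"
  by auto

lemma multilinear_replicate_scale:
  assumes "multilinear n T" "v \<in> hcarrier H"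
  shows "us @ replicate k v \<in> tuples n (hcarrier H) \<Longrightarrow>
    T (us @ replicate k (hscale H c v)) = cnj c ^ k * T (us @ replicate k v)"
proof (induction k arbitrary: us)
  case (Suc k)
  have "T (us @ replicate (Suc k) (hscale H c v)) = cnj c * T (us @ v # replicate k (hscale H c v))"
    using multilinear_scale[OF assms, of us "replicate k (hscale H c v)" c] Suc.prems assms(2) by (auto simp: tuples_def)
  also have "\<dots> = cnj c * (cnj c ^ k * T (us @ v # replicate k v))"
    using Suc.IH[of "us @ [v]"] Suc.prems by simp
  finally show ?case by (simp add: mult.assoc)
qed simp

text \<open>Polarisation by differentiation. If \<open>T\<close> vanishes on lists with
  \<open>k\<close> free entries followed by copies of any \<open>v\<close>, then replacing
  \<open>v\<close> by \<open>v + h y\<close> and differentiating at \<open>h = 0\<close> frees one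
  more entry: by symmetry all positions contribute equally, and their number is not zero.\<close>

lemma diagonal_eq_zero:
  assumes T: "multilinear n T" and sym: "symmetric T"
    and diag: "\<And>v. v \<in> hcarrier H \<Longrightarrow> T (replicate n v) = 0"
  shows "T xs = 0"
proof -
  have main: "T (ys @ replicate (n - k) v) = 0"
    if "k \<le> n" "ys \<in> tuples k (hcarrier H)" "v \<in> hcarrier H" for k ys v
    using that
  proof (induction k arbitrary: ys v)
    case 0
    then show ?case using diag by simp
  next
    case (Suc k)
    then obtain y zs where ys: "ys = y # zs" "y \<in> hcarrier H" "zs \<in> tuples k (hcarrier H)"
      by (cases ys) (auto simp: tuples_def)
    let ?m = "n - k"
    let ?c = "\<lambda>h x. hadd H x (hscale H (of_real h) y)"
    have m: "?m = Suc (n - Suc k)" using Suc.prems(1) by simp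
    have "((\<lambda>h. T (zs @ map (?c h) (replicate ?m v))) has_vector_derivative
        (\<Sum>p<length (replicate ?m v). T (zs @ (replicate ?m v)[p := y]))) (at 0)"
    proof (rule multilinear_derivative[OF T])
      fix x assume "x \<in> set (replicate ?m v)"
      then have x: "x = v" by auto
      show "?c 0 x = x" unfolding x using Suc.prems(3) ys by (intro weak_eqI) auto
      show "?c h x \<in> hcarrier H" for h unfolding x using Suc.prems(3) ys by simp
      have "hscale H (1 / of_real h) (hdiff H (?c h x) x) = y" if "h \<noteq> 0" for h
        unfolding x using Suc.prems(3) ys that by (intro weak_eqI) auto
      then have "\<forall>\<^sub>F h in at 0. hdist H (hscale H (1 / of_real h) (hdiff H (?c h x) x)) y = 0"
        using ys(2) by (auto simp: eventually_at_filter hdist_def hdiff_self)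
      then show "hconverges H (\<lambda>h. hscale H (1 / of_real h) (hdiff H (?c h x) x)) y (at 0)"
        using ys(2) by (simp add: hconverges_def tendsto_eventually)
    next
      show "zs @ replicate ?m v \<in> tuples n (hcarrier H)"
        using ys Suc.prems by (auto simp: tuples_def)
    qed
    moreover have "T (zs @ map (?c h) (replicate ?m v)) = 0" for h
      using Suc.IH[OF _ ys(3), of "?c h v"] Suc.prems ys by simp
    ultimately have "((\<lambda>h::real. 0) has_vector_derivative (\<Sum>p<?m. T (zs @ (replicate ?m v)[p := y]))) (at 0)"
      by simp
    then have "(\<Sum>p<?m. T (zs @ (replicate ?m v)[p := y])) = 0"
      using has_vector_derivative_const vector_derivative_unique_at by metis
    moreover have "T (zs @ (replicate ?m v)[p := y]) = T (ys @ replicate (n - Suc k) v)" if "p < ?m" for p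
    proof -
      have "mset ((replicate ?m v)[p := y]) = add_mset y (replicate_mset ?m v - {#v#})"
        using that by (simp add: mset_update)
      also have "replicate_mset ?m v - {#v#} = replicate_mset (n - Suc k) v" by (simp add: m)
      finally have "mset ((replicate ?m v)[p := y]) = add_mset y (replicate_mset (n - Suc k) v)" .
      then have "mset (zs @ (replicate ?m v)[p := y]) = mset (ys @ replicate (n - Suc k) v)" by (simp add: ys)
      then show ?thesis using sym unfolding symmetric_def by blast
    qed
    ultimately have "of_nat ?m * T (ys @ replicate (n - Suc k) v) = 0" by simp
    then show ?case using m by (metis mult_eq_0_iff of_nat_eq_0_iff nat.distinct(1))
  qed
  show ?thesis
  proof (cases "xs \<in> tuples n (hcarrier H)")
    case True
    then show ?thesis using main[of n xs "hzero H"] by simp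
  qed (use multilinear_outside[OF T] in auto)
qed

text \<open>Scaling \<open>v\<close> turns the inner product into a power series in the scalar, so
  every degree vanishes on the diagonal by itself. The scalar is inserted as \<open>cnj c\<close>
  because functionals are conjugate-homogeneous.\<close>

lemma exp_vec_total:
  assumes x: "\<xi> \<in> hcarrier \<F>" and z: "\<And>v. v \<in> hcarrier H \<Longrightarrow> hinner \<F> \<xi> (exp_vec H v) = 0"
  shows "\<xi> = hzero \<F>"
proof -
  have "\<xi> n xs = 0" for n xs
  proof (rule diagonal_eq_zero)
    fix v assume v: "v \<in> hcarrier H"
    have "(\<lambda>n. \<xi> n (replicate n v) / of_real (sqrt (fact n)) * c ^ n) sums 0" for c
    proof -
      have "\<xi> n (replicate n (hscale H (cnj c) v)) = c ^ n * \<xi> n (replicate n v)" for n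
        using multilinear_replicate_scale[OF fock_memD(1)[OF x] v, of "[]" n n "cnj c"] replicate_tuples[OF v] by simp
      then show ?thesis
        using inner_exp_vec_sums[OF x, of "hscale H (cnj c) v"] z[of "hscale H (cnj c) v"] v by (simp add: mult_ac)
    qed
    then have "\<xi> n (replicate n v) / of_real (sqrt (fact n)) = 0" by (rule power_series_zero)
    then show "\<xi> n (replicate n v) = 0" by simp
  qed (use x fock_memD in auto)
  then show ?thesis by (simp add: fock_simps fun_eq_iff)
qed

text \<open>Differential second quantisation on functionals: \<open>T\<close> acts on one argument
  at a time. On elementary tensors, acting on the arguments produces the adjoint of
  \<open>T\<close>, which is \<open>T\<close> itself in the self-adjoint case.\<close>

definition dGamma :: "('a \<Rightarrow> 'a) \<Rightarrow> (nat \<Rightarrow> 'a list \<Rightarrow> complex) \<Rightarrow> nat \<Rightarrow> 'a list \<Rightarrow> complex" where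
  "dGamma T \<xi> n xs = (if xs \<in> tuples n (hcarrier H) then \<Sum>p<n. \<xi> n (xs[p := T (xs ! p)]) else 0)"

text \<open>Factorial decay of the components makes a vector smooth for every \<open>dGamma T\<close> at once.\<close>

definition analytic_vectors :: "(nat \<Rightarrow> 'a list \<Rightarrow> complex) set" where
  "analytic_vectors = {\<xi> \<in> hcarrier \<F>. \<exists>c M. c \<ge> 0 \<and> M \<ge> 0 \<and> (\<forall>n. hs n (\<xi> n) \<le> c * M ^ n / fact n)}"

lemma tuples_update: "xs \<in> tuples n A \<Longrightarrow> x \<in> A \<Longrightarrow> xs[p := x] \<in> tuples n A"
  unfolding tuples_def using set_update_subset_insert by fastforce

lemma multilinear_update:
  assumes T: "multilinear n T" and xs: "xs \<in> tuples n (hcarrier H)" "p < n"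
    and x: "x \<in> hcarrier H" "y \<in> hcarrier H"
  shows "T (xs[p := hadd H x y]) = T (xs[p := x]) + T (xs[p := y])"
    "T (xs[p := hscale H c x]) = cnj c * T (xs[p := x])"
proof -
  have u: "xs[p := z] = take p xs @ z # drop (Suc p) xs" for z
    using xs by (intro upd_conv_take_nth_drop) (simp add: tuples_def)
  have t: "take p xs @ x # drop (Suc p) xs \<in> tuples n (hcarrier H)"
    using tuples_update[OF xs(1) x(1), of p] unfolding u .
  show "T (xs[p := hadd H x y]) = T (xs[p := x]) + T (xs[p := y])"
    unfolding u using T x t by (rule multilinear_add)
  show "T (xs[p := hscale H c x]) = cnj c * T (xs[p := x])"
    unfolding u using T x(1) t by (rule multilinear_scale)
qed

lemma prod_list_update_le:
  assumes "xs \<in> tuples n (hcarrier H)" "p < n" "hnorm H y \<le> c * hnorm H (xs ! p)" "y \<in> hcarrier H"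
  shows "(\<Prod>x\<leftarrow>xs[p := y]. hnorm H x) \<le> c * (\<Prod>x\<leftarrow>xs. hnorm H x)"
proof -
  let ?P = "(\<Prod>x\<leftarrow>take p xs. hnorm H x) * (\<Prod>x\<leftarrow>drop (Suc p) xs. hnorm H x)"
  have sub: "set (take p xs) \<subseteq> hcarrier H" "set (drop (Suc p) xs) \<subseteq> hcarrier H"
    using assms(1) set_take_subset[of p xs] set_drop_subset[of "Suc p" xs] by (auto simp: tuples_def)
  then have P: "?P \<ge> 0" by (intro mult_nonneg_nonneg prod_list_nonneg) auto
  have "(\<Prod>x\<leftarrow>xs[p := y]. hnorm H x) = hnorm H y * ?P"
    using assms by (simp add: upd_conv_take_nth_drop tuples_def mult_ac)
  also have "\<dots> \<le> (c * hnorm H (xs ! p)) * ?P" using assms P by (intro mult_right_mono) auto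
  also have "\<dots> = c * (\<Prod>x\<leftarrow>take p xs @ xs ! p # drop (Suc p) xs. hnorm H x)" by (simp add: mult_ac)
  also have "take p xs @ xs ! p # drop (Suc p) xs = xs" using assms by (simp add: id_take_nth_drop[symmetric] tuples_def)
  finally show ?thesis .
qed

lemma multilinear_dGamma:
  assumes S: "multilinear n (\<xi> n)" and T: "bounded_operator H T"
  shows "multilinear n (dGamma T \<xi> n)"
proof -
  have lin: "linear_operator H T" using T by (simp add: bounded_operator_def)
  note TL = linear_operatorD[OF lin]
  obtain L where L: "L > 0" "\<And>x. x \<in> hcarrier H \<Longrightarrow> hnorm H (T x) \<le> L * hnorm H x" using bounded_operatorD[OF T] by blast
  obtain K where K: "K \<ge> 0" "\<forall>xs\<in>tuples n (hcarrier H). cmod (\<xi> n xs) \<le> K * (\<Prod>x\<leftarrow>xs. hnorm H x)"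
    using multilinear_bound[OF S] by blast
  have Txs: "T (xs ! p) \<in> hcarrier H" "xs ! p \<in> hcarrier H" if "xs \<in> tuples n (hcarrier H)" "p < n" for xs p
  proof -
    show "xs ! p \<in> hcarrier H" using that unfolding tuples_def by (metis (mono_tags, lifting) mem_Collect_eq nth_mem subsetD)
    then show "T (xs ! p) \<in> hcarrier H" by (rule TL(1))
  qed
  \<comment> \<open>Separates the slot \<open>length us\<close>, in which linearity is tested, from
    the slot \<open>p\<close> hit by \<open>T\<close>. If they differ, the two updates commute, and
    the tested slot becomes the outer update of a list that does not depend on
    \<open>z\<close>.\<close>
  have step: "\<xi> n ((us @ z # vs)[p := T ((us @ z # vs) ! p)]) =
      (if p = length us then \<xi> n ((us @ z # vs)[p := T z])
       else \<xi> n (((us @ z0 # vs)[p := T ((us @ z0 # vs) ! p)])[length us := z]))" for us vs z z0 p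
  proof (cases "p = length us")
    case False
    have "us @ z # vs = (us @ z0 # vs)[length us := z]" by simp
    then show ?thesis using False by (metis list_update_swap nth_list_update_neq)
  qed simp
  show ?thesis
  proof (rule multilinearI[where K = "real n * (K * L)"])
    fix us vs x y assume x: "x \<in> hcarrier H" and y: "y \<in> hcarrier H" and t: "us @ x # vs \<in> tuples n (hcarrier H)"
    let ?zs = "us @ hzero H # vs"
    have tz: "us @ z # vs \<in> tuples n (hcarrier H)" if "z \<in> hcarrier H" for z
      using t that by (auto simp: tuples_def)
    have q: "length us < n" using t by (auto simp: tuples_def)
    have xy: "T x \<in> hcarrier H" "T y \<in> hcarrier H" "T (hadd H x y) = hadd H (T x) (T y)" using x y TL by auto
    have "\<xi> n ((us @ hadd H x y # vs)[p := T ((us @ hadd H x y # vs) ! p)]) =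
        \<xi> n ((us @ x # vs)[p := T ((us @ x # vs) ! p)]) + \<xi> n ((us @ y # vs)[p := T ((us @ y # vs) ! p)])" if "p < n" for p
    proof (cases "p = length us")
      case True
      then show ?thesis using multilinear_update(1)[OF S tz[of "hzero H"] q xy(1,2)] xy by simp
    next
      case False
      then show ?thesis
        using multilinear_update(1)[OF S tuples_update[OF tz[of "hzero H"] Txs(1)[OF tz[of "hzero H"] that]] q x y]
        unfolding step[of us _ vs p "hzero H"] by simp
    qed
    then show "dGamma T \<xi> n (us @ hadd H x y # vs) = dGamma T \<xi> n (us @ x # vs) + dGamma T \<xi> n (us @ y # vs)"
      using tz x y by (simp add: dGamma_def sum.distrib)
  next
    fix us vs c x assume x: "x \<in> hcarrier H" and t: "us @ x # vs \<in> tuples n (hcarrier H)"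
    have tz: "us @ z # vs \<in> tuples n (hcarrier H)" if "z \<in> hcarrier H" for z
      using t that by (auto simp: tuples_def)
    have q: "length us < n" using t by (auto simp: tuples_def)
    have xy: "T x \<in> hcarrier H" "T (hscale H c x) = hscale H c (T x)" using x TL by auto
    have "\<xi> n ((us @ hscale H c x # vs)[p := T ((us @ hscale H c x # vs) ! p)]) =
        cnj c * \<xi> n ((us @ x # vs)[p := T ((us @ x # vs) ! p)])" if "p < n" for p
    proof (cases "p = length us")
      case True
      then show ?thesis using multilinear_update(2)[OF S tz[of "hzero H"] q xy(1) xy(1)] xy by simp
    next
      case False
      then show ?thesis
        using multilinear_update(2)[OF S tuples_update[OF tz[of "hzero H"] Txs(1)[OF tz[of "hzero H"] that]] q x x]
        unfolding step[of us _ vs p "hzero H"] by simp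
    qed
    then show "dGamma T \<xi> n (us @ hscale H c x # vs) = cnj c * dGamma T \<xi> n (us @ x # vs)"
      using tz x by (simp add: dGamma_def sum_distrib_left)
  next
    fix xs assume xs: "xs \<in> tuples n (hcarrier H)"
    have "cmod (\<xi> n (xs[p := T (xs ! p)])) \<le> K * (L * (\<Prod>x\<leftarrow>xs. hnorm H x))" if "p < n" for p
    proof -
      have "cmod (\<xi> n (xs[p := T (xs ! p)])) \<le> K * (\<Prod>x\<leftarrow>xs[p := T (xs ! p)]. hnorm H x)"
        using K(2) tuples_update[OF xs Txs(1)[OF xs that]] by blast
      also have "\<dots> \<le> K * (L * (\<Prod>x\<leftarrow>xs. hnorm H x))"
        using K(1) xs that Txs[OF xs that] L(2) by (intro mult_left_mono prod_list_update_le) auto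
      finally show ?thesis .
    qed
    then have "cmod (\<Sum>p<n. \<xi> n (xs[p := T (xs ! p)])) \<le> of_nat (card {..<n}) * (K * (L * (\<Prod>x\<leftarrow>xs. hnorm H x)))"
      by (intro order_trans[OF norm_sum] sum_bounded_above) auto
    then show "cmod (dGamma T \<xi> n xs) \<le> (real n * (K * L)) * (\<Prod>x\<leftarrow>xs. hnorm H x)"
      using xs by (simp add: dGamma_def mult.assoc)
  qed (simp add: dGamma_def)
qed

lemma symmetric_dGamma:
  assumes sym: "symmetric (\<xi> n)"
  shows "symmetric (dGamma T \<xi> n)"
  unfolding symmetric_def
proof (intro allI impI)
  fix xs ys :: "'a list" assume m: "mset xs = mset ys"
  have t: "xs \<in> tuples n (hcarrier H) \<longleftrightarrow> ys \<in> tuples n (hcarrier H)"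
    using mset_eq_length[OF m] mset_eq_setD[OF m] by (simp add: tuples_def)
  \<comment> \<open>A symmetric functional factors through multisets. With \<open>G\<close> the sum
    over positions becomes a sum over the multiset of entries, which is visibly symmetric.\<close>
  define G where "G M = \<xi> n (SOME zs. mset zs = M)" for M
  have G: "\<xi> n zs = G (mset zs)" for zs
  proof -
    have "mset (SOME zs'. mset zs' = mset zs) = mset zs" by (rule someI[where P = "\<lambda>zs'. mset zs' = mset zs", OF refl])
    then show ?thesis using sym unfolding G_def symmetric_def by metis
  qed
  have *: "(\<Sum>p<n. \<xi> n (zs[p := T (zs ! p)])) = (\<Sum>x\<in>#mset zs. G (add_mset (T x) (mset zs - {#x#})))"
    if "length zs = n" for zs
  proof -
    have "(\<Sum>p<n. \<xi> n (zs[p := T (zs ! p)])) = (\<Sum>p<n. G (add_mset (T (zs ! p)) (mset zs - {#zs ! p#})))"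
      using that by (intro sum.cong) (auto simp: G mset_update)
    also have "\<dots> = (\<Sum>x\<leftarrow>zs. G (add_mset (T x) (mset zs - {#x#})))"
      using that by (simp add: sum_list_sum_nth atLeast0LessThan)
    also have "\<dots> = (\<Sum>x\<in>#mset zs. G (add_mset (T x) (mset zs - {#x#})))"
      by (simp only: mset_map[symmetric] sum_mset_sum_list)
    finally show ?thesis .
  qed
  show "dGamma T \<xi> n xs = dGamma T \<xi> n ys"
  proof (cases "xs \<in> tuples n (hcarrier H)")
    case True
    then have "length xs = n" "length ys = n" using t by (auto simp: tuples_def)
    then show ?thesis using True t m *[of xs] *[of ys] by (simp add: dGamma_def)
  qed (use t in \<open>simp add: dGamma_def\<close>)
qed

lemma adjoint_bound_id: "adjoint_bound (\<lambda>x. x) 1"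
  unfolding adjoint_bound_def by (auto intro!: exI[of _ "\<lambda>x. x"])

text \<open>Each summand is estimated by \<open>hs_contraction\<close> with \<open>T\<close> in one
  slot and the identity in the others. One factor \<open>n\<close> comes from squaring a sum of
  \<open>n\<close> terms, the other from adding the \<open>n\<close> estimates.\<close>

lemma hs_dGamma:
  assumes S: "multilinear n (\<xi> n)" "(\<lambda>bs. (cmod (\<xi> n bs))\<^sup>2) summable_on tuples n basis"
    and T: "adjoint_bound T c"
  shows "(\<lambda>bs. (cmod (dGamma T \<xi> n bs))\<^sup>2) summable_on tuples n basis \<and> hs n (dGamma T \<xi> n) \<le> (real n)\<^sup>2 * c\<^sup>2 * hs n (\<xi> n)"
proof -
  let ?f = "\<lambda>p bs. (cmod (\<xi> n (bs[p := T (bs ! p)])))\<^sup>2"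
  have slot: "?f p summable_on tuples n basis \<and> infsum (?f p) (tuples n basis) \<le> c\<^sup>2 * hs n (\<xi> n)" if p: "p < n" for p
  proof -
    define Ws :: "(('a \<Rightarrow> 'a) \<times> real) list" where "Ws = (replicate n (\<lambda>x. x, 1))[p := (T, c)]"
    have "(W, d) = (\<lambda>x. x, 1) \<or> (W, d) = (T, c)" if "(W, d) \<in> set Ws" for W d
      using that set_update_subset_insert[of "replicate n (\<lambda>x. x, 1)" p "(T, c)"] unfolding Ws_def by auto
    then have ab: "adjoint_bound W d" if "(W, d) \<in> set Ws" for W d using that T adjoint_bound_id by blast
    have prod: "(\<Prod>(W, d)\<leftarrow>Ws. d\<^sup>2) = c\<^sup>2"
      using p unfolding Ws_def by (simp add: upd_conv_take_nth_drop prod_list_replicate)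
    have eq: "map2 (\<lambda>(W, d) b. W b) Ws bs = bs[p := T (bs ! p)]" if "bs \<in> tuples n basis" for bs
      using that p by (intro nth_equalityI) (auto simp: Ws_def tuples_def nth_list_update)
    have "length Ws = n" by (simp add: Ws_def)
    from hs_contraction[OF S this ab] show ?thesis
      by (simp add: prod eq cong: summable_on_cong infsum_cong)
  qed
  have le: "(cmod (dGamma T \<xi> n bs))\<^sup>2 \<le> real n * (\<Sum>p<n. ?f p bs)" if "bs \<in> tuples n basis" for bs
  proof -
    have "(cmod (dGamma T \<xi> n bs))\<^sup>2 \<le> (\<Sum>p<n. cmod (\<xi> n (bs[p := T (bs ! p)])))\<^sup>2"
      using tuples_basis_mem[OF that] by (auto simp: dGamma_def intro!: power_mono norm_sum)
    also have "\<dots> \<le> (\<Sum>p<n. (cmod (\<xi> n (bs[p := T (bs ! p)])))\<^sup>2) * card {..<n}"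
      by (rule sum_squared_le_sum_of_squares) 
    finally show ?thesis by (simp add: mult.commute)
  qed
  have hsum: "((\<lambda>bs. real n * (\<Sum>p<n. ?f p bs)) has_sum real n * (\<Sum>p<n. infsum (?f p) (tuples n basis))) (tuples n basis)"
    using slot by (intro has_sum_cmult_right has_sum_finite_sum) auto
  have s: "(\<lambda>bs. (cmod (dGamma T \<xi> n bs))\<^sup>2) summable_on tuples n basis"
    using le has_sum_imp_summable[OF hsum] by (rule_tac summable_on_comparison_test) auto
  have "hs n (dGamma T \<xi> n) \<le> real n * (\<Sum>p<n. infsum (?f p) (tuples n basis))"
    unfolding hs_def using s le hsum by (intro has_sum_mono[OF has_sum_infsum[OF s] hsum]) auto
  also have "\<dots> \<le> real n * (\<Sum>p<n. c\<^sup>2 * hs n (\<xi> n))"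
    using slot by (intro mult_left_mono sum_mono) auto
  finally show ?thesis using s by (simp add: power2_eq_square mult_ac)
qed

lemma analytic_mem [simp]: "\<xi> \<in> analytic_vectors \<Longrightarrow> \<xi> \<in> hcarrier \<F>"
  by (simp add: analytic_vectors_def)

lemma hs_nonneg: "hs n T \<ge> 0"
  unfolding hs_def by (intro infsum_nonneg) auto

lemma summable_factorial: "summable (\<lambda>n. c * M ^ n / fact n :: real)"
  using summable_mult[OF summable_exp_generic[of M], of c] by (simp add: field_simps)

lemma self_adjoint_bound: "self_adjoint H T \<Longrightarrow> \<exists>c. adjoint_bound T c"
proof -
  assume T: "self_adjoint H T"
  then obtain K where "K > 0" "\<forall>x\<in>hcarrier H. hnorm H (T x) \<le> K * hnorm H x"
    using bounded_operatorD[of T] unfolding self_adjoint_def by blast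
  then show ?thesis using T unfolding adjoint_bound_def self_adjoint_def bounded_operator_def linear_operator_def
    by (intro exI[of _ K] conjI exI[of _ T] ballI) (auto simp: less_imp_le)
qed

text \<open>The polynomial loss is absorbed by \<open>n^2 \<le> 4^n\<close>, which enlarges
  \<open>M\<close> to \<open>4 * M\<close> and keeps the factorial decay.\<close>

lemma analytic_dGamma [simp]:
  assumes x: "\<xi> \<in> analytic_vectors" and T: "self_adjoint H T"
  shows "dGamma T \<xi> \<in> analytic_vectors"
proof -
  obtain c M where cM: "c \<ge> 0" "M \<ge> 0" "\<And>n. hs n (\<xi> n) \<le> c * M ^ n / fact n"
    using x unfolding analytic_vectors_def by blast
  obtain L where L: "adjoint_bound T L" using self_adjoint_bound[OF T] by blast
  note mem = fock_memD[OF analytic_mem[OF x]]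
  have h: "hs n (dGamma T \<xi> n) \<le> (L\<^sup>2 * c) * (4 * M) ^ n / fact n" for n
  proof -
    have "real n \<le> 2 ^ n" using less_exp[of n] by (metis of_nat_less_iff of_nat_numeral of_nat_power less_imp_le)
    then have "(real n)\<^sup>2 \<le> (2 ^ n)\<^sup>2" by (intro power_mono) auto
    also have "(2 ^ n)\<^sup>2 = (4::real) ^ n" by (simp add: power_mult_distrib[symmetric] power2_eq_square)
    finally have "(real n)\<^sup>2 * L\<^sup>2 * hs n (\<xi> n) \<le> 4 ^ n * L\<^sup>2 * (c * M ^ n / fact n)"
      using cM hs_nonneg by (intro mult_mono) auto
    moreover have "hs n (dGamma T \<xi> n) \<le> (real n)\<^sup>2 * L\<^sup>2 * hs n (\<xi> n)"
      using hs_dGamma[where \<xi> = \<xi>, OF mem(1,4) L] by blast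
    ultimately have "hs n (dGamma T \<xi> n) \<le> 4 ^ n * L\<^sup>2 * (c * M ^ n / fact n)" by linarith
    then show ?thesis by (simp add: power_mult_distrib mult_ac)
  qed
  have "summable (\<lambda>n. hs n (dGamma T \<xi> n))"
    using h hs_nonneg by (intro summable_comparison_test'[OF summable_factorial[of "L\<^sup>2 * c" "4 * M"], where N = 0]) auto
  then have "dGamma T \<xi> \<in> hcarrier \<F>"
    unfolding fock_mem_iff coord_sq_summable_iff using hs_dGamma[where \<xi> = \<xi>, OF mem(1,4) L] T
    by (simp add: multilinear_dGamma[where \<xi> = \<xi>, OF mem(1)] symmetric_dGamma[where \<xi> = \<xi>, OF mem(2)] self_adjoint_def)
  moreover have "L\<^sup>2 * c \<ge> 0" "4 * M \<ge> 0" using cM by auto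
  ultimately show ?thesis using h unfolding analytic_vectors_def by blast
qed

lemma analytic_lin_comb [simp]:
  assumes "\<xi> \<in> analytic_vectors" "\<eta> \<in> analytic_vectors"
  shows "(\<lambda>n xs. a * \<xi> n xs + b * \<eta> n xs) \<in> analytic_vectors"
proof -
  obtain c M d N where cM: "c \<ge> 0" "M \<ge> 0" "\<And>n. hs n (\<xi> n) \<le> c * M ^ n / fact n"
    and dN: "d \<ge> 0" "N \<ge> 0" "\<And>n. hs n (\<eta> n) \<le> d * N ^ n / fact n"
    using assms unfolding analytic_vectors_def by blast
  note mem = fock_memD(4)[OF analytic_mem[OF assms(1)]] fock_memD(4)[OF analytic_mem[OF assms(2)]]
  let ?k = "2 * (cmod a)\<^sup>2 * c + 2 * (cmod b)\<^sup>2 * d"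
  have "hs n (\<lambda>xs. a * \<xi> n xs + b * \<eta> n xs) \<le> ?k * (max M N) ^ n / fact n" for n
  proof -
    have "hs n (\<lambda>xs. a * \<xi> n xs + b * \<eta> n xs) \<le> 2 * (cmod a)\<^sup>2 * hs n (\<xi> n) + 2 * (cmod b)\<^sup>2 * hs n (\<eta> n)"
      unfolding hs_def
    proof (rule has_sum_mono)
      show "((\<lambda>bs. (cmod (a * \<xi> n bs + b * \<eta> n bs))\<^sup>2) has_sum infsum (\<lambda>bs. (cmod (a * \<xi> n bs + b * \<eta> n bs))\<^sup>2) (tuples n basis)) (tuples n basis)"
        using mem by (intro has_sum_infsum l2_add l2_scale)
      show "((\<lambda>bs. 2 * (cmod a)\<^sup>2 * (cmod (\<xi> n bs))\<^sup>2 + 2 * (cmod b)\<^sup>2 * (cmod (\<eta> n bs))\<^sup>2) has_sum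
          2 * (cmod a)\<^sup>2 * infsum (\<lambda>bs. (cmod (\<xi> n bs))\<^sup>2) (tuples n basis)
          + 2 * (cmod b)\<^sup>2 * infsum (\<lambda>bs. (cmod (\<eta> n bs))\<^sup>2) (tuples n basis)) (tuples n basis)"
        using mem by (intro has_sum_add has_sum_cmult_right has_sum_infsum)
      fix bs
      have "(cmod (a * \<xi> n bs + b * \<eta> n bs))\<^sup>2 \<le> (cmod (a * \<xi> n bs) + cmod (b * \<eta> n bs))\<^sup>2"
        by (intro power_mono norm_triangle_ineq) auto
      moreover have "0 \<le> (cmod (a * \<xi> n bs) - cmod (b * \<eta> n bs))\<^sup>2" by simp
      ultimately show "(cmod (a * \<xi> n bs + b * \<eta> n bs))\<^sup>2 \<le> 2 * (cmod a)\<^sup>2 * (cmod (\<xi> n bs))\<^sup>2 + 2 * (cmod b)\<^sup>2 * (cmod (\<eta> n bs))\<^sup>2"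
        unfolding power2_sum power2_diff norm_mult power_mult_distrib by linarith
    qed
    also have "\<dots> \<le> 2 * (cmod a)\<^sup>2 * (c * (max M N) ^ n / fact n) + 2 * (cmod b)\<^sup>2 * (d * (max M N) ^ n / fact n)"
    proof (intro add_mono mult_left_mono)
      show "hs n (\<xi> n) \<le> c * (max M N) ^ n / fact n"
        using cM by (intro order_trans[OF cM(3)] divide_right_mono mult_left_mono power_mono) auto
      show "hs n (\<eta> n) \<le> d * (max M N) ^ n / fact n"
        using dN by (intro order_trans[OF dN(3)] divide_right_mono mult_left_mono power_mono) auto
    qed auto
    finally show ?thesis by (simp add: algebra_simps add_divide_distrib)
  qed
  moreover have "?k \<ge> 0" "max M N \<ge> 0" using cM dN by auto
  ultimately show ?thesis using fock_lin_comb[OF analytic_mem[OF assms(1)] analytic_mem[OF assms(2)]]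
    unfolding analytic_vectors_def by blast
qed

lemma analytic_exp_vec [simp]:
  assumes v: "v \<in> hcarrier H"
  shows "exp_vec H v \<in> analytic_vectors"
proof -
  have "hs n (exp_vec H v n) = (hnorm H v)\<^sup>2 ^ n / fact n" for n
  proof -
    have "((\<lambda>bs. (cmod (\<Prod>b\<leftarrow>bs. hinner H v b))\<^sup>2 / fact n) has_sum (hnorm H v)\<^sup>2 ^ n / fact n) (tuples n basis)"
      using power_vector_l2[OF v] by (rule has_sum_divide_const)
    then have "((\<lambda>bs. (cmod (exp_vec H v n bs))\<^sup>2) has_sum (hnorm H v)\<^sup>2 ^ n / fact n) (tuples n basis)"
      by (simp add: exp_vec_eq tuples_basis_mem norm_divide norm_mult power_divide cong: has_sum_cong)
    then show ?thesis by (simp add: hs_def has_sum_iff)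
  qed
  then have "(1::real) \<ge> 0 \<and> (hnorm H v)\<^sup>2 \<ge> 0 \<and> (\<forall>n. hs n (exp_vec H v n) \<le> 1 * (hnorm H v)\<^sup>2 ^ n / fact n)" by simp
  then have "\<exists>c M. c \<ge> 0 \<and> M \<ge> 0 \<and> (\<forall>n. hs n (exp_vec H v n) \<le> c * M ^ n / fact n)" by blast
  then show ?thesis using v unfolding analytic_vectors_def by simp
qed

end

section \<open>Second quantisation and its generators\<close>

lemma differentiable_bound_real:
  fixes g :: "real \<Rightarrow> complex"
  assumes "\<And>s. (g has_vector_derivative g' s) (at s)" "\<And>s. norm (g' s) \<le> B"
  shows "norm (g r - g 0) \<le> B * \<bar>r\<bar>"
proof -
  have "norm (g r - g 0) \<le> B * norm (r - 0)"
  proof (rule differentiable_bound[of UNIV])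
    show "(g has_derivative (\<lambda>h. h *\<^sub>R g' s)) (at s within UNIV)" for s
      using assms(1)[of s] by (simp add: has_vector_derivative_def)
    show "onorm (\<lambda>h. h *\<^sub>R g' s) \<le> B" for s
      using assms(2)[of s] onorm_scaleR_left[of "\<lambda>x::real. x" "g' s"] by (simp add: onorm_id[unfolded id_def])
  qed auto
  then show ?thesis by simp
qed

lemma filterlim_uminus_at_0: "filterlim (\<lambda>r::real. - r) (at 0) (at 0)"
  unfolding filterlim_at by (auto intro!: tendsto_eq_intros simp: eventually_at_filter)

section \<open>The second quantised unitary group and its coordinates\<close>

context self_adjoint_op
begin

lemma E_norm: "x \<in> hcarrier H \<Longrightarrow> hnorm H (E r x) = hnorm H x"
  by (simp add: hnorm_def E_isometric)

lemma T_E_commute: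
  assumes x: "x \<in> hcarrier H"
  shows "T (E r x) = E r (T x)"
proof (rule weak_eqI)
  fix y assume y: "y \<in> hcarrier H"
  have "(\<lambda>k. (\<i> * of_real r) ^ k / fact k * hinner H ((T ^^ k) x) (T y)) sums hinner H (E r x) (T y)"
    using x y by (intro E_sums) auto
  moreover have "hinner H ((T ^^ k) x) (T y) = hinner H ((T ^^ k) (T x)) y" for k
    using T_sym[of "(T ^^ k) x" y] x y by (simp add: funpow_swap1)
  ultimately show "hinner H (T (E r x)) y = hinner H (E r (T x)) y"
    using E_sums[of "T x" y r] T_sym[of "E r x" y] x y by (simp add: sums_unique2)
qed (use x in auto)

text \<open>The second quantisation of \<open>E r\<close>. What acts on the arguments is the
  adjoint, which is the inverse \<open>E (- r)\<close>.\<close>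

definition Gam :: "real \<Rightarrow> (nat \<Rightarrow> 'a list \<Rightarrow> complex) \<Rightarrow> nat \<Rightarrow> 'a list \<Rightarrow> complex" where
  "Gam r \<xi> n xs = (if xs \<in> tuples n (hcarrier H) then \<xi> n (map (E (- r)) xs) else 0)"

lemma map_E_mem: "xs \<in> tuples n (hcarrier H) \<Longrightarrow> map (E r) xs \<in> tuples n (hcarrier H)"
  by (auto simp: tuples_def)

lemma adjoint_bound_E: "adjoint_bound (E r) 1"
  unfolding adjoint_bound_def using E_adjoint[of _ _ "- r"]
  by (auto intro!: exI[of _ "E (- r)"] simp: E_norm)

lemma multilinear_Gam:
  assumes S: "multilinear n (\<xi> n)"
  shows "multilinear n (Gam r \<xi> n)"
proof -
  obtain K where K: "\<forall>xs\<in>tuples n (hcarrier H). cmod (\<xi> n xs) \<le> K * (\<Prod>x\<leftarrow>xs. hnorm H x)"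
    using multilinear_bound[OF S] by blast
  note EL = linear_operatorD[OF E_linear]
  show ?thesis
  proof (rule multilinearI)
    fix us vs x y assume x: "x \<in> hcarrier H" and y: "y \<in> hcarrier H" and t: "us @ x # vs \<in> tuples n (hcarrier H)"
    have tz: "us @ z # vs \<in> tuples n (hcarrier H)" if "z \<in> hcarrier H" for z
      using t that by (auto simp: tuples_def)
    show "Gam r \<xi> n (us @ hadd H x y # vs) = Gam r \<xi> n (us @ x # vs) + Gam r \<xi> n (us @ y # vs)"
      using multilinear_add[OF S, of "E (- r) x" "E (- r) y" "map (E (- r)) us" "map (E (- r)) vs"]
        map_E_mem[OF tz[OF x], of "- r"] x y tz by (simp add: Gam_def EL)
  next
    fix us vs c x assume x: "x \<in> hcarrier H" and t: "us @ x # vs \<in> tuples n (hcarrier H)"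
    have tz: "us @ z # vs \<in> tuples n (hcarrier H)" if "z \<in> hcarrier H" for z
      using t that by (auto simp: tuples_def)
    show "Gam r \<xi> n (us @ hscale H c x # vs) = cnj c * Gam r \<xi> n (us @ x # vs)"
      using multilinear_scale[OF S, of "E (- r) x" "map (E (- r)) us" "map (E (- r)) vs" c]
        map_E_mem[OF tz[OF x], of "- r"] x tz by (simp add: Gam_def EL)
  next
    fix xs assume xs: "xs \<in> tuples n (hcarrier H)"
    have "(\<Prod>x\<leftarrow>xs. hnorm H (E (- r) x)) = (\<Prod>x\<leftarrow>xs. hnorm H x)"
      using xs by (intro arg_cong[of _ _ prod_list] map_cong) (auto simp: E_norm tuples_def)
    then show "cmod (Gam r \<xi> n xs) \<le> K * (\<Prod>x\<leftarrow>xs. hnorm H x)"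
      using bspec[OF K map_E_mem[OF xs, of "- r"]] xs by (simp add: Gam_def comp_def)
  qed (simp add: Gam_def)
qed

lemma hs_Gam:
  assumes "multilinear n (\<xi> n)" "(\<lambda>bs. (cmod (\<xi> n bs))\<^sup>2) summable_on tuples n basis"
  shows "(\<lambda>bs. (cmod (Gam r \<xi> n bs))\<^sup>2) summable_on tuples n basis" "hs n (Gam r \<xi> n) \<le> hs n (\<xi> n)"
proof -
  have eq: "map2 (\<lambda>(W, d) b. W b) (replicate n (E (- r), 1::real)) bs = map (E (- r)) bs" if "bs \<in> tuples n basis" for bs
    using that by (intro nth_equalityI) (auto simp: tuples_def)
  have "(W, c) \<in> set (replicate n (E (- r), 1)) \<Longrightarrow> adjoint_bound W c" for W c
    using adjoint_bound_E by auto
  from hs_contraction[OF assms, of "replicate n (E (- r), 1)"] this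
  show "(\<lambda>bs. (cmod (Gam r \<xi> n bs))\<^sup>2) summable_on tuples n basis" "hs n (Gam r \<xi> n) \<le> hs n (\<xi> n)"
    by (simp_all add: eq Gam_def tuples_basis_mem prod_list_replicate hs_def cong: summable_on_cong infsum_cong)
qed

lemma Gam_mem [simp]:
  assumes x: "\<xi> \<in> hcarrier \<F>"
  shows "Gam r \<xi> \<in> hcarrier \<F>"
proof -
  note mem = fock_memD[OF x]
  have "symmetric (Gam r \<xi> n)" for n
    unfolding symmetric_def
  proof (intro allI impI)
    fix xs ys :: "'a list" assume m: "mset xs = mset ys"
    then have "mset (map (E (- r)) xs) = mset (map (E (- r)) ys)" by simp
    then have "\<xi> n (map (E (- r)) xs) = \<xi> n (map (E (- r)) ys)"
      using mem(2)[of n] unfolding symmetric_def by blast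
    then show "Gam r \<xi> n xs = Gam r \<xi> n ys"
      using mset_eq_length[OF m] mset_eq_setD[OF m] by (simp add: tuples_def Gam_def)
  qed
  moreover have "summable (\<lambda>n. hs n (Gam r \<xi> n))"
  proof (rule summable_comparison_test')
    show "summable (\<lambda>n. hs n (\<xi> n))" using x unfolding fock_mem_iff coord_sq_summable_iff by blast
    show "norm (hs n (Gam r \<xi> n)) \<le> hs n (\<xi> n)" for n
      using hs_Gam(2)[where \<xi> = \<xi>, OF mem(1,4)] by (simp add: hs_nonneg)
  qed
  ultimately show ?thesis
    unfolding fock_mem_iff coord_sq_summable_iff by (simp add: multilinear_Gam[where \<xi> = \<xi>, OF mem(1)] hs_Gam(1)[where \<xi> = \<xi>, OF mem(1,4)])
qed

lemma Gam_add:
  shows "Gam (r + s) \<xi> = Gam r (Gam s \<xi>)"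
proof (intro ext)
  fix n xs
  have "map (E (- s)) (map (E (- r)) xs) = map (E (- (r + s))) xs" if "xs \<in> tuples n (hcarrier H)"
  proof -
    \<comment> \<open>Acting on arguments reverses the order of composition; commutativity of
      addition repairs this.\<close>
    have "E (- (r + s)) x = E (- s) (E (- r) x)" if "x \<in> hcarrier H" for x
      using E_add[OF that, of "- s" "- r"] by (simp add: add.commute)
    then show ?thesis using that by (auto simp: tuples_def)
  qed
  then show "Gam (r + s) \<xi> n xs = Gam r (Gam s \<xi>) n xs"
    using map_E_mem[of xs n "- r"] by (auto simp: Gam_def simp del: map_map)
qed

lemma Gam_zero:
  assumes "\<xi> \<in> hcarrier \<F>"
  shows "Gam 0 \<xi> = \<xi>"
proof (intro ext)
  fix n xs
  have "map (E 0) xs = xs" if "xs \<in> tuples n (hcarrier H)"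
    using that by (intro map_idI) (auto simp: tuples_def E_zero)
  then show "Gam 0 \<xi> n xs = \<xi> n xs"
    using multilinear_outside[OF fock_memD(1)[OF assms], of xs n] by (auto simp: Gam_def)
qed

lemma Gam_lin_comb: "Gam r (\<lambda>n xs. a * \<xi> n xs + b * \<eta> n xs) = (\<lambda>n xs. a * Gam r \<xi> n xs + b * Gam r \<eta> n xs)"
  by (auto simp: Gam_def fun_eq_iff)

lemma Gam_norm_le:
  assumes x: "\<xi> \<in> hcarrier \<F>"
  shows "hnorm \<F> (Gam r \<xi>) \<le> hnorm \<F> \<xi>"
proof -
  interpret F: pre_hilbert \<F> by (rule fock_pre_hilbert)
  have norm: "(\<lambda>n. hs n (\<zeta> n)) sums (hnorm \<F> \<zeta>)\<^sup>2" if z: "\<zeta> \<in> hcarrier \<F>" for \<zeta>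
  proof (rule has_sum_imp_sums, rule has_sum_SigmaD)
    show "((\<lambda>(n, bs). (cmod (coord \<zeta> bs))\<^sup>2) has_sum (hnorm \<F> \<zeta>)\<^sup>2) (SIGMA n:UNIV. tuples n basis)"
      using fock_norm_has_sum[OF z] by (simp flip: has_sum_lists)
    show "((\<lambda>bs. (\<lambda>(n, bs). (cmod (coord \<zeta> bs))\<^sup>2) (n, bs)) has_sum hs n (\<zeta> n)) (tuples n basis)" for n
      using has_sum_infsum[OF fock_memD(4)[OF z, of n]] unfolding hs_def
      by (simp add: coord_tuples cong: has_sum_cong)
  qed
  have "(hnorm \<F> (Gam r \<xi>))\<^sup>2 \<le> (hnorm \<F> \<xi>)\<^sup>2"
    using hs_Gam(2)[where \<xi> = \<xi>, OF fock_memD(1,4)[OF x]] norm[OF Gam_mem[OF x]] norm[OF x] by (rule sums_le)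
  then show ?thesis using x by (auto intro: power2_le_imp_le)
qed

text \<open>The contraction estimate only says that norms do not grow. Applied to
  \<open>Gam r\<close> and to its inverse it gives an isometry, and polarisation passes to inner
  products.\<close>

lemma Gam_unitary: "unitary_operator \<F> (Gam r)"
proof -
  interpret F: pre_hilbert \<F> by (rule fock_pre_hilbert)
  have inv: "Gam (- r) (Gam r \<xi>) = \<xi>" "Gam r (Gam (- r) \<xi>) = \<xi>" if "\<xi> \<in> hcarrier \<F>" for \<xi> r
    using that Gam_zero by (simp_all flip: Gam_add)
  have norm: "hnorm \<F> (Gam r \<xi>) = hnorm \<F> \<xi>" if "\<xi> \<in> hcarrier \<F>" for \<xi>
    using Gam_norm_le[OF that, of r] Gam_norm_le[OF Gam_mem[OF that], of "- r" r] inv[OF that] by simp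
  have add: "Gam r (hadd \<F> \<xi> \<eta>) = hadd \<F> (Gam r \<xi>) (Gam r \<eta>)" for \<xi> \<eta>
    using Gam_lin_comb[of r 1 \<xi> 1 \<eta>] by (simp add: fock_simps)
  have scale: "Gam r (hscale \<F> c \<xi>) = hscale \<F> c (Gam r \<xi>)" for c \<xi>
    using Gam_lin_comb[of r c \<xi> 0 \<xi>] by (simp add: fock_simps)
  have "bij_betw (Gam r) (hcarrier \<F>) (hcarrier \<F>)"
    by (rule bij_betw_byWitness[where f' = "Gam (- r)"]) (auto simp: inv)
  then show ?thesis
    using F.isometric_inner[of "Gam r"] add scale norm
    by (auto simp: unitary_operator_def linear_operator_def)
qed

lemma Gam_dGamma_commute: "dGamma T (Gam r \<xi>) = Gam r (dGamma T \<xi>)"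
proof (intro ext)
  fix n xs
  have "\<xi> n (map (E (- r)) (xs[p := T (xs ! p)])) = \<xi> n ((map (E (- r)) xs)[p := T (map (E (- r)) xs ! p)])"
    if "xs \<in> tuples n (hcarrier H)" "p < n" for p
    using that T_E_commute[of "xs ! p" "- r"] by (auto simp: tuples_def map_update subset_iff)
  moreover have "xs[p := T (xs ! p)] \<in> tuples n (hcarrier H)" if "xs \<in> tuples n (hcarrier H)" "p < n" for p
    using that by (intro tuples_update) (auto simp: tuples_def subset_iff)
  ultimately show "dGamma T (Gam r \<xi>) n xs = Gam r (dGamma T \<xi>) n xs"
    using map_E_mem[of xs n "- r"] by (auto simp: dGamma_def Gam_def intro!: sum.cong)
qed

text \<open>At time 0 this is the product rule, each conjugate-linear slot converting
  \<open>- \<i>\<close> into \<open>\<i>\<close>; other times follow from the group law. It holds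
  for every Fock vector because a single coordinate of \<open>dGamma\<close> is a finite
  sum.\<close>

lemma Gam_coord_derivative:
  assumes x: "\<xi> \<in> hcarrier \<F>" and bs: "bs \<in> lists basis"
  shows "((\<lambda>s. coord (Gam s \<xi>) bs) has_vector_derivative \<i> * coord (dGamma T (Gam r \<xi>)) bs) (at r)"
proof -
  define n where "n = length bs"
  have t: "bs \<in> tuples n (hcarrier H)" using bs basis_mem by (auto simp: n_def tuples_def)
  have zero: "((\<lambda>h. coord (Gam h \<eta>) bs) has_vector_derivative \<i> * coord (dGamma T \<eta>) bs) (at 0)" if y: "\<eta> \<in> hcarrier \<F>" for \<eta>
  proof -
    have xp: "bs ! p \<in> hcarrier H" if "p < n" for p using t that by (auto simp: tuples_def subset_iff)
    have "((\<lambda>h. \<eta> n ([] @ map (\<lambda>x. E (- h) x) bs)) has_vector_derivative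
        (\<Sum>p<length bs. \<eta> n ([] @ bs[p := hscale H (- \<i>) (T (bs ! p))]))) (at 0)"
      using t by (intro multilinear_derivative[OF fock_memD(1)[OF y]] E_derivative) (auto simp: tuples_def E_zero subset_iff)
    moreover have "\<eta> n (bs[p := hscale H (- \<i>) (T (bs ! p))]) = \<i> * \<eta> n (bs[p := T (bs ! p)])" if "p < n" for p
      using multilinear_update(2)[OF fock_memD(1)[OF y] t that, of "T (bs ! p)" "T (bs ! p)" "- \<i>"] xp[OF that] by simp
    ultimately show ?thesis
      using t by (simp add: coord_def Gam_def dGamma_def n_def[symmetric] sum_distrib_left)
  qed
  have "((\<lambda>h. coord (Gam h (Gam r \<xi>)) bs) has_vector_derivative \<i> * coord (dGamma T (Gam r \<xi>)) bs) (at 0)"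
    using x by (intro zero) auto
  then have "((\<lambda>h. (coord (Gam (r + h) \<xi>) bs - coord (Gam r \<xi>) bs) /\<^sub>R h) \<longlongrightarrow> \<i> * coord (dGamma T (Gam r \<xi>)) bs) (at 0)"
    using Gam_add[of 0 r \<xi>] unfolding has_vector_derivative_iff_quotient Gam_add[symmetric] by (simp add: add.commute)
  then show ?thesis by (simp add: has_vector_derivative_iff_quotient)
qed

lemma fock_strong_convergence:
  assumes f: "\<And>r. f r \<in> hcarrier \<F>" and g: "g \<in> hcarrier \<F>"
    and pt: "\<And>bs. bs \<in> lists basis \<Longrightarrow> ((\<lambda>r. coord (f r) bs) \<longlongrightarrow> coord g bs) F"
    and le: "\<forall>\<^sub>F r in F. hnorm \<F> (f r) \<le> hnorm \<F> g"
  shows "hconverges \<F> f g F"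
proof -
  interpret F: pre_hilbert \<F> by (rule fock_pre_hilbert)
  have "((\<lambda>r. (hnorm \<F> (hdiff \<F> (f r) g))\<^sup>2) \<longlongrightarrow> 0) F"
  proof (rule l2_strong_convergence[OF pt])
    show "((\<lambda>bs. (cmod (coord (f r) bs))\<^sup>2) has_sum (hnorm \<F> (f r))\<^sup>2) (lists basis)" for r
      using f by (rule fock_norm_has_sum)
    show "((\<lambda>bs. (cmod (coord g bs))\<^sup>2) has_sum (hnorm \<F> g)\<^sup>2) (lists basis)"
      using g by (rule fock_norm_has_sum)
    show "\<forall>\<^sub>F r in F. (hnorm \<F> (f r))\<^sup>2 \<le> (hnorm \<F> g)\<^sup>2"
      using le by eventually_elim (use f in \<open>auto intro: power_mono\<close>)
    show "((\<lambda>bs. (cmod (coord (f r) bs - coord g bs))\<^sup>2) has_sum (hnorm \<F> (hdiff \<F> (f r) g))\<^sup>2) (lists basis)" for r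
      using fock_norm_has_sum[OF F.diff_mem[OF f g], of r] by (simp add: fock_simps)
  qed
  from tendsto_real_sqrt[OF this] have "((\<lambda>r. hnorm \<F> (hdiff \<F> (f r) g)) \<longlongrightarrow> 0) F"
    using f g by simp
  then show ?thesis using g by (simp add: hconverges_def hdist_def)
qed

text \<open>For strong continuity, the coordinates are continuous because they are differentiable,
  and the norms are constant.\<close>

lemma Gam_group: "unitary_group \<F> Gam"
  unfolding unitary_group_def
proof (intro conjI allI ballI)
  fix \<xi> r assume x: "\<xi> \<in> hcarrier \<F>"
  interpret F: pre_hilbert \<F> by (rule fock_pre_hilbert)
  show "hconverges \<F> (\<lambda>s. Gam s \<xi>) (Gam r \<xi>) (at r)"
  proof (rule fock_strong_convergence)
    fix bs assume bs: "bs \<in> lists basis"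
    show "((\<lambda>s. coord (Gam s \<xi>) bs) \<longlongrightarrow> coord (Gam r \<xi>) bs) (at r)"
      using has_vector_derivative_continuous[OF Gam_coord_derivative[OF x bs]] by (simp add: isCont_def)
  next
    have "hnorm \<F> (Gam s \<xi>) = hnorm \<F> \<xi>" for s
      using Gam_unitary[of s] x by (simp add: unitary_operator_def hnorm_def)
    then show "\<forall>\<^sub>F s in at r. hnorm \<F> (Gam s \<xi>) \<le> hnorm \<F> (Gam r \<xi>)" by simp
  qed (use x in auto)
qed (use Gam_unitary Gam_zero Gam_add in auto)

text \<open>A mean value inequality on a finite set \<open>J\<close> of coordinates. The function
  \<open>g\<close> pairs \<open>Gam s \<xi>\<close> with the difference \<open>\<Delta>\<close>
  restricted to \<open>J\<close>: its increment is the squared norm of that restriction, and its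
  derivative is at most that norm times the norm of \<open>dGamma T \<xi>\<close>, because
  \<open>Gam\<close> is a contraction commuting with \<open>dGamma\<close>. Dividing and letting
  \<open>J\<close> grow gives the claim.\<close>

lemma Gam_difference_bound:
  assumes x: "\<xi> \<in> hcarrier \<F>" and d: "dGamma T \<xi> \<in> hcarrier \<F>"
  shows "hnorm \<F> (hdiff \<F> (Gam r \<xi>) \<xi>) \<le> hnorm \<F> (dGamma T \<xi>) * \<bar>r\<bar>"
proof -
  interpret F: pre_hilbert \<F> by (rule fock_pre_hilbert)
  let ?\<eta> = "dGamma T \<xi>"
  let ?B = "hnorm \<F> ?\<eta>"
  define \<Delta> where "\<Delta> bs = coord (Gam r \<xi>) bs - coord \<xi> bs" for bs
  have "((\<lambda>bs. (cmod (\<Delta> bs))\<^sup>2) has_sum (hnorm \<F> (hdiff \<F> (Gam r \<xi>) \<xi>))\<^sup>2) (lists basis)"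
    using fock_norm_has_sum[OF F.diff_mem[OF Gam_mem[OF x] x], of r] by (simp add: fock_simps \<Delta>_def)
  moreover have "(\<Sum>bs\<in>J. (cmod (\<Delta> bs))\<^sup>2) \<le> (?B * \<bar>r\<bar>)\<^sup>2" if J: "finite J" "J \<subseteq> lists basis" for J
  proof -
    define S where "S = (\<Sum>bs\<in>J. (cmod (\<Delta> bs))\<^sup>2)"
    have S: "S \<ge> 0" by (auto simp: S_def intro: sum_nonneg)
    define g where "g s = (\<Sum>bs\<in>J. cnj (\<Delta> bs) * coord (Gam s \<xi>) bs)" for s
    have "norm (g r - g 0) \<le> (sqrt S * ?B) * \<bar>r\<bar>"
    proof (rule differentiable_bound_real)
      show "(g has_vector_derivative (\<Sum>bs\<in>J. cnj (\<Delta> bs) * (\<i> * coord (dGamma T (Gam s \<xi>)) bs))) (at s)" for s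
        unfolding g_def using J
        by (intro has_vector_derivative_sum has_vector_derivative_mult_right Gam_coord_derivative[OF x]) auto
      fix s
      have m: "Gam s ?\<eta> \<in> hcarrier \<F>" using d by simp
      have "norm (\<Sum>bs\<in>J. cnj (\<Delta> bs) * (\<i> * coord (dGamma T (Gam s \<xi>)) bs))
          \<le> (\<Sum>bs\<in>J. \<bar>cmod (\<Delta> bs)\<bar> * \<bar>cmod (coord (Gam s ?\<eta>) bs)\<bar>)"
        unfolding Gam_dGamma_commute by (rule order_trans[OF norm_sum]) (simp add: norm_mult)
      also have "\<dots> \<le> L2_set (\<lambda>bs. cmod (\<Delta> bs)) J * L2_set (\<lambda>bs. cmod (coord (Gam s ?\<eta>) bs)) J"
        by (rule L2_set_mult_ineq)
      also have "\<dots> \<le> sqrt S * ?B"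
      proof (intro mult_mono)
        have "(\<Sum>bs\<in>J. (cmod (coord (Gam s ?\<eta>) bs))\<^sup>2) \<le> (hnorm \<F> (Gam s ?\<eta>))\<^sup>2"
          using J by (intro finite_sum_le_has_sum[OF fock_norm_has_sum[OF m]]) auto
        also have "\<dots> \<le> ?B\<^sup>2" using Gam_norm_le[OF d] m by (intro power_mono) auto
        finally have "sqrt (\<Sum>bs\<in>J. (cmod (coord (Gam s ?\<eta>) bs))\<^sup>2) \<le> sqrt (?B\<^sup>2)" by (rule real_sqrt_le_mono)
        then show "L2_set (\<lambda>bs. cmod (coord (Gam s ?\<eta>) bs)) J \<le> ?B" using d by (simp add: L2_set_def)
      qed (auto simp: L2_set_def S_def sum_nonneg)
      finally show "norm (\<Sum>bs\<in>J. cnj (\<Delta> bs) * (\<i> * coord (dGamma T (Gam s \<xi>)) bs)) \<le> sqrt S * ?B" .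
    qed
    also have "g r - g 0 = (\<Sum>bs\<in>J. cnj (\<Delta> bs) * \<Delta> bs)"
      using x by (simp add: g_def Gam_zero \<Delta>_def right_diff_distrib sum_subtractf)
    also have "\<dots> = of_real S"
      unfolding S_def of_real_sum by (intro sum.cong refl) (metis complex_norm_square mult.commute)
    finally have "S \<le> sqrt S * (?B * \<bar>r\<bar>)" using S by (simp add: mult_ac)
    then have "sqrt S * sqrt S \<le> sqrt S * (?B * \<bar>r\<bar>)" using S by simp
    then have "sqrt S \<le> ?B * \<bar>r\<bar>"
      using S d by (cases "S = 0") (auto simp del: real_sqrt_mult_self dest: mult_left_le_imp_le)
    then have "(sqrt S)\<^sup>2 \<le> (?B * \<bar>r\<bar>)\<^sup>2" using S by (intro power_mono) auto
    then show ?thesis using S by (simp add: S_def)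
  qed
  ultimately have "(hnorm \<F> (hdiff \<F> (Gam r \<xi>) \<xi>))\<^sup>2 \<le> (?B * \<bar>r\<bar>)\<^sup>2" by (rule has_sum_le_finite_sums)
  then show ?thesis using d by (auto intro: power2_le_imp_le)
qed

section \<open>Identification of the generator\<close>

lemma Gam_generator:
  assumes x: "\<xi> \<in> hcarrier \<F>" and d: "dGamma T \<xi> \<in> hcarrier \<F>"
  shows "hconverges \<F> (\<lambda>r. hscale \<F> (1 / (\<i> * of_real r)) (hdiff \<F> (Gam r \<xi>) \<xi>)) (dGamma T \<xi>) (at 0)"
proof (rule fock_strong_convergence)
  interpret F: pre_hilbert \<F> by (rule fock_pre_hilbert)
  show "hscale \<F> (1 / (\<i> * of_real r)) (hdiff \<F> (Gam r \<xi>) \<xi>) \<in> hcarrier \<F>" for r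
    using x by simp
  fix bs assume bs: "bs \<in> lists basis"
  have "((\<lambda>h. - \<i> * ((coord (Gam (0 + h) \<xi>) bs - coord (Gam 0 \<xi>) bs) /\<^sub>R h)) \<longlongrightarrow> - \<i> * (\<i> * coord (dGamma T (Gam 0 \<xi>)) bs)) (at 0)"
    using Gam_coord_derivative[OF x bs, of 0] unfolding has_vector_derivative_iff_quotient by (intro tendsto_intros)
  moreover have "coord (hscale \<F> (1 / (\<i> * of_real r)) (hdiff \<F> (Gam r \<xi>) \<xi>)) bs
      = - \<i> * ((coord (Gam (0 + r) \<xi>) bs - coord (Gam 0 \<xi>) bs) /\<^sub>R r)" for r
    using x by (simp add: fock_simps coord_def Gam_zero scaleR_conv_of_real divide_simps)
  ultimately show "((\<lambda>r. coord (hscale \<F> (1 / (\<i> * of_real r)) (hdiff \<F> (Gam r \<xi>) \<xi>)) bs) \<longlongrightarrow> coord (dGamma T \<xi>) bs) (at 0)"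
    using x by (simp only: Gam_zero) simp
next
  interpret F: pre_hilbert \<F> by (rule fock_pre_hilbert)
  show "\<forall>\<^sub>F r in at 0. hnorm \<F> (hscale \<F> (1 / (\<i> * of_real r)) (hdiff \<F> (Gam r \<xi>) \<xi>)) \<le> hnorm \<F> (dGamma T \<xi>)"
    unfolding eventually_at_filter
  proof (intro always_eventually allI impI)
    fix r :: real assume "r \<noteq> 0"
    then show "hnorm \<F> (hscale \<F> (1 / (\<i> * of_real r)) (hdiff \<F> (Gam r \<xi>) \<xi>)) \<le> hnorm \<F> (dGamma T \<xi>)"
      using Gam_difference_bound[OF x d, of r] x by (simp add: norm_divide norm_mult divide_simps)
  qed
qed (fact d)

lemma Gam_exp_vec:
  assumes v: "v \<in> hcarrier H"
  shows "Gam r (exp_vec H v) = exp_vec H (E r v)"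
proof (intro ext)
  fix n xs
  show "Gam r (exp_vec H v) n xs = exp_vec H (E r v) n xs"
  proof (cases "xs \<in> tuples n (hcarrier H)")
    case True
    then have "(\<Prod>x\<leftarrow>xs. hinner H v (E (- r) x)) = (\<Prod>x\<leftarrow>xs. hinner H (E r v) x)"
      using v by (intro arg_cong[of _ _ prod_list] map_cong) (auto simp: E_adjoint tuples_def)
    then show ?thesis using True map_E_mem[OF True, of "- r"] by (simp add: Gam_def exp_vec_eq comp_def)
  qed (simp add: Gam_def exp_vec_eq)
qed

text \<open>The description in \<open>conservation_sa\<close> requires all admissible groups to have
  the same generator. Unitarity moves \<open>U r\<close> onto the exponential vector, whose image is
  prescribed. So \<open>U r\<close> and \<open>Gam r\<close> have the same inner products with a
  total family and agree on the carrier, which is all that \<open>generator\<close>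
  inspects.\<close>

lemma conservation_sa_eq: "conservation_sa H T = generator \<F> Gam"
proof -
  interpret F: pre_hilbert \<F> by (rule fock_pre_hilbert)
  define P where "P U \<longleftrightarrow> unitary_group \<F> U \<and> (\<forall>r. \<forall>v\<in>hcarrier H. U r (exp_vec H v) = exp_vec H (E r v))" for U
  have PG: "P Gam" using Gam_group Gam_exp_vec by (simp add: P_def)
  have uniq: "generator \<F> U = generator \<F> Gam" if U: "P U" for U
  proof -
    have un: "unitary_operator \<F> (U r)" for r using U by (simp add: P_def unitary_group_def)
    have eq: "U r \<xi> = Gam r \<xi>" if x: "\<xi> \<in> hcarrier \<F>" for r \<xi>
    proof (rule F.hdiff_eq_zeroD)
      show mem: "U r \<xi> \<in> hcarrier \<F>" "Gam r \<xi> \<in> hcarrier \<F>"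
        using un[of r] x by (auto simp: unitary_operator_def linear_operator_def)
      show "hdiff \<F> (U r \<xi>) (Gam r \<xi>) = hzero \<F>"
      proof (rule exp_vec_total)
        fix v assume v: "v \<in> hcarrier H"
        have val: "hinner \<F> (W r \<xi>) (exp_vec H v) = hinner \<F> \<xi> (exp_vec H (E (- r) v))" if W: "P W" for W
        proof -
          have "exp_vec H v = W r (exp_vec H (E (- r) v))" using W v by (simp add: P_def E_inverse)
          then have "hinner \<F> (W r \<xi>) (exp_vec H v) = hinner \<F> (W r \<xi>) (W r (exp_vec H (E (- r) v)))" by simp
          also have "\<dots> = hinner \<F> \<xi> (exp_vec H (E (- r) v))"
          proof -
            have "hinner \<F> (W r \<zeta>) (W r \<eta>) = hinner \<F> \<zeta> \<eta>" if "\<zeta> \<in> hcarrier \<F>" "\<eta> \<in> hcarrier \<F>" for \<zeta> \<eta>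
              using W that by (simp add: P_def unitary_group_def unitary_operator_def)
            then show ?thesis using v x by simp
          qed
          finally show ?thesis .
        qed
        show "hinner \<F> (hdiff \<F> (U r \<xi>) (Gam r \<xi>)) (exp_vec H v) = 0"
          using mem v val[OF U] val[OF PG] by simp
      qed (use mem in simp)
    qed
    show ?thesis
    proof
      fix \<xi>
      show "generator \<F> U \<xi> = generator \<F> Gam \<xi>"
        using eq by (cases "\<xi> \<in> hcarrier \<F>") (simp_all add: generator_def cong: if_cong)
    qed
  qed
  have "conservation_sa H T = (THE L. \<exists>U. P U \<and> L = generator \<F> U)"
    unfolding conservation_sa_def P_def unitary_exp_def by (simp only: conj_assoc)
  also have "\<dots> = generator \<F> Gam"
  proof (rule the_equality)
    show "\<exists>U. P U \<and> generator \<F> Gam = generator \<F> U" using PG by blast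
  qed (use uniq in blast)
  finally show ?thesis .
qed

lemma generator_Some:
  assumes "generator \<F> Gam \<xi> = Some \<eta>"
  shows "\<xi> \<in> hcarrier \<F>"
    "hconverges \<F> (\<lambda>r. hscale \<F> (1 / (\<i> * of_real r)) (hdiff \<F> (Gam r \<xi>) \<xi>)) \<eta> (at 0)"
proof -
  interpret F: pre_hilbert \<F> by (rule fock_pre_hilbert)
  let ?q = "\<lambda>r. hscale \<F> (1 / (\<i> * of_real r)) (hdiff \<F> (Gam r \<xi>) \<xi>)"
  show x: "\<xi> \<in> hcarrier \<F>" using assms by (auto simp: generator_def Let_def split: if_splits)
  obtain \<zeta> where z: "hconverges \<F> ?q \<zeta> (at 0)" "\<eta> = hlim \<F> ?q (at 0)"
    using assms by (auto simp: generator_def Let_def split: if_splits)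
  have "\<eta> = \<zeta>" unfolding z(2) using x by (intro F.hlim_eq[OF z(1)]) auto
  then show "hconverges \<F> ?q \<eta> (at 0)" using z(1) by simp
qed

lemma generator_eq:
  assumes x: "\<xi> \<in> hcarrier \<F>" and d: "dGamma T \<xi> \<in> hcarrier \<F>"
  shows "generator \<F> Gam \<xi> = Some (dGamma T \<xi>)"
proof -
  interpret F: pre_hilbert \<F> by (rule fock_pre_hilbert)
  show ?thesis
    using F.hlim_eq[OF Gam_generator[OF x d]] Gam_generator[OF x d] x by (auto simp: generator_def Let_def)
qed

lemma conservation_sa_analytic:
  "\<xi> \<in> analytic_vectors \<Longrightarrow> conservation_sa H T \<xi> = Some (dGamma T \<xi>)"
  unfolding conservation_sa_eq using sa by (intro generator_eq) auto

text \<open>Here \<open>\<xi>\<close> ranges over the full domain of the generator, since the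
  adjoint inside \<open>variance\<close> is taken with respect to that domain.\<close>

lemma conservation_sa_symmetric:
  assumes x: "conservation_sa H T \<xi> = Some \<zeta>" and y: "\<eta> \<in> analytic_vectors"
  shows "\<xi> \<in> hcarrier \<F>" "\<zeta> \<in> hcarrier \<F>" "hinner \<F> \<zeta> \<eta> = hinner \<F> \<xi> (dGamma T \<eta>)"
proof -
  interpret F: pre_hilbert \<F> by (rule fock_pre_hilbert)
  note g = generator_Some[OF x[unfolded conservation_sa_eq]]
  show xm: "\<xi> \<in> hcarrier \<F>" by (rule g(1))
  show zm: "\<zeta> \<in> hcarrier \<F>" using g(2) by (simp add: hconverges_def)
  have ym: "\<eta> \<in> hcarrier \<F>" "dGamma T \<eta> \<in> hcarrier \<F>" using y sa by auto
  have 1: "((\<lambda>r. hinner \<F> (hscale \<F> (1 / (\<i> * of_real r)) (hdiff \<F> (Gam r \<xi>) \<xi>)) \<eta>) \<longlongrightarrow> hinner \<F> \<zeta> \<eta>) (at 0)"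
    using xm ym by (intro F.hconverges_inner[OF g(2)]) auto
  have "((\<lambda>r. cnj (hinner \<F> (hscale \<F> (1 / (\<i> * of_real r)) (hdiff \<F> (Gam r \<eta>) \<eta>)) \<xi>)) \<longlongrightarrow> cnj (hinner \<F> (dGamma T \<eta>) \<xi>)) (at 0)"
    using xm ym by (intro tendsto_cnj F.hconverges_inner[OF Gam_generator]) auto
  \<comment> \<open>The group passes to the other side of the inner product with \<open>- r\<close>,
    so this quotient is reparametrised before the two limits are compared.\<close>
  from filterlim_compose[OF this filterlim_uminus_at_0]
  have 3: "((\<lambda>r. cnj (hinner \<F> (hscale \<F> (1 / (\<i> * of_real (- r))) (hdiff \<F> (Gam (- r) \<eta>) \<eta>)) \<xi>)) \<longlongrightarrow> cnj (hinner \<F> (dGamma T \<eta>) \<xi>)) (at 0)" .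
  have "hinner \<F> (Gam r \<xi>) \<eta> = hinner \<F> \<xi> (Gam (- r) \<eta>)" for r
  proof -
    have "hinner \<F> (Gam (- r) (Gam r \<xi>)) (Gam (- r) \<eta>) = hinner \<F> (Gam r \<xi>) \<eta>"
      using Gam_unitary[of "- r"] xm ym by (simp add: unitary_operator_def)
    then show ?thesis using xm by (simp add: Gam_zero flip: Gam_add)
  qed
  then have "cnj (hinner \<F> (hscale \<F> (1 / (\<i> * of_real (- r))) (hdiff \<F> (Gam (- r) \<eta>) \<eta>)) \<xi>)
      = hinner \<F> (hscale \<F> (1 / (\<i> * of_real r)) (hdiff \<F> (Gam r \<xi>) \<xi>)) \<eta>" for r
    using xm ym F.hinner_commute[of "Gam (- r) \<eta>" \<xi>] F.hinner_commute[of \<eta> \<xi>] by (simp add: algebra_simps)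
  with 3 have "((\<lambda>r. hinner \<F> (hscale \<F> (1 / (\<i> * of_real r)) (hdiff \<F> (Gam r \<xi>) \<xi>)) \<eta>) \<longlongrightarrow> cnj (hinner \<F> (dGamma T \<eta>) \<xi>)) (at 0)"
    by simp
  with 1 have "hinner \<F> \<zeta> \<eta> = cnj (hinner \<F> (dGamma T \<eta>) \<xi>)" using tendsto_unique[OF trivial_limit_at] by blast
  then show "hinner \<F> \<zeta> \<eta> = hinner \<F> \<xi> (dGamma T \<eta>)"
    using F.hinner_commute[OF ym(2) xm] by simp
qed

text \<open>In the function picture \<open>dGamma T\<close> is differentiation along the flow
  \<open>E (- r)\<close>; this is the source of the Leibniz rule.\<close>

lemma dGamma_exp_derivative:
  assumes x: "\<xi> \<in> analytic_vectors" and v: "v \<in> hcarrier H"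
  shows "((\<lambda>r. hinner \<F> \<xi> (exp_vec H (E (- r) v))) has_vector_derivative \<i> * hinner \<F> (dGamma T \<xi>) (exp_vec H v)) (at 0)"
proof -
  interpret F: pre_hilbert \<F> by (rule fock_pre_hilbert)
  have xm: "\<xi> \<in> hcarrier \<F>" "dGamma T \<xi> \<in> hcarrier \<F>" using x sa by auto
  have "((\<lambda>r. \<i> * hinner \<F> (hscale \<F> (1 / (\<i> * of_real r)) (hdiff \<F> (Gam r \<xi>) \<xi>)) (exp_vec H v))
      \<longlongrightarrow> \<i> * hinner \<F> (dGamma T \<xi>) (exp_vec H v)) (at 0)"
    using xm v by (intro tendsto_mult_left F.hconverges_inner[OF Gam_generator]) auto
  moreover have "hinner \<F> (Gam r \<xi>) (exp_vec H v) = hinner \<F> \<xi> (exp_vec H (E (- r) v))" for r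
  proof -
    have "hinner \<F> (Gam r \<xi>) (Gam r (exp_vec H (E (- r) v))) = hinner \<F> \<xi> (exp_vec H (E (- r) v))"
      using Gam_unitary[of r] xm v by (simp add: unitary_operator_def)
    then show ?thesis using v by (simp add: Gam_exp_vec E_inverse)
  qed
  ultimately show ?thesis
    using xm v by (simp add: has_vector_derivative_iff_quotient E_zero scaleR_conv_of_real divide_simps mult.commute)
qed

end

section \<open>Conservation operators as derivations\<close>

lemma sum_Pow_insert:
  assumes "finite S" "i \<notin> S"
  shows "(\<Sum>J\<in>Pow (insert i S). f J) = (\<Sum>J\<in>Pow S. f (insert i J) + f J :: 'b::comm_monoid_add)"
proof -
  have inj: "inj_on (insert i) (Pow S)" using assms(2) by (intro inj_onI) (auto simp: insert_eq_iff)
  have "(\<Sum>J\<in>Pow (insert i S). f J) = (\<Sum>J\<in>Pow S. f J) + (\<Sum>J\<in>insert i ` Pow S. f J)"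
    unfolding Pow_insert using assms by (intro sum.union_disjoint) auto
  also have "(\<Sum>J\<in>insert i ` Pow S. f J) = (\<Sum>J\<in>Pow S. f (insert i J))"
    using inj by (simp add: sum.reindex)
  finally show ?thesis by (simp add: sum.distrib add.commute)
qed

context complex_hilbert_space
begin

text \<open>
  Under \<open>\<xi> \<mapsto> (v \<mapsto> \<langle>\<xi>, e(v)\<rangle>)\<close> conservation operators act as derivations, creation operators as
  multiplication by \<open>\<langle>\<theta>, v\<rangle>\<close>, and the commutation relation between both is the Leibniz rule.
  \<open>derivation X K d\<close> states this for \<open>X\<close> with symbol \<open>K\<close> and additive constant \<open>d\<close>.
\<close>

definition derivation ::
  "((nat \<Rightarrow> 'a list \<Rightarrow> complex) \<Rightarrow> nat \<Rightarrow> 'a list \<Rightarrow> complex) \<Rightarrow> ('a \<Rightarrow> 'a) \<Rightarrow> complex \<Rightarrow> bool" where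
  "derivation X K d \<longleftrightarrow> (\<forall>\<xi>\<in>analytic_vectors. X \<xi> \<in> analytic_vectors)
    \<and> (\<forall>v\<in>hcarrier H. K v \<in> hcarrier H)
    \<and> (\<forall>u\<in>hcarrier H. \<forall>v\<in>hcarrier H. hinner \<F> (X (exp_vec H u)) (exp_vec H v) =
         (hinner H (K u) v + d) * hinner \<F> (exp_vec H u) (exp_vec H v))
    \<and> (\<forall>\<xi>\<in>analytic_vectors. \<forall>J :: nat set set. \<forall>\<theta> \<zeta> a. \<forall>\<zeta>\<^sub>0\<in>analytic_vectors. finite J \<longrightarrow> (\<forall>j\<in>J. \<theta> j \<in> hcarrier H) \<longrightarrow>
         (\<forall>j\<in>J. \<zeta> j \<in> analytic_vectors) \<longrightarrow>
         (\<forall>v\<in>hcarrier H. hinner \<F> \<xi> (exp_vec H v) =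
           (\<Sum>j\<in>J. hinner H (\<theta> j) v * hinner \<F> (\<zeta> j) (exp_vec H v)) + a * hinner \<F> \<zeta>\<^sub>0 (exp_vec H v)) \<longrightarrow>
         (\<forall>v\<in>hcarrier H. hinner \<F> (X \<xi>) (exp_vec H v) =
           (\<Sum>j\<in>J. hinner H (K (\<theta> j)) v * hinner \<F> (\<zeta> j) (exp_vec H v)
              + hinner H (\<theta> j) v * hinner \<F> (X (\<zeta> j)) (exp_vec H v)) + a * hinner \<F> (X \<zeta>\<^sub>0) (exp_vec H v)))"

lemma
  assumes "derivation X K d"
  shows derivation_mem: "\<xi> \<in> analytic_vectors \<Longrightarrow> X \<xi> \<in> analytic_vectors"
    and derivation_symbol: "v \<in> hcarrier H \<Longrightarrow> K v \<in> hcarrier H"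
    and derivation_exp: "u \<in> hcarrier H \<Longrightarrow> v \<in> hcarrier H \<Longrightarrow> hinner \<F> (X (exp_vec H u)) (exp_vec H v) =
         (hinner H (K u) v + d) * hinner \<F> (exp_vec H u) (exp_vec H v)"
  using assms unfolding derivation_def by blast+

text \<open>Creation operators appear only through the factors
  \<open>hinner H (\<theta> j) v\<close>. The term with \<open>a\<close> carries an additive
  constant, and the index type fits the subsets of indices over which products are expanded.\<close>

lemma derivation_Leibniz:
  fixes J :: "nat set set"
  assumes "derivation X K d" "\<xi> \<in> analytic_vectors" "\<zeta>\<^sub>0 \<in> analytic_vectors" "finite J"
    "\<And>j. j \<in> J \<Longrightarrow> \<theta> j \<in> hcarrier H" "\<And>j. j \<in> J \<Longrightarrow> \<zeta> j \<in> analytic_vectors"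
    "\<And>v. v \<in> hcarrier H \<Longrightarrow> hinner \<F> \<xi> (exp_vec H v) =
           (\<Sum>j\<in>J. hinner H (\<theta> j) v * hinner \<F> (\<zeta> j) (exp_vec H v)) + a * hinner \<F> \<zeta>\<^sub>0 (exp_vec H v)"
    "v \<in> hcarrier H"
  shows "hinner \<F> (X \<xi>) (exp_vec H v) =
           (\<Sum>j\<in>J. hinner H (K (\<theta> j)) v * hinner \<F> (\<zeta> j) (exp_vec H v)
              + hinner H (\<theta> j) v * hinner \<F> (X (\<zeta> j)) (exp_vec H v)) + a * hinner \<F> (X \<zeta>\<^sub>0) (exp_vec H v)"
proof -
  note Leibniz = assms(1)[unfolded derivation_def, THEN conjunct2, THEN conjunct2, THEN conjunct2, rule_format]
  show ?thesis by (rule Leibniz[OF assms(2,3,4,5,6,7,8)])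
qed

text \<open>Only symbols on the carrier and operators on analytic vectors matter, so both may be
  rewritten there.\<close>

lemma derivation_cong:
  assumes "derivation X K d" "\<And>v. v \<in> hcarrier H \<Longrightarrow> K v = K' v" "\<And>\<xi>. \<xi> \<in> analytic_vectors \<Longrightarrow> X \<xi> = X' \<xi>"
  shows "derivation X' K' d"
  unfolding derivation_def
proof (intro conjI ballI allI impI)
  fix \<xi> assume "\<xi> \<in> analytic_vectors"
  then show "X' \<xi> \<in> analytic_vectors" using derivation_mem[OF assms(1)] assms(3) by metis
next
  fix v assume "v \<in> hcarrier H"
  then show "K' v \<in> hcarrier H" using derivation_symbol[OF assms(1)] assms(2) by metis
next
  fix u v assume "u \<in> hcarrier H" "v \<in> hcarrier H"
  then show "hinner \<F> (X' (exp_vec H u)) (exp_vec H v) = (hinner H (K' u) v + d) * hinner \<F> (exp_vec H u) (exp_vec H v)"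
    using derivation_exp[OF assms(1)] assms(2,3) analytic_exp_vec by metis
next
  fix \<xi> and J :: "nat set set" and \<theta> \<zeta> a \<zeta>\<^sub>0 v
  assume *: "\<xi> \<in> analytic_vectors" "\<zeta>\<^sub>0 \<in> analytic_vectors" "finite J" "\<forall>j\<in>J. \<theta> j \<in> hcarrier H"
    "\<forall>j\<in>J. \<zeta> j \<in> analytic_vectors" "\<forall>v\<in>hcarrier H. hinner \<F> \<xi> (exp_vec H v) =
           (\<Sum>j\<in>J. hinner H (\<theta> j) v * hinner \<F> (\<zeta> j) (exp_vec H v)) + a * hinner \<F> \<zeta>\<^sub>0 (exp_vec H v)"
    "v \<in> hcarrier H"
  have "hinner \<F> (X \<xi>) (exp_vec H v) =
           (\<Sum>j\<in>J. hinner H (K (\<theta> j)) v * hinner \<F> (\<zeta> j) (exp_vec H v)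
              + hinner H (\<theta> j) v * hinner \<F> (X (\<zeta> j)) (exp_vec H v)) + a * hinner \<F> (X \<zeta>\<^sub>0) (exp_vec H v)"
    using * by (intro derivation_Leibniz[OF assms(1)]) auto
  also have "(\<Sum>j\<in>J. hinner H (K (\<theta> j)) v * hinner \<F> (\<zeta> j) (exp_vec H v)
              + hinner H (\<theta> j) v * hinner \<F> (X (\<zeta> j)) (exp_vec H v)) =
      (\<Sum>j\<in>J. hinner H (K' (\<theta> j)) v * hinner \<F> (\<zeta> j) (exp_vec H v)
              + hinner H (\<theta> j) v * hinner \<F> (X' (\<zeta> j)) (exp_vec H v))"
    using *(4,5) assms(2,3) by (intro sum.cong) auto
  finally show "hinner \<F> (X' \<xi>) (exp_vec H v) =
           (\<Sum>j\<in>J. hinner H (K' (\<theta> j)) v * hinner \<F> (\<zeta> j) (exp_vec H v)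
              + hinner H (\<theta> j) v * hinner \<F> (X' (\<zeta> j)) (exp_vec H v)) + a * hinner \<F> (X' \<zeta>\<^sub>0) (exp_vec H v)"
    using *(1,2) assms(3) by simp
qed

lemma fock_inner_lin_comb:
  assumes "\<xi> \<in> hcarrier \<F>" "\<eta> \<in> hcarrier \<F>" "\<zeta> \<in> hcarrier \<F>"
  shows "hinner \<F> (\<lambda>n xs. a * \<xi> n xs + b * \<eta> n xs) \<zeta> = a * hinner \<F> \<xi> \<zeta> + b * hinner \<F> \<eta> \<zeta>"
proof -
  interpret F: pre_hilbert \<F> by (rule fock_pre_hilbert)
  have "(\<lambda>n xs. a * \<xi> n xs + b * \<eta> n xs) = hadd \<F> (hscale \<F> a \<xi>) (hscale \<F> b \<eta>)" by (simp add: fock_simps)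
  then show ?thesis using assms by simp
qed

lemma derivation_lin_comb:
  assumes X: "derivation X K d" and X': "derivation X' K' d'"
  shows "derivation (\<lambda>\<xi> n xs. b * X \<xi> n xs + c * X' \<xi> n xs) (\<lambda>v. hadd H (hscale H b (K v)) (hscale H c (K' v))) (b * d + c * d')"
  unfolding derivation_def
proof (intro conjI ballI allI impI)
  note mem = derivation_mem[OF X] derivation_mem[OF X'] derivation_symbol[OF X] derivation_symbol[OF X']
  show "(\<lambda>n xs. b * X \<xi> n xs + c * X' \<xi> n xs) \<in> analytic_vectors" if "\<xi> \<in> analytic_vectors" for \<xi>
    using that mem by simp
  show "hadd H (hscale H b (K v)) (hscale H c (K' v)) \<in> hcarrier H" if "v \<in> hcarrier H" for v
    using that mem by simp
  show "hinner \<F> (\<lambda>n xs. b * X (exp_vec H u) n xs + c * X' (exp_vec H u) n xs) (exp_vec H v) =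
      (hinner H (hadd H (hscale H b (K u)) (hscale H c (K' u))) v + (b * d + c * d')) * hinner \<F> (exp_vec H u) (exp_vec H v)"
    if "u \<in> hcarrier H" "v \<in> hcarrier H" for u v
    using that mem by (simp add: fock_inner_lin_comb derivation_exp[OF X] derivation_exp[OF X'] algebra_simps)
  fix \<xi> and J :: "nat set set" and \<theta> \<zeta> a \<zeta>\<^sub>0 v
  assume *: "\<xi> \<in> analytic_vectors" "\<zeta>\<^sub>0 \<in> analytic_vectors" "finite J" "\<forall>j\<in>J. \<theta> j \<in> hcarrier H"
    "\<forall>j\<in>J. \<zeta> j \<in> analytic_vectors" "\<forall>v\<in>hcarrier H. hinner \<F> \<xi> (exp_vec H v) =
           (\<Sum>j\<in>J. hinner H (\<theta> j) v * hinner \<F> (\<zeta> j) (exp_vec H v)) + a * hinner \<F> \<zeta>\<^sub>0 (exp_vec H v)"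
    and v: "v \<in> hcarrier H"
  let ?e = "exp_vec H v"
  have 1: "hinner \<F> (X \<xi>) ?e = (\<Sum>j\<in>J. hinner H (K (\<theta> j)) v * hinner \<F> (\<zeta> j) ?e + hinner H (\<theta> j) v * hinner \<F> (X (\<zeta> j)) ?e)
      + a * hinner \<F> (X \<zeta>\<^sub>0) ?e"
    using * v by (intro derivation_Leibniz[OF X]) auto
  have 2: "hinner \<F> (X' \<xi>) ?e = (\<Sum>j\<in>J. hinner H (K' (\<theta> j)) v * hinner \<F> (\<zeta> j) ?e + hinner H (\<theta> j) v * hinner \<F> (X' (\<zeta> j)) ?e)
      + a * hinner \<F> (X' \<zeta>\<^sub>0) ?e"
    using * v by (intro derivation_Leibniz[OF X']) auto
  have lc: "hinner \<F> (\<lambda>n xs. b * X \<eta> n xs + c * X' \<eta> n xs) ?e = b * hinner \<F> (X \<eta>) ?e + c * hinner \<F> (X' \<eta>) ?e"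
    if "\<eta> \<in> analytic_vectors" for \<eta>
    using that v mem by (intro fock_inner_lin_comb) auto
  have "(\<Sum>j\<in>J. hinner H (hadd H (hscale H b (K (\<theta> j))) (hscale H c (K' (\<theta> j)))) v * hinner \<F> (\<zeta> j) ?e
       + hinner H (\<theta> j) v * hinner \<F> (\<lambda>n xs. b * X (\<zeta> j) n xs + c * X' (\<zeta> j) n xs) ?e) =
     (\<Sum>j\<in>J. b * (hinner H (K (\<theta> j)) v * hinner \<F> (\<zeta> j) ?e + hinner H (\<theta> j) v * hinner \<F> (X (\<zeta> j)) ?e)
       + c * (hinner H (K' (\<theta> j)) v * hinner \<F> (\<zeta> j) ?e + hinner H (\<theta> j) v * hinner \<F> (X' (\<zeta> j)) ?e))"
    using *(4,5) v mem lc by (intro sum.cong) (auto simp: algebra_simps)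
  then show "hinner \<F> (\<lambda>n xs. b * X \<xi> n xs + c * X' \<xi> n xs) ?e =
      (\<Sum>j\<in>J. hinner H (hadd H (hscale H b (K (\<theta> j))) (hscale H c (K' (\<theta> j)))) v * hinner \<F> (\<zeta> j) ?e
       + hinner H (\<theta> j) v * hinner \<F> (\<lambda>n xs. b * X (\<zeta> j) n xs + c * X' (\<zeta> j) n xs) ?e)
      + a * hinner \<F> (\<lambda>n xs. b * X \<zeta>\<^sub>0 n xs + c * X' \<zeta>\<^sub>0 n xs) ?e"
    using lc[OF *(1)] lc[OF *(2)] 1 2 by (simp add: sum.distrib sum_distrib_left algebra_simps)
qed

text \<open>Together with \<open>derivation_lin_comb\<close> this gives centring: subtracting a
  scalar \<open>c\<close> keeps the symbol and shifts the constant by \<open>- c\<close>.\<close>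

lemma derivation_id: "derivation (\<lambda>\<xi>. \<xi>) (\<lambda>v. hzero H) 1"
  unfolding derivation_def by (auto simp: algebra_simps)

text \<open>The assumed identity of functions is evaluated along \<open>E (- r) v\<close> and
  differentiated at 0 on both sides. For exponential vectors the function is
  \<open>exp (hinner H u v)\<close>, and the chain rule produces the factor
  \<open>hinner H (T u) v\<close>.\<close>

lemma derivation_dGamma:
  assumes T: "self_adjoint H T"
  shows "derivation (dGamma T) T 0"
proof -
  interpret S: self_adjoint_op H T using T by unfold_locales
  have dchi: "((\<lambda>r. hinner H \<theta> (S.E (- r) v)) has_vector_derivative \<i> * hinner H (T \<theta>) v) (at 0)"
    if "\<theta> \<in> hcarrier H" "v \<in> hcarrier H" for \<theta> v using that by (intro S.E_derivative_inner)
  show ?thesis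
    unfolding derivation_def
  proof (intro conjI ballI allI impI)
    show "dGamma T \<xi> \<in> analytic_vectors" if "\<xi> \<in> analytic_vectors" for \<xi> using that T by simp
    show "T v \<in> hcarrier H" if "v \<in> hcarrier H" for v using that by simp
  next
    fix u v assume u: "u \<in> hcarrier H" and v: "v \<in> hcarrier H"
    have "((\<lambda>r. hinner \<F> (exp_vec H u) (exp_vec H (S.E (- r) v))) has_vector_derivative \<i> * hinner \<F> (dGamma T (exp_vec H u)) (exp_vec H v)) (at 0)"
      using u v by (intro S.dGamma_exp_derivative) auto
    then have 1: "((\<lambda>r. exp (hinner H u (S.E (- r) v))) has_vector_derivative \<i> * hinner \<F> (dGamma T (exp_vec H u)) (exp_vec H v)) (at 0)"
      using u v by (simp add: inner_exp_exp)
    have "((exp \<circ> (\<lambda>r. hinner H u (S.E (- r) v))) has_vector_derivative (\<i> * hinner H (T u) v) * exp (hinner H u (S.E (- 0) v))) (at 0)"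
      using dchi[OF u v] by (rule field_vector_diff_chain_at) (rule DERIV_exp)
    then have 2: "((\<lambda>r. exp (hinner H u (S.E (- r) v))) has_vector_derivative (\<i> * hinner H (T u) v) * exp (hinner H u v)) (at 0)"
      using v by (simp add: comp_def S.E_zero)
    have "\<i> * hinner \<F> (dGamma T (exp_vec H u)) (exp_vec H v) = (\<i> * hinner H (T u) v) * exp (hinner H u v)"
      using 1 2 by (rule vector_derivative_unique_at)
    then show "hinner \<F> (dGamma T (exp_vec H u)) (exp_vec H v) = (hinner H (T u) v + 0) * hinner \<F> (exp_vec H u) (exp_vec H v)"
      using u v by (simp add: inner_exp_exp)
  next
    fix \<xi> and J :: "nat set set" and \<theta> \<zeta> a \<zeta>\<^sub>0 v
    assume *: "\<xi> \<in> analytic_vectors" "\<zeta>\<^sub>0 \<in> analytic_vectors" "finite J" "\<forall>j\<in>J. \<theta> j \<in> hcarrier H"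
      "\<forall>j\<in>J. \<zeta> j \<in> analytic_vectors" "\<forall>v\<in>hcarrier H. hinner \<F> \<xi> (exp_vec H v) =
             (\<Sum>j\<in>J. hinner H (\<theta> j) v * hinner \<F> (\<zeta> j) (exp_vec H v)) + a * hinner \<F> \<zeta>\<^sub>0 (exp_vec H v)"
      and v: "v \<in> hcarrier H"
    let ?v = "\<lambda>r. S.E (- r) v" and ?e = "exp_vec H v"
    have ex: "((\<lambda>r. hinner \<F> \<eta> (exp_vec H (?v r))) has_vector_derivative \<i> * hinner \<F> (dGamma T \<eta>) ?e) (at 0)"
      if "\<eta> \<in> analytic_vectors" for \<eta> using that v by (intro S.dGamma_exp_derivative)
    have "((\<lambda>r. (\<Sum>j\<in>J. hinner H (\<theta> j) (?v r) * hinner \<F> (\<zeta> j) (exp_vec H (?v r))) + a * hinner \<F> \<zeta>\<^sub>0 (exp_vec H (?v r)))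
        has_vector_derivative (\<Sum>j\<in>J. hinner H (\<theta> j) (?v 0) * (\<i> * hinner \<F> (dGamma T (\<zeta> j)) ?e)
          + \<i> * hinner H (T (\<theta> j)) v * hinner \<F> (\<zeta> j) (exp_vec H (?v 0))) + a * (\<i> * hinner \<F> (dGamma T \<zeta>\<^sub>0) ?e)) (at 0)"
      using * v by (intro has_vector_derivative_add has_vector_derivative_sum has_vector_derivative_mult
          has_vector_derivative_mult_right dchi ex) auto
    moreover have "(\<Sum>j\<in>J. hinner H (\<theta> j) (?v r) * hinner \<F> (\<zeta> j) (exp_vec H (?v r))) + a * hinner \<F> \<zeta>\<^sub>0 (exp_vec H (?v r))
        = hinner \<F> \<xi> (exp_vec H (?v r))" for r
      using bspec[OF *(6), of "?v r"] v by simp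
    moreover have "(\<Sum>j\<in>J. hinner H (\<theta> j) (?v 0) * (\<i> * hinner \<F> (dGamma T (\<zeta> j)) ?e)
          + \<i> * hinner H (T (\<theta> j)) v * hinner \<F> (\<zeta> j) (exp_vec H (?v 0))) + a * (\<i> * hinner \<F> (dGamma T \<zeta>\<^sub>0) ?e)
       = \<i> * ((\<Sum>j\<in>J. hinner H (T (\<theta> j)) v * hinner \<F> (\<zeta> j) ?e
          + hinner H (\<theta> j) v * hinner \<F> (dGamma T (\<zeta> j)) ?e) + a * hinner \<F> (dGamma T \<zeta>\<^sub>0) ?e)"
    proof -
      have "(\<Sum>j\<in>J. hinner H (\<theta> j) (?v 0) * (\<i> * hinner \<F> (dGamma T (\<zeta> j)) ?e)
          + \<i> * hinner H (T (\<theta> j)) v * hinner \<F> (\<zeta> j) (exp_vec H (?v 0)))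
        = \<i> * (\<Sum>j\<in>J. hinner H (T (\<theta> j)) v * hinner \<F> (\<zeta> j) ?e + hinner H (\<theta> j) v * hinner \<F> (dGamma T (\<zeta> j)) ?e)"
        unfolding sum_distrib_left using v by (intro sum.cong) (auto simp: S.E_zero algebra_simps)
      then show ?thesis by (simp only: distrib_left mult.left_commute)
    qed
    ultimately have 1: "((\<lambda>r. hinner \<F> \<xi> (exp_vec H (?v r)))
        has_vector_derivative \<i> * ((\<Sum>j\<in>J. hinner H (T (\<theta> j)) v * hinner \<F> (\<zeta> j) ?e
          + hinner H (\<theta> j) v * hinner \<F> (dGamma T (\<zeta> j)) ?e) + a * hinner \<F> (dGamma T \<zeta>\<^sub>0) ?e)) (at 0)"
      by simp
    have "\<i> * hinner \<F> (dGamma T \<xi>) ?e = \<i> * ((\<Sum>j\<in>J. hinner H (T (\<theta> j)) v * hinner \<F> (\<zeta> j) ?e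
          + hinner H (\<theta> j) v * hinner \<F> (dGamma T (\<zeta> j)) ?e) + a * hinner \<F> (dGamma T \<zeta>\<^sub>0) ?e)"
      using ex[OF *(1)] 1 by (rule vector_derivative_unique_at)
    then show "hinner \<F> (dGamma T \<xi>) ?e = (\<Sum>j\<in>J. hinner H (T (\<theta> j)) v * hinner \<F> (\<zeta> j) ?e
          + hinner H (\<theta> j) v * hinner \<F> (dGamma T (\<zeta> j)) ?e) + a * hinner \<F> (dGamma T \<zeta>\<^sub>0) ?e"
      by simp
  qed
qed

text \<open>The rightmost operator multiplies the function of the exponential vector by
  \<open>hinner H (K k u) v + d k\<close>. Each further operator acts either on this prefactor or on
  the remaining vector, and \<open>J\<close> records those that act on the prefactor.\<close>

lemma derivation_product_expansion:
  fixes "is" :: "nat list" and k :: nat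
  assumes Y: "\<And>i. i \<in> set is \<union> {k} \<Longrightarrow> derivation (Y i) (K i) (d i)" and u: "u \<in> hcarrier H"
    and dist: "distinct is" and v: "v \<in> hcarrier H"
  shows "hinner \<F> (foldr Y (is @ [k]) (exp_vec H u)) (exp_vec H v) =
    (\<Sum>J\<in>Pow (set is). hinner H (foldr K (filter (\<lambda>i. i \<in> J) is @ [k]) u) v
       * hinner \<F> (foldr Y (filter (\<lambda>i. i \<notin> J) is) (exp_vec H u)) (exp_vec H v))
    + d k * hinner \<F> (foldr Y is (exp_vec H u)) (exp_vec H v)"
  using Y dist v
proof (induction "is" arbitrary: v)
  case Nil
  then show ?case using u derivation_exp[OF Nil(1)[of k]] by (simp add: algebra_simps)
next
  case (Cons i "is")
  note D = Cons.prems(1)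
  have Yan: "foldr Y js (exp_vec H u) \<in> analytic_vectors" if "set js \<subseteq> set (i # is) \<union> {k}" for js
    using that
  proof (induction js)
    case (Cons j js)
    then have "derivation (Y j) (K j) (d j)" using D by auto
    from derivation_mem[OF this] Cons show ?case by simp
  qed (simp add: u)
  have Kc: "foldr K js u \<in> hcarrier H" if "set js \<subseteq> set (i # is) \<union> {k}" for js
    using that
  proof (induction js)
    case (Cons j js)
    then have "derivation (Y j) (K j) (d j)" using D by auto
    from derivation_symbol[OF this] Cons show ?case by simp
  qed (simp add: u)
  let ?f = "\<lambda>J. filter (\<lambda>i. i \<in> J) is" and ?g = "\<lambda>J. filter (\<lambda>i. i \<notin> J) is" and ?e = "exp_vec H v"
  have "hinner \<F> (foldr Y ((i # is) @ [k]) (exp_vec H u)) ?e = hinner \<F> (Y i (foldr Y (is @ [k]) (exp_vec H u))) ?e" by simp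
  also have "\<dots> = (\<Sum>J\<in>Pow (set is). hinner H (K i (foldr K (?f J @ [k]) u)) v * hinner \<F> (foldr Y (?g J) (exp_vec H u)) ?e
       + hinner H (foldr K (?f J @ [k]) u) v * hinner \<F> (Y i (foldr Y (?g J) (exp_vec H u))) ?e)
       + d k * hinner \<F> (Y i (foldr Y is (exp_vec H u))) ?e"
  proof (rule derivation_Leibniz[where X = "Y i" and K = "K i" and d = "d i" and a = "d k"
      and \<theta> = "\<lambda>J. foldr K (?f J @ [k]) u" and \<zeta> = "\<lambda>J. foldr Y (?g J) (exp_vec H u)"])
    show "derivation (Y i) (K i) (d i)" using Cons.prems(1) by simp
    show "hinner \<F> (foldr Y (is @ [k]) (exp_vec H u)) (exp_vec H w) =
      (\<Sum>J\<in>Pow (set is). hinner H (foldr K (?f J @ [k]) u) w * hinner \<F> (foldr Y (?g J) (exp_vec H u)) (exp_vec H w))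
      + d k * hinner \<F> (foldr Y is (exp_vec H u)) (exp_vec H w)" if "w \<in> hcarrier H" for w
      using Cons.prems(2) that by (intro Cons.IH Cons.prems(1)) auto
  qed (use Cons.prems(3) in \<open>auto intro!: Yan Kc simp del: foldr_append\<close>)
  also have "(\<Sum>J\<in>Pow (set is). hinner H (K i (foldr K (?f J @ [k]) u)) v * hinner \<F> (foldr Y (?g J) (exp_vec H u)) ?e
       + hinner H (foldr K (?f J @ [k]) u) v * hinner \<F> (Y i (foldr Y (?g J) (exp_vec H u))) ?e) =
    (\<Sum>J\<in>Pow (set (i # is)). hinner H (foldr K (filter (\<lambda>i. i \<in> J) (i # is) @ [k]) u) v
       * hinner \<F> (foldr Y (filter (\<lambda>i. i \<notin> J) (i # is)) (exp_vec H u)) ?e)"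
  proof -
    have i: "i \<notin> set is" using Cons.prems(2) by simp
    \<comment> \<open>Since \<open>i\<close> does not occur in the tail, adding it to
      \<open>J\<close> does not change which entries of the tail are selected.\<close>
    have f: "filter (\<lambda>x. x = i \<or> x \<in> J) is = ?f J" "filter (\<lambda>x. x \<noteq> i \<and> x \<notin> J) is = ?g J" for J
      using i by (auto intro!: filter_cong)
    have "i \<notin> J" if "J \<in> Pow (set is)" for J using that i by blast
    then show ?thesis
      unfolding list.set sum_Pow_insert[OF finite_set i] by (intro sum.cong) (auto simp: f)
  qed
  finally show ?case by simp
qed

text \<open>At \<open>v = u\<close> the term with \<open>J = {}\<close> is
  \<open>hinner H (K k u) u\<close> times the moment of \<open>is\<close>, and the additive constant
  of \<open>Y k\<close> cancels it exactly.\<close>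

lemma centred_moment_recursion:
  fixes "is" :: "nat list" and k :: nat
  assumes Y: "\<And>i. i \<in> set is \<union> {k} \<Longrightarrow> derivation (Y i) (K i) (- hinner H (K i u) u)" and u: "u \<in> hcarrier H"
    and dist: "distinct is"
  defines "\<nu> \<equiv> \<lambda>js. hinner \<F> (foldr Y js (exp_vec H u)) (exp_vec H u) / hinner \<F> (exp_vec H u) (exp_vec H u)"
  shows "\<nu> (is @ [k]) = (\<Sum>J\<in>Pow (set is) - {{}}. hinner H (foldr K (filter (\<lambda>i. i \<in> J) is @ [k]) u) u
       * \<nu> (filter (\<lambda>i. i \<notin> J) is))"
proof -
  let ?t = "\<lambda>J. hinner H (foldr K (filter (\<lambda>i. i \<in> J) is @ [k]) u) u * hinner \<F> (foldr Y (filter (\<lambda>i. i \<notin> J) is) (exp_vec H u)) (exp_vec H u)"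
  have "hinner \<F> (foldr Y (is @ [k]) (exp_vec H u)) (exp_vec H u) = (\<Sum>J\<in>Pow (set is). ?t J)
      - hinner H (K k u) u * hinner \<F> (foldr Y is (exp_vec H u)) (exp_vec H u)"
    using derivation_product_expansion[OF Y u dist u] by simp
  also have "(\<Sum>J\<in>Pow (set is). ?t J) = ?t {} + (\<Sum>J\<in>Pow (set is) - {{}}. ?t J)"
    by (intro sum.remove) auto
  finally show ?thesis by (simp add: \<nu>_def sum_divide_distrib)
qed

section \<open>Splitting a bounded operator into self-adjoint parts\<close>

definition real_part :: "('a \<Rightarrow> 'a) \<Rightarrow> 'a \<Rightarrow> 'a" where
  "real_part T x = hscale H (1 / 2) (hadd H (T x) (bounded_adjoint H T x))"

definition imag_part :: "('a \<Rightarrow> 'a) \<Rightarrow> 'a \<Rightarrow> 'a" where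
  "imag_part T x = hscale H (1 / (2 * \<i>)) (hdiff H (T x) (bounded_adjoint H T x))"

lemma bounded_operator_comb:
  assumes "bounded_operator H S" "bounded_operator H T"
  shows "bounded_operator H (\<lambda>x. hadd H (hscale H a (S x)) (hscale H b (T x)))"
proof -
  have lin: "linear_operator H S" "linear_operator H T" using assms by (auto simp: bounded_operator_def)
  obtain K L where K: "K > 0" "\<forall>x\<in>hcarrier H. hnorm H (S x) \<le> K * hnorm H x"
    and L: "L > 0" "\<forall>x\<in>hcarrier H. hnorm H (T x) \<le> L * hnorm H x" using assms bounded_operatorD by metis
  note SL = linear_operatorD[OF lin(1)] and TL = linear_operatorD[OF lin(2)]
  have "hnorm H (hadd H (hscale H a (S x)) (hscale H b (T x))) \<le> (cmod a * K + cmod b * L) * hnorm H x"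
    if x: "x \<in> hcarrier H" for x
  proof -
    have "hnorm H (hadd H (hscale H a (S x)) (hscale H b (T x))) \<le> cmod a * hnorm H (S x) + cmod b * hnorm H (T x)"
      using x hnorm_triangle[of "hscale H a (S x)" "hscale H b (T x)"] by (simp add: SL TL)
    also have "\<dots> \<le> cmod a * (K * hnorm H x) + cmod b * (L * hnorm H x)"
      using x K(2) L(2) by (intro add_mono mult_left_mono) auto
    finally show ?thesis by (simp add: algebra_simps)
  qed
  moreover have "linear_operator H (\<lambda>x. hadd H (hscale H a (S x)) (hscale H b (T x)))"
    unfolding linear_operator_def by (auto intro!: weak_eqI simp: SL TL algebra_simps)
  ultimately show ?thesis unfolding bounded_operator_def by blast
qed

lemma hinner_adjoint_left:
  assumes T: "bounded_operator H T" and x: "x \<in> hcarrier H" and y: "y \<in> hcarrier H"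
  shows "hinner H (bounded_adjoint H T x) y = hinner H x (T y)"
  using hinner_adjoint[OF T x y] hinner_commute[of "T y" x] hinner_commute[of y "bounded_adjoint H T x"] x y T
  by (simp add: linear_operatorD bounded_operator_def)

lemma
  assumes T: "bounded_operator H T"
  shows real_part_self_adjoint: "self_adjoint H (real_part T)"
    and imag_part_self_adjoint: "self_adjoint H (imag_part T)"
proof -
  have lin: "x \<in> hcarrier H \<Longrightarrow> T x \<in> hcarrier H" for x using T by (simp add: bounded_operator_def linear_operatorD)
  have A: "bounded_operator H (bounded_adjoint H T)" using T by (rule bounded_adjoint_bounded)
  have r: "bounded_operator H (real_part T)"
  proof -
    have "bounded_operator H (\<lambda>x. hadd H (hscale H (1/2) (T x)) (hscale H (1/2) (bounded_adjoint H T x)))"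
      using T A by (rule bounded_operator_comb)
    moreover have "real_part T x = hadd H (hscale H (1/2) (T x)) (hscale H (1/2) (bounded_adjoint H T x))" if "x \<in> hcarrier H" for x
      using that lin T by (simp add: real_part_def hscale_add_right)
    ultimately show ?thesis by (simp add: bounded_operator_def linear_operator_def)
  qed
  have i: "bounded_operator H (imag_part T)"
  proof -
    have "bounded_operator H (\<lambda>x. hadd H (hscale H (1/(2*\<i>)) (T x)) (hscale H (-1/(2*\<i>)) (bounded_adjoint H T x)))"
      using T A by (rule bounded_operator_comb)
    moreover have "imag_part T x = hadd H (hscale H (1/(2*\<i>)) (T x)) (hscale H (-1/(2*\<i>)) (bounded_adjoint H T x))" if "x \<in> hcarrier H" for x
      using that lin T by (simp add: imag_part_def hdiff_def hscale_add_right hscale_hscale)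
    ultimately show ?thesis by (simp add: bounded_operator_def linear_operator_def)
  qed
  show "self_adjoint H (real_part T)"
    using r lin T by (auto simp: self_adjoint_def real_part_def hinner_adjoint_left simp flip: hinner_adjoint)
  show "self_adjoint H (imag_part T)"
    using i lin T by (auto simp: self_adjoint_def imag_part_def hinner_adjoint_left algebra_simps simp flip: hinner_adjoint)
qed

text \<open>The second identity supplies the symbol of the formal adjoint, which the variance
  requires. The coefficient 1 matches the shape produced by
  \<open>derivation_lin_comb\<close>.\<close>

lemma real_imag_part:
  assumes T: "bounded_operator H T" and x: "x \<in> hcarrier H"
  shows "hadd H (hscale H 1 (real_part T x)) (hscale H \<i> (imag_part T x)) = T x"
    "hadd H (hscale H 1 (real_part T x)) (hscale H (- \<i>) (imag_part T x)) = bounded_adjoint H T x"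
proof -
  have "T x \<in> hcarrier H" "bounded_adjoint H T x \<in> hcarrier H"
    using T x by (auto simp: bounded_operator_def linear_operatorD)
  then show "hadd H (hscale H 1 (real_part T x)) (hscale H \<i> (imag_part T x)) = T x"
    "hadd H (hscale H 1 (real_part T x)) (hscale H (- \<i>) (imag_part T x)) = bounded_adjoint H T x"
    by (auto intro!: weak_eqI simp: real_part_def imag_part_def field_simps)
qed

definition number_op where
  "number_op T \<xi> = (\<lambda>n xs. 1 * dGamma (real_part T) \<xi> n xs + \<i> * dGamma (imag_part T) \<xi> n xs)"

lemma derivation_number_op:
  assumes T: "bounded_operator H T"
  shows "derivation (number_op T) T 0"
proof -
  have D: "derivation (\<lambda>\<xi> n xs. 1 * dGamma (real_part T) \<xi> n xs + \<i> * dGamma (imag_part T) \<xi> n xs)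
      (\<lambda>v. hadd H (hscale H 1 (real_part T v)) (hscale H \<i> (imag_part T v))) (1 * 0 + \<i> * 0)"
    using T by (intro derivation_lin_comb derivation_dGamma real_part_self_adjoint imag_part_self_adjoint)
  have "derivation (number_op T) T (1 * 0 + \<i> * 0)"
    using D by (rule derivation_cong) (simp_all only: real_imag_part(1)[OF T] number_op_def)
  then show ?thesis by simp
qed

end

section \<open>Expectation, variance and standardisation in an exponential vector\<close>

context complex_hilbert_space
begin

lemma conservation_sa_real_imag:
  assumes "bounded_operator H T" "\<xi> \<in> analytic_vectors"
  shows "conservation_sa H (real_part T) \<xi> = Some (dGamma (real_part T) \<xi>)"
    "conservation_sa H (imag_part T) \<xi> = Some (dGamma (imag_part T) \<xi>)"
proof -
  interpret R: self_adjoint_op H "real_part T" using real_part_self_adjoint[OF assms(1)] by unfold_locales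
  interpret S: self_adjoint_op H "imag_part T" using imag_part_self_adjoint[OF assms(1)] by unfold_locales
  show "conservation_sa H (real_part T) \<xi> = Some (dGamma (real_part T) \<xi>)"
    "conservation_sa H (imag_part T) \<xi> = Some (dGamma (imag_part T) \<xi>)"
    using assms(2) R.conservation_sa_analytic S.conservation_sa_analytic by auto
qed

lemma conservation_parts:
  "conservation H T = op_add \<F> (conservation_sa H (real_part T)) (op_scale \<F> \<i> (conservation_sa H (imag_part T)))"
  unfolding conservation_def real_part_def imag_part_def ..

lemma conservation_analytic:
  assumes "bounded_operator H T" "\<xi> \<in> analytic_vectors"
  shows "conservation H T \<xi> = Some (number_op T \<xi>)"
  using conservation_sa_real_imag[OF assms]
  by (simp add: conservation_parts op_add_def op_scale_def domIff number_op_def fock_simps)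

lemma op_shift_analytic:
  assumes "X \<xi> = Some \<eta>" "\<xi> \<in> analytic_vectors"
  shows "op_shift \<F> X c \<xi> = Some (\<lambda>n xs. 1 * \<eta> n xs + (- c) * \<xi> n xs)"
  using assms by (simp add: op_shift_def op_add_def op_scale_def op_id_def domIff fock_simps)

lemma exp_vec_inner_nonzero: "v \<in> hcarrier H \<Longrightarrow> hinner \<F> (exp_vec H v) (exp_vec H v) \<noteq> 0"
  by (simp add: inner_exp_exp)

lemma expect_conservation:
  assumes T: "bounded_operator H T" and u: "u \<in> hcarrier H"
  shows "expect H u (conservation H T) = hinner H (T u) u"
  using derivation_exp[OF derivation_number_op[OF T] u u] exp_vec_inner_nonzero[OF u] u
  by (simp add: expect_def conservation_analytic[OF T])

definition centred :: "('a \<Rightarrow> 'a) \<Rightarrow> complex \<Rightarrow> (nat \<Rightarrow> 'a list \<Rightarrow> complex) \<Rightarrow> nat \<Rightarrow> 'a list \<Rightarrow> complex" where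
  "centred T c \<xi> = (\<lambda>n xs. 1 * number_op T \<xi> n xs + (- c) * \<xi> n xs)"

lemma derivation_centred:
  assumes T: "bounded_operator H T"
  shows "derivation (centred T c) T (- c)"
proof -
  have "derivation (\<lambda>\<xi> n xs. 1 * number_op T \<xi> n xs + (- c) * \<xi> n xs) (\<lambda>v. hadd H (hscale H 1 (T v)) (hscale H (- c) (hzero H))) (1 * 0 + (- c) * 1)"
    by (intro derivation_lin_comb derivation_number_op T derivation_id)
  then have "derivation (centred T c) T (1 * 0 + (- c) * 1)"
  proof (rule derivation_cong)
    fix v assume v: "v \<in> hcarrier H"
    then have "T v \<in> hcarrier H" using T by (simp add: bounded_operator_def linear_operatorD)
    then show "hadd H (hscale H 1 (T v)) (hscale H (- c) (hzero H)) = T v" by (intro weak_eqI) auto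
  qed (simp add: centred_def)
  then show ?thesis by simp
qed

text \<open>Moves the shifted operator, on its full domain, to its formal adjoint acting on an
  analytic vector. This provides the witness that \<open>op_adjoint\<close> asks for.\<close>

lemma hinner_dGamma_parts:
  assumes T: "bounded_operator H T" and y: "\<eta> \<in> analytic_vectors"
    and x: "\<xi> \<in> dom (op_shift \<F> (conservation H T) c)"
  shows "\<xi> \<in> hcarrier \<F>"
    "hinner \<F> (the (op_shift \<F> (conservation H T) c \<xi>)) \<eta> =
      hinner \<F> \<xi> (\<lambda>n xs. 1 * (\<lambda>n xs. 1 * dGamma (real_part T) \<eta> n xs + (- \<i>) * dGamma (imag_part T) \<eta> n xs) n xs + (- cnj c) * \<eta> n xs)"
proof -
  interpret F: pre_hilbert \<F> by (rule fock_pre_hilbert)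
  interpret R: self_adjoint_op H "real_part T" using real_part_self_adjoint[OF T] by unfold_locales
  interpret S: self_adjoint_op H "imag_part T" using imag_part_self_adjoint[OF T] by unfold_locales
  obtain \<zeta> \<theta> where z: "conservation_sa H (real_part T) \<xi> = Some \<zeta>" "conservation_sa H (imag_part T) \<xi> = Some \<theta>"
    and xm: "\<xi> \<in> hcarrier \<F>"
    using x by (auto simp: op_shift_def conservation_parts op_add_def op_scale_def op_id_def domIff split: if_splits)
  note zr = R.conservation_sa_symmetric[OF z(1) y] and zs = S.conservation_sa_symmetric[OF z(2) y]
  have val: "the (op_shift \<F> (conservation H T) c \<xi>) = hadd \<F> (hadd \<F> \<zeta> (hscale \<F> \<i> \<theta>)) (hscale \<F> (- c) \<xi>)"
    using z xm by (simp add: op_shift_def conservation_parts op_add_def op_scale_def op_id_def domIff)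
  have an: "dGamma (real_part T) \<eta> \<in> hcarrier \<F>" "dGamma (imag_part T) \<eta> \<in> hcarrier \<F>" "\<eta> \<in> hcarrier \<F>"
    using y R.sa S.sa by auto
  have "(\<lambda>n xs. 1 * (\<lambda>n xs. 1 * dGamma (real_part T) \<eta> n xs + (- \<i>) * dGamma (imag_part T) \<eta> n xs) n xs + (- cnj c) * \<eta> n xs)
      = hadd \<F> (hadd \<F> (dGamma (real_part T) \<eta>) (hscale \<F> (- \<i>) (dGamma (imag_part T) \<eta>))) (hscale \<F> (- cnj c) \<eta>)"
    by (simp add: fock_simps)
  then show "hinner \<F> (the (op_shift \<F> (conservation H T) c \<xi>)) \<eta> =
      hinner \<F> \<xi> (\<lambda>n xs. 1 * (\<lambda>n xs. 1 * dGamma (real_part T) \<eta> n xs + (- \<i>) * dGamma (imag_part T) \<eta> n xs) n xs + (- cnj c) * \<eta> n xs)"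
    unfolding val using xm an zr zs by simp
  show "\<xi> \<in> hcarrier \<F>" by (rule xm)
qed

text \<open>The centred operator sends the exponential vector to \<open>\<eta>\<close>, whose
  function is that of the exponential vector times \<open>hinner H (T u) v - c\<close>. On
  \<open>\<eta>\<close> the adjoint acts as the derivation \<open>Z\<close> with symbol
  \<open>bounded_adjoint H T\<close>, and the Leibniz rule leaves
  \<open>hinner H (T u) (T u)\<close>.\<close>

lemma variance_conservation:
  assumes T: "bounded_operator H T" and u: "u \<in> hcarrier H"
  shows "variance H u (conservation H T) = of_real ((hnorm H (T u))\<^sup>2)"
proof -
  interpret F: pre_hilbert \<F> by (rule fock_pre_hilbert)
  define c where "c = hinner H (T u) u"
  define Y where "Y = op_shift \<F> (conservation H T) c"
  let ?e = "exp_vec H u"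
  define \<eta> where "\<eta> = centred T c ?e"
  define Z where "Z \<xi> = (\<lambda>n xs. 1 * (\<lambda>n xs. 1 * dGamma (real_part T) \<xi> n xs + (- \<i>) * dGamma (imag_part T) \<xi> n xs) n xs + (- cnj c) * \<xi> n xs)" for \<xi>
  have Tu: "T u \<in> hcarrier H" using T u by (simp add: bounded_operator_def linear_operatorD)
  have YS: "Y \<xi> = Some (centred T c \<xi>)" if "\<xi> \<in> analytic_vectors" for \<xi>
    unfolding Y_def centred_def using that by (intro op_shift_analytic conservation_analytic[OF T])
  have eta: "\<eta> \<in> analytic_vectors" unfolding \<eta>_def using u by (intro derivation_mem[OF derivation_centred[OF T]]) simp
  have D: "derivation Z (\<lambda>v. hadd H (hscale H 1 (hadd H (hscale H 1 (real_part T v)) (hscale H (- \<i>) (imag_part T v)))) (hscale H (- cnj c) (hzero H)))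
      (1 * (1 * 0 + (- \<i>) * 0) + (- cnj c) * 1)"
    unfolding Z_def using T
    by (intro derivation_lin_comb derivation_dGamma real_part_self_adjoint imag_part_self_adjoint derivation_id)
  have D': "derivation Z (bounded_adjoint H T) (1 * (1 * 0 + (- \<i>) * 0) + (- cnj c) * 1)"
    using D
  proof (rule derivation_cong)
    fix v assume v: "v \<in> hcarrier H"
    then show "hadd H (hscale H 1 (hadd H (hscale H 1 (real_part T v)) (hscale H (- \<i>) (imag_part T v)))) (hscale H (- cnj c) (hzero H)) = bounded_adjoint H T v"
      unfolding real_imag_part(2)[OF T v] using T by (intro weak_eqI) auto
  qed simp
  have Zeta: "Z \<eta> \<in> analytic_vectors" using eta by (rule derivation_mem[OF D])
  \<comment> \<open>The witness is unique because the domain of \<open>Y\<close> contains all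
    exponential vectors, which are total.\<close>
  have adj: "op_adjoint \<F> Y \<eta> = Some (Z \<eta>)"
  proof -
    let ?P = "\<lambda>z. z \<in> hcarrier \<F> \<and> (\<forall>x\<in>dom Y. hinner \<F> (the (Y x)) \<eta> = hinner \<F> x z)"
    have P: "?P (Z \<eta>)"
      using Zeta hinner_dGamma_parts(2)[OF T eta] unfolding Y_def Z_def by auto
    have "z = Z \<eta>" if z: "?P z" for z
    proof (rule F.hdiff_eq_zeroD)
      show "hdiff \<F> z (Z \<eta>) = hzero \<F>"
      proof (rule exp_vec_total)
        fix v assume v: "v \<in> hcarrier H"
        have "exp_vec H v \<in> dom Y" using YS[of "exp_vec H v"] v by auto
        then have "hinner \<F> (exp_vec H v) z = hinner \<F> (exp_vec H v) (Z \<eta>)" using z P by metis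
        then have "hinner \<F> z (exp_vec H v) = hinner \<F> (Z \<eta>) (exp_vec H v)"
          using F.hinner_commute[of "exp_vec H v" z] F.hinner_commute[of "exp_vec H v" "Z \<eta>"] z v Zeta by simp
        then show "hinner \<F> (hdiff \<F> z (Z \<eta>)) (exp_vec H v) = 0" using z v Zeta by simp
      qed (use z Zeta in simp)
    qed (use z Zeta in auto)
    then have "(THE z. ?P z) = Z \<eta>" using P by (intro the_equality) auto
    then show ?thesis unfolding op_adjoint_def Let_def using eta P by auto
  qed
  have prod: "op_prod \<F> [op_adjoint \<F> Y, Y] ?e = Some (Z \<eta>)"
    using u YS[of ?e] adj by (simp add: op_prod_def op_id_def \<eta>_def)
  \<comment> \<open>The sum over the one-element index set \<open>{{}}\<close> brings the function
    of \<open>\<eta>\<close> into the form that the Leibniz rule expects.\<close>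
  have "hinner \<F> \<eta> (exp_vec H v) = (\<Sum>j\<in>{{}::nat set}. hinner H (T u) v * hinner \<F> ?e (exp_vec H v)) + (- c) * hinner \<F> ?e (exp_vec H v)"
    if v: "v \<in> hcarrier H" for v
    unfolding \<eta>_def using derivation_exp[OF derivation_centred[OF T] u v] by (simp add: algebra_simps)
  from derivation_Leibniz[OF D' eta _ _ _ _ this u]
  have "hinner \<F> (Z \<eta>) ?e = (\<Sum>j\<in>{{}::nat set}. hinner H (bounded_adjoint H T (T u)) u * hinner \<F> ?e ?e
      + hinner H (T u) u * hinner \<F> (Z ?e) ?e) + (- c) * hinner \<F> (Z ?e) ?e"
    using u Tu by simp
  \<comment> \<open>The two terms with \<open>Z ?e\<close> cancel because \<open>c\<close> is
    \<open>hinner H (T u) u\<close>.\<close>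
  also have "\<dots> = hinner H (T u) (T u) * hinner \<F> ?e ?e"
    by (simp add: c_def hinner_adjoint_left[OF T Tu u])
  finally have "hinner \<F> (Z \<eta>) ?e = of_real ((hnorm H (T u))\<^sup>2) * hinner \<F> ?e ?e" by (simp add: hinner_self[OF Tu])
  then have "expect H u (op_prod \<F> [op_adjoint \<F> Y, Y]) = of_real ((hnorm H (T u))\<^sup>2)"
    using prod exp_vec_inner_nonzero[OF u] by (simp add: expect_def)
  then show ?thesis
    by (simp add: variance_def Let_def expect_conservation[OF T u] Y_def c_def)
qed

text \<open>The divisor is the standard deviation from \<open>variance_conservation\<close>. The
  vanishing summand gives the body the form of a combination of two derivations, as in
  \<open>derivation_lin_comb\<close>.\<close>

definition std_op :: "'a \<Rightarrow> ('a \<Rightarrow> 'a) \<Rightarrow> (nat \<Rightarrow> 'a list \<Rightarrow> complex) \<Rightarrow> nat \<Rightarrow> 'a list \<Rightarrow> complex" where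
  "std_op u T \<xi> = (\<lambda>n xs. (1 / of_real (hnorm H (T u))) * centred T (hinner H (T u) u) \<xi> n xs + 0 * \<xi> n xs)"

lemma standardize_conservation:
  assumes T: "bounded_operator H T" and u: "u \<in> hcarrier H" and x: "\<xi> \<in> analytic_vectors"
  shows "standardize H u (conservation H T) \<xi> = Some (std_op u T \<xi>)"
proof -
  have Tu: "T u \<in> hcarrier H" using T u by (simp add: bounded_operator_def linear_operatorD)
  \<comment> \<open>The variance is a nonnegative real, at which the principal root is the real
    square root.\<close>
  then have "csqrt (of_real ((hnorm H (T u))\<^sup>2)) = of_real (hnorm H (T u))"
    by (simp add: of_real_sqrt[symmetric] del: of_real_power)
  then show ?thesis
    using op_shift_analytic[where X = "conservation H T" and \<xi> = \<xi>, OF conservation_analytic[OF T x] x]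
    by (simp add: standardize_def expect_conservation[OF T u] variance_conservation[OF T u] op_scale_def std_op_def
        centred_def fock_simps del: of_real_power)
qed

lemma derivation_std_op:
  assumes T: "bounded_operator H T" and u: "u \<in> hcarrier H"
  shows "derivation (std_op u T) (\<lambda>v. hscale H (1 / of_real (hnorm H (T u))) (T v))
    (- hinner H (hscale H (1 / of_real (hnorm H (T u))) (T u)) u)"
proof -
  let ?a = "1 / complex_of_real (hnorm H (T u))"
  have Tv: "T v \<in> hcarrier H" if "v \<in> hcarrier H" for v using T that by (simp add: bounded_operator_def linear_operatorD)
  have "derivation (std_op u T) (\<lambda>v. hadd H (hscale H ?a (T v)) (hscale H 0 (hzero H))) (?a * (- hinner H (T u) u) + 0 * 1)"
    unfolding std_op_def by (intro derivation_lin_comb derivation_centred T derivation_id)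
  then have "derivation (std_op u T) (\<lambda>v. hscale H ?a (T v)) (?a * (- hinner H (T u) u) + 0 * 1)"
    by (rule derivation_cong) (auto intro!: weak_eqI simp: Tv)
  then show ?thesis using Tv[OF u] u by simp
qed

text \<open>Invariance of the analytic vectors keeps each partial product inside the domain of the
  next factor.\<close>

lemma op_prod_standardize:
  assumes T: "\<And>i. i \<in> set is \<Longrightarrow> bounded_operator H (T i)" and u: "u \<in> hcarrier H"
  shows "op_prod \<F> (map (\<lambda>i. standardize H u (conservation H (T i))) is) (exp_vec H u) = Some (foldr (\<lambda>i. std_op u (T i)) is (exp_vec H u))
    \<and> foldr (\<lambda>i. std_op u (T i)) is (exp_vec H u) \<in> analytic_vectors"
  using T
proof (induction "is")
  case Nil
  then show ?case using u by (simp add: op_prod_def op_id_def)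
next
  case (Cons i "is")
  then have Ti: "bounded_operator H (T i)" and IH: "op_prod \<F> (map (\<lambda>i. standardize H u (conservation H (T i))) is) (exp_vec H u) = Some (foldr (\<lambda>i. std_op u (T i)) is (exp_vec H u))"
    "foldr (\<lambda>i. std_op u (T i)) is (exp_vec H u) \<in> analytic_vectors" by auto
  show ?case
    using IH standardize_conservation[OF Ti u IH(2)] derivation_mem[OF derivation_std_op[OF Ti u] IH(2)]
    by (simp add: op_prod_def)
qed

text \<open>For commuting operators \<open>std_moment_recursion\<close> is the classical
  moment-cumulant recursion with these numbers as joint cumulants. In general the order of the list
  matters.\<close>

definition cumulant :: "'a \<Rightarrow> (nat \<Rightarrow> 'a \<Rightarrow> 'a) \<Rightarrow> nat list \<Rightarrow> complex" where
  "cumulant u T is = hinner H (foldr (\<lambda>i v. hscale H (1 / of_real (hnorm H (T i u))) (T i v)) is u) u"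

definition std_moment :: "'a \<Rightarrow> (nat \<Rightarrow> 'a \<Rightarrow> 'a) \<Rightarrow> nat list \<Rightarrow> complex" where
  "std_moment u T is = expect H u (op_prod \<F> (map (\<lambda>i. standardize H u (conservation H (T i))) is))"

lemma std_moment_Nil: "u \<in> hcarrier H \<Longrightarrow> std_moment u T [] = 1"
  using exp_vec_inner_nonzero[of u] by (simp add: std_moment_def expect_def op_prod_def op_id_def)

lemma std_moment_recursion:
  assumes T: "\<And>i. i \<in> set is \<union> {k} \<Longrightarrow> bounded_operator H (T i)" and u: "u \<in> hcarrier H" and dist: "distinct is"
  shows "std_moment u T (is @ [k]) = (\<Sum>J\<in>Pow (set is) - {{}}. cumulant u T (filter (\<lambda>i. i \<in> J) is @ [k])
       * std_moment u T (filter (\<lambda>i. i \<notin> J) is))"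
proof -
  have eq: "std_moment u T js = hinner \<F> (foldr (\<lambda>i. std_op u (T i)) js (exp_vec H u)) (exp_vec H u) / hinner \<F> (exp_vec H u) (exp_vec H u)"
    if "set js \<subseteq> set is \<union> {k}" for js
  proof -
    have "bounded_operator H (T i)" if "i \<in> set js" for i using T that \<open>set js \<subseteq> set is \<union> {k}\<close> by blast
    from op_prod_standardize[of js T, OF this u] show ?thesis by (simp add: std_moment_def expect_def)
  qed
  have "std_moment u T (is @ [k]) = (\<Sum>J\<in>Pow (set is) - {{}}. cumulant u T (filter (\<lambda>i. i \<in> J) is @ [k])
      * (hinner \<F> (foldr (\<lambda>i. std_op u (T i)) (filter (\<lambda>i. i \<notin> J) is) (exp_vec H u)) (exp_vec H u) / hinner \<F> (exp_vec H u) (exp_vec H u)))"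
    using centred_moment_recursion[of "is" k "\<lambda>i. std_op u (T i)" "\<lambda>i v. hscale H (1 / of_real (hnorm H (T i u))) (T i v)" u]
      T u dist derivation_std_op by (simp add: eq cumulant_def)
  then show ?thesis by (subst (asm) eq[symmetric]) auto
qed

end

section \<open>Pairings and scaling\<close>

definition pairings :: "nat set \<Rightarrow> nat set set set" where
  "pairings I = {\<pi>. partition_on I \<pi> \<and> (\<forall>B\<in>\<pi>. card B = 2)}"

lemma pairings_empty: "pairings {} = {{}}"
  by (auto simp: pairings_def partition_on_def)

lemma finite_pairings: "finite I \<Longrightarrow> finite (pairings I)"
  unfolding pairings_def by (rule finite_subset[OF _ finitely_many_partition_on]) auto

lemma pairings_insert_iff:
  assumes k: "k \<in> I" "a \<in> I - {k}" and p: "\<pi>' \<in> pairings (I - {k} - {a})"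
  shows "insert {a, k} \<pi>' \<in> pairings I" "{a, k} \<notin> \<pi>'"
proof -
  have part: "partition_on (I - {k} - {a}) \<pi>'" "\<forall>B\<in>\<pi>'. card B = 2" using p by (auto simp: pairings_def)
  have sub: "B \<subseteq> I - {k} - {a}" if "B \<in> \<pi>'" for B using part(1) that by (auto simp: partition_on_def)
  then show "{a, k} \<notin> \<pi>'" by blast
  have "disjnt {a, k} (\<Union>\<pi>')" using sub by (auto simp: disjnt_def)
  moreover have "I - {k} - {a} = I - {a, k}" by auto
  ultimately have "partition_on I (insert {a, k} \<pi>')"
    using part(1) k by (simp add: partition_on_insert)
  moreover have "card {a, k} = 2" using k by auto
  ultimately show "insert {a, k} \<pi>' \<in> pairings I" using part(2) by (auto simp: pairings_def)
qed

lemma pairings_remove: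
  assumes k: "k \<in> I" and p: "\<pi> \<in> pairings I"
  shows "\<exists>a\<in>I - {k}. \<exists>\<pi>'\<in>pairings (I - {k} - {a}). \<pi> = insert {a, k} \<pi>'"
proof -
  have part: "\<Union>\<pi> = I" "disjoint \<pi>" "{} \<notin> \<pi>" "\<forall>B\<in>\<pi>. card B = 2" using p by (auto simp: pairings_def partition_on_def)
  obtain B where B: "B \<in> \<pi>" "k \<in> B" using part(1) k by blast
  then obtain x y where xy: "B = {x, y}" "x \<noteq> y" using part(4) card_2_iff by metis
  define a where "a = (if k = x then y else x)"
  have Ba: "B = {a, k}" "a \<noteq> k" using xy B(2) by (auto simp: a_def)
  have aI: "a \<in> I - {k}" using Ba B(1) part(1) by auto
  have disj: "C \<inter> B = {}" if "C \<in> \<pi>" "C \<noteq> B" for C using part(2) B(1) that by (auto simp: disjoint_def)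
  have "disjnt B (\<Union>(\<pi> - {B}))" using disj by (auto simp: disjnt_def)
  moreover have "insert B (\<pi> - {B}) = \<pi>" using B(1) by auto
  ultimately have "partition_on (I - B) (\<pi> - {B})"
    using p partition_on_insert[of B "\<pi> - {B}" I] by (simp add: pairings_def)
  moreover have "I - B = I - {k} - {a}" using Ba by auto
  ultimately have "\<pi> - {B} \<in> pairings (I - {k} - {a})"
    using part(4) by (simp add: pairings_def)
  moreover have "\<pi> = insert {a, k} (\<pi> - {B})" using B(1) Ba(1) by auto
  ultimately show ?thesis using aI by blast
qed

text \<open>A pair partition amounts to the partner \<open>a\<close> of \<open>k\<close> and a pair
  partition of the rest. With \<open>k\<close> the maximum, this mirrors the terms with one-element
  \<open>J\<close> in the moment recursion.\<close>

lemma sum_pairings: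
  fixes c :: "nat set \<Rightarrow> complex"
  assumes I: "finite I" "k \<in> I"
  shows "(\<Sum>\<pi>\<in>pairings I. \<Prod>B\<in>\<pi>. c B) = (\<Sum>a\<in>I - {k}. c {a, k} * (\<Sum>\<pi>\<in>pairings (I - {k} - {a}). \<Prod>B\<in>\<pi>. c B))"
proof -
  have fin: "finite \<pi>" if "\<pi> \<in> pairings J" "finite J" for \<pi> J
    using that finite_elements unfolding pairings_def by blast
  have "bij_betw (\<lambda>(a, \<pi>'). insert {a, k} \<pi>') (SIGMA a:I - {k}. pairings (I - {k} - {a})) (pairings I)"
  proof (rule bij_betw_imageI)
    show "inj_on (\<lambda>(a, \<pi>'). insert {a, k} \<pi>') (SIGMA a:I - {k}. pairings (I - {k} - {a}))"
    proof (rule inj_onI)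
      fix p q :: "nat \<times> nat set set"
      assume "p \<in> (SIGMA a:I - {k}. pairings (I - {k} - {a}))" "q \<in> (SIGMA a:I - {k}. pairings (I - {k} - {a}))"
        "(\<lambda>(a, \<pi>'). insert {a, k} \<pi>') p = (\<lambda>(a, \<pi>'). insert {a, k} \<pi>') q"
      then obtain a \<pi> b \<rho> where p: "p = (a, \<pi>)" "q = (b, \<rho>)" and a: "a \<in> I" "a \<noteq> k" "\<pi> \<in> pairings (I - {k} - {a})" and b: "b \<in> I" "b \<noteq> k" "\<rho> \<in> pairings (I - {k} - {b})"
        and eq: "insert {a, k} \<pi> = insert {b, k} \<rho>"
        by (cases p; cases q) auto
      have "\<Union>\<rho> = I - {k} - {b}" using b(3) unfolding pairings_def partition_on_def by blast
      then have "{a, k} \<notin> \<rho>" by blast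
      then have "{a, k} = {b, k}" using eq by blast
      then have "a = b" using a(2) b(2) by (auto simp: doubleton_eq_iff)
      moreover have "\<pi> = \<rho>"
      proof -
        have "{a, k} \<notin> \<pi>" using a by (intro pairings_insert_iff(2)[OF I(2) _ a(3)]) simp
        moreover have "{b, k} \<notin> \<rho>" using b by (intro pairings_insert_iff(2)[OF I(2) _ b(3)]) simp
        ultimately show ?thesis using eq insert_ident[of "{a, k}" \<pi> \<rho>] \<open>a = b\<close> by simp
      qed
      ultimately show "p = q" using p by simp
    qed
    show "(\<lambda>(a, \<pi>'). insert {a, k} \<pi>') ` (SIGMA a:I - {k}. pairings (I - {k} - {a})) = pairings I"
      using pairings_insert_iff(1)[OF I(2)] pairings_remove[OF I(2)] by force
  qed
  from sum.reindex_bij_betw[OF this, of "\<lambda>\<pi>. \<Prod>B\<in>\<pi>. c B"]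
  have "(\<Sum>\<pi>\<in>pairings I. \<Prod>B\<in>\<pi>. c B) = (\<Sum>(a, \<pi>)\<in>(SIGMA a:I - {k}. pairings (I - {k} - {a})). \<Prod>B\<in>insert {a, k} \<pi>. c B)"
    by (simp add: case_prod_unfold)
  also have "\<dots> = (\<Sum>a\<in>I - {k}. \<Sum>\<pi>\<in>pairings (I - {k} - {a}). \<Prod>B\<in>insert {a, k} \<pi>. c B)"
    using I finite_pairings by (subst sum.Sigma) auto
  also have "\<dots> = (\<Sum>a\<in>I - {k}. \<Sum>\<pi>\<in>pairings (I - {k} - {a}). c {a, k} * (\<Prod>B\<in>\<pi>. c B))"
  proof (intro sum.cong refl)
    fix a \<pi> assume a: "a \<in> I - {k}" and p: "\<pi> \<in> pairings (I - {k} - {a})"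
    show "(\<Prod>B\<in>insert {a, k} \<pi>. c B) = c {a, k} * (\<Prod>B\<in>\<pi>. c B)"
      using pairings_insert_iff(2)[OF I(2) a p] fin[OF p] I(1) by (intro prod.insert) auto
  qed
  finally show ?thesis by (simp add: sum_distrib_left)
qed

text \<open>
  \<open>\<nu>\<close> are the moments at time \<open>t\<close>, \<open>\<mu>\<close> those at time \<open>N t\<close>, \<open>\<kappa>\<close> the cumulants at time \<open>t\<close>. Passing to
  time \<open>N t\<close> multiplies a cumulant of order \<open>n\<close> by \<open>N / \<surd>N ^ n\<close>, so only pairs survive.
\<close>

locale scaled_cumulants =
  fixes m :: nat and \<nu> \<mu> \<kappa> :: "nat \<Rightarrow> nat set \<Rightarrow> complex"
  assumes nu: "\<And>N I. N \<ge> 1 \<Longrightarrow> I \<subseteq> {1..m} \<Longrightarrow> I \<noteq> {} \<Longrightarrow>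
      \<nu> N I = (\<Sum>J\<in>Pow (I - {Max I}) - {{}}. \<kappa> N (insert (Max I) J) * \<nu> N (I - {Max I} - J))"
    and mu: "\<And>N I. N \<ge> 1 \<Longrightarrow> I \<subseteq> {1..m} \<Longrightarrow> I \<noteq> {} \<Longrightarrow>
      \<mu> N I = (\<Sum>J\<in>Pow (I - {Max I}) - {{}}.
        of_real (real N / sqrt (real N) ^ Suc (card J)) * \<kappa> N (insert (Max I) J) * \<mu> N (I - {Max I} - J))"
    and moment_empty: "\<And>N. N \<ge> 1 \<Longrightarrow> \<nu> N {} = 1" "\<And>N. N \<ge> 1 \<Longrightarrow> \<mu> N {} = 1"
    and nu_bounded: "\<And>I. I \<subseteq> {1..m} \<Longrightarrow> (\<lambda>N. \<nu> N I) \<in> O(\<lambda>N. 1)"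
begin

section \<open>Bounds and limits for the scaled moments\<close>

abbreviation scale :: "nat \<Rightarrow> nat set \<Rightarrow> complex" where
  "scale N J \<equiv> of_real (real N / sqrt (real N) ^ Suc (card J))"

lemma ev1: "\<forall>\<^sub>F N in sequentially. N \<ge> (1::nat)"
  by (rule eventually_ge_at_top)

lemma bigo_mult_one:
  fixes f g :: "nat \<Rightarrow> complex"
  assumes "f \<in> O(\<lambda>N. 1)" "g \<in> O(\<lambda>N. 1)"
  shows "(\<lambda>N. f N * g N) \<in> O(\<lambda>N. 1)"
  using landau_o.big.mult[OF assms] by simp

lemma Max_facts:
  assumes "I \<subseteq> {1..m}" "I \<noteq> {}"
  shows "finite I" "Max I \<in> I"
  using assms finite_subset[of I "{1..m}"] Max_in by auto

text \<open>In the recursion for \<open>\<nu> N I\<close> the largest \<open>J\<close> carries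
  \<open>\<kappa> N I\<close> with the factor \<open>\<nu> N {} = 1\<close>. Solving for it
  expresses \<open>\<kappa> N I\<close> by bounded moments and by cumulants of smaller sets, which
  have at least two elements because \<open>J\<close> is nonempty.\<close>

lemma kappa_bounded:
  "I \<subseteq> {1..m} \<Longrightarrow> card I \<ge> 2 \<Longrightarrow> (\<lambda>N. \<kappa> N I) \<in> O(\<lambda>N. 1)"
proof (induction "card I" arbitrary: I rule: less_induct)
  case less
  have ne: "I \<noteq> {}" using less.prems by auto
  note M = Max_facts[OF less.prems(1) ne]
  define k where "k = Max I"
  have k: "finite I" "k \<in> I" using M by (auto simp: k_def)
  have I1: "I - {k} \<noteq> {}"
  proof
    assume "I - {k} = {}"
    then have "I = {k}" using k by blast
    then show False using less.prems(2) by simp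
  qed
  let ?R = "\<lambda>N. \<Sum>J\<in>Pow (I - {k}) - {{}} - {I - {k}}. \<kappa> N (insert k J) * \<nu> N (I - {k} - J)"
  have ev: "\<forall>\<^sub>F N in sequentially. \<kappa> N I = \<nu> N I - ?R N"
    using ev1
  proof eventually_elim
    case (elim N)
    have "\<nu> N I = (\<Sum>J\<in>Pow (I - {k}) - {{}}. \<kappa> N (insert k J) * \<nu> N (I - {k} - J))"
      unfolding k_def using elim less.prems(1) ne by (rule nu)
    also have "\<dots> = \<kappa> N (insert k (I - {k})) * \<nu> N (I - {k} - (I - {k})) + ?R N"
      using k I1 by (intro sum.remove) auto
    also have "insert k (I - {k}) = I" using k by blast
    finally show ?case using moment_empty(1)[OF elim] by simp
  qed
  moreover have "(\<lambda>N. \<nu> N I - ?R N) \<in> O(\<lambda>N. 1)"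
  proof (intro sum_in_bigo nu_bounded less.prems big_sum_in_bigo bigo_mult_one)
    fix J assume J: "J \<in> Pow (I - {k}) - {{}} - {I - {k}}"
    then have "insert k J \<subset> I" using k by auto
    then have "card (insert k J) < card I" using k psubset_card_mono by blast
    moreover have "card (insert k J) \<ge> 2"
    proof -
      have "finite J" "k \<notin> J" "J \<noteq> {}" using J k finite_subset[of J I] by auto
      then show ?thesis by (simp add: Suc_le_eq card_gt_0_iff)
    qed
    ultimately show "(\<lambda>N. \<kappa> N (insert k J)) \<in> O(\<lambda>N. 1)"
      using J k less.prems(1) by (intro less.hyps) auto
    show "I - {k} - J \<subseteq> {1..m}" using less.prems(1) by blast
  qed
  ultimately show ?case using landau_o.big.in_cong[OF ev] by blast
qed

lemma scale_pair: "\<forall>\<^sub>F N in sequentially. scale N {a} = 1"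
  using ev1 by eventually_elim simp

text \<open>\<open>J\<close> omits the distinguished index, so the cumulant has order
  \<open>card J + 1\<close>, at least 3, and its scale is \<open>1 / sqrt N\<close> to a positive
  power.\<close>

lemma scale_tendsto_zero:
  assumes "card J \<ge> 2"
  shows "(\<lambda>N. scale N J) \<longlonglongrightarrow> 0"
proof -
  obtain j where j: "card J = Suc (Suc j)" using assms by (metis add_2_eq_Suc le_Suc_ex)
  have "((\<lambda>N. 1 / sqrt (real N) ^ Suc j) \<longlonglongrightarrow> 0)"
    by real_asymp
  moreover have "\<forall>\<^sub>F N in sequentially. 1 / sqrt (real N) ^ Suc j = real N / sqrt (real N) ^ Suc (card J)"
    using ev1 by eventually_elim (simp add: j field_simps)
  ultimately have "(\<lambda>N. real N / sqrt (real N) ^ Suc (card J)) \<longlonglongrightarrow> 0" by (rule Lim_transform_eventually)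
  from tendsto_of_real[OF this, where 'a = complex] show ?thesis by simp
qed

lemma bounded_mult_null:
  fixes f g :: "nat \<Rightarrow> complex"
  assumes "f \<longlonglongrightarrow> 0" "g \<in> O(\<lambda>N. 1)"
  shows "(\<lambda>N. f N * g N) \<longlonglongrightarrow> 0"
proof -
  have "f \<in> o(\<lambda>N. 1)" using assms(1) by (intro smalloI_tendsto) auto
  from landau_o.small_big_mult[OF this assms(2)] show ?thesis by (auto dest: smalloD_tendsto)
qed

lemma null_bigo: "f \<longlonglongrightarrow> (c::complex) \<Longrightarrow> f \<in> O(\<lambda>N::nat. 1)"
  by (rule bigoI_tendsto[of _ _ c]) auto

lemma card_cases:
  assumes "J \<in> Pow (I - {k}) - {{}}" "finite I"
  obtains a where "a \<in> I - {k}" "J = {a}" | "card J \<ge> 2"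
proof -
  have "finite J" using assms finite_subset[of J I] by auto
  then have "card J \<noteq> 0" using assms by auto
  then consider "card J = 1" | "card J \<ge> 2" by linarith
  then show thesis using that assms by cases (auto simp: card_1_singleton_iff)
qed

lemma mu_step:
  assumes I: "I \<subseteq> {1..m}" "I \<noteq> {}"
    and t: "\<And>J. J \<in> Pow (I - {Max I}) - {{}} \<Longrightarrow>
      (\<lambda>N. scale N J * \<kappa> N (insert (Max I) J) * \<mu> N (I - {Max I} - J)) \<longlonglongrightarrow> L J"
  shows "(\<lambda>N. \<mu> N I) \<longlonglongrightarrow> (\<Sum>J\<in>Pow (I - {Max I}) - {{}}. L J)"
proof -
  have "(\<lambda>N. \<Sum>J\<in>Pow (I - {Max I}) - {{}}. scale N J * \<kappa> N (insert (Max I) J) * \<mu> N (I - {Max I} - J))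
      \<longlonglongrightarrow> (\<Sum>J\<in>Pow (I - {Max I}) - {{}}. L J)"
    using t by (rule tendsto_sum)
  moreover have "\<forall>\<^sub>F N in sequentially. (\<Sum>J\<in>Pow (I - {Max I}) - {{}}. scale N J * \<kappa> N (insert (Max I) J) * \<mu> N (I - {Max I} - J)) = \<mu> N I"
    using ev1 by eventually_elim (use mu[OF _ I] in simp)
  ultimately show ?thesis by (rule Lim_transform_eventually)
qed

lemma kappa_insert_bounded:
  assumes I: "I \<subseteq> {1..m}" "I \<noteq> {}" and J: "J \<in> Pow (I - {Max I}) - {{}}"
  shows "(\<lambda>N. \<kappa> N (insert (Max I) J)) \<in> O(\<lambda>N. 1)"
proof (rule kappa_bounded)
  note M = Max_facts[OF I]
  show "insert (Max I) J \<subseteq> {1..m}" using I(1) J M by auto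
  have "finite J" "Max I \<notin> J" "J \<noteq> {}" using J M finite_subset[of J I] by auto
  then show "card (insert (Max I) J) \<ge> 2" by (simp add: Suc_le_eq card_gt_0_iff)
qed

text \<open>Terms of higher order are a null sequence times moments at the scaled time, so
  boundedness of those moments has to be secured before any limit is taken.\<close>

lemma mu_bounded: "I \<subseteq> {1..m} \<Longrightarrow> (\<lambda>N. \<mu> N I) \<in> O(\<lambda>N. 1)"
proof (induction "card I" arbitrary: I rule: less_induct)
  case less
  show ?case
  proof (cases "I = {}")
    case True
    have "\<forall>\<^sub>F N in sequentially. \<mu> N {} = 1" using ev1 by eventually_elim (rule moment_empty(2))
    then have "(\<lambda>N. \<mu> N {}) \<longlonglongrightarrow> 1" by (rule tendsto_eventually)
    then show ?thesis using True null_bigo by blast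
  next
    case ne: False
    note M = Max_facts[OF less.prems ne]
    let ?k = "Max I"
    have "(\<lambda>N. \<Sum>J\<in>Pow (I - {?k}) - {{}}. scale N J * \<kappa> N (insert ?k J) * \<mu> N (I - {?k} - J)) \<in> O(\<lambda>N. 1)"
    proof (intro big_sum_in_bigo bigo_mult_one)
      fix J assume J: "J \<in> Pow (I - {?k}) - {{}}"
      show "(\<lambda>N. scale N J) \<in> O(\<lambda>N. 1)"
        using J M(1)
      proof (cases rule: card_cases)
        case (1 a)
        then show ?thesis using tendsto_eventually[OF scale_pair] null_bigo by blast
      next
        case 2
        then show ?thesis using scale_tendsto_zero null_bigo by blast
      qed
      show "(\<lambda>N. \<kappa> N (insert ?k J)) \<in> O(\<lambda>N. 1)" using less.prems ne J by (rule kappa_insert_bounded)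
      show "(\<lambda>N. \<mu> N (I - {?k} - J)) \<in> O(\<lambda>N. 1)"
        using less.prems M J by (intro less.hyps psubset_card_mono) auto
    qed
    moreover have "\<forall>\<^sub>F N in sequentially. \<mu> N I = (\<Sum>J\<in>Pow (I - {?k}) - {{}}. scale N J * \<kappa> N (insert ?k J) * \<mu> N (I - {?k} - J))"
      using ev1 by eventually_elim (use mu[OF _ less.prems ne] in simp)
    ultimately show ?thesis by (simp add: landau_o.big.in_cong)
  qed
qed

lemma higher_null:
  assumes I: "I \<subseteq> {1..m}" "I \<noteq> {}" and J: "J \<in> Pow (I - {Max I}) - {{}}" "card J \<ge> 2"
  shows "(\<lambda>N. scale N J * \<kappa> N (insert (Max I) J) * \<mu> N (I - {Max I} - J)) \<longlonglongrightarrow> 0"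
proof -
  have "(\<lambda>N. scale N J * (\<kappa> N (insert (Max I) J) * \<mu> N (I - {Max I} - J))) \<longlonglongrightarrow> 0"
    using I J by (intro bounded_mult_null scale_tendsto_zero bigo_mult_one kappa_insert_bounded mu_bounded) auto
  then show ?thesis by (simp add: mult.assoc)
qed

text \<open>Removing a pair keeps the cardinality odd. The case is treated apart from
  \<open>mu_even\<close> because limits of covariances are assumed for even \<open>m\<close> only;
  here the pair cumulants are just bounded.\<close>

lemma mu_odd: "I \<subseteq> {1..m} \<Longrightarrow> odd (card I) \<Longrightarrow> (\<lambda>N. \<mu> N I) \<longlonglongrightarrow> 0"
proof (induction "card I" arbitrary: I rule: less_induct)
  case less
  have ne: "I \<noteq> {}" using less.prems by auto
  note M = Max_facts[OF less.prems(1) ne]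
  let ?k = "Max I"
  have "(\<lambda>N. \<mu> N I) \<longlonglongrightarrow> (\<Sum>J\<in>Pow (I - {?k}) - {{}}. 0)"
  proof (rule mu_step[OF less.prems(1) ne])
    fix J assume J: "J \<in> Pow (I - {?k}) - {{}}"
    show "(\<lambda>N. scale N J * \<kappa> N (insert ?k J) * \<mu> N (I - {?k} - J)) \<longlonglongrightarrow> 0"
      using J M(1)
    proof (cases rule: card_cases)
      case (1 a)
      have c: "card I = Suc (Suc (card (I - {?k} - {a})))"
        using M 1 by (metis card.remove finite_Diff)
      then have "(\<lambda>N. \<mu> N (I - {?k} - {a})) \<longlonglongrightarrow> 0"
        using less.prems by (intro less.hyps) auto
      moreover have "(\<lambda>N. scale N J * \<kappa> N (insert ?k J)) \<in> O(\<lambda>N. 1)"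
        using bigo_mult_one[OF null_bigo[OF tendsto_eventually[OF scale_pair, of a]] kappa_insert_bounded[OF less.prems(1) ne J]]
        unfolding 1(2) .
      ultimately have "(\<lambda>N. \<mu> N (I - {?k} - {a}) * (scale N J * \<kappa> N (insert ?k J))) \<longlonglongrightarrow> 0"
        by (rule bounded_mult_null)
      then show ?thesis using 1 by (simp add: mult_ac)
    next
      case 2
      then show ?thesis using J by (intro higher_null less.prems ne)
    qed
  qed
  then show ?case by simp
qed

text \<open>With two indices the recursion has the single term \<open>J = {a}\<close>, and the
  remaining moment is that of the empty set.\<close>

lemma kappa_pair:
  assumes "a < b" "a \<in> {1..m}" "b \<in> {1..m}" "N \<ge> 1"
  shows "\<kappa> N {a, b} = \<nu> N {a, b}"
proof -
  have M: "Max {a, b} = b" "{a, b} - {b} = {a}" "Pow {a} - {{}} = {{a}}" using assms(1) by auto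
  have "\<nu> N {a, b} = (\<Sum>J\<in>Pow ({a, b} - {Max {a, b}}) - {{}}. \<kappa> N (insert (Max {a, b}) J) * \<nu> N ({a, b} - {Max {a, b}} - J))"
    using assms by (intro nu) auto
  then show ?thesis using moment_empty(1)[OF assms(4)] unfolding M by (simp add: insert_commute)
qed

text \<open>The induction runs over all subsets, including those of odd size, for which
  \<open>pairings I\<close> is empty and the limit is zero. Only one-element \<open>J\<close>
  contribute, and these reproduce \<open>sum_pairings\<close>.\<close>

lemma mu_even:
  assumes c: "\<And>a b. 1 \<le> a \<Longrightarrow> a < b \<Longrightarrow> b \<le> m \<Longrightarrow> (\<lambda>N. \<nu> N {a, b}) \<longlonglongrightarrow> c {a, b}"
  shows "I \<subseteq> {1..m} \<Longrightarrow> (\<lambda>N. \<mu> N I) \<longlonglongrightarrow> (\<Sum>\<pi>\<in>pairings I. \<Prod>B\<in>\<pi>. c B)"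
proof (induction "card I" arbitrary: I rule: less_induct)
  case less
  let ?L = "\<lambda>I. \<Sum>\<pi>\<in>pairings I. \<Prod>B\<in>\<pi>. c B"
  show ?case
  proof (cases "I = {}")
    case True
    have "\<forall>\<^sub>F N in sequentially. \<mu> N {} = 1" using ev1 by eventually_elim (rule moment_empty(2))
    then have "(\<lambda>N. \<mu> N {}) \<longlonglongrightarrow> 1" by (rule tendsto_eventually)
    then show ?thesis using True by (simp add: pairings_empty)
  next
    case ne: False
    note M = Max_facts[OF less.prems ne]
    let ?k = "Max I"
    let ?l = "\<lambda>J. if card J = 1 then c (insert ?k J) * ?L (I - {?k} - J) else 0"
    have "(\<lambda>N. \<mu> N I) \<longlonglongrightarrow> (\<Sum>J\<in>Pow (I - {?k}) - {{}}. ?l J)"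
    proof (rule mu_step[OF less.prems ne])
      fix J assume J: "J \<in> Pow (I - {?k}) - {{}}"
      show "(\<lambda>N. scale N J * \<kappa> N (insert ?k J) * \<mu> N (I - {?k} - J)) \<longlonglongrightarrow> ?l J"
        using J M(1)
      proof (cases rule: card_cases)
        case (1 a)
        have ak: "a < ?k" using 1 M by (metis DiffD1 DiffD2 Max_ge insertI1 le_neq_implies_less)
        have mem: "a \<in> {1..m}" "?k \<in> {1..m}" using 1(1) M(2) less.prems by blast+
        have "(\<lambda>N. \<nu> N {a, ?k}) \<longlonglongrightarrow> c {a, ?k}" using ak mem by (intro c) auto
        moreover have "\<forall>\<^sub>F N in sequentially. \<nu> N {a, ?k} = \<kappa> N {a, ?k}"
          using ev1 by eventually_elim (use kappa_pair[OF ak mem] in simp)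
        ultimately have k: "(\<lambda>N. \<kappa> N {a, ?k}) \<longlonglongrightarrow> c {a, ?k}" by (rule Lim_transform_eventually)
        have "(\<lambda>N. \<mu> N (I - {?k} - {a})) \<longlonglongrightarrow> ?L (I - {?k} - {a})"
        proof (rule less.hyps)
          show "card (I - {?k} - {a}) < card I" using M by (intro psubset_card_mono) auto
          show "I - {?k} - {a} \<subseteq> {1..m}" using less.prems by blast
        qed
        then have "(\<lambda>N. scale N {a} * \<kappa> N {a, ?k} * \<mu> N (I - {?k} - {a})) \<longlonglongrightarrow> 1 * c {a, ?k} * ?L (I - {?k} - {a})"
          using k by (intro tendsto_mult tendsto_eventually[OF scale_pair])
        then show ?thesis unfolding 1(2) by (simp add: insert_commute)
      next
        case 2
        then show ?thesis using higher_null[OF less.prems ne J] by simp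
      qed
    qed
    \<comment> \<open>\<open>?l\<close> is zero off singletons, so the sum over subsets becomes a
      sum over the partners of \<open>?k\<close>.\<close>
    also have "(\<Sum>J\<in>Pow (I - {?k}) - {{}}. ?l J) = (\<Sum>J\<in>(\<lambda>a. {a}) ` (I - {?k}). ?l J)"
      using M by (intro sum.mono_neutral_right) (auto simp: card_1_singleton_iff)
    also have "\<dots> = (\<Sum>a\<in>I - {?k}. c {a, ?k} * ?L (I - {?k} - {a}))"
      by (subst sum.reindex) (auto simp: insert_commute)
    also have "\<dots> = ?L I" using M by (rule sum_pairings[symmetric])
    finally show ?thesis .
  qed
qed

end

section \<open>The limit theorem\<close>

context complex_hilbert_space
begin

lemma step_vec_scale:
  assumes "v \<in> hcarrier H"
  shows "hscale (L2_space H) c (step_vec H v s) = step_vec H (hscale H c v) s"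
  unfolding step_vec_def L2_scale[OF step_square_integrable[OF assms]]
  using assms by (intro L2_class_cong') (simp add: hscale_hscale mult.commute)

text \<open>The part of a cumulant that does not depend on time; it is computed in the value
  space.\<close>

definition reduced_cumulant :: "'a \<Rightarrow> (nat \<Rightarrow> 'a \<Rightarrow> 'a) \<Rightarrow> nat list \<Rightarrow> complex" where
  "reduced_cumulant v a is = hinner H (foldr (\<lambda>i v'. hscale H (1 / of_real (hnorm H (a i v))) (a i v')) is v) v"

text \<open>Each normalisation divides by the norm of a step vector, which is \<open>sqrt s\<close>
  times a norm in the value space, and the final pairing contributes \<open>s\<close>.\<close>

lemma process_cumulant:
  assumes a: "\<And>i. i \<in> set is \<Longrightarrow> bounded_operator H (a i)" and v: "v \<in> hcarrier H" and s: "s > 0"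
  shows "complex_hilbert_space.cumulant (L2_space H) (step_vec H v s) (\<lambda>i. process_op (a i) s) is
    = of_real (s / sqrt s ^ length is) * reduced_cumulant v a is"
proof -
  interpret L: complex_hilbert_space "L2_space H" by (rule L2_hilbert)
  let ?u = "step_vec H v s"
  let ?f = "\<lambda>i v'. hscale H (1 / of_real (hnorm H (a i v))) (a i v')"
  let ?g = "\<lambda>i v'. hscale (L2_space H) (1 / of_real (hnorm (L2_space H) (process_op (a i) s ?u))) (process_op (a i) s v')"
  have fold: "foldr ?f is v \<in> hcarrier H \<and> foldr ?g is ?u = step_vec H (hscale H (of_real (1 / sqrt s ^ length is)) (foldr ?f is v)) s"
    using a
  proof (induction "is")
    case Nil
    then show ?case using v by (simp add: hscale_one)
  next
    case (Cons i "is")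
    then have ai: "bounded_operator H (a i)" by simp
    then have lin: "linear_operator H (a i)" by (simp add: bounded_operator_def)
    let ?w = "foldr ?f is v"
    have w: "?w \<in> hcarrier H" "foldr ?g is ?u = step_vec H (hscale H (of_real (1 / sqrt s ^ length is)) ?w) s"
      using Cons by auto
    have av: "a i v \<in> hcarrier H" "a i ?w \<in> hcarrier H" using lin v w by (auto simp: linear_operatorD)
    have "(hnorm (L2_space H) (process_op (a i) s ?u))\<^sup>2 = (sqrt s * hnorm H (a i v))\<^sup>2"
      using step_vec_inner[OF av(1) av(1), of s] s av
      by (simp add: process_op_step[OF ai v] hnorm_def power_mult_distrib hinner_ge_zero)
    then have n: "hnorm (L2_space H) (process_op (a i) s ?u) = sqrt s * hnorm H (a i v)"
      using s av step_vec_mem[OF av(1)] by (simp add: process_op_step[OF ai v] power2_eq_iff_nonneg)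
    have "foldr ?g (i # is) ?u = step_vec H (hscale H (1 / of_real (sqrt s * hnorm H (a i v)))
        (a i (hscale H (of_real (1 / sqrt s ^ length is)) ?w))) s"
      using w av lin by (simp add: n process_op_step[OF ai] step_vec_scale linear_operatorD)
    also have "hscale H (1 / of_real (sqrt s * hnorm H (a i v))) (a i (hscale H (of_real (1 / sqrt s ^ length is)) ?w))
        = hscale H (of_real (1 / sqrt s ^ length (i # is))) (foldr ?f (i # is) v)"
      using w av lin by (simp add: linear_operatorD hscale_hscale mult_ac)
    finally show ?case using av by simp
  qed
  have "L.cumulant ?u (\<lambda>i. process_op (a i) s) is = hinner (L2_space H) (foldr ?g is ?u) ?u"
    by (simp add: L.cumulant_def)
  also have "\<dots> = of_real s * hinner H (hscale H (of_real (1 / sqrt s ^ length is)) (foldr ?f is v)) v"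
    using fold v s by (simp add: step_vec_inner)
  finally show ?thesis using fold v by (simp add: reduced_cumulant_def)
qed

lemma standardized_moment_eq:
  "standardized_moment H v a s is = complex_hilbert_space.std_moment (L2_space H) (step_vec H v s) (\<lambda>i. process_op (a i) s) is"
proof -
  interpret L: complex_hilbert_space "L2_space H" by (rule L2_hilbert)
  have "conservation_process H b s = conservation (L2_space H) (process_op b s)" for b
    unfolding conservation_process_def process_op_def[abs_def] ..
  then show ?thesis by (simp add: standardized_moment_def L.std_moment_def)
qed

lemma standardized_moment_Nil: "v \<in> hcarrier H \<Longrightarrow> standardized_moment H v a s [] = 1"
  unfolding standardized_moment_eq
  by (rule complex_hilbert_space.std_moment_Nil[OF L2_hilbert step_vec_mem])

lemma standardized_moment_recursion:
  assumes a: "\<And>i. i \<in> set is \<union> {k} \<Longrightarrow> bounded_operator H (a i)" and v: "v \<in> hcarrier H" and s: "s > 0"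
    and dist: "distinct is"
  shows "standardized_moment H v a s (is @ [k]) = (\<Sum>J\<in>Pow (set is) - {{}}.
    of_real (s / sqrt s ^ Suc (card J)) * reduced_cumulant v a (filter (\<lambda>i. i \<in> J) is @ [k])
      * standardized_moment H v a s (filter (\<lambda>i. i \<notin> J) is))"
proof -
  interpret L: complex_hilbert_space "L2_space H" by (rule L2_hilbert)
  let ?T = "\<lambda>i. process_op (a i) s" and ?u = "step_vec H v s"
  have "standardized_moment H v a s (is @ [k]) = (\<Sum>J\<in>Pow (set is) - {{}}. L.cumulant ?u ?T (filter (\<lambda>i. i \<in> J) is @ [k])
       * standardized_moment H v a s (filter (\<lambda>i. i \<notin> J) is))"
    unfolding standardized_moment_eq
    using a v by (intro L.std_moment_recursion dist process_op_bounded step_vec_mem) auto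
  also have "\<dots> = (\<Sum>J\<in>Pow (set is) - {{}}.
    of_real (s / sqrt s ^ Suc (card J)) * reduced_cumulant v a (filter (\<lambda>i. i \<in> J) is @ [k])
      * standardized_moment H v a s (filter (\<lambda>i. i \<notin> J) is))"
  proof (rule sum.cong[OF refl])
    fix J assume "J \<in> Pow (set is) - {{}}"
    then have J: "J \<subseteq> set is" by blast
    have "length (filter (\<lambda>i. i \<in> J) is) = card (set (filter (\<lambda>i. i \<in> J) is))"
      using dist by (intro distinct_card[symmetric]) simp
    also have "set (filter (\<lambda>i. i \<in> J) is) = J" using J by auto
    finally have len: "length (filter (\<lambda>i. i \<in> J) is @ [k]) = Suc (card J)" by simp
    have "L.cumulant ?u ?T (filter (\<lambda>i. i \<in> J) is @ [k]) = of_real (s / sqrt s ^ length (filter (\<lambda>i. i \<in> J) is @ [k]))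
        * reduced_cumulant v a (filter (\<lambda>i. i \<in> J) is @ [k])"
      using a v s by (intro process_cumulant) auto
    then show "L.cumulant ?u ?T (filter (\<lambda>i. i \<in> J) is @ [k]) * standardized_moment H v a s (filter (\<lambda>i. i \<notin> J) is)
      = of_real (s / sqrt s ^ Suc (card J)) * reduced_cumulant v a (filter (\<lambda>i. i \<in> J) is @ [k])
        * standardized_moment H v a s (filter (\<lambda>i. i \<notin> J) is)"
      unfolding len by simp
  qed
  finally show ?thesis .
qed

end

lemma filter_sorted_list_of_set:
  "finite (S :: nat set) \<Longrightarrow> filter P (sorted_list_of_set S) = sorted_list_of_set {x \<in> S. P x}"
  by (rule sorted_distinct_set_unique) (auto simp: sorted_filter[of id, simplified])

lemma sorted_list_of_set_snoc:
  assumes "finite (S :: nat set)" "\<And>x. x \<in> S \<Longrightarrow> x < k"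
  shows "sorted_list_of_set S @ [k] = sorted_list_of_set (insert k S)"
proof -
  let ?xs = "sorted_list_of_set S @ [k]"
  have "sorted ?xs" "distinct ?xs" using assms by (auto simp: sorted_append less_imp_le)
  then have "sorted_list_of_set (set ?xs) = ?xs" by (rule sorted_list_of_set.idem_if_sorted_distinct)
  moreover have "set ?xs = insert k S" using assms(1) by simp
  ultimately show ?thesis by metis
qed

text \<open>Sets suffice to encode the ordered products that occur: the maximum is the last entry of
  the sorted list, and filtering a sorted list gives the sorted list of a subset. So the order of
  the factors is never lost.\<close>

lemma (in complex_hilbert_space) standardized_moment_recursion_set:
  assumes a: "\<And>i. i \<in> I \<Longrightarrow> bounded_operator H (a i)" and v: "v \<in> hcarrier H" and s: "s > 0"
    and I: "finite I" "I \<noteq> {}"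
  defines "\<nu> \<equiv> \<lambda>J. standardized_moment H v a s (sorted_list_of_set J)"
  shows "\<nu> I = (\<Sum>J\<in>Pow (I - {Max I}) - {{}}.
    of_real (s / sqrt s ^ Suc (card J)) * reduced_cumulant v a (sorted_list_of_set (insert (Max I) J))
      * \<nu> (I - {Max I} - J))"
proof -
  let ?k = "Max I"
  let ?S = "I - {?k}"
  have k: "?k \<in> I" using I by simp
  have less: "x < ?k" if "x \<in> ?S" for x using that I Max_ge[of I x] by (auto simp: less_le)
  have "sorted_list_of_set I = sorted_list_of_set ?S @ [?k]"
    using sorted_list_of_set_snoc[of ?S ?k] less I(1) k by (simp add: insert_absorb)
  then have "\<nu> I = standardized_moment H v a s (sorted_list_of_set ?S @ [?k])" by (simp add: \<nu>_def)
  also have "\<dots> = (\<Sum>J\<in>Pow (set (sorted_list_of_set ?S)) - {{}}.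
      of_real (s / sqrt s ^ Suc (card J)) * reduced_cumulant v a (filter (\<lambda>i. i \<in> J) (sorted_list_of_set ?S) @ [?k])
        * standardized_moment H v a s (filter (\<lambda>i. i \<notin> J) (sorted_list_of_set ?S)))"
    using a k I(1) by (intro standardized_moment_recursion v s) auto
  also have "\<dots> = (\<Sum>J\<in>Pow ?S - {{}}.
      of_real (s / sqrt s ^ Suc (card J)) * reduced_cumulant v a (sorted_list_of_set (insert ?k J)) * \<nu> (?S - J))"
  proof (rule sum.cong)
    show "Pow (set (sorted_list_of_set ?S)) - {{}} = Pow ?S - {{}}" using I(1) by simp
    fix J assume "J \<in> Pow ?S - {{}}"
    then have J: "J \<subseteq> ?S" by blast
    have "{x \<in> ?S. x \<in> J} = J" "{x \<in> ?S. x \<notin> J} = ?S - J" using J by auto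
    then have f: "filter (\<lambda>i. i \<in> J) (sorted_list_of_set ?S) = sorted_list_of_set J"
      "filter (\<lambda>i. i \<notin> J) (sorted_list_of_set ?S) = sorted_list_of_set (?S - J)"
      using filter_sorted_list_of_set[of ?S "\<lambda>i. i \<in> J"] filter_sorted_list_of_set[of ?S "\<lambda>i. i \<notin> J"] I(1) by auto
    have "sorted_list_of_set J @ [?k] = sorted_list_of_set (insert ?k J)"
      using J less I(1) finite_subset[OF J] by (intro sorted_list_of_set_snoc) auto
    then show "of_real (s / sqrt s ^ Suc (card J)) * reduced_cumulant v a (filter (\<lambda>i. i \<in> J) (sorted_list_of_set ?S) @ [?k])
        * standardized_moment H v a s (filter (\<lambda>i. i \<notin> J) (sorted_list_of_set ?S))
      = of_real (s / sqrt s ^ Suc (card J)) * reduced_cumulant v a (sorted_list_of_set (insert ?k J)) * \<nu> (?S - J)"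
      unfolding f \<nu>_def by simp
  qed
  finally show ?thesis .
qed

text \<open>Writing \<open>C_{a,b}(t)\<close> as a limit presupposes that it exists; this is made a
  hypothesis for even \<open>m\<close>, where these limits occur. A pair \<open>B\<close> is listed
  as \<open>[Min B, Max B]\<close> because the factors need not commute.\<close>

theorem theorem2p1:
  fixes m :: nat and t C :: real
    and V :: "nat \<Rightarrow> 'v inner_space"
    and \<psi> :: "nat \<Rightarrow> 'v"
    and h :: "nat \<Rightarrow> nat \<Rightarrow> 'v \<Rightarrow> 'v"
  assumes "m \<ge> 1" and "t > 0"
    and "\<And>N. N \<ge> 1 \<Longrightarrow> complex_hilbert_space (V N)"
    and "\<And>N. N \<ge> 1 \<Longrightarrow> \<psi> N \<in> hcarrier (V N)"
    and "\<And>N i. N \<ge> 1 \<Longrightarrow> i \<in> {1..m} \<Longrightarrow> bounded_operator (V N) (h N i)"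
    and "\<And>N i. N \<ge> 1 \<Longrightarrow> i \<in> {1..m} \<Longrightarrow> h N i (\<psi> N) \<noteq> hzero (V N)"
    and "C > 0"
    and "\<And>N k is. N \<ge> 1 \<Longrightarrow> k \<in> {1..m} \<Longrightarrow> length is = k \<Longrightarrow> set is \<subseteq> {1..m} \<Longrightarrow>
           cmod (standardized_moment (V N) (\<psi> N) (h N) t is) < C"
    and "\<And>a b. even m \<Longrightarrow> 1 \<le> a \<Longrightarrow> a < b \<Longrightarrow> b \<le> m \<Longrightarrow>
           convergent (\<lambda>N. standardized_moment (V N) (\<psi> N) (h N) t [a, b])"
  shows "(\<lambda>N. standardized_moment (V N) (\<psi> N) (h N) (real N * t) [1..<Suc m]) \<longlonglongrightarrow>
    (if even m
     then \<Sum>\<pi>\<in>pair_partitions m. \<Prod>B\<in>\<pi>.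
            lim (\<lambda>N. standardized_moment (V N) (\<psi> N) (h N) t [Min B, Max B])
     else 0)"
proof -
  define \<nu> where "\<nu> N I = standardized_moment (V N) (\<psi> N) (h N) t (sorted_list_of_set I)" for N I
  define \<mu> where "\<mu> N I = standardized_moment (V N) (\<psi> N) (h N) (real N * t) (sorted_list_of_set I)" for N I
  \<comment> \<open>The power of \<open>t\<close> is included, so that passing to time
    \<open>N * t\<close> multiplies by a power of \<open>N\<close> alone.\<close>
  define \<kappa> where "\<kappa> N I = of_real (t / sqrt t ^ card I)
    * complex_hilbert_space.reduced_cumulant (V N) (\<psi> N) (h N) (sorted_list_of_set I)" for N I
  have ins: "card (insert (Max I) J) = Suc (card J)"
    if "I \<subseteq> {1..m}" "J \<in> Pow (I - {Max I}) - {{}}" for I J :: "nat set"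
  proof -
    have "finite J" using that finite_subset[of J "{1..m}"] by auto
    moreover have "Max I \<notin> J" using that by auto
    ultimately show ?thesis by simp
  qed
  have rec: "standardized_moment (V N) (\<psi> N) (h N) s (sorted_list_of_set I) = (\<Sum>J\<in>Pow (I - {Max I}) - {{}}.
      of_real (s / sqrt s ^ Suc (card J)) * complex_hilbert_space.reduced_cumulant (V N) (\<psi> N) (h N) (sorted_list_of_set (insert (Max I) J))
        * standardized_moment (V N) (\<psi> N) (h N) s (sorted_list_of_set (I - {Max I} - J)))"
    if N: "N \<ge> 1" and I: "I \<subseteq> {1..m}" "I \<noteq> {}" and s: "s > 0" for N I s
  proof -
    interpret complex_hilbert_space "V N" using assms(3)[OF N] .
    show ?thesis
      using assms(5)[OF N] I finite_subset[OF I(1)] by (intro standardized_moment_recursion_set assms(4) N s) auto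
  qed
  interpret scaled_cumulants m \<nu> \<mu> \<kappa>
  proof
    fix N :: nat and I :: "nat set" assume N: "N \<ge> 1" and I: "I \<subseteq> {1..m}" "I \<noteq> {}"
    show "\<nu> N I = (\<Sum>J\<in>Pow (I - {Max I}) - {{}}. \<kappa> N (insert (Max I) J) * \<nu> N (I - {Max I} - J))"
      unfolding \<nu>_def \<kappa>_def rec[OF N I assms(2)] using ins[OF I(1)] by (intro sum.cong) auto
    have Nt: "real N * t > 0" using N assms(2) by simp
    show "\<mu> N I = (\<Sum>J\<in>Pow (I - {Max I}) - {{}}.
        of_real (real N / sqrt (real N) ^ Suc (card J)) * \<kappa> N (insert (Max I) J) * \<mu> N (I - {Max I} - J))"
      unfolding \<mu>_def \<kappa>_def rec[OF N I Nt]
    proof (rule sum.cong[OF refl])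
      fix J assume J: "J \<in> Pow (I - {Max I}) - {{}}"
      \<comment> \<open>The time factor is multiplicative in time, so it splits into its values at
        \<open>N\<close> and at \<open>t\<close>.\<close>
      have "real N * t / sqrt (real N * t) ^ Suc (card J) = (real N / sqrt (real N) ^ Suc (card J)) * (t / sqrt t ^ Suc (card J))"
        by (simp add: real_sqrt_mult power_mult_distrib)
      then show "of_real (real N * t / sqrt (real N * t) ^ Suc (card J)) * complex_hilbert_space.reduced_cumulant (V N) (\<psi> N) (h N) (sorted_list_of_set (insert (Max I) J))
          * standardized_moment (V N) (\<psi> N) (h N) (real N * t) (sorted_list_of_set (I - {Max I} - J))
        = of_real (real N / sqrt (real N) ^ Suc (card J)) * (of_real (t / sqrt t ^ card (insert (Max I) J)) * complex_hilbert_space.reduced_cumulant (V N) (\<psi> N) (h N) (sorted_list_of_set (insert (Max I) J)))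
          * standardized_moment (V N) (\<psi> N) (h N) (real N * t) (sorted_list_of_set (I - {Max I} - J))"
        unfolding ins[OF I(1) J] by (simp only: of_real_mult mult.assoc)
    qed
  next
    fix N :: nat assume N: "N \<ge> 1"
    interpret complex_hilbert_space "V N" using assms(3)[OF N] .
    show "\<nu> N {} = 1" "\<mu> N {} = 1"
      using standardized_moment_Nil assms(4)[OF N] by (simp_all add: \<nu>_def \<mu>_def)
  next
    fix I assume I: "I \<subseteq> {1..m}"
    have fin: "finite I" using I finite_subset by blast
    \<comment> \<open>The hypothesis bounds nonempty products; the extra 1 covers the empty
      moment.\<close>
    have "cmod (\<nu> N I) \<le> C + 1" if N: "N \<ge> 1" for N
    proof (cases "I = {}")
      case True
      interpret complex_hilbert_space "V N" using assms(3)[OF N] .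
      show ?thesis using True standardized_moment_Nil assms(4)[OF N] assms(7) by (simp add: \<nu>_def)
    next
      case False
      have "card I \<in> {1..m}"
        using False fin card_mono[OF _ I] by (simp add: Suc_le_eq card_gt_0_iff)
      then have "cmod (\<nu> N I) < C" unfolding \<nu>_def using I fin by (intro assms(8)[OF N, of "card I"]) auto
      then show ?thesis by simp
    qed
    then show "(\<lambda>N. \<nu> N I) \<in> O(\<lambda>N. 1)"
      by (intro bigoI[of _ "C + 1"] eventually_sequentiallyI[of 1]) simp
  qed
  have range: "sorted_list_of_set {1..m} = [1..<Suc m]"
    by (rule sorted_distinct_set_unique) (auto simp del: upt_Suc)
  show ?thesis
  proof (cases "even m")
    case True
    let ?c = "\<lambda>B. lim (\<lambda>N. standardized_moment (V N) (\<psi> N) (h N) t [Min B, Max B])"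
    have "(\<lambda>N. \<nu> N {a, b}) \<longlonglongrightarrow> ?c {a, b}" if ab: "1 \<le> a" "a < b" "b \<le> m" for a b
    proof -
      have "sorted_list_of_set {a, b} = [a, b]" using ab by (intro sorted_distinct_set_unique) auto
      moreover have "Min {a, b} = a" "Max {a, b} = b" using ab by auto
      ultimately show ?thesis
        using assms(9)[OF True ab] by (simp add: \<nu>_def convergent_LIMSEQ_iff)
    qed
    from mu_even[OF this, of "{1..m}"]
    show ?thesis unfolding range[symmetric] using True by (simp add: \<mu>_def pairings_def pair_partitions_def)
  next
    case False
    then show ?thesis unfolding range[symmetric] using mu_odd[of "{1..m}"] by (simp add: \<mu>_def)
  qed
qed

end
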